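(* Let $G$ be a discrete group containing an infinite weakly amenable subgroup. Then $VN(G)$ is not operator projective in $A_{cb}(G)$-mod.
   Context: Operator projectivity. $\widehat\otimes$ is the operator space projective tensor product. A completely contractive Banach algebra is a Banach algebra $A$ with an operator space structure such that multiplication extends to a complete contraction $A\widehat\otimes A\to A$. $A$-mod denotes the collection of completely bounded left $A$-modules: operator spaces $X$ which are left $A$-modules with $A\widehat\otimes X\to X$, $a\otimes x\mapsto a\cdot x$, completely bounded. ${}_ACB(X,Y)$ is the space of completely bounded left $A$-module maps. $T\in CB(E,F)$ is admissible if $\ker T$ is completely complemented (i.e. the range of a completely bounded projection) in $E$ and the range of $T$ is closed and completely complemented in $F$. $X\in A$-mod is operator projective in $A$-mod if for all $E,F\in A$-mod, every admissible surjective $T\in{}_ACB(E,F)$ and every $S\in{}_ACB(X,F)$ there is $R\in{}_ACB(X,E)$ with $T\circ R=S$. Spaces. $VN(G)$ is the group von Neumann algebra generated by the left regular representation, and $A(G)$ the Fourier algebra, its predual, with predual operator space structure and pointwise multiplication. $M_{cb}A(G)$ is the algebra of continuous functions $f$ on $G$ for which multiplication by $f$ is a completely bounded map on $A(G)$, with the operator space structure inherited from $CB(A(G))$; $A_{cb}(G)$ is the closure of $A(G)$ in $M_{cb}A(G)$, a completely contractive Banach algebra. $VN(G)=A(G)^*$ is an $A_{cb}(G)$-module by $(f\cdot T)(v)=T(fv)$. A group $H$ is weakly amenable if $A(H)$ has an approximate identity that is bounded in the norm of $M_{cb}A(H)$. *)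

theory Defs
  imports "HOL-Analysis.Analysis" "HOL-Algebra.Algebra" "HOL-Algebra.Algebraic_Closure_Type"
begin

section \<open>Operator spaces\<close>

text \<open>
  A complex vector space is a HOL-Algebra module over the field of complex numbers; the fields
  \<open>mult\<close> and \<open>one\<close> of the record carry no meaning unless the space is used as an algebra.
  An \<open>n \<times> n\<close> matrix over \<open>V\<close> is a function \<open>nat \<Rightarrow> nat \<Rightarrow> 'v\<close> of which only the entries with
  indices below \<open>n\<close> matter, and \<open>mnorm V n\<close> is the norm of \<open>M\<^sub>n(V)\<close>.
\<close>

abbreviation complex_ring :: "complex ring" where
  "complex_ring \<equiv> ring_of_type_algebra"

record 'v opspace = "(complex, 'v) module" +
  mnorm :: "nat \<Rightarrow> (nat \<Rightarrow> nat \<Rightarrow> 'v) \<Rightarrow> real"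

definition mats :: "('v, 'm) opspace_scheme \<Rightarrow> nat \<Rightarrow> (nat \<Rightarrow> nat \<Rightarrow> 'v) set" where
  "mats V n = {v. \<forall>i<n. \<forall>j<n. v i j \<in> carrier V}"

definition vnorm :: "('v, 'm) opspace_scheme \<Rightarrow> 'v \<Rightarrow> real" where
  "vnorm V x = mnorm V 1 (\<lambda>_ _. x)"

text \<open>The operator norm of a scalar \<open>m \<times> n\<close> matrix, acting between Euclidean spaces.\<close>

definition scalar_norm :: "nat \<Rightarrow> nat \<Rightarrow> (nat \<Rightarrow> nat \<Rightarrow> complex) \<Rightarrow> real" where
  "scalar_norm m n \<alpha> =
     Sup {sqrt (\<Sum>i<m. (cmod (\<Sum>j<n. \<alpha> i j * z j))\<^sup>2) | z. (\<Sum>j<n. (cmod (z j))\<^sup>2) \<le> 1}"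

text \<open>\<open>mat_sandwich V n \<alpha> v \<beta>\<close> is \<open>\<alpha> v \<beta>\<close> for \<open>v \<in> M\<^sub>n(V)\<close>.\<close>

definition mat_sandwich ::
  "('v, 'm) opspace_scheme \<Rightarrow> nat \<Rightarrow> (nat \<Rightarrow> nat \<Rightarrow> complex) \<Rightarrow> (nat \<Rightarrow> nat \<Rightarrow> 'v)
     \<Rightarrow> (nat \<Rightarrow> nat \<Rightarrow> complex) \<Rightarrow> nat \<Rightarrow> nat \<Rightarrow> 'v" where
  "mat_sandwich V n \<alpha> v \<beta> =
     (\<lambda>i j. \<Oplus>\<^bsub>V\<^esub>p \<in> {..<n} \<times> {..<n}. (\<alpha> i (fst p) * \<beta> (snd p) j) \<odot>\<^bsub>V\<^esub> v (fst p) (snd p))"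

definition mat_dsum ::
  "('v, 'm) opspace_scheme \<Rightarrow> nat \<Rightarrow> (nat \<Rightarrow> nat \<Rightarrow> 'v) \<Rightarrow> (nat \<Rightarrow> nat \<Rightarrow> 'v) \<Rightarrow> nat \<Rightarrow> nat \<Rightarrow> 'v" where
  "mat_dsum V m v w =
     (\<lambda>i j. if i < m \<and> j < m then v i j
            else if m \<le> i \<and> m \<le> j then w (i - m) (j - m)
            else \<zero>\<^bsub>V\<^esub>)"

text \<open>Complete abstract operator spaces, by Ruan's axioms.\<close>

locale operator_space = Module.module complex_ring V
  for V :: "('v, 'm) opspace_scheme" (structure) +
  assumes mnorm_cong:
      "\<And>n v w. (\<And>i j. i < n \<Longrightarrow> j < n \<Longrightarrow> v i j = w i j) \<Longrightarrow> mnorm V n v = mnorm V n w"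
    and mnorm_nonneg: "\<And>n v. 0 < n \<Longrightarrow> v \<in> mats V n \<Longrightarrow> 0 \<le> mnorm V n v"
    and mnorm_eq_0:
      "\<And>n v. 0 < n \<Longrightarrow> v \<in> mats V n \<Longrightarrow>
         mnorm V n v = 0 \<longleftrightarrow> (\<forall>i<n. \<forall>j<n. v i j = \<zero>\<^bsub>V\<^esub>)"
    and mnorm_triangle:
      "\<And>n v w. 0 < n \<Longrightarrow> v \<in> mats V n \<Longrightarrow> w \<in> mats V n \<Longrightarrow>
         mnorm V n (\<lambda>i j. v i j \<oplus>\<^bsub>V\<^esub> w i j) \<le> mnorm V n v + mnorm V n w"
    and mnorm_scale:
      "\<And>n c v. 0 < n \<Longrightarrow> v \<in> mats V n \<Longrightarrow>
         mnorm V n (\<lambda>i j. c \<odot>\<^bsub>V\<^esub> v i j) = cmod c * mnorm V n v"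
    and mnorm_dsum:
      "\<And>m n v w. 0 < m \<Longrightarrow> 0 < n \<Longrightarrow> v \<in> mats V m \<Longrightarrow> w \<in> mats V n \<Longrightarrow>
         mnorm V (m + n) (mat_dsum V m v w) = max (mnorm V m v) (mnorm V n w)"
    and mnorm_sandwich:
      "\<And>m n \<alpha> v \<beta>. 0 < m \<Longrightarrow> 0 < n \<Longrightarrow> v \<in> mats V n \<Longrightarrow>
         mnorm V m (mat_sandwich V n \<alpha> v \<beta>) \<le> scalar_norm m n \<alpha> * mnorm V n v * scalar_norm n m \<beta>"
    and complete:
      "\<And>x :: nat \<Rightarrow> 'v. range x \<subseteq> carrier V \<Longrightarrow>
         (\<forall>e>0. \<exists>N. \<forall>k\<ge>N. \<forall>l\<ge>N. vnorm V (x k \<ominus>\<^bsub>V\<^esub> x l) < e) \<Longrightarrow>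
         \<exists>y\<in>carrier V. (\<lambda>k. vnorm V (x k \<ominus>\<^bsub>V\<^esub> y)) \<longlonglongrightarrow> 0"

definition complex_opspace :: "complex opspace" where
  "complex_opspace =
     \<lparr>carrier = UNIV, mult = (*), one = 1, ring.zero = 0, add = (+), smult = (*),
      mnorm = (\<lambda>n. scalar_norm n n)\<rparr>"

definition norm_closure :: "('v, 'm) opspace_scheme \<Rightarrow> 'v set \<Rightarrow> 'v set" where
  "norm_closure V S = {x \<in> carrier V. \<forall>e>0. \<exists>y\<in>S. vnorm V (x \<ominus>\<^bsub>V\<^esub> y) < e}"


section \<open>Completely bounded maps\<close>

definition linear_map ::
  "('v, 'm) opspace_scheme \<Rightarrow> ('w, 'l) opspace_scheme \<Rightarrow> ('v \<Rightarrow> 'w) \<Rightarrow> bool" where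
  "linear_map V W T \<longleftrightarrow>
     (\<forall>x\<in>carrier V. T x \<in> carrier W) \<and>
     (\<forall>x\<in>carrier V. \<forall>y\<in>carrier V. T (x \<oplus>\<^bsub>V\<^esub> y) = T x \<oplus>\<^bsub>W\<^esub> T y) \<and>
     (\<forall>c. \<forall>x\<in>carrier V. T (c \<odot>\<^bsub>V\<^esub> x) = c \<odot>\<^bsub>W\<^esub> T x)"

definition completely_bounded ::
  "('v, 'm) opspace_scheme \<Rightarrow> ('w, 'l) opspace_scheme \<Rightarrow> ('v \<Rightarrow> 'w) \<Rightarrow> bool" where
  "completely_bounded V W T \<longleftrightarrow>
     linear_map V W T \<and>
     (\<exists>C. \<forall>n>0. \<forall>v\<in>mats V n. mnorm W n (\<lambda>i j. T (v i j)) \<le> C * mnorm V n v)"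

text \<open>
  The norm of \<open>[\<Phi>\<^sub>i\<^sub>j] \<in> M\<^sub>n(CB(V, W)) = CB(V, M\<^sub>n(W))\<close>. In an \<open>nm \<times> nm\<close> matrix the pair of
  indices \<open>(i, k)\<close> with \<open>i < n\<close>, \<open>k < m\<close> is encoded as \<open>i * m + k\<close>.
\<close>

definition cb_mnorm ::
  "('v, 'm) opspace_scheme \<Rightarrow> ('w, 'l) opspace_scheme \<Rightarrow> nat \<Rightarrow> (nat \<Rightarrow> nat \<Rightarrow> 'v \<Rightarrow> 'w) \<Rightarrow> real" where
  "cb_mnorm V W n \<Phi> =
     Sup {mnorm W (n * m) (\<lambda>p q. \<Phi> (p div m) (q div m) (v (p mod m) (q mod m))) | m v.
            0 < m \<and> v \<in> mats V m \<and> mnorm V m v \<le> 1}"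

definition completely_complemented :: "('v, 'm) opspace_scheme \<Rightarrow> 'v set \<Rightarrow> bool" where
  "completely_complemented V S \<longleftrightarrow>
     (\<exists>P. completely_bounded V V P \<and> (\<forall>x\<in>carrier V. P (P x) = P x) \<and> P ` carrier V = S)"

definition admissible ::
  "('v, 'm) opspace_scheme \<Rightarrow> ('w, 'l) opspace_scheme \<Rightarrow> ('v \<Rightarrow> 'w) \<Rightarrow> bool" where
  "admissible V W T \<longleftrightarrow>
     completely_bounded V W T \<and>
     completely_complemented V {x \<in> carrier V. T x = \<zero>\<^bsub>W\<^esub>} \<and>
     norm_closure W (T ` carrier V) = T ` carrier V \<and>
     completely_complemented W (T ` carrier V)"


section \<open>The operator space projective tensor product\<close>

text \<open>
  The algebraic tensor product \<open>V \<otimes> W\<close> is realised inside the functionals on the space of bilinear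
  forms, \<open>v \<otimes> w\<close> being evaluation at \<open>(v, w)\<close>. It carries the projective operator space norm
  \<open>\<parallel>u\<parallel> = inf \<parallel>\<alpha>\<parallel> \<parallel>v\<parallel> \<parallel>w\<parallel> \<parallel>\<beta>\<parallel>\<close>, over all \<open>u = \<alpha> (v \<otimes> w) \<beta>\<close> with \<open>v \<in> M\<^sub>p(V)\<close>, \<open>w \<in> M\<^sub>q(W)\<close>.
  The operator space projective tensor product is the completion of this normed space, so the
  completely bounded maps from it into a (complete) operator space are exactly the continuous
  extensions of the completely bounded maps on \<open>proj_tensor V W\<close>.
\<close>

definition bilinear_forms ::
  "('v, 'm) opspace_scheme \<Rightarrow> ('w, 'l) opspace_scheme \<Rightarrow> ('v \<Rightarrow> 'w \<Rightarrow> complex) set" where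
  "bilinear_forms V W =
     {\<phi>. (\<forall>w\<in>carrier W. linear_map V complex_opspace (\<lambda>v. \<phi> v w)) \<and>
          (\<forall>v\<in>carrier V. linear_map W complex_opspace (\<phi> v))}"

definition elem_tensor ::
  "('v, 'm) opspace_scheme \<Rightarrow> ('w, 'l) opspace_scheme \<Rightarrow> 'v \<Rightarrow> 'w
     \<Rightarrow> ('v \<Rightarrow> 'w \<Rightarrow> complex) \<Rightarrow> complex" where
  "elem_tensor V W v w = (\<lambda>\<phi>. if \<phi> \<in> bilinear_forms V W then \<phi> v w else 0)"

definition alg_tensor ::
  "('v, 'm) opspace_scheme \<Rightarrow> ('w, 'l) opspace_scheme
     \<Rightarrow> (('v \<Rightarrow> 'w \<Rightarrow> complex) \<Rightarrow> complex) opspace" where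
  "alg_tensor V W =
     \<lparr>carrier = {(\<lambda>\<phi>. \<Sum>k<(N::nat). elem_tensor V W (v k) (w k) \<phi>) | N v w.
                   \<forall>k<N. v k \<in> carrier V \<and> w k \<in> carrier W},
      mult = undefined, one = undefined,
      ring.zero = (\<lambda>_. 0), add = (\<lambda>s t \<phi>. s \<phi> + t \<phi>), smult = (\<lambda>c s \<phi>. c * s \<phi>),
      mnorm = undefined\<rparr>"

definition proj_tensor ::
  "('v, 'm) opspace_scheme \<Rightarrow> ('w, 'l) opspace_scheme
     \<Rightarrow> (('v \<Rightarrow> 'w \<Rightarrow> complex) \<Rightarrow> complex) opspace" where
  "proj_tensor V W =
     (alg_tensor V W)\<lparr>mnorm := (\<lambda>n u.
        Inf {scalar_norm n (p * q) \<alpha> * mnorm V p v * mnorm W q w * scalar_norm (p * q) n \<beta>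
             | p q \<alpha> v w \<beta>.
             0 < p \<and> 0 < q \<and> v \<in> mats V p \<and> w \<in> mats W q \<and>
             (\<forall>i<n. \<forall>j<n. u i j =
                mat_sandwich (alg_tensor V W) (p * q) \<alpha>
                  (\<lambda>k l. elem_tensor V W (v (k div q) (l div q)) (w (k mod q) (l mod q))) \<beta> i j)})\<rparr>"


section \<open>Completely bounded modules and operator projectivity\<close>

definition cb_left_module ::
  "('a, 'm) opspace_scheme \<Rightarrow> ('x, 'l) opspace_scheme \<Rightarrow> ('a \<Rightarrow> 'x \<Rightarrow> 'x) \<Rightarrow> bool" where
  "cb_left_module A M act \<longleftrightarrow>
     operator_space M \<and>
     (\<forall>x\<in>carrier M. linear_map A M (\<lambda>a. act a x)) \<and>
     (\<forall>a\<in>carrier A. linear_map M M (act a)) \<and>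
     (\<forall>a\<in>carrier A. \<forall>b\<in>carrier A. \<forall>x\<in>carrier M. act (a \<otimes>\<^bsub>A\<^esub> b) x = act a (act b x)) \<and>
     (\<exists>\<Phi>. completely_bounded (proj_tensor A M) M \<Phi> \<and>
          (\<forall>a\<in>carrier A. \<forall>x\<in>carrier M. \<Phi> (elem_tensor A M a x) = act a x))"

definition cb_module_maps ::
  "('a, 'k) opspace_scheme \<Rightarrow> ('x, 'm) opspace_scheme \<Rightarrow> ('a \<Rightarrow> 'x \<Rightarrow> 'x)
     \<Rightarrow> ('y, 'l) opspace_scheme \<Rightarrow> ('a \<Rightarrow> 'y \<Rightarrow> 'y) \<Rightarrow> ('x \<Rightarrow> 'y) set" where
  "cb_module_maps A M actM Y actY =
     {T. completely_bounded M Y T \<and>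
         (\<forall>a\<in>carrier A. \<forall>x\<in>carrier M. T (actM a x) = actY a (T x))}"

text \<open>
  The lifting property that defines operator projectivity of a module \<open>M\<close> over \<open>A\<close>. HOL cannot
  quantify over the underlying types of the test modules, so these are the modules whose underlying
  set is contained in the type \<open>'u\<close>. The property for one \<open>'u\<close> is implied by operator projectivity
  in the unrestricted sense. Membership of \<open>M\<close> itself in \<open>A\<close>-mod is not part of the definition, so
  the negation asserts that a lifting fails to exist.
\<close>

definition operator_projective ::
  "'u itself \<Rightarrow> ('a, 'm) opspace_scheme \<Rightarrow> ('x, 'l) opspace_scheme \<Rightarrow> ('a \<Rightarrow> 'x \<Rightarrow> 'x) \<Rightarrow> bool" where
  "operator_projective _ A M actM \<longleftrightarrow>
     (\<forall>(E :: 'u opspace) actE (F :: 'u opspace) actF T S.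
        cb_left_module A E actE \<longrightarrow> cb_left_module A F actF \<longrightarrow>
        T \<in> cb_module_maps A E actE F actF \<longrightarrow> admissible E F T \<longrightarrow>
        T ` carrier E = carrier F \<longrightarrow>
        S \<in> cb_module_maps A M actM F actF \<longrightarrow>
        (\<exists>R\<in>cb_module_maps A M actM E actE. \<forall>x\<in>carrier M. T (R x) = S x))"


section \<open>The Hilbert space of square summable functions and its bounded operators\<close>

text \<open>
  Functions on the set \<open>I\<close> are functions on the ambient type that vanish off \<open>I\<close>, and operators on
  \<open>\<ell>\<^sup>2(I)\<close> are extended by \<open>0\<close> off \<open>\<ell>\<^sup>2(I)\<close>; equality is then equality of HOL functions.
\<close>

definition l2 :: "'g set \<Rightarrow> ('g \<Rightarrow> complex) set" where
  "l2 I = {\<xi>. (\<forall>x. x \<notin> I \<longrightarrow> \<xi> x = 0) \<and> (\<lambda>x. (cmod (\<xi> x))\<^sup>2) summable_on UNIV}"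

definition l2_norm :: "('g \<Rightarrow> complex) \<Rightarrow> real" where
  "l2_norm \<xi> = sqrt (infsum (\<lambda>x. (cmod (\<xi> x))\<^sup>2) UNIV)"

definition l2_inner :: "('g \<Rightarrow> complex) \<Rightarrow> ('g \<Rightarrow> complex) \<Rightarrow> complex" where
  "l2_inner \<xi> \<eta> = infsum (\<lambda>x. \<xi> x * cnj (\<eta> x)) UNIV"

type_synonym 'g l2_op = "('g \<Rightarrow> complex) \<Rightarrow> 'g \<Rightarrow> complex"

definition bounded_ops :: "'g set \<Rightarrow> 'g l2_op set" where
  "bounded_ops I =
     {T. (\<forall>\<xi>\<in>l2 I. T \<xi> \<in> l2 I) \<and> (\<forall>\<xi>. \<xi> \<notin> l2 I \<longrightarrow> T \<xi> = (\<lambda>_. 0)) \<and>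
         (\<forall>\<xi>\<in>l2 I. \<forall>\<eta>\<in>l2 I. T (\<lambda>x. \<xi> x + \<eta> x) = (\<lambda>x. T \<xi> x + T \<eta> x)) \<and>
         (\<forall>c. \<forall>\<xi>\<in>l2 I. T (\<lambda>x. c * \<xi> x) = (\<lambda>x. c * T \<xi> x)) \<and>
         (\<exists>C. \<forall>\<xi>\<in>l2 I. l2_norm (T \<xi>) \<le> C * l2_norm \<xi>)}"

text \<open>The norm of \<open>[T\<^sub>i\<^sub>j]\<close> as an operator on the direct sum of \<open>n\<close> copies of \<open>\<ell>\<^sup>2(I)\<close>.\<close>

definition op_mnorm :: "'g set \<Rightarrow> nat \<Rightarrow> (nat \<Rightarrow> nat \<Rightarrow> 'g l2_op) \<Rightarrow> real" where
  "op_mnorm I n T =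
     Sup {sqrt (\<Sum>i<n. (l2_norm (\<lambda>x. \<Sum>j<n. T i j (\<xi> j) x))\<^sup>2) | \<xi>.
            (\<forall>j<n. \<xi> j \<in> l2 I) \<and> (\<Sum>j<n. (l2_norm (\<xi> j))\<^sup>2) \<le> 1}"

definition commutant :: "'g set \<Rightarrow> 'g l2_op set \<Rightarrow> 'g l2_op set" where
  "commutant I S = {T \<in> bounded_ops I. \<forall>R\<in>S. T \<circ> R = R \<circ> T}"


section \<open>The group von Neumann algebra and the Fourier algebra of a discrete group\<close>

definition left_regular :: "('g, 'b) monoid_scheme \<Rightarrow> 'g \<Rightarrow> 'g l2_op" where
  "left_regular G s =
     (\<lambda>\<xi> t. if \<xi> \<in> l2 (carrier G) \<and> t \<in> carrier G then \<xi> (inv\<^bsub>G\<^esub> s \<otimes>\<^bsub>G\<^esub> t) else 0)"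

definition VN :: "('g, 'b) monoid_scheme \<Rightarrow> 'g l2_op opspace" where
  "VN G =
     \<lparr>carrier = commutant (carrier G) (commutant (carrier G) (left_regular G ` carrier G)),
      mult = (\<circ>), one = (\<lambda>\<xi>. if \<xi> \<in> l2 (carrier G) then \<xi> else (\<lambda>_. 0)),
      ring.zero = (\<lambda>_ _. 0), add = (\<lambda>S T \<xi> x. S \<xi> x + T \<xi> x), smult = (\<lambda>c T \<xi> x. c * T \<xi> x),
      mnorm = op_mnorm (carrier G)\<rparr>"

text \<open>
  The predual of \<open>VN(G)\<close>, i.e. its normal (ultraweakly continuous) functionals, which are the
  sums \<open>T \<mapsto> \<Sum>\<^sub>k \<langle>T \<xi>\<^sub>k, \<eta>\<^sub>k\<rangle>\<close> with square summable \<open>\<parallel>\<xi>\<^sub>k\<parallel>\<close> and \<open>\<parallel>\<eta>\<^sub>k\<parallel>\<close>. The functional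
  \<open>\<omega>\<close> is identified with the function \<open>s \<mapsto> \<omega>(\<lambda>(s))\<close> on \<open>G\<close>; these functions form the Fourier
  algebra. \<open>duality G T u\<close> is the resulting pairing of \<open>T \<in> VN(G)\<close> with \<open>u \<in> A(G)\<close>.
\<close>

definition normal_functionals :: "('g, 'b) monoid_scheme \<Rightarrow> ('g l2_op \<Rightarrow> complex) set" where
  "normal_functionals G =
     {(\<lambda>T. if T \<in> carrier (VN G) then suminf (\<lambda>k. l2_inner (T (\<xi> k)) (\<eta> k)) else 0) | \<xi> \<eta>.
        range \<xi> \<subseteq> l2 (carrier G) \<and> range \<eta> \<subseteq> l2 (carrier G) \<and>
        summable (\<lambda>k::nat. (l2_norm (\<xi> k))\<^sup>2) \<and> summable (\<lambda>k. (l2_norm (\<eta> k))\<^sup>2)}"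

definition coefficient_function ::
  "('g, 'b) monoid_scheme \<Rightarrow> ('g l2_op \<Rightarrow> complex) \<Rightarrow> 'g \<Rightarrow> complex" where
  "coefficient_function G \<omega> = (\<lambda>s. if s \<in> carrier G then \<omega> (left_regular G s) else 0)"

definition duality :: "('g, 'b) monoid_scheme \<Rightarrow> 'g l2_op \<Rightarrow> ('g \<Rightarrow> complex) \<Rightarrow> complex" where
  "duality G T u = inv_into (normal_functionals G) (coefficient_function G) u T"

text \<open>
  The matrix norms of \<open>A(G)\<close> are those inherited from the dual \<open>VN(G)\<^sup>* = CB(VN(G), \<complex>)\<close>. The
  constant function \<open>1\<close> is a unit for the product and lies in \<open>M\<^sub>c\<^sub>bA(G)\<close>, but in general not in
  \<open>A(G)\<close>.
\<close>

definition Fourier_algebra :: "('g, 'b) monoid_scheme \<Rightarrow> ('g \<Rightarrow> complex) opspace" where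
  "Fourier_algebra G =
     \<lparr>carrier = coefficient_function G ` normal_functionals G,
      mult = (\<lambda>u v x. u x * v x), one = indicator (carrier G),
      ring.zero = (\<lambda>_. 0), add = (\<lambda>u v x. u x + v x), smult = (\<lambda>c u x. c * u x),
      mnorm = (\<lambda>n u. cb_mnorm (VN G) complex_opspace n (\<lambda>i j T. duality G T (u i j)))\<rparr>"

text \<open>Continuity of the multipliers is automatic, as \<open>G\<close> is discrete.\<close>

definition Mcb_Fourier :: "('g, 'b) monoid_scheme \<Rightarrow> ('g \<Rightarrow> complex) opspace" where
  "Mcb_Fourier G =
     (Fourier_algebra G)
       \<lparr>carrier := {f. (\<forall>x. x \<notin> carrier G \<longrightarrow> f x = 0) \<and>
                       completely_bounded (Fourier_algebra G) (Fourier_algebra G)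
                         (\<lambda>u x. f x * u x)},
        mnorm := (\<lambda>n f. cb_mnorm (Fourier_algebra G) (Fourier_algebra G) n
                          (\<lambda>i j u x. f i j x * u x))\<rparr>"

definition Acb :: "('g, 'b) monoid_scheme \<Rightarrow> ('g \<Rightarrow> complex) opspace" where
  "Acb G =
     (Mcb_Fourier G)\<lparr>carrier := norm_closure (Mcb_Fourier G) (carrier (Fourier_algebra G))\<rparr>"

definition VN_act :: "('g, 'b) monoid_scheme \<Rightarrow> ('g \<Rightarrow> complex) \<Rightarrow> 'g l2_op \<Rightarrow> 'g l2_op" where
  "VN_act G f T =
     (THE S. S \<in> carrier (VN G) \<and>
             (\<forall>v\<in>carrier (Fourier_algebra G). duality G S v = duality G T (\<lambda>x. f x * v x)))"

text \<open>Nets are rendered as proper filters; the product is commutative, so one side suffices.\<close>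

definition weakly_amenable :: "('g, 'b) monoid_scheme \<Rightarrow> bool" where
  "weakly_amenable G \<longleftrightarrow>
     (\<exists>(\<F> :: ('g \<Rightarrow> complex) filter) C. \<F> \<noteq> bot \<and>
        (\<forall>\<^sub>F e in \<F>. e \<in> carrier (Fourier_algebra G) \<and> vnorm (Mcb_Fourier G) e \<le> C) \<and>
        (\<forall>u\<in>carrier (Fourier_algebra G).
           ((\<lambda>e. vnorm (Fourier_algebra G) (e \<otimes>\<^bsub>Fourier_algebra G\<^esub> u \<ominus>\<^bsub>Fourier_algebra G\<^esub> u)) \<longlongrightarrow> 0) \<F>))"

text \<open>
  The type over which the test modules range. Let \<open>A\<^sub>+\<close> be the unitization of \<open>A\<^sub>c\<^sub>b(G)\<close>, with
  underlying set in \<open>('g \<Rightarrow> complex) \<times> complex\<close>. The algebraic tensor product \<open>A\<^sub>+ \<otimes> VN(G)\<close> is a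
  subset of this type. For infinite \<open>G\<close>, its completion and \<open>VN(G)\<close> have at most the cardinality of
  \<open>'g \<Rightarrow> complex\<close>, so both have isomorphic copies over this type. As \<open>VN(G)\<close> is operator projective
  iff the multiplication map from the completion onto \<open>VN(G)\<close> has a right inverse in \<open>A\<^sub>c\<^sub>b(G)\<close>-mod,
  restricting the test modules to this type does not change operator projectivity of \<open>VN(G)\<close>.
\<close>

type_synonym 'g test_universe = "(('g \<Rightarrow> complex) \<times> complex \<Rightarrow> 'g l2_op \<Rightarrow> complex) \<Rightarrow> complex"

end

theory Submission
  imports Defs
begin

text \<open>
  Under pointwise multiplication, the functions on the one-point compactification of the discrete
  space \<open>G\<close> that are continuous at infinity form a module \<open>E\<close> over \<open>A\<^sub>c\<^sub>b(G)\<close>, and evaluation at infinity is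
  an admissible map from \<open>E\<close> onto the complex numbers with the zero action. A completely bounded
  functional \<open>\<sigma>\<close> on \<open>VN(G)\<close> that vanishes on \<open>A\<^sub>c\<^sub>b(G) \<cdot> VN(G)\<close> is a module map into the latter. If \<open>R\<close> lifts it,
  then \<open>\<delta>\<^sub>s \<cdot> T = (T \<delta>\<^sub>1)(s) \<lambda>(s)\<close> gives \<open>(R T)(s) = (T \<delta>\<^sub>1)(s) (R \<lambda>(s))(s)\<close>. This tends to \<open>0\<close> as \<open>s\<close> tends to
  infinity because \<open>T \<delta>\<^sub>1\<close> is square summable, so \<open>\<sigma>(T) = (R T)(\<infinity>) = 0\<close> for all \<open>T\<close>.

  A nonzero \<open>\<sigma>\<close> exists for every infinite \<open>G\<close>: take a limit of vector functionals \<open>T \<mapsto> \<langle>T \<zeta>\<^sub>n, \<eta>\<^sub>n\<rangle>\<close> whose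
  coefficient functions have finite, pairwise disjoint supports, so that \<open>A\<^sub>c\<^sub>b(G)\<close> kills it, and an
  operator \<open>T\<close> with \<open>Re \<langle>T \<zeta>\<^sub>n, \<eta>\<^sub>n\<rangle> \<ge> 1/4\<close> for all \<open>n\<close>. Such a \<open>T\<close> is a weak limit of contractions, each obtained from the
  previous one by a perturbation with small matrix entries. The perturbations come from self-adjoint
  contractions \<open>b\<close> with \<open>\<parallel>b\<parallel>\<close> close to \<open>1\<close> and \<open>\<parallel>b \<delta>\<^sub>1\<parallel>\<close> small, namely high powers of a normalised convolution
  operator with positive symmetric weight on a countably infinite subgroup.
\<close>

(* This arrow of HOL-Algebra makes the limit arrow ambiguous. *)
no_notation exact_seq_arrow
  (\<open>(\<open>indent=3 notation=\<open>mixfix exact_seq\<close>\<close>_ / \<longlongrightarrow>\<index> _)\<close> [1000, 60])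

section \<open>Square summable functions\<close>

text \<open>The obstacle is to keep \<sigma> nonzero. Point masses on G have disjoint supports, but
  as functionals they read off coordinates of T \<delta>_1, and these tend to 0 by the same square
  summability that makes the lift vanish. So the vectors \<zeta>_n have to spread out: they are
  vectors on which a norm-one element of \<open>VN G\<close> with a small column at the unit is
  nearly isometric. A perturbation built from such an element gains 1/2 at the new pair of vectors
  and hardly moves any matrix entry. Each earlier pairing depends on finitely many entries, so the
  losses can be made summable, and 1/4 survives at every pair. High powers work because squaring a
  self-adjoint contraction of norm one keeps the norm equal to one, while the column at the unit
  must die out: otherwise a square summable function would be constant and nonzero on an infinite
  subgroup. Since the module action is defined by duality, an element of A(G) must first be seen to
  determine its normal functional; this is what the double commutant argument supplies.\<close>

lemma l2_D: "\<xi> \<in> l2 I \<Longrightarrow> x \<notin> I \<Longrightarrow> \<xi> x = 0"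
  by (simp add: l2_def)

lemma l2_summable: "\<xi> \<in> l2 I \<Longrightarrow> (\<lambda>x. (cmod (\<xi> x))\<^sup>2) summable_on UNIV"
  by (simp add: l2_def)

lemma l2_zero [simp]: "(\<lambda>_. 0) \<in> l2 I"
  by (simp add: l2_def)

lemma l2_scale: "\<xi> \<in> l2 I \<Longrightarrow> (\<lambda>x. c * \<xi> x) \<in> l2 I"
  by (auto simp: l2_def norm_mult power_mult_distrib intro: summable_on_cmult_right)

lemma l2_inner_abs_summable:
  assumes "\<xi> \<in> l2 I" "\<eta> \<in> l2 J"
  shows "(\<lambda>x. cmod (\<xi> x) * cmod (\<eta> x)) summable_on UNIV"
proof (rule summable_on_comparison_test)
  show "(\<lambda>x. (cmod (\<xi> x))\<^sup>2 + (cmod (\<eta> x))\<^sup>2) summable_on UNIV"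
    using assms by (intro summable_on_add l2_summable)
  fix x :: 'a
  have "2 * (cmod (\<xi> x) * cmod (\<eta> x)) \<le> (cmod (\<xi> x))\<^sup>2 + (cmod (\<eta> x))\<^sup>2"
    using sum_squares_bound[of "cmod (\<xi> x)" "cmod (\<eta> x)"] by simp
  then show "cmod (\<xi> x) * cmod (\<eta> x) \<le> (cmod (\<xi> x))\<^sup>2 + (cmod (\<eta> x))\<^sup>2"
    by (smt (verit) mult_nonneg_nonneg norm_ge_zero)
qed simp

lemma l2_inner_summable:
  assumes "\<xi> \<in> l2 I" "\<eta> \<in> l2 J"
  shows "(\<lambda>x. \<xi> x * cnj (\<eta> x)) summable_on UNIV"
  by (rule abs_summable_summable) (simp add: norm_mult l2_inner_abs_summable[OF assms])

lemma l2_add: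
  assumes "\<xi> \<in> l2 I" "\<eta> \<in> l2 I"
  shows "(\<lambda>x. \<xi> x + \<eta> x) \<in> l2 I"
proof -
  have "(\<lambda>x. (cmod (\<xi> x + \<eta> x))\<^sup>2) summable_on UNIV"
  proof (rule summable_on_comparison_test)
    show "(\<lambda>x. 2 * (cmod (\<xi> x))\<^sup>2 + 2 * (cmod (\<eta> x))\<^sup>2) summable_on UNIV"
      using assms by (intro summable_on_add summable_on_cmult_right l2_summable)
    fix x :: 'a
    have "(cmod (\<xi> x + \<eta> x))\<^sup>2 \<le> (cmod (\<xi> x) + cmod (\<eta> x))\<^sup>2"
      by (intro power_mono norm_triangle_ineq) auto
    also have "\<dots> \<le> 2 * (cmod (\<xi> x))\<^sup>2 + 2 * (cmod (\<eta> x))\<^sup>2"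
      using sum_squares_bound[of "cmod (\<xi> x)" "cmod (\<eta> x)"] by (simp add: power2_sum)
    finally show "(cmod (\<xi> x + \<eta> x))\<^sup>2 \<le> 2 * (cmod (\<xi> x))\<^sup>2 + 2 * (cmod (\<eta> x))\<^sup>2" .
  qed simp
  then show ?thesis using assms by (auto simp: l2_def)
qed

lemma l2_uminus: "\<xi> \<in> l2 I \<Longrightarrow> (\<lambda>x. - \<xi> x) \<in> l2 I"
  using l2_scale[of \<xi> I "-1"] by simp

lemma l2_diff: "\<xi> \<in> l2 I \<Longrightarrow> \<eta> \<in> l2 I \<Longrightarrow> (\<lambda>x. \<xi> x - \<eta> x) \<in> l2 I"
  using l2_add[of \<xi> I "\<lambda>x. - \<eta> x"] l2_uminus[of \<eta> I] by simp

lemma l2_sum: "(\<And>i. i \<in> A \<Longrightarrow> \<xi> i \<in> l2 I) \<Longrightarrow> (\<lambda>x. \<Sum>i\<in>A. \<xi> i x) \<in> l2 I"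
  by (induction A rule: infinite_finite_induct) (auto intro: l2_add)

lemma l2_inner_add_left:
  "\<lbrakk>\<xi> \<in> l2 I; \<xi>' \<in> l2 I'; \<eta> \<in> l2 J\<rbrakk>
     \<Longrightarrow> l2_inner (\<lambda>x. \<xi> x + \<xi>' x) \<eta> = l2_inner \<xi> \<eta> + l2_inner \<xi>' \<eta>"
  unfolding l2_inner_def distrib_right by (intro infsum_add l2_inner_summable)

lemma l2_inner_scale_left: "l2_inner (\<lambda>x. c * \<xi> x) \<eta> = c * l2_inner \<xi> \<eta>"
  unfolding l2_inner_def by (simp add: mult.assoc infsum_cmult_right')

lemma l2_inner_commute: "l2_inner \<eta> \<xi> = cnj (l2_inner \<xi> \<eta>)"
  unfolding l2_inner_def infsum_cnj[symmetric] by (simp add: mult.commute)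

lemma l2_inner_add_right:
  "\<lbrakk>\<xi> \<in> l2 I; \<xi>' \<in> l2 I'; \<eta> \<in> l2 J\<rbrakk>
     \<Longrightarrow> l2_inner \<eta> (\<lambda>x. \<xi> x + \<xi>' x) = l2_inner \<eta> \<xi> + l2_inner \<eta> \<xi>'"
  by (simp add: l2_inner_commute[of \<eta>] l2_inner_add_left)

lemma l2_inner_scale_right: "l2_inner \<xi> (\<lambda>x. c * \<eta> x) = cnj c * l2_inner \<xi> \<eta>"
  by (simp add: l2_inner_commute[of \<xi>] l2_inner_scale_left)

lemma l2_inner_zero_left [simp]: "l2_inner (\<lambda>_. 0) \<eta> = 0"
  by (simp add: l2_inner_def)

lemma l2_inner_zero_right [simp]: "l2_inner \<eta> (\<lambda>_. 0) = 0"
  by (simp add: l2_inner_def)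

lemma l2_inner_minus_left: "l2_inner (\<lambda>x. - \<xi> x) \<eta> = - l2_inner \<xi> \<eta>"
  using l2_inner_scale_left[of "-1"] by simp

lemma l2_inner_minus_right: "l2_inner \<xi> (\<lambda>x. - \<eta> x) = - l2_inner \<xi> \<eta>"
  using l2_inner_scale_right[of _ "-1"] by simp

lemma l2_inner_diff_left:
  "\<lbrakk>\<xi> \<in> l2 I; \<xi>' \<in> l2 I'; \<eta> \<in> l2 J\<rbrakk>
     \<Longrightarrow> l2_inner (\<lambda>x. \<xi> x - \<xi>' x) \<eta> = l2_inner \<xi> \<eta> - l2_inner \<xi>' \<eta>"
  using l2_inner_add_left[of \<xi> I "\<lambda>x. - \<xi>' x" I' \<eta> J] by (simp add: l2_uminus l2_inner_minus_left)

lemma l2_inner_diff_right: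
  "\<lbrakk>\<xi> \<in> l2 I; \<xi>' \<in> l2 I'; \<eta> \<in> l2 J\<rbrakk>
     \<Longrightarrow> l2_inner \<eta> (\<lambda>x. \<xi> x - \<xi>' x) = l2_inner \<eta> \<xi> - l2_inner \<eta> \<xi>'"
  using l2_inner_add_right[of \<xi> I "\<lambda>x. - \<xi>' x" I' \<eta> J] by (simp add: l2_uminus l2_inner_minus_right)

lemma l2_inner_sum_left:
  assumes "\<And>i. i \<in> A \<Longrightarrow> \<xi> i \<in> l2 I" "\<eta> \<in> l2 J"
  shows "l2_inner (\<lambda>x. \<Sum>i\<in>A. \<xi> i x) \<eta> = (\<Sum>i\<in>A. l2_inner (\<xi> i) \<eta>)"
  using assms
proof (induction A rule: infinite_finite_induct)
  case (insert a A)
  then have "l2_inner (\<lambda>x. \<xi> a x + (\<Sum>i\<in>A. \<xi> i x)) \<eta> = l2_inner (\<xi> a) \<eta> + l2_inner (\<lambda>x. \<Sum>i\<in>A. \<xi> i x) \<eta>"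
    by (intro l2_inner_add_left l2_sum) auto
  with insert show ?case by simp
qed auto

lemma l2_norm_nonneg [simp]: "0 \<le> l2_norm \<xi>"
  by (simp add: l2_norm_def infsum_nonneg)

lemma l2_norm_sq: "(l2_norm \<xi>)\<^sup>2 = infsum (\<lambda>x. (cmod (\<xi> x))\<^sup>2) UNIV"
  by (simp add: l2_norm_def infsum_nonneg)

lemma l2_norm_zero [simp]: "l2_norm (\<lambda>_. 0) = 0"
  by (simp add: l2_norm_def)

lemma l2_inner_self: "l2_inner \<xi> \<xi> = of_real ((l2_norm \<xi>)\<^sup>2)"
proof -
  have "l2_inner \<xi> \<xi> = infsum (\<lambda>x. of_real ((cmod (\<xi> x))\<^sup>2)) UNIV"
    unfolding l2_inner_def by (simp add: complex_norm_square[symmetric] mult.commute)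
  \<comment> \<open>Summability passes through \<open>of_real\<close> in both directions, so no
    hypothesis on \<xi> is required: if the squares are not summable, both sides are 0.\<close>
  also have "\<dots> = of_real (infsum (\<lambda>x. (cmod (\<xi> x))\<^sup>2) UNIV)"
    by (rule infsum_bounded_linear_strong)
      (rule summable_on_bounded_linear_iff[OF bounded_linear_of_real bounded_linear_Re], simp, rule bounded_linear_of_real)
  finally show ?thesis by (simp add: l2_norm_sq)
qed

lemma l2_norm_scale: "l2_norm (\<lambda>x. c * \<xi> x) = cmod c * l2_norm \<xi>"
  by (simp add: l2_norm_def norm_mult power_mult_distrib infsum_cmult_right' real_sqrt_mult)

lemma l2_norm_uminus [simp]: "l2_norm (\<lambda>x. - \<xi> x) = l2_norm \<xi>"
  by (simp add: l2_norm_def)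

lemma L2_set_le_l2_norm:
  assumes "\<xi> \<in> l2 I" "finite F"
  shows "L2_set (\<lambda>x. cmod (\<xi> x)) F \<le> l2_norm \<xi>"
  unfolding L2_set_def l2_norm_def
  using assms by (intro real_sqrt_le_mono finite_sum_le_infsum l2_summable) auto

lemma l2_coord_le: "\<xi> \<in> l2 I \<Longrightarrow> cmod (\<xi> x) \<le> l2_norm \<xi>"
  using L2_set_le_l2_norm[of \<xi> I "{x}"] by (simp add: L2_set_def)

lemma l2_norm_eq_0: "\<xi> \<in> l2 I \<Longrightarrow> l2_norm \<xi> = 0 \<Longrightarrow> \<xi> = (\<lambda>_. 0)"
  using l2_coord_le[of \<xi> I] by force

lemma l2_abs_CS:
  assumes "\<xi> \<in> l2 I" "\<eta> \<in> l2 J"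
  shows "(\<Sum>\<^sub>\<infinity>x. cmod (\<xi> x) * cmod (\<eta> x)) \<le> l2_norm \<xi> * l2_norm \<eta>"
proof (rule infsum_le_finite_sums[OF l2_inner_abs_summable[OF assms]])
  fix F :: "'a set" assume "finite F"
  have "(\<Sum>x\<in>F. cmod (\<xi> x) * cmod (\<eta> x)) \<le> L2_set (\<lambda>x. cmod (\<xi> x)) F * L2_set (\<lambda>x. cmod (\<eta> x)) F"
    using L2_set_mult_ineq[of "\<lambda>x. cmod (\<xi> x)" "\<lambda>x. cmod (\<eta> x)" F] by simp
  also have "\<dots> \<le> l2_norm \<xi> * l2_norm \<eta>"
    using assms \<open>finite F\<close> by (intro mult_mono L2_set_le_l2_norm) auto
  finally show "(\<Sum>x\<in>F. cmod (\<xi> x) * cmod (\<eta> x)) \<le> l2_norm \<xi> * l2_norm \<eta>" .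
qed

lemma l2_CS:
  assumes "\<xi> \<in> l2 I" "\<eta> \<in> l2 J"
  shows "cmod (l2_inner \<xi> \<eta>) \<le> l2_norm \<xi> * l2_norm \<eta>"
proof -
  have "cmod (l2_inner \<xi> \<eta>) \<le> (\<Sum>\<^sub>\<infinity>x. cmod (\<xi> x * cnj (\<eta> x)))"
    unfolding l2_inner_def using l2_inner_abs_summable[OF assms]
    by (intro norm_infsum_bound) (simp add: norm_mult)
  then show ?thesis using l2_abs_CS[OF assms] by (simp add: norm_mult)
qed

lemma l2_norm_add_sq:
  assumes "\<xi> \<in> l2 I" "\<eta> \<in> l2 I"
  shows "(l2_norm (\<lambda>x. \<xi> x + \<eta> x))\<^sup>2 = (l2_norm \<xi>)\<^sup>2 + 2 * Re (l2_inner \<xi> \<eta>) + (l2_norm \<eta>)\<^sup>2"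
proof -
  have "complex_of_real ((l2_norm (\<lambda>x. \<xi> x + \<eta> x))\<^sup>2) = l2_inner (\<lambda>x. \<xi> x + \<eta> x) (\<lambda>x. \<xi> x + \<eta> x)"
    by (simp add: l2_inner_self)
  also have "\<dots> = l2_inner \<xi> \<xi> + l2_inner \<xi> \<eta> + (l2_inner \<eta> \<xi> + l2_inner \<eta> \<eta>)"
    using assms by (simp add: l2_inner_add_left[of _ I _ I _ I] l2_inner_add_right[of _ I _ I _ I] l2_add)
  also have "\<dots> = (l2_norm \<xi>)\<^sup>2 + (l2_inner \<xi> \<eta> + cnj (l2_inner \<xi> \<eta>)) + (l2_norm \<eta>)\<^sup>2"
    by (simp add: l2_inner_self l2_inner_commute[of \<eta> \<xi>])
  also have "\<dots> = complex_of_real ((l2_norm \<xi>)\<^sup>2 + 2 * Re (l2_inner \<xi> \<eta>) + (l2_norm \<eta>)\<^sup>2)"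
    by (simp add: complex_add_cnj)
  finally show ?thesis by (simp only: of_real_eq_iff)
qed

lemma l2_norm_diff_sq:
  assumes "\<xi> \<in> l2 I" "\<eta> \<in> l2 I"
  shows "(l2_norm (\<lambda>x. \<xi> x - \<eta> x))\<^sup>2 = (l2_norm \<xi>)\<^sup>2 - 2 * Re (l2_inner \<xi> \<eta>) + (l2_norm \<eta>)\<^sup>2"
  using l2_norm_add_sq[OF assms(1) l2_uminus[OF assms(2)]]
  by (simp add: l2_inner_minus_right)

lemma l2_triangle:
  assumes "\<xi> \<in> l2 I" "\<eta> \<in> l2 I"
  shows "l2_norm (\<lambda>x. \<xi> x + \<eta> x) \<le> l2_norm \<xi> + l2_norm \<eta>"
proof (rule power2_le_imp_le)
  have "Re (l2_inner \<xi> \<eta>) \<le> l2_norm \<xi> * l2_norm \<eta>"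
    using l2_CS[OF assms] complex_Re_le_cmod order_trans by blast
  then show "(l2_norm (\<lambda>x. \<xi> x + \<eta> x))\<^sup>2 \<le> (l2_norm \<xi> + l2_norm \<eta>)\<^sup>2"
    by (simp add: l2_norm_add_sq[OF assms] power2_sum)
qed simp

lemma l2_triangle_diff:
  assumes "\<xi> \<in> l2 I" "\<eta> \<in> l2 I"
  shows "l2_norm (\<lambda>x. \<xi> x - \<eta> x) \<le> l2_norm \<xi> + l2_norm \<eta>"
  using l2_triangle[OF assms(1) l2_uminus[OF assms(2)]] by simp

lemma l2_norm_sum_le:
  assumes "\<And>i. i \<in> A \<Longrightarrow> \<xi> i \<in> l2 I"
  shows "l2_norm (\<lambda>x. \<Sum>i\<in>A. \<xi> i x) \<le> (\<Sum>i\<in>A. l2_norm (\<xi> i))"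
  using assms
proof (induction A rule: infinite_finite_induct)
  case (insert a A)
  then have "l2_norm (\<lambda>x. \<xi> a x + (\<Sum>i\<in>A. \<xi> i x)) \<le> l2_norm (\<xi> a) + l2_norm (\<lambda>x. \<Sum>i\<in>A. \<xi> i x)"
    by (intro l2_triangle l2_sum) auto
  with insert show ?case by force
qed auto

section \<open>Point masses and truncations\<close>

definition l2_delta :: "'i \<Rightarrow> 'i \<Rightarrow> complex" where
  "l2_delta x = (\<lambda>y. if y = x then 1 else 0)"

lemma l2_finite_support:
  assumes "finite Y" "Y \<subseteq> I" "\<And>x. x \<notin> Y \<Longrightarrow> \<xi> x = 0"
  shows "\<xi> \<in> l2 I"
proof -
  have "(\<lambda>x. (cmod (\<xi> x))\<^sup>2) summable_on UNIV"
    using assms by (intro finite_nonzero_values_imp_summable_on) (auto intro: finite_subset[of _ Y])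
  then show ?thesis using assms by (auto simp: l2_def)
qed

lemma l2_delta_in [simp]: "x \<in> I \<Longrightarrow> l2_delta x \<in> l2 I"
  by (rule l2_finite_support[of "{x}"]) (auto simp: l2_delta_def)

lemma l2_inner_delta_right [simp]: "l2_inner \<xi> (l2_delta x) = \<xi> x"
proof -
  have "l2_inner \<xi> (l2_delta x) = infsum (\<lambda>y. \<xi> y * cnj (l2_delta x y)) {x}"
    unfolding l2_inner_def by (rule infsum_cong_neutral) (auto simp: l2_delta_def)
  then show ?thesis by (simp add: l2_delta_def)
qed

lemma l2_inner_delta_left [simp]: "l2_inner (l2_delta x) \<xi> = cnj (\<xi> x)"
  by (simp add: l2_inner_commute[of "l2_delta x"])

lemma l2_norm_delta [simp]: "l2_norm (l2_delta x) = 1"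
proof -
  have "complex_of_real ((l2_norm (l2_delta x))\<^sup>2) = 1"
    unfolding l2_inner_self[symmetric] l2_inner_delta_right by (simp add: l2_delta_def)
  then have "(l2_norm (l2_delta x))\<^sup>2 = 1" by (metis of_real_eq_1_iff)
  then show ?thesis using l2_norm_nonneg[of "l2_delta x"] by (simp only: power2_eq_1_iff) linarith
qed

definition l2_trunc :: "'i set \<Rightarrow> ('i \<Rightarrow> complex) \<Rightarrow> 'i \<Rightarrow> complex" where
  "l2_trunc Y \<xi> = (\<lambda>x. if x \<in> Y then \<xi> x else 0)"

lemma l2_trunc_in:
  assumes "\<xi> \<in> l2 I" shows "l2_trunc Y \<xi> \<in> l2 I"
proof -
  have "(\<lambda>x. (cmod (l2_trunc Y \<xi> x))\<^sup>2) summable_on UNIV"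
    by (rule summable_on_comparison_test[OF l2_summable[OF assms]]) (auto simp: l2_trunc_def)
  then show ?thesis using assms by (auto simp: l2_def l2_trunc_def)
qed

lemma l2_norm_mono:
  assumes "\<eta> \<in> l2 I" "\<And>x. cmod (\<xi> x) \<le> cmod (\<eta> x)"
  shows "l2_norm \<xi> \<le> l2_norm \<eta>"
proof -
  have "(\<lambda>x. (cmod (\<xi> x))\<^sup>2) summable_on UNIV"
    by (rule summable_on_comparison_test[OF l2_summable[OF assms(1)]])
      (auto simp: assms(2) intro: power_mono)
  then show ?thesis
    unfolding l2_norm_def using assms
    by (intro real_sqrt_le_mono infsum_mono) (auto intro: power_mono l2_summable)
qed

lemma l2_norm_trunc_le: "\<xi> \<in> l2 I \<Longrightarrow> l2_norm (l2_trunc Y \<xi>) \<le> l2_norm \<xi>"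
  by (rule l2_norm_mono) (auto simp: l2_trunc_def)

lemma l2_norm_trunc_finite:
  assumes "finite Y" shows "l2_norm (l2_trunc Y \<xi>) = L2_set (\<lambda>x. cmod (\<xi> x)) Y"
proof -
  have "infsum (\<lambda>x. (cmod (l2_trunc Y \<xi> x))\<^sup>2) UNIV = infsum (\<lambda>x. (cmod (\<xi> x))\<^sup>2) Y"
    by (rule infsum_cong_neutral) (auto simp: l2_trunc_def)
  then show ?thesis using assms by (simp add: l2_norm_def L2_set_def)
qed

lemma l2_trunc_tendsto:
  assumes "\<xi> \<in> l2 I"
  shows "((\<lambda>Y. l2_norm (\<lambda>x. \<xi> x - l2_trunc Y \<xi> x)) \<longlongrightarrow> 0) (finite_subsets_at_top UNIV)"
proof -
  let ?f = "\<lambda>x. (cmod (\<xi> x))\<^sup>2"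
  have lim: "((\<lambda>Y. sum ?f Y) \<longlongrightarrow> infsum ?f UNIV) (finite_subsets_at_top UNIV)"
    by (rule infsum_tendsto[OF l2_summable[OF assms]])
  have eq: "\<forall>\<^sub>F Y in finite_subsets_at_top UNIV.
      l2_norm (\<lambda>x. \<xi> x - l2_trunc Y \<xi> x) = sqrt (infsum ?f UNIV - sum ?f Y)"
  proof (rule eventually_finite_subsets_at_top_weakI)
    fix Y :: "'a set" assume Y: "finite Y"
    have "infsum (\<lambda>x. (cmod (\<xi> x - l2_trunc Y \<xi> x))\<^sup>2) UNIV = infsum ?f (UNIV - Y)"
      by (rule infsum_cong_neutral) (auto simp: l2_trunc_def)
    moreover have "infsum ?f UNIV = infsum ?f (UNIV - Y) + infsum ?f Y"
      using infsum_Un_disjoint[of ?f "UNIV - Y" Y] summable_on_subset_banach[OF l2_summable[OF assms]] Y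
      by (simp add: Int_commute)
    ultimately show "l2_norm (\<lambda>x. \<xi> x - l2_trunc Y \<xi> x) = sqrt (infsum ?f UNIV - sum ?f Y)"
      using Y by (simp add: l2_norm_def)
  qed
  have "((\<lambda>Y. sqrt (infsum ?f UNIV - sum ?f Y)) \<longlongrightarrow> sqrt (infsum ?f UNIV - infsum ?f UNIV)) (finite_subsets_at_top UNIV)"
    by (intro tendsto_intros lim)
  then show ?thesis by (subst tendsto_cong[OF eq]) simp
qed

lemma l2_trunc_approx:
  assumes "\<xi> \<in> l2 I" "0 < e"
  obtains Y where "finite Y" "Y \<subseteq> I" "l2_norm (\<lambda>x. \<xi> x - l2_trunc Y \<xi> x) < e"
proof -
  have "\<forall>\<^sub>F Y in finite_subsets_at_top UNIV. l2_norm (\<lambda>x. \<xi> x - l2_trunc Y \<xi> x) < e"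
    using order_tendstoD(2)[OF l2_trunc_tendsto[OF assms(1)] assms(2)] .
  then obtain Y where Y: "finite Y" "l2_norm (\<lambda>x. \<xi> x - l2_trunc Y \<xi> x) < e"
    by (auto simp: eventually_finite_subsets_at_top)
  have "l2_trunc (Y \<inter> I) \<xi> = l2_trunc Y \<xi>"
    using assms(1) by (auto simp: l2_trunc_def l2_def)
  then show ?thesis using Y by (intro that[of "Y \<inter> I"]) auto
qed

lemma l2_ext:
  assumes "\<xi> \<in> l2 I" "\<xi>' \<in> l2 I" "\<And>\<eta>. \<eta> \<in> l2 I \<Longrightarrow> l2_inner \<xi> \<eta> = l2_inner \<xi>' \<eta>"
  shows "\<xi> = \<xi>'"
proof
  fix x show "\<xi> x = \<xi>' x"
    using assms(3)[of "l2_delta x"] l2_D[OF assms(1)] l2_D[OF assms(2)] by (cases "x \<in> I") auto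
qed

text \<open>Testing against \<xi> itself cancels one factor of the norm.\<close>

lemma l2_norm_le_inner:
  assumes "\<xi> \<in> l2 I" "\<And>\<eta>. \<eta> \<in> l2 I \<Longrightarrow> cmod (l2_inner \<xi> \<eta>) \<le> C * l2_norm \<eta>" "0 \<le> C"
  shows "l2_norm \<xi> \<le> C"
proof (cases "l2_norm \<xi> = 0")
  case False
  have "(l2_norm \<xi>)\<^sup>2 = cmod (l2_inner \<xi> \<xi>)"
    by (simp add: l2_inner_self norm_power)
  also have "\<dots> \<le> C * l2_norm \<xi>" using assms by blast
  finally show ?thesis
    using False by (simp add: power2_eq_square)
      (metis l2_norm_nonneg less_eq_real_def mult_le_cancel_right not_less)
qed (use assms in simp)

section \<open>The Riesz representation and weak compactness\<close>

text \<open>The coordinates of \<open>y\<close> are forced by the point masses. Testing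
  \<open>f\<close> on the finite truncations of \<open>y\<close> itself bounds the square sums, and
  agreement on truncations extends to all vectors by continuity.\<close>

lemma Riesz_l2:
  assumes add: "\<And>\<xi> \<eta>. \<xi> \<in> l2 I \<Longrightarrow> \<eta> \<in> l2 I \<Longrightarrow> f (\<lambda>x. \<xi> x + \<eta> x) = f \<xi> + f \<eta>"
    and scale: "\<And>c \<xi>. \<xi> \<in> l2 I \<Longrightarrow> f (\<lambda>x. c * \<xi> x) = cnj c * f \<xi>"
    and bound: "\<And>\<xi>. \<xi> \<in> l2 I \<Longrightarrow> cmod (f \<xi>) \<le> C * l2_norm \<xi>"
  obtains y where "y \<in> l2 I" "\<And>\<eta>. \<eta> \<in> l2 I \<Longrightarrow> l2_inner y \<eta> = f \<eta>" 
    "0 \<le> C \<Longrightarrow> l2_norm y \<le> C"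
proof -
  define y where "y = (\<lambda>x. if x \<in> I then f (l2_delta x) else 0)"
  have fin: "f (l2_trunc Y \<xi>) = (\<Sum>x\<in>Y. y x * cnj (\<xi> x))" if "finite Y" "\<xi> \<in> l2 I" for Y \<xi>
    using that(1)
  proof induction
    case empty
    have "f (\<lambda>x. 0) = 0" using scale[of "\<lambda>x. 0" 0] by simp
    then show ?case by (simp add: l2_trunc_def)
  next
    case (insert a Y)
    show ?case
    proof (cases "a \<in> I")
      case True
      have "l2_trunc (insert a Y) \<xi> = (\<lambda>x. \<xi> a * l2_delta a x + l2_trunc Y \<xi> x)"
        using insert by (auto simp: l2_trunc_def l2_delta_def)
      then have "f (l2_trunc (insert a Y) \<xi>) = cnj (\<xi> a) * f (l2_delta a) + f (l2_trunc Y \<xi>)"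
        using True that(2) by (simp add: add scale l2_scale l2_trunc_in)
      then show ?thesis using insert True by (simp add: y_def mult.commute)
    next
      case False
      then have "l2_trunc (insert a Y) \<xi> = l2_trunc Y \<xi>"
        using that(2) by (auto simp: l2_trunc_def l2_def)
      then show ?thesis using insert False by (simp add: y_def)
    qed
  qed
  \<comment> \<open>If l2 I is trivial, the bound does not force \<open>C\<close> to be nonnegative;
    hence the absolute value here and the condition on the last conclusion.\<close>
  have CC: "cmod (f \<xi>) \<le> \<bar>C\<bar> * l2_norm \<xi>" if "\<xi> \<in> l2 I" for \<xi>
    using bound[OF that] mult_right_mono[OF abs_ge_self[of C] l2_norm_nonneg[of \<xi>]] by linarith
  have ybd: "(\<Sum>x\<in>Y. (cmod (y x))\<^sup>2) \<le> C\<^sup>2" if "finite Y" for Y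
  proof -
    define z where "z = l2_trunc Y y"
    have z: "z \<in> l2 I"
      by (rule l2_finite_support[of "Y \<inter> I"]) (use that in \<open>auto simp: z_def l2_trunc_def y_def\<close>)
    have tz: "l2_trunc Y z = z" by (auto simp: z_def l2_trunc_def)
    have zn: "l2_norm z = sqrt (\<Sum>x\<in>Y. (cmod (y x))\<^sup>2)"
      unfolding z_def by (simp add: l2_norm_trunc_finite[OF that] L2_set_def)
    let ?S = "\<Sum>x\<in>Y. (cmod (y x))\<^sup>2"
    have "f z = (\<Sum>x\<in>Y. y x * cnj (z x))" using fin[OF that z] tz by simp
    also have "\<dots> = (\<Sum>x\<in>Y. y x * cnj (y x))"
      by (rule sum.cong) (auto simp: z_def l2_trunc_def)
    also have "\<dots> = of_real ?S"
      by (simp add: complex_norm_square[symmetric] mult.commute)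
    finally have "\<bar>?S\<bar> \<le> \<bar>C\<bar> * sqrt ?S" using CC[OF z] zn by (simp del: of_real_sum)
    moreover have "0 \<le> ?S" by (simp add: sum_nonneg)
    ultimately have "sqrt ?S * sqrt ?S \<le> \<bar>C\<bar> * sqrt ?S" by simp
    moreover have "r \<le> c" if "r * r \<le> c * r" "0 \<le> c" "0 \<le> r" for r c :: real
      using that by (cases "r = 0") auto
    ultimately have "sqrt ?S \<le> \<bar>C\<bar>" using \<open>0 \<le> ?S\<close> abs_ge_zero real_sqrt_ge_zero by blast
    then have "(sqrt ?S)\<^sup>2 \<le> \<bar>C\<bar>\<^sup>2" by (intro power_mono) (simp_all add: \<open>0 \<le> ?S\<close>)
    then show ?thesis using \<open>0 \<le> ?S\<close> by simp
  qed
  have ys: "(\<lambda>x. (cmod (y x))\<^sup>2) summable_on UNIV"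
    by (rule nonneg_bdd_above_summable_on) (use ybd in \<open>auto intro!: bdd_aboveI[of _ "C\<^sup>2"]\<close>)
  then have y: "y \<in> l2 I" by (auto simp: l2_def y_def)
  have "l2_norm y \<le> C" if "0 \<le> C"
  proof -
    have "infsum (\<lambda>x. (cmod (y x))\<^sup>2) UNIV \<le> C\<^sup>2"
      by (rule infsum_le_finite_sums[OF ys]) (use ybd in auto)
    then show ?thesis unfolding l2_norm_def using that by (simp add: real_le_lsqrt infsum_nonneg)
  qed
  moreover have "l2_inner y \<eta> = f \<eta>" if "\<eta> \<in> l2 I" for \<eta>
  proof -
    let ?F = "finite_subsets_at_top (UNIV :: 'a set)"
    have l1: "((\<lambda>Y. \<Sum>x\<in>Y. y x * cnj (\<eta> x)) \<longlongrightarrow> l2_inner y \<eta>) ?F"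
      unfolding l2_inner_def by (rule infsum_tendsto[OF l2_inner_summable[OF y that]])
    have "((\<lambda>Y. f (l2_trunc Y \<eta>) - f \<eta>) \<longlongrightarrow> 0) ?F"
    proof (rule Lim_null_comparison)
      show "((\<lambda>Y. \<bar>C\<bar> * l2_norm (\<lambda>x. \<eta> x - l2_trunc Y \<eta> x)) \<longlongrightarrow> 0) ?F"
        using tendsto_mult_right_zero[OF l2_trunc_tendsto[OF that]] .
      have "norm (f (l2_trunc Y \<eta>) - f \<eta>) \<le> \<bar>C\<bar> * l2_norm (\<lambda>x. \<eta> x - l2_trunc Y \<eta> x)" for Y
      proof -
        have "f (\<lambda>x. (\<eta> x - l2_trunc Y \<eta> x) + l2_trunc Y \<eta> x) = f (\<lambda>x. \<eta> x - l2_trunc Y \<eta> x) + f (l2_trunc Y \<eta>)"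
          using that by (intro add l2_diff l2_trunc_in)
        then have "norm (f (l2_trunc Y \<eta>) - f \<eta>) = norm (f (\<lambda>x. \<eta> x - l2_trunc Y \<eta> x))"
          by (simp add: norm_minus_commute)
        then show ?thesis using CC[OF l2_diff[OF that l2_trunc_in[OF that]]] by simp
      qed
      then show "\<forall>\<^sub>F Y in ?F. norm (f (l2_trunc Y \<eta>) - f \<eta>) \<le> \<bar>C\<bar> * l2_norm (\<lambda>x. \<eta> x - l2_trunc Y \<eta> x)"
        by simp
    qed
    then have l2: "((\<lambda>Y. f (l2_trunc Y \<eta>)) \<longlongrightarrow> f \<eta>) ?F"
      by (simp add: LIM_zero_iff)
    have "\<forall>\<^sub>F Y in ?F. f (l2_trunc Y \<eta>) = (\<Sum>x\<in>Y. y x * cnj (\<eta> x))"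
      by (rule eventually_finite_subsets_at_top_weakI) (use fin that in auto)
    then have "((\<lambda>Y. \<Sum>x\<in>Y. y x * cnj (\<eta> x)) \<longlongrightarrow> f \<eta>) ?F"
      by (rule Lim_transform_eventually[OF l2])
    then show ?thesis by (rule tendsto_unique[OF finite_subsets_at_top_neq_bot l1])
  qed
  ultimately show ?thesis using y that by blast
qed

text \<open>The sequence \<open>d\<close> runs in a product of closed discs, which is compact by
  Tychonoff. The index type may be uncountable, so a cluster point is reached along a filter finer
  than \<open>sequentially\<close> and not along a subsequence.\<close>

lemma bounded_families_limit_filter:
  fixes d :: "nat \<Rightarrow> 'x \<Rightarrow> complex"
  assumes "\<And>n x. cmod (d n x) \<le> C x"
  obtains \<U> \<sigma> where "\<U> \<noteq> bot" "\<U> \<le> sequentially" "\<And>x. ((\<lambda>n. d n x) \<longlongrightarrow> \<sigma> x) \<U>"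
proof -
  let ?K = "PiE UNIV (\<lambda>x. cball (0::complex) (C x))"
  have "compactin (product_topology (\<lambda>x. euclidean) UNIV) ?K"
    by (subst compactin_PiE) auto
  then have K: "compact ?K" by (simp add: euclidean_product_topology)
  have ev: "eventually (\<lambda>g. g \<in> ?K) (filtermap d sequentially)"
    unfolding eventually_filtermap using assms by (auto simp: PiE_def)
  have "filtermap d sequentially \<noteq> bot" by (simp add: filtermap_bot_iff)
  with K ev obtain \<sigma> where \<sigma>: "inf (nhds \<sigma>) (filtermap d sequentially) \<noteq> bot"
    unfolding compact_filter by blast
  \<comment> \<open>Pulling the neighbourhoods of the cluster point back along \<open>d\<close>
    turns it into a limit; the infimum makes the filter refine \<open>sequentially\<close>.\<close>
  define \<U> where "\<U> = inf (filtercomap d (nhds \<sigma>)) sequentially"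
  have "\<U> \<noteq> bot"
  proof
    assume "\<U> = bot"
    then obtain P Q where PQ: "eventually P (filtercomap d (nhds \<sigma>))" "eventually Q sequentially" "\<And>n. P n \<Longrightarrow> Q n \<Longrightarrow> False"
      unfolding \<U>_def trivial_limit_def eventually_inf by auto
    from PQ(1) obtain P' where P': "eventually P' (nhds \<sigma>)" "\<And>n. P' (d n) \<Longrightarrow> P n"
      by (auto simp: eventually_filtercomap)
    have "eventually (\<lambda>g. \<forall>n. g = d n \<longrightarrow> \<not> P' g) (filtermap d sequentially)"
    proof -
      have "eventually (\<lambda>n. \<not> P' (d n)) sequentially"
        using PQ(2) by (rule eventually_mono) (use PQ(3) P'(2) in blast)
      then show ?thesis unfolding eventually_filtermap by (rule eventually_mono) auto
    qed
    moreover have "eventually (\<lambda>g. \<exists>n. g = d n) (filtermap d sequentially)"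
      unfolding eventually_filtermap by (rule always_eventually) blast
    ultimately have "eventually (\<lambda>g. \<not> P' g) (filtermap d sequentially)"
      by eventually_elim auto
    with P'(1) have "eventually (\<lambda>g. False) (inf (nhds \<sigma>) (filtermap d sequentially))"
      unfolding eventually_inf by blast
    with \<sigma> show False by (simp add: trivial_limit_def)
  qed
  moreover have "\<U> \<le> sequentially" by (simp add: \<U>_def)
  moreover have "((\<lambda>n. d n x) \<longlongrightarrow> \<sigma> x) \<U>" for x
  proof -
    have "(d \<longlongrightarrow> \<sigma>) \<U>"
      unfolding \<U>_def filterlim_iff_le_filtercomap by simp
    then have "filterlim d (nhds \<sigma>) \<U>" .
    moreover have "filterlim (\<lambda>g :: 'x \<Rightarrow> complex. g x) (nhds (\<sigma> x)) (nhds \<sigma>)"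
    proof -
      have "continuous_on UNIV (\<lambda>g :: 'x \<Rightarrow> complex. g x)"
        by (rule continuous_on_product_coordinates)
      then have "filterlim (\<lambda>g :: 'x \<Rightarrow> complex. g x) (nhds (\<sigma> x)) (at \<sigma>)"
        unfolding continuous_on_def by simp
      then show ?thesis by (simp add: tendsto_at_iff_tendsto_nhds[of "\<lambda>g. g x"])
    qed
    ultimately show ?thesis using filterlim_compose by blast
  qed
  ultimately show ?thesis using that by blast
qed

section \<open>Bounded operators and their adjoints\<close>

lemma bounded_ops_l2: "T \<in> bounded_ops I \<Longrightarrow> \<xi> \<in> l2 I \<Longrightarrow> T \<xi> \<in> l2 I"
  by (simp add: bounded_ops_def)

lemma bounded_ops_out: "T \<in> bounded_ops I \<Longrightarrow> \<xi> \<notin> l2 I \<Longrightarrow> T \<xi> = (\<lambda>_. 0)"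
  by (simp add: bounded_ops_def)

lemma bounded_ops_add:
  "T \<in> bounded_ops I \<Longrightarrow> \<xi> \<in> l2 I \<Longrightarrow> \<eta> \<in> l2 I \<Longrightarrow> T (\<lambda>x. \<xi> x + \<eta> x) = (\<lambda>x. T \<xi> x + T \<eta> x)"
  by (simp add: bounded_ops_def)

lemma bounded_ops_scale:
  "T \<in> bounded_ops I \<Longrightarrow> \<xi> \<in> l2 I \<Longrightarrow> T (\<lambda>x. c * \<xi> x) = (\<lambda>x. c * T \<xi> x)"
  by (simp add: bounded_ops_def)

lemma bounded_ops_bound:
  assumes "T \<in> bounded_ops I"
  obtains C where "0 \<le> C" "\<And>\<xi>. \<xi> \<in> l2 I \<Longrightarrow> l2_norm (T \<xi>) \<le> C * l2_norm \<xi>"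
proof -
  obtain C where C: "\<And>\<xi>. \<xi> \<in> l2 I \<Longrightarrow> l2_norm (T \<xi>) \<le> C * l2_norm \<xi>"
    using assms unfolding bounded_ops_def by blast
  have "l2_norm (T \<xi>) \<le> \<bar>C\<bar> * l2_norm \<xi>" if "\<xi> \<in> l2 I" for \<xi>
    using C[OF that] mult_right_mono[OF abs_ge_self[of C] l2_norm_nonneg[of \<xi>]] by linarith
  then show ?thesis using that[of "\<bar>C\<bar>"] by simp
qed

lemma bounded_ops_zero: "T \<in> bounded_ops I \<Longrightarrow> T (\<lambda>_. 0) = (\<lambda>_. 0)"
  using bounded_ops_scale[of T I "\<lambda>_. 0" 0] by simp

lemma bounded_ops_diff:
  assumes "T \<in> bounded_ops I" "\<xi> \<in> l2 I" "\<eta> \<in> l2 I"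
  shows "T (\<lambda>x. \<xi> x - \<eta> x) = (\<lambda>x. T \<xi> x - T \<eta> x)"
  using bounded_ops_add[OF assms(1,2) l2_scale[OF assms(3), of "-1"]]
    bounded_ops_scale[OF assms(1,3), of "-1"] by simp

lemma bounded_ops_sum:
  assumes "T \<in> bounded_ops I" "\<And>i. i \<in> A \<Longrightarrow> \<xi> i \<in> l2 I"
  shows "T (\<lambda>x. \<Sum>i\<in>A. \<xi> i x) = (\<lambda>x. \<Sum>i\<in>A. T (\<xi> i) x)"
  using assms(2)
proof (induction A rule: infinite_finite_induct)
  case (insert a A)
  have "T (\<lambda>x. \<xi> a x + (\<Sum>i\<in>A. \<xi> i x)) = (\<lambda>x. T (\<xi> a) x + T (\<lambda>x. \<Sum>i\<in>A. \<xi> i x) x)"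
    using insert by (intro bounded_ops_add[OF assms(1)] l2_sum) auto
  with insert show ?case by simp
qed (simp_all add: bounded_ops_zero[OF assms(1)])

lemma bounded_opsI:
  assumes "\<And>\<xi>. \<xi> \<in> l2 I \<Longrightarrow> T \<xi> \<in> l2 I" "\<And>\<xi>. \<xi> \<notin> l2 I \<Longrightarrow> T \<xi> = (\<lambda>_. 0)"
    "\<And>\<xi> \<eta>. \<xi> \<in> l2 I \<Longrightarrow> \<eta> \<in> l2 I \<Longrightarrow> T (\<lambda>x. \<xi> x + \<eta> x) = (\<lambda>x. T \<xi> x + T \<eta> x)"
    "\<And>c \<xi>. \<xi> \<in> l2 I \<Longrightarrow> T (\<lambda>x. c * \<xi> x) = (\<lambda>x. c * T \<xi> x)"
    "\<And>\<xi>. \<xi> \<in> l2 I \<Longrightarrow> l2_norm (T \<xi>) \<le> C * l2_norm \<xi>"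
  shows "T \<in> bounded_ops I"
  using assms unfolding bounded_ops_def by blast

lemma bounded_ops_ext:
  assumes "T \<in> bounded_ops I" "S \<in> bounded_ops I"
    "\<And>\<xi> \<eta>. \<xi> \<in> l2 I \<Longrightarrow> \<eta> \<in> l2 I \<Longrightarrow> l2_inner (T \<xi>) \<eta> = l2_inner (S \<xi>) \<eta>"
  shows "T = S"
proof
  fix \<xi> show "T \<xi> = S \<xi>"
  proof (cases "\<xi> \<in> l2 I")
    case True
    then show ?thesis
      by (intro l2_ext[of _ I] assms bounded_ops_l2[OF assms(1)] bounded_ops_l2[OF assms(2)])
  next
    case False
    then show ?thesis by (simp add: bounded_ops_out[OF assms(1)] bounded_ops_out[OF assms(2)])
  qed
qed

lemma bounded_ops_comp:
  assumes "T \<in> bounded_ops I" "S \<in> bounded_ops I"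
  shows "T \<circ> S \<in> bounded_ops I"
proof -
  obtain C where C: "0 \<le> C" "\<And>\<xi>. \<xi> \<in> l2 I \<Longrightarrow> l2_norm (T \<xi>) \<le> C * l2_norm \<xi>"
    using bounded_ops_bound[OF assms(1)] by blast
  obtain D where D: "0 \<le> D" "\<And>\<xi>. \<xi> \<in> l2 I \<Longrightarrow> l2_norm (S \<xi>) \<le> D * l2_norm \<xi>"
    using bounded_ops_bound[OF assms(2)] by blast
  show ?thesis
  proof (rule bounded_opsI)
    fix \<xi> assume \<xi>: "\<xi> \<in> l2 I"
    have "l2_norm (T (S \<xi>)) \<le> C * l2_norm (S \<xi>)" by (rule C(2)[OF bounded_ops_l2[OF assms(2) \<xi>]])
    also have "\<dots> \<le> C * (D * l2_norm \<xi>)" by (rule mult_left_mono[OF D(2)[OF \<xi>] C(1)])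
    finally show "l2_norm ((T \<circ> S) \<xi>) \<le> (C * D) * l2_norm \<xi>" by (simp add: mult.assoc)
  qed (use assms in \<open>auto simp: bounded_ops_l2 bounded_ops_out bounded_ops_zero bounded_ops_add bounded_ops_scale\<close>)
qed

lemma bounded_ops_plus:
  assumes "T \<in> bounded_ops I" "S \<in> bounded_ops I"
  shows "(\<lambda>\<xi> x. T \<xi> x + S \<xi> x) \<in> bounded_ops I"
proof -
  obtain C where C: "0 \<le> C" "\<And>\<xi>. \<xi> \<in> l2 I \<Longrightarrow> l2_norm (T \<xi>) \<le> C * l2_norm \<xi>"
    using bounded_ops_bound[OF assms(1)] by blast
  obtain D where D: "0 \<le> D" "\<And>\<xi>. \<xi> \<in> l2 I \<Longrightarrow> l2_norm (S \<xi>) \<le> D * l2_norm \<xi>"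
    using bounded_ops_bound[OF assms(2)] by blast
  show ?thesis
  proof (rule bounded_opsI)
    fix \<xi> assume \<xi>: "\<xi> \<in> l2 I"
    have "l2_norm (\<lambda>x. T \<xi> x + S \<xi> x) \<le> l2_norm (T \<xi>) + l2_norm (S \<xi>)"
      by (intro l2_triangle[of _ I] bounded_ops_l2[OF assms(1)] bounded_ops_l2[OF assms(2)] \<xi>)
    then show "l2_norm (\<lambda>x. T \<xi> x + S \<xi> x) \<le> (C + D) * l2_norm \<xi>"
      using C(2)[OF \<xi>] D(2)[OF \<xi>] by (simp add: distrib_right)
  qed (use assms in \<open>auto simp: bounded_ops_l2 bounded_ops_out bounded_ops_zero bounded_ops_add bounded_ops_scale l2_add algebra_simps\<close>)
qed

lemma bounded_ops_smult:
  assumes "T \<in> bounded_ops I"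
  shows "(\<lambda>\<xi> x. c * T \<xi> x) \<in> bounded_ops I"
proof -
  obtain C where C: "0 \<le> C" "\<And>\<xi>. \<xi> \<in> l2 I \<Longrightarrow> l2_norm (T \<xi>) \<le> C * l2_norm \<xi>"
    using bounded_ops_bound[OF assms(1)] by blast
  show ?thesis
  proof (rule bounded_opsI)
    fix \<xi> assume \<xi>: "\<xi> \<in> l2 I"
    show "l2_norm (\<lambda>x. c * T \<xi> x) \<le> (cmod c * C) * l2_norm \<xi>"
      using mult_left_mono[OF C(2)[OF \<xi>], of "cmod c"] by (simp add: l2_norm_scale mult.assoc)
  qed (use assms in \<open>auto simp: bounded_ops_l2 bounded_ops_out bounded_ops_zero bounded_ops_add bounded_ops_scale l2_scale algebra_simps\<close>)
qed

text \<open>The Riesz representation in the second variable. All operators below that have no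
  explicit formula come from here: adjoints, the module action, convolutions and weak
  limits.\<close>

lemma form_operator:
  assumes addl: "\<And>\<xi> \<xi>' \<eta>. \<lbrakk>\<xi> \<in> l2 I; \<xi>' \<in> l2 I; \<eta> \<in> l2 I\<rbrakk> \<Longrightarrow> B (\<lambda>x. \<xi> x + \<xi>' x) \<eta> = B \<xi> \<eta> + B \<xi>' \<eta>"
    and addr: "\<And>\<xi> \<xi>' \<eta>. \<lbrakk>\<xi> \<in> l2 I; \<xi>' \<in> l2 I; \<eta> \<in> l2 I\<rbrakk> \<Longrightarrow> B \<eta> (\<lambda>x. \<xi> x + \<xi>' x) = B \<eta> \<xi> + B \<eta> \<xi>'"
    and scalel: "\<And>c \<xi> \<eta>. \<lbrakk>\<xi> \<in> l2 I; \<eta> \<in> l2 I\<rbrakk> \<Longrightarrow> B (\<lambda>x. c * \<xi> x) \<eta> = c * B \<xi> \<eta>"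
    and scaler: "\<And>c \<xi> \<eta>. \<lbrakk>\<xi> \<in> l2 I; \<eta> \<in> l2 I\<rbrakk> \<Longrightarrow> B \<eta> (\<lambda>x. c * \<xi> x) = cnj c * B \<eta> \<xi>"
    and bound: "\<And>\<xi> \<eta>. \<lbrakk>\<xi> \<in> l2 I; \<eta> \<in> l2 I\<rbrakk> \<Longrightarrow> cmod (B \<xi> \<eta>) \<le> C * l2_norm \<xi> * l2_norm \<eta>"
    and "0 \<le> C"
  obtains T where "T \<in> bounded_ops I"
    "\<And>\<xi> \<eta>. \<lbrakk>\<xi> \<in> l2 I; \<eta> \<in> l2 I\<rbrakk> \<Longrightarrow> l2_inner (T \<xi>) \<eta> = B \<xi> \<eta>"
    "\<And>\<xi>. \<xi> \<in> l2 I \<Longrightarrow> l2_norm (T \<xi>) \<le> C * l2_norm \<xi>"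
proof -
  have "\<exists>y. \<xi> \<in> l2 I \<longrightarrow> y \<in> l2 I \<and> (\<forall>\<eta>\<in>l2 I. l2_inner y \<eta> = B \<xi> \<eta>) \<and> l2_norm y \<le> C * l2_norm \<xi>" for \<xi>
  proof (cases "\<xi> \<in> l2 I")
    case True
    show ?thesis
    proof (rule Riesz_l2[of I "B \<xi>" "C * l2_norm \<xi>"])
      fix y assume "y \<in> l2 I" "\<And>\<eta>. \<eta> \<in> l2 I \<Longrightarrow> l2_inner y \<eta> = B \<xi> \<eta>"
         "0 \<le> C * l2_norm \<xi> \<Longrightarrow> l2_norm y \<le> C * l2_norm \<xi>"
      then show ?thesis using \<open>0 \<le> C\<close> by auto
    qed (use True addr scaler bound in auto)
  qed auto
  then obtain T0 where T0: "\<And>\<xi>. \<xi> \<in> l2 I \<Longrightarrow> T0 \<xi> \<in> l2 I"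
    "\<And>\<xi> \<eta>. \<xi> \<in> l2 I \<Longrightarrow> \<eta> \<in> l2 I \<Longrightarrow> l2_inner (T0 \<xi>) \<eta> = B \<xi> \<eta>"
    "\<And>\<xi>. \<xi> \<in> l2 I \<Longrightarrow> l2_norm (T0 \<xi>) \<le> C * l2_norm \<xi>"
    by metis
  define T where "T = (\<lambda>\<xi>. if \<xi> \<in> l2 I then T0 \<xi> else (\<lambda>_. 0))"
  have "T \<in> bounded_ops I"
  proof (rule bounded_opsI)
    fix \<xi> \<eta> assume *: "\<xi> \<in> l2 I" "\<eta> \<in> l2 I"
    have "T0 (\<lambda>x. \<xi> x + \<eta> x) = (\<lambda>x. T0 \<xi> x + T0 \<eta> x)"
      by (rule l2_ext[of _ I]) (simp_all add: * T0 l2_add addl l2_inner_add_left[of _ I _ I _ I])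
    then show "T (\<lambda>x. \<xi> x + \<eta> x) = (\<lambda>x. T \<xi> x + T \<eta> x)" by (simp add: T_def * l2_add)
  next
    fix c \<xi> assume *: "\<xi> \<in> l2 I"
    have "T0 (\<lambda>x. c * \<xi> x) = (\<lambda>x. c * T0 \<xi> x)"
      by (rule l2_ext[of _ I]) (simp_all add: * T0 l2_scale scalel l2_inner_scale_left)
    then show "T (\<lambda>x. c * \<xi> x) = (\<lambda>x. c * T \<xi> x)" by (simp add: T_def * l2_scale)
  next
    fix \<xi> assume "\<xi> \<in> l2 I" then show "l2_norm (T \<xi>) \<le> C * l2_norm \<xi>" by (simp add: T_def T0)
  qed (simp_all add: T_def T0)
  then show ?thesis by (rule that) (simp_all add: T_def T0)
qed

lemma adjoint_exists:
  assumes "T \<in> bounded_ops I"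
  obtains T' where "T' \<in> bounded_ops I"
    "\<And>\<xi> \<eta>. \<xi> \<in> l2 I \<Longrightarrow> \<eta> \<in> l2 I \<Longrightarrow> l2_inner (T' \<xi>) \<eta> = l2_inner \<xi> (T \<eta>)"
proof -
  obtain C where C: "0 \<le> C" "\<And>\<xi>. \<xi> \<in> l2 I \<Longrightarrow> l2_norm (T \<xi>) \<le> C * l2_norm \<xi>"
    using bounded_ops_bound[OF assms(1)] by blast
  show ?thesis
  proof (rule form_operator[of I "\<lambda>\<xi> \<eta>. l2_inner \<xi> (T \<eta>)" C])
    fix \<xi> \<eta> assume *: "\<xi> \<in> l2 I" "\<eta> \<in> l2 I"
    have "cmod (l2_inner \<xi> (T \<eta>)) \<le> l2_norm \<xi> * l2_norm (T \<eta>)"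
      by (rule l2_CS[OF *(1) bounded_ops_l2[OF assms *(2)]])
    also have "\<dots> \<le> l2_norm \<xi> * (C * l2_norm \<eta>)" by (rule mult_left_mono[OF C(2)[OF *(2)]]) simp
    finally show "cmod (l2_inner \<xi> (T \<eta>)) \<le> C * l2_norm \<xi> * l2_norm \<eta>" by (simp add: mult_ac)
  qed (use assms C(1) that in \<open>auto simp: bounded_ops_l2 bounded_ops_add bounded_ops_scale
        l2_inner_add_left[of _ I _ I _ I] l2_inner_add_right[of _ I _ I _ I] l2_inner_scale_left l2_inner_scale_right\<close>)
qed

definition op_adjoint :: "'i set \<Rightarrow> 'i l2_op \<Rightarrow> 'i l2_op" where
  "op_adjoint I T = (SOME T'. T' \<in> bounded_ops I \<and>
     (\<forall>\<xi>\<in>l2 I. \<forall>\<eta>\<in>l2 I. l2_inner (T' \<xi>) \<eta> = l2_inner \<xi> (T \<eta>)))"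

lemma op_adjoint:
  assumes "T \<in> bounded_ops I"
  shows op_adjoint_in: "op_adjoint I T \<in> bounded_ops I"
    and op_adjoint_left: "\<And>\<xi> \<eta>. \<xi> \<in> l2 I \<Longrightarrow> \<eta> \<in> l2 I \<Longrightarrow> l2_inner (op_adjoint I T \<xi>) \<eta> = l2_inner \<xi> (T \<eta>)"
proof -
  have "\<exists>T'. T' \<in> bounded_ops I \<and> (\<forall>\<xi>\<in>l2 I. \<forall>\<eta>\<in>l2 I. l2_inner (T' \<xi>) \<eta> = l2_inner \<xi> (T \<eta>))"
    by (rule adjoint_exists[OF assms]) blast
  from someI_ex[OF this] show "op_adjoint I T \<in> bounded_ops I"
    "\<And>\<xi> \<eta>. \<xi> \<in> l2 I \<Longrightarrow> \<eta> \<in> l2 I \<Longrightarrow> l2_inner (op_adjoint I T \<xi>) \<eta> = l2_inner \<xi> (T \<eta>)"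
    unfolding op_adjoint_def by auto
qed

lemma op_adjoint_right:
  assumes "T \<in> bounded_ops I" "\<xi> \<in> l2 I" "\<eta> \<in> l2 I"
  shows "l2_inner \<xi> (op_adjoint I T \<eta>) = l2_inner (T \<xi>) \<eta>"
  using op_adjoint_left[OF assms(1,3,2)]
  by (simp add: l2_inner_commute[of "T \<xi>"] l2_inner_commute[of \<xi>])

text \<open>With \<open>R\<close> moved to the other side, commutation becomes an identity between
  matrix coefficients of \<open>T\<close> alone. In this form it visibly passes to sums, multiples
  and weak limits.\<close>

lemma commute_iff_inner:
  assumes "T \<in> bounded_ops I" "R \<in> bounded_ops I"
  shows "T \<circ> R = R \<circ> T \<longleftrightarrow>
    (\<forall>\<xi>\<in>l2 I. \<forall>\<eta>\<in>l2 I. l2_inner (T (R \<xi>)) \<eta> = l2_inner (T \<xi>) (op_adjoint I R \<eta>))" (is "?L \<longleftrightarrow> ?R")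
proof
  assume ?L
  then have "T (R \<xi>) = R (T \<xi>)" for \<xi> by (metis comp_apply)
  then show ?R using assms by (simp add: op_adjoint_right bounded_ops_l2)
next
  assume ?R
  then show ?L
    using assms by (intro bounded_ops_ext[of _ I] bounded_ops_comp) (auto simp: op_adjoint_right bounded_ops_l2)
qed

section \<open>Amplifications\<close>

lemma has_sum_finite_sum:
  fixes f :: "'a \<Rightarrow> 'k \<Rightarrow> 'c :: topological_comm_monoid_add"
  assumes "\<And>a. a \<in> A \<Longrightarrow> (f a has_sum s a) B"
  shows "((\<lambda>k. \<Sum>a\<in>A. f a k) has_sum (\<Sum>a\<in>A. s a)) B"
  using assms by (induction A rule: infinite_finite_induct) (auto intro: has_sum_add)

definition slice :: "('k \<times> 'i \<Rightarrow> complex) \<Rightarrow> 'k \<Rightarrow> 'i \<Rightarrow> complex" where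
  "slice \<Xi> k = (\<lambda>x. \<Xi> (k, x))"

text \<open>The operator 1 \<otimes> T on a direct sum of copies of l2. Vectors of the direct sum
  are functions of pairs, so that the theory of \<open>l2\<close> applies to them unchanged, and a
  square summable sequence of vectors becomes one vector.\<close>

definition amp :: "'i l2_op \<Rightarrow> ('k \<times> 'i \<Rightarrow> complex) \<Rightarrow> 'k \<times> 'i \<Rightarrow> complex" where
  "amp T \<Xi> = (\<lambda>(k, x). T (slice \<Xi> k) x)"

lemma slice_amp [simp]: "slice (amp T \<Xi>) k = T (slice \<Xi> k)"
  by (simp add: slice_def amp_def)

lemma slice_in:
  assumes "\<Xi> \<in> l2 (UNIV \<times> I)" shows "slice \<Xi> k \<in> l2 I"
proof -
  have "(\<lambda>(k,x). (cmod (\<Xi> (k, x)))\<^sup>2) summable_on UNIV \<times> UNIV"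
    using l2_summable[OF assms] by (simp add: case_prod_unfold)
  then have "(\<lambda>x. (cmod (\<Xi> (k, x)))\<^sup>2) summable_on UNIV"
    using summable_on_SigmaD1[of "\<lambda>k x. (cmod (\<Xi> (k, x)))\<^sup>2" UNIV "\<lambda>_. UNIV" k] by simp
  then show ?thesis using assms by (auto simp: l2_def slice_def)
qed

lemma slice_norm_summable:
  assumes "\<Xi> \<in> l2 (UNIV \<times> I)"
  shows "(\<lambda>k. (l2_norm (slice \<Xi> k))\<^sup>2) summable_on UNIV"
    and "(\<Sum>\<^sub>\<infinity>k. (l2_norm (slice \<Xi> k))\<^sup>2) = (l2_norm \<Xi>)\<^sup>2"
proof -
  have *: "(\<lambda>(k,x). (cmod (\<Xi> (k, x)))\<^sup>2) summable_on UNIV \<times> UNIV"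
    using l2_summable[OF assms] by (simp add: case_prod_unfold)
  from summable_on_Sigma_banach[OF *] show "(\<lambda>k. (l2_norm (slice \<Xi> k))\<^sup>2) summable_on UNIV"
    by (simp add: l2_norm_sq slice_def)
  from infsum_Sigma'_banach[OF *] show "(\<Sum>\<^sub>\<infinity>k. (l2_norm (slice \<Xi> k))\<^sup>2) = (l2_norm \<Xi>)\<^sup>2"
    by (simp add: l2_norm_sq slice_def case_prod_unfold)
qed

lemma l2_prodI:
  assumes "\<And>k. slice \<Xi> k \<in> l2 I" "(\<lambda>k. (l2_norm (slice \<Xi> k))\<^sup>2) summable_on UNIV"
  shows "\<Xi> \<in> l2 (UNIV \<times> I)"
proof -
  have "(\<lambda>p. (cmod (\<Xi> p))\<^sup>2) summable_on UNIV \<times> UNIV"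
  proof (rule summable_on_SigmaI)
    show "((\<lambda>x. (cmod (\<Xi> (k, x)))\<^sup>2) has_sum (l2_norm (slice \<Xi> k))\<^sup>2) UNIV" for k
      using l2_summable[OF assms(1)[of k]] by (simp add: l2_norm_sq slice_def)
  qed (use assms(2) in auto)
  moreover have "\<Xi> p = 0" if "p \<notin> UNIV \<times> I" for p
    using that l2_D[OF assms(1)[of "fst p"], of "snd p"] by (cases p) (auto simp: slice_def)
  ultimately show ?thesis by (auto simp: l2_def)
qed

lemma inner_slices:
  assumes "\<Xi> \<in> l2 (UNIV \<times> I)" "\<Theta> \<in> l2 (UNIV \<times> J)"
  shows "((\<lambda>k. l2_inner (slice \<Xi> k) (slice \<Theta> k)) has_sum l2_inner \<Xi> \<Theta>) UNIV"
proof -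
  have *: "(\<lambda>(k,x). \<Xi> (k, x) * cnj (\<Theta> (k, x))) summable_on UNIV \<times> UNIV"
    using l2_inner_summable[OF assms] by (simp add: case_prod_unfold)
  show ?thesis
    using summable_on_Sigma_banach[OF *] infsum_Sigma'_banach[OF *]
    by (simp add: l2_inner_def slice_def has_sum_iff case_prod_unfold)
qed

text \<open>The estimate holds in each fibre \<open>k\<close>, and summing over the fibres preserves
  it. So amplification does not increase the norm of an operator matrix. The finite index sets are
  arbitrary in order to cover single operators as well.\<close>

lemma amp_matrix_bound:
  fixes \<Xi> :: "'j \<Rightarrow> 'k \<times> 'i \<Rightarrow> complex"
  assumes T: "\<And>a b. a \<in> A \<Longrightarrow> b \<in> B \<Longrightarrow> T a b \<in> bounded_ops I"
    and bound: "\<And>\<xi>. (\<And>b. b \<in> B \<Longrightarrow> \<xi> b \<in> l2 I) \<Longrightarrow>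
        (\<Sum>a\<in>A. (l2_norm (\<lambda>x. \<Sum>b\<in>B. T a b (\<xi> b) x))\<^sup>2) \<le> C * (\<Sum>b\<in>B. (l2_norm (\<xi> b))\<^sup>2)"
    and \<Xi>: "\<And>b. b \<in> B \<Longrightarrow> \<Xi> b \<in> l2 (UNIV \<times> I)"
    and fin: "finite A" "finite B"
  shows "\<And>a. a \<in> A \<Longrightarrow> (\<lambda>p. \<Sum>b\<in>B. amp (T a b) (\<Xi> b) p) \<in> l2 (UNIV \<times> I)"
    and "(\<Sum>a\<in>A. (l2_norm (\<lambda>p. \<Sum>b\<in>B. amp (T a b) (\<Xi> b) p))\<^sup>2) \<le> C * (\<Sum>b\<in>B. (l2_norm (\<Xi> b))\<^sup>2)"
proof -
  define \<Psi> where "\<Psi> = (\<lambda>a p. \<Sum>b\<in>B. amp (T a b) (\<Xi> b) p)"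
  have sl: "slice (\<Psi> a) k = (\<lambda>x. \<Sum>b\<in>B. T a b (slice (\<Xi> b) k) x)" for a k
    by (simp add: \<Psi>_def slice_def amp_def)
  have le: "(\<Sum>a\<in>A. (l2_norm (slice (\<Psi> a) k))\<^sup>2) \<le> C * (\<Sum>b\<in>B. (l2_norm (slice (\<Xi> b) k))\<^sup>2)" for k
    unfolding sl by (rule bound) (rule slice_in[OF \<Xi>])
  have sumr: "(\<lambda>k. C * (\<Sum>b\<in>B. (l2_norm (slice (\<Xi> b) k))\<^sup>2)) summable_on UNIV"
    by (rule summable_on_cmult_right, rule has_sum_imp_summable, rule has_sum_finite_sum,
        rule has_sum_infsum, rule slice_norm_summable(1)[OF \<Xi>])
  have s: "(\<lambda>k. (l2_norm (slice (\<Psi> a) k))\<^sup>2) summable_on UNIV" if "a \<in> A" for a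
  proof (rule summable_on_comparison_test[OF sumr])
    fix k
    have "(l2_norm (slice (\<Psi> a) k))\<^sup>2 \<le> (\<Sum>a\<in>A. (l2_norm (slice (\<Psi> a) k))\<^sup>2)"
      using that fin by (intro member_le_sum) auto
    with le[of k] show "(l2_norm (slice (\<Psi> a) k))\<^sup>2 \<le> C * (\<Sum>b\<in>B. (l2_norm (slice (\<Xi> b) k))\<^sup>2)"
      by linarith
  qed simp
  have \<Psi>: "\<Psi> a \<in> l2 (UNIV \<times> I)" if "a \<in> A" for a
  proof (rule l2_prodI[OF _ s[OF that]])
    show "slice (\<Psi> a) k \<in> l2 I" for k
      unfolding sl using that by (intro l2_sum bounded_ops_l2[OF T] slice_in[OF \<Xi>]) auto
  qed
  then show "\<And>a. a \<in> A \<Longrightarrow> (\<lambda>p. \<Sum>b\<in>B. amp (T a b) (\<Xi> b) p) \<in> l2 (UNIV \<times> I)"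
    by (simp add: \<Psi>_def)
  have "(\<Sum>a\<in>A. (l2_norm (\<Psi> a))\<^sup>2) = (\<Sum>a\<in>A. \<Sum>\<^sub>\<infinity>k. (l2_norm (slice (\<Psi> a) k))\<^sup>2)"
    by (rule sum.cong) (simp_all add: slice_norm_summable(2)[OF \<Psi>])
  also have "\<dots> = (\<Sum>\<^sub>\<infinity>k. \<Sum>a\<in>A. (l2_norm (slice (\<Psi> a) k))\<^sup>2)"
    by (intro infsumI[symmetric] has_sum_finite_sum has_sum_infsum s)
  also have "\<dots> \<le> (\<Sum>\<^sub>\<infinity>k. C * (\<Sum>b\<in>B. (l2_norm (slice (\<Xi> b) k))\<^sup>2))"
    by (rule infsum_mono, rule has_sum_imp_summable, rule has_sum_finite_sum, rule has_sum_infsum,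
        erule s, rule sumr, rule le)
  also have "\<dots> = C * (\<Sum>\<^sub>\<infinity>k. \<Sum>b\<in>B. (l2_norm (slice (\<Xi> b) k))\<^sup>2)"
    by (rule infsum_cmult_right')
  also have "(\<Sum>\<^sub>\<infinity>k. \<Sum>b\<in>B. (l2_norm (slice (\<Xi> b) k))\<^sup>2) = (\<Sum>b\<in>B. \<Sum>\<^sub>\<infinity>k. (l2_norm (slice (\<Xi> b) k))\<^sup>2)"
    by (intro infsumI has_sum_finite_sum has_sum_infsum slice_norm_summable(1)[OF \<Xi>])
  also have "\<dots> = (\<Sum>b\<in>B. (l2_norm (\<Xi> b))\<^sup>2)"
    by (rule sum.cong) (simp_all add: slice_norm_summable(2)[OF \<Xi>])
  finally show "(\<Sum>a\<in>A. (l2_norm (\<lambda>p. \<Sum>b\<in>B. amp (T a b) (\<Xi> b) p))\<^sup>2) \<le> C * (\<Sum>b\<in>B. (l2_norm (\<Xi> b))\<^sup>2)"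
    by (simp add: \<Psi>_def)
qed

lemma amp_bound:
  fixes \<Xi> :: "'k \<times> 'i \<Rightarrow> complex"
  assumes T: "T \<in> bounded_ops I" and bound: "\<And>\<xi>. \<xi> \<in> l2 I \<Longrightarrow> l2_norm (T \<xi>) \<le> C * l2_norm \<xi>"
    and "0 \<le> C" and \<Xi>: "\<Xi> \<in> l2 (UNIV \<times> I)"
  shows "amp T \<Xi> \<in> l2 (UNIV \<times> I)" "l2_norm (amp T \<Xi>) \<le> C * l2_norm \<Xi>"
proof -
  have "(\<Sum>a\<in>{()}. (l2_norm (\<lambda>x. \<Sum>b\<in>{()}. T (\<xi> b) x))\<^sup>2) \<le> C\<^sup>2 * (\<Sum>b\<in>{()}. (l2_norm (\<xi> b))\<^sup>2)"
    if "\<And>b. b \<in> {()} \<Longrightarrow> \<xi> b \<in> l2 I" for \<xi> :: "unit \<Rightarrow> 'i \<Rightarrow> complex"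
    using power_mono[OF bound[OF that[of "()"]], of 2] by (simp add: power_mult_distrib)
  note m = amp_matrix_bound[of "{()}" "{()}" "\<lambda>_ _. T" I "C\<^sup>2" "\<lambda>_. \<Xi>", OF T this \<Xi>]
  from m(1)[of "()"] show "amp T \<Xi> \<in> l2 (UNIV \<times> I)" by simp
  from m(2) have "(l2_norm (amp T \<Xi>))\<^sup>2 \<le> (C * l2_norm \<Xi>)\<^sup>2" by (simp add: power_mult_distrib)
  then show "l2_norm (amp T \<Xi>) \<le> C * l2_norm \<Xi>"
    by (rule power2_le_imp_le) (simp add: \<open>0 \<le> C\<close>)
qed

lemma amp_in: "T \<in> bounded_ops I \<Longrightarrow> \<Xi> \<in> l2 (UNIV \<times> I) \<Longrightarrow> amp T \<Xi> \<in> l2 (UNIV \<times> I)"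
  by (metis amp_bound(1) bounded_ops_bound)

lemma slice_add: "slice (\<lambda>p. \<Xi> p + \<Theta> p) k = (\<lambda>x. slice \<Xi> k x + slice \<Theta> k x)"
  by (simp add: slice_def)

lemma slice_scale: "slice (\<lambda>p. c * \<Xi> p) k = (\<lambda>x. c * slice \<Xi> k x)"
  by (simp add: slice_def)

lemma amp_add:
  assumes "T \<in> bounded_ops I" "\<Xi> \<in> l2 (UNIV \<times> I)" "\<Theta> \<in> l2 (UNIV \<times> I)"
  shows "amp T (\<lambda>p. \<Xi> p + \<Theta> p) = (\<lambda>p. amp T \<Xi> p + amp T \<Theta> p)"
  by (auto simp: fun_eq_iff amp_def slice_add bounded_ops_add[OF assms(1) slice_in[OF assms(2)] slice_in[OF assms(3)]])

lemma amp_scale: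
  assumes "T \<in> bounded_ops I" "\<Xi> \<in> l2 (UNIV \<times> I)"
  shows "amp T (\<lambda>p. c * \<Xi> p) = (\<lambda>p. c * amp T \<Xi> p)"
  by (auto simp: fun_eq_iff amp_def slice_scale bounded_ops_scale[OF assms(1) slice_in[OF assms(2)]])

lemma amp_diff:
  assumes "T \<in> bounded_ops I" "\<Xi> \<in> l2 (UNIV \<times> I)" "\<Theta> \<in> l2 (UNIV \<times> I)"
  shows "amp T (\<lambda>p. \<Xi> p - \<Theta> p) = (\<lambda>p. amp T \<Xi> p - amp T \<Theta> p)"
  using amp_add[OF assms(1,2) l2_scale[OF assms(3), of "-1"]] amp_scale[OF assms(1,3), of "-1"] by simp

lemma op_adjoint_amp:
  assumes "T \<in> bounded_ops I" "\<Xi> \<in> l2 (UNIV \<times> I)" "\<Theta> \<in> l2 (UNIV \<times> I)"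
  shows "l2_inner (amp (op_adjoint I T) \<Xi>) \<Theta> = l2_inner \<Xi> (amp T \<Theta>)"
proof -
  have "((\<lambda>k. l2_inner (op_adjoint I T (slice \<Xi> k)) (slice \<Theta> k)) has_sum l2_inner (amp (op_adjoint I T) \<Xi>) \<Theta>) UNIV"
    using inner_slices[OF amp_in[OF op_adjoint_in[OF assms(1)] assms(2)] assms(3)] by simp
  moreover have "((\<lambda>k. l2_inner (slice \<Xi> k) (T (slice \<Theta> k))) has_sum l2_inner \<Xi> (amp T \<Theta>)) UNIV"
    using inner_slices[OF assms(2) amp_in[OF assms(1,3)]] by simp
  ultimately show ?thesis
    using has_sum_unique by (simp add: op_adjoint_left[OF assms(1) slice_in[OF assms(2)] slice_in[OF assms(3)]])
qed

section \<open>Orthogonal projections\<close>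

text \<open>Weak compactness of balls: all inner products with the sequence converge at once along
  one filter, and the limits form a bounded functional.\<close>

lemma weak_limit_l2:
  assumes "\<And>n::nat. m n \<in> l2 I" "\<And>n. l2_norm (m n) \<le> C"
  obtains \<U> y where "\<U> \<noteq> bot" "\<U> \<le> sequentially" "y \<in> l2 I"
    "\<And>\<eta>. \<eta> \<in> l2 I \<Longrightarrow> ((\<lambda>n. l2_inner (m n) \<eta>) \<longlongrightarrow> l2_inner y \<eta>) \<U>"
proof -
  have C: "0 \<le> C" using assms(2)[of 0] l2_norm_nonneg order_trans by blast
  define d where "d = (\<lambda>n \<eta>. if \<eta> \<in> l2 I then l2_inner (m n) \<eta> else 0)"
  have d: "cmod (d n \<eta>) \<le> C * l2_norm \<eta>" for n \<eta>
  proof (cases "\<eta> \<in> l2 I")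
    case True
    have "cmod (l2_inner (m n) \<eta>) \<le> l2_norm (m n) * l2_norm \<eta>" by (rule l2_CS[OF assms(1) True])
    also have "\<dots> \<le> C * l2_norm \<eta>" by (rule mult_right_mono[OF assms(2)]) simp
    finally show ?thesis using True by (simp add: d_def)
  qed (simp add: d_def C)
  obtain \<U> \<sigma> where U: "\<U> \<noteq> bot" "\<U> \<le> sequentially" and \<sigma>: "\<And>\<eta>. ((\<lambda>n. d n \<eta>) \<longlongrightarrow> \<sigma> \<eta>) \<U>"
    using bounded_families_limit_filter[of d "\<lambda>\<eta>. C * l2_norm \<eta>", OF d] by blast
  have lim: "((\<lambda>n. l2_inner (m n) \<eta>) \<longlongrightarrow> \<sigma> \<eta>) \<U>" if "\<eta> \<in> l2 I" for \<eta>
    using \<sigma>[of \<eta>] that by (simp add: d_def)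
  show ?thesis
  proof (rule Riesz_l2[of I \<sigma> C])
    fix \<xi> \<eta> assume *: "\<xi> \<in> l2 I" "\<eta> \<in> l2 I"
    have "((\<lambda>n. l2_inner (m n) \<xi> + l2_inner (m n) \<eta>) \<longlongrightarrow> \<sigma> (\<lambda>x. \<xi> x + \<eta> x)) \<U>"
      using lim[OF l2_add[OF *]] by (simp add: l2_inner_add_right[OF * assms(1)])
    then show "\<sigma> (\<lambda>x. \<xi> x + \<eta> x) = \<sigma> \<xi> + \<sigma> \<eta>"
      by (rule tendsto_unique[OF U(1)]) (intro tendsto_add lim *)
  next
    fix c \<xi> assume *: "\<xi> \<in> l2 I"
    have "((\<lambda>n. cnj c * l2_inner (m n) \<xi>) \<longlongrightarrow> \<sigma> (\<lambda>x. c * \<xi> x)) \<U>"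
      using lim[OF l2_scale[OF *, of c]] by (simp add: l2_inner_scale_right)
    then show "\<sigma> (\<lambda>x. c * \<xi> x) = cnj c * \<sigma> \<xi>"
      by (rule tendsto_unique[OF U(1)]) (intro tendsto_mult tendsto_const lim *)
  next
    fix \<xi> show "cmod (\<sigma> \<xi>) \<le> C * l2_norm \<xi>"
      by (rule tendsto_upperbound[OF tendsto_norm[OF \<sigma>[of \<xi>]] _ U(1)]) (simp add: d)
  next
    fix y assume "y \<in> l2 I" "\<And>\<eta>. \<eta> \<in> l2 I \<Longrightarrow> l2_inner y \<eta> = \<sigma> \<eta>"
    then show ?thesis using that[OF U] lim by simp
  qed
qed

text \<open>\<open>M\<close> is a subspace that need not be closed. A minimising sequence is
  asymptotically orthogonal to \<open>M\<close> after subtraction from \<zeta>, and its weak limit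
  is the projection onto the closure. The last conclusion expresses membership in the closure by
  annihilators.\<close>

lemma projection_exists:
  assumes M: "M \<subseteq> l2 J" "M \<noteq> {}"
    and Madd: "\<And>u v. u \<in> M \<Longrightarrow> v \<in> M \<Longrightarrow> (\<lambda>x. u x + v x) \<in> M"
    and Mscale: "\<And>c u. u \<in> M \<Longrightarrow> (\<lambda>x. c * u x) \<in> M"
    and \<zeta>: "\<zeta> \<in> l2 J"
  obtains y where "y \<in> l2 J" "\<And>m. m \<in> M \<Longrightarrow> l2_inner y m = l2_inner \<zeta> m"
    "\<And>\<theta>. \<theta> \<in> l2 J \<Longrightarrow> (\<And>m. m \<in> M \<Longrightarrow> l2_inner m \<theta> = 0) \<Longrightarrow> l2_inner y \<theta> = 0"
proof -
  define D where "D = (\<lambda>m. (l2_norm (\<lambda>x. \<zeta> x - m x))\<^sup>2) ` M"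
  have D: "D \<noteq> {}" "bdd_below D" using M by (auto simp: D_def intro!: bdd_belowI[of _ 0])
  define d where "d = Inf D"
  have dle: "d \<le> (l2_norm (\<lambda>x. \<zeta> x - m x))\<^sup>2" if "m \<in> M" for m
    unfolding d_def by (rule cInf_lower) (use that D in \<open>auto simp: D_def\<close>)
  have "\<exists>m\<in>M. (l2_norm (\<lambda>x. \<zeta> x - m x))\<^sup>2 < d + 1 / real (Suc n)" for n
    using cInf_lessD[OF D(1), of "d + 1 / real (Suc n)"] by (auto simp: d_def D_def)
  then obtain m where m: "\<And>n. m n \<in> M" "\<And>n. (l2_norm (\<lambda>x. \<zeta> x - m n x))\<^sup>2 < d + 1 / real (Suc n)"
    by metis
  have ml: "m n \<in> l2 J" for n using m(1) M by blast
  have ort: "(cmod (l2_inner (\<lambda>x. \<zeta> x - m n x) u))\<^sup>2 \<le> (l2_norm u)\<^sup>2 / real (Suc n)" if u: "u \<in> M" for n u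
  proof (cases "l2_norm u = 0")
    case True
    then show ?thesis using l2_norm_eq_0[of u J] u M by auto
  next
    case False
    have ul: "u \<in> l2 J" using u M by blast
    let ?z = "\<lambda>x. \<zeta> x - m n x"
    let ?w = "l2_inner ?z u"
    \<comment> \<open>The coefficient that minimises the distance from \<open>?z\<close> to the line
      through \<open>u\<close>.\<close>
    define c where "c = ?w / of_real ((l2_norm u)\<^sup>2)"
    have z: "?z \<in> l2 J" by (rule l2_diff[OF \<zeta> ml])
    have "(\<lambda>x. m n x + c * u x) \<in> M" by (intro Madd Mscale m u)
    from dle[OF this] have "d \<le> (l2_norm (\<lambda>x. ?z x - c * u x))\<^sup>2" by (simp add: algebra_simps)
    also have "\<dots> = (l2_norm ?z)\<^sup>2 - 2 * Re (cnj c * ?w) + (cmod c * l2_norm u)\<^sup>2"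
      using l2_norm_diff_sq[OF z l2_scale[OF ul, of c]] by (simp add: l2_inner_scale_right l2_norm_scale)
    also have "cnj c * ?w = of_real ((cmod ?w)\<^sup>2 / (l2_norm u)\<^sup>2)"
      by (simp add: c_def complex_norm_square[symmetric] mult.commute[of "cnj ?w"] del: of_real_power)
    also have "(cmod c * l2_norm u)\<^sup>2 = (cmod ?w)\<^sup>2 / (l2_norm u)\<^sup>2"
      using False by (simp add: c_def norm_divide norm_mult norm_power power2_eq_square)
    finally have "d \<le> (l2_norm ?z)\<^sup>2 - (cmod ?w)\<^sup>2 / (l2_norm u)\<^sup>2" by simp
    with m(2)[of n] have "(cmod ?w)\<^sup>2 / (l2_norm u)\<^sup>2 \<le> 1 / real (Suc n)" by linarith
    moreover have "0 < (l2_norm u)\<^sup>2" using False by simp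
    ultimately show ?thesis by (simp add: field_simps)
  qed
  \<comment> \<open>A crude uniform bound, enough for weak compactness: the squared distances are at
    most d + 1, hence at most the square of d + 2.\<close>
  have bd: "l2_norm (m n) \<le> l2_norm \<zeta> + (d + 2)" for n
  proof -
    have "1 / real (Suc n) \<le> 1" by simp
    with m(2)[of n] have a: "(l2_norm (\<lambda>x. \<zeta> x - m n x))\<^sup>2 \<le> d + 1" by linarith
    have "0 \<le> d" unfolding d_def by (rule cInf_greatest[OF D(1)]) (auto simp: D_def)
    then have "d + 1 \<le> (d + 2)\<^sup>2" by (simp add: power2_eq_square algebra_simps)
    with a have "(l2_norm (\<lambda>x. \<zeta> x - m n x))\<^sup>2 \<le> (d + 2)\<^sup>2" by linarith
    then have "l2_norm (\<lambda>x. \<zeta> x - m n x) \<le> d + 2"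
      by (rule power2_le_imp_le) (use \<open>0 \<le> d\<close> in simp)
    moreover have "l2_norm (\<lambda>x. \<zeta> x - (\<zeta> x - m n x)) \<le> l2_norm \<zeta> + l2_norm (\<lambda>x. \<zeta> x - m n x)"
      by (rule l2_triangle_diff[OF \<zeta> l2_diff[OF \<zeta> ml]])
    ultimately show ?thesis by simp
  qed
  obtain \<U> y where U: "\<U> \<noteq> bot" "\<U> \<le> sequentially" and y: "y \<in> l2 J"
    and lim: "\<And>\<eta>. \<eta> \<in> l2 J \<Longrightarrow> ((\<lambda>n. l2_inner (m n) \<eta>) \<longlongrightarrow> l2_inner y \<eta>) \<U>"
    by (rule weak_limit_l2[of m J, OF ml bd]) (rule that)
  show ?thesis
  proof (rule that[OF y])
    fix \<theta> assume "\<theta> \<in> l2 J" "\<And>m. m \<in> M \<Longrightarrow> l2_inner m \<theta> = 0"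
    then have "((\<lambda>n. 0) \<longlongrightarrow> l2_inner y \<theta>) \<U>"
      using lim[of \<theta>] m(1) by simp
    then show "l2_inner y \<theta> = 0"
      by (rule tendsto_unique[OF U(1)]) simp
  next
    fix u assume u: "u \<in> M"
    then have ul: "u \<in> l2 J" using M by blast
    have "((\<lambda>n. (cmod (l2_inner (\<lambda>x. \<zeta> x - m n x) u))\<^sup>2) \<longlongrightarrow> 0) sequentially"
    proof (rule tendsto_sandwich[of "\<lambda>_. 0"])
      show "(\<lambda>n. (l2_norm u)\<^sup>2 / real (Suc n)) \<longlonglongrightarrow> 0"
        using tendsto_mult_right_zero[OF LIMSEQ_inverse_real_of_nat, of "(l2_norm u)\<^sup>2"]
        by (simp add: field_simps)
    qed (use ort[OF u] in auto)
    then have "((\<lambda>n. (cmod (l2_inner (\<lambda>x. \<zeta> x - m n x) u))\<^sup>2) \<longlongrightarrow> 0) \<U>"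
      by (rule filterlim_mono) (simp_all add: U)
    then have "((\<lambda>n. sqrt ((cmod (l2_inner (\<lambda>x. \<zeta> x - m n x) u))\<^sup>2)) \<longlongrightarrow> sqrt 0) \<U>"
      by (rule tendsto_real_sqrt)
    then have "((\<lambda>n. l2_inner (\<lambda>x. \<zeta> x - m n x) u) \<longlongrightarrow> 0) \<U>"
      by (simp add: tendsto_norm_zero_iff)
    moreover have "((\<lambda>n. l2_inner (\<lambda>x. \<zeta> x - m n x) u) \<longlongrightarrow> l2_inner \<zeta> u - l2_inner y u) \<U>"
      unfolding l2_inner_diff_left[OF \<zeta> ml ul] by (intro tendsto_diff tendsto_const lim ul)
    ultimately show "l2_inner y u = l2_inner \<zeta> u"
      using tendsto_unique[OF U(1)] by force
  qed
qed

section \<open>Norms of scalar and operator matrices\<close>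

abbreviation vec_norm :: "nat \<Rightarrow> (nat \<Rightarrow> complex) \<Rightarrow> real" where
  "vec_norm n z \<equiv> L2_set (\<lambda>j. cmod (z j)) {..<n}"

abbreviation mat_vec :: "nat \<Rightarrow> (nat \<Rightarrow> nat \<Rightarrow> complex) \<Rightarrow> (nat \<Rightarrow> complex) \<Rightarrow> nat \<Rightarrow> complex" where
  "mat_vec n \<alpha> z \<equiv> (\<lambda>i. \<Sum>j<n. \<alpha> i j * z j)"

lemma L2_set_zero [simp]: "L2_set (\<lambda>_. 0) A = 0"
  by (simp add: L2_set_def)

lemma L2_set_sq: "(L2_set f A)\<^sup>2 = (\<Sum>i\<in>A. (f i)\<^sup>2)"
  by (simp add: L2_set_def sum_nonneg)

lemma vec_norm_mult_ineq: "cmod (\<Sum>j<n. a j * b j) \<le> vec_norm n a * vec_norm n b"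
proof -
  have "cmod (\<Sum>j<n. a j * b j) \<le> (\<Sum>j<n. cmod (a j) * cmod (b j))"
    by (rule norm_sum[THEN order_trans]) (simp add: norm_mult)
  then show ?thesis
    using L2_set_mult_ineq[of "\<lambda>j. cmod (a j)" "\<lambda>j. cmod (b j)" "{..<n}"] by simp
qed

lemma vec_norm_scale: "vec_norm n (\<lambda>j. c * z j) = cmod c * vec_norm n z"
  by (simp add: norm_mult L2_set_right_distrib)

lemma vec_norm_triangle: "vec_norm n (\<lambda>j. a j + b j) \<le> vec_norm n a + vec_norm n b"
  by (rule order_trans[OF L2_set_mono L2_set_triangle_ineq]) (auto intro: norm_triangle_ineq)

lemma scalar_norm_eq:
  "scalar_norm m n \<alpha> = Sup {vec_norm m (mat_vec n \<alpha> z) | z. vec_norm n z \<le> 1}"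
proof -
  have "(\<Sum>j<n. (cmod (z j))\<^sup>2) \<le> 1 \<longleftrightarrow> vec_norm n z \<le> 1" for z
    by (simp add: L2_set_def)
  then show ?thesis by (simp add: scalar_norm_def L2_set_def)
qed

lemma scalar_norm_bdd: "bdd_above {vec_norm m (mat_vec n \<alpha> z) | z. vec_norm n z \<le> 1}"
proof (rule bdd_aboveI)
  fix r assume "r \<in> {vec_norm m (mat_vec n \<alpha> z) | z. vec_norm n z \<le> 1}"
  then obtain z where z: "vec_norm n z \<le> 1" "r = vec_norm m (mat_vec n \<alpha> z)" by blast
  have "r \<le> L2_set (\<lambda>i. vec_norm n (\<alpha> i)) {..<m}"
    unfolding z(2)
  proof (rule L2_set_mono)
    fix i
    have "cmod (mat_vec n \<alpha> z i) \<le> vec_norm n (\<alpha> i) * vec_norm n z" by (rule vec_norm_mult_ineq)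
    also have "\<dots> \<le> vec_norm n (\<alpha> i)" using z(1) by (simp add: mult_left_le)
    finally show "cmod (mat_vec n \<alpha> z i) \<le> vec_norm n (\<alpha> i)" .
  qed simp
  then show "r \<le> L2_set (\<lambda>i. vec_norm n (\<alpha> i)) {..<m}" .
qed

lemma scalar_norm_upper: "vec_norm n z \<le> 1 \<Longrightarrow> vec_norm m (mat_vec n \<alpha> z) \<le> scalar_norm m n \<alpha>"
  unfolding scalar_norm_eq by (rule cSup_upper[OF _ scalar_norm_bdd]) auto

lemma scalar_norm_nonneg [simp]: "0 \<le> scalar_norm m n \<alpha>"
  using scalar_norm_upper[where z="\<lambda>_. 0" and n=n and m=m and \<alpha>=\<alpha>] by (simp add: L2_set_def)

lemma vec_norm_0D: "vec_norm n z = 0 \<Longrightarrow> j < n \<Longrightarrow> z j = 0"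
  by (simp add: L2_set_eq_0_iff)

lemma scalar_norm_apply: "vec_norm m (mat_vec n \<alpha> z) \<le> scalar_norm m n \<alpha> * vec_norm n z"
proof (cases "vec_norm n z = 0")
  case True
  then have "mat_vec n \<alpha> z i = 0" for i
    by (intro sum.neutral) (auto dest: vec_norm_0D)
  then have "vec_norm m (mat_vec n \<alpha> z) = 0" by (intro L2_set_0') simp
  then show ?thesis using True by simp
next
  case False
  define r where "r = vec_norm n z"
  have r: "0 < r" using False by (simp add: r_def less_le)
  define y where "y = (\<lambda>j. of_real (inverse r) * z j)"
  have "vec_norm n y = 1" unfolding y_def vec_norm_scale using r by (simp add: r_def[symmetric] norm_inverse)
  then have "vec_norm m (mat_vec n \<alpha> y) \<le> scalar_norm m n \<alpha>" by (intro scalar_norm_upper) simp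
  moreover have "vec_norm m (mat_vec n \<alpha> y) = vec_norm m (\<lambda>i. of_real (inverse r) * mat_vec n \<alpha> z i)"
    by (simp add: y_def sum_distrib_left algebra_simps)
  ultimately have "inverse r * vec_norm m (mat_vec n \<alpha> z) \<le> scalar_norm m n \<alpha>"
    using r by (simp only: vec_norm_scale) (simp add: norm_inverse)
  then show ?thesis using r by (simp add: r_def[symmetric] field_simps)
qed

lemma scalar_norm_least:
  assumes "\<And>z. vec_norm n z \<le> 1 \<Longrightarrow> vec_norm m (mat_vec n \<alpha> z) \<le> C"
  shows "scalar_norm m n \<alpha> \<le> C"
  unfolding scalar_norm_eq
proof (rule cSup_least)
  have "vec_norm n (\<lambda>_. 0) \<le> 1" by (simp add: L2_set_def)
  then have "vec_norm m (mat_vec n \<alpha> (\<lambda>_. 0)) \<in> {vec_norm m (mat_vec n \<alpha> z) |z. vec_norm n z \<le> 1}"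
    by (intro CollectI exI[of _ "\<lambda>_. 0"] conjI refl)
  then show "{vec_norm m (mat_vec n \<alpha> z) |z. vec_norm n z \<le> 1} \<noteq> {}" by auto
qed (use assms in auto)

lemma scalar_norm_leI:
  assumes "0 \<le> C" "\<And>z. vec_norm m (mat_vec n \<alpha> z) \<le> C * vec_norm n z"
  shows "scalar_norm m n \<alpha> \<le> C"
proof (rule scalar_norm_least)
  fix z assume "vec_norm n z \<le> 1"
  then show "vec_norm m (mat_vec n \<alpha> z) \<le> C"
    using assms(2)[of z] mult_left_mono[OF _ assms(1), of "vec_norm n z" 1] by simp
qed

lemma scalar_norm_form:
  "cmod (\<Sum>i<m. \<Sum>j<n. w i * \<alpha> i j * z j) \<le> scalar_norm m n \<alpha> * vec_norm m w * vec_norm n z"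
proof -
  have "(\<Sum>i<m. \<Sum>j<n. w i * \<alpha> i j * z j) = (\<Sum>i<m. w i * mat_vec n \<alpha> z i)"
    by (simp add: sum_distrib_left mult.assoc)
  then have "cmod (\<Sum>i<m. \<Sum>j<n. w i * \<alpha> i j * z j) \<le> vec_norm m w * vec_norm m (mat_vec n \<alpha> z)"
    by (simp only: vec_norm_mult_ineq)
  also have "\<dots> \<le> vec_norm m w * (scalar_norm m n \<alpha> * vec_norm n z)"
    by (intro mult_left_mono scalar_norm_apply) simp
  finally show ?thesis by (simp add: mult_ac)
qed

text \<open>Taking for \<open>w\<close> the conjugate of the image vector turns the bilinear form
  into the square of the norm of the image.\<close>

lemma scalar_norm_form_leI:
  assumes "0 \<le> C"
    "\<And>w z. cmod (\<Sum>i<m. \<Sum>j<n. w i * \<alpha> i j * z j) \<le> C * vec_norm m w * vec_norm n z"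
  shows "scalar_norm m n \<alpha> \<le> C"
proof (rule scalar_norm_leI[OF assms(1)])
  fix z
  define y where "y = mat_vec n \<alpha> z"
  define w where "w = (\<lambda>i. cnj (y i))"
  have wy: "vec_norm m w = vec_norm m y" by (simp add: w_def)
  have "(\<Sum>i<m. \<Sum>j<n. w i * \<alpha> i j * z j) = (\<Sum>i<m. w i * y i)"
    by (simp add: y_def sum_distrib_left mult.assoc)
  also have "\<dots> = of_real ((vec_norm m y)\<^sup>2)"
    by (simp add: w_def L2_set_sq complex_norm_square[symmetric] mult.commute)
  finally have "(vec_norm m y)\<^sup>2 = cmod (\<Sum>i<m. \<Sum>j<n. w i * \<alpha> i j * z j)"
    by (simp add: norm_power)
  then have *: "vec_norm m y * vec_norm m y \<le> C * vec_norm n z * vec_norm m y"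
    using assms(2)[of w z] wy by (simp add: power2_eq_square mult_ac)
  have "vec_norm m y \<le> C * vec_norm n z"
  proof (cases "vec_norm m y = 0")
    case True
    moreover have "0 \<le> C * vec_norm n z" by (rule mult_nonneg_nonneg[OF assms(1)]) simp
    ultimately show ?thesis by linarith
  next
    case False
    then have "0 < vec_norm m y" using L2_set_nonneg[of "\<lambda>j. cmod (y j)" "{..<m}"] by linarith
    then show ?thesis using * by (simp only: mult_le_cancel_right_pos)
  qed
  then show "vec_norm m (mat_vec n \<alpha> z) \<le> C * vec_norm n z" by (simp only: y_def)
qed

lemma scalar_norm_cong:
  assumes "\<And>i j. i < m \<Longrightarrow> j < n \<Longrightarrow> \<alpha> i j = \<beta> i j"
  shows "scalar_norm m n \<alpha> = scalar_norm m n \<beta>"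
proof -
  have "(\<Sum>i<m. (cmod (mat_vec n \<alpha> z i))\<^sup>2) = (\<Sum>i<m. (cmod (mat_vec n \<beta> z i))\<^sup>2)" for z
    using assms by (intro sum.cong refl arg_cong[of _ _ "\<lambda>t. (cmod t)\<^sup>2"]) auto
  then show ?thesis by (simp only: scalar_norm_def)
qed

lemma scalar_norm_entry:
  assumes "i < m" "j < n"
  shows "cmod (\<alpha> i j) \<le> scalar_norm m n \<alpha>"
proof -
  let ?e = "\<lambda>k l. if l = k then (1::complex) else 0"
  have n1: "vec_norm n (?e j) = 1" if "j < n" for j n
  proof -
    have "(cmod (?e j l))\<^sup>2 = (if l = j then 1 else 0)" for l by auto
    then show ?thesis using that by (simp only: L2_set_def) simp
  qed
  have "mat_vec n \<alpha> (?e j) i = \<alpha> i j" for i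
  proof -
    have "mat_vec n \<alpha> (?e j) i = (\<Sum>l<n. if l = j then \<alpha> i l else 0)"
      by (intro sum.cong) auto
    then show ?thesis using assms by simp
  qed
  then have "cmod (\<alpha> i j) = cmod (mat_vec n \<alpha> (?e j) i)" by simp
  also have "\<dots> \<le> vec_norm m (mat_vec n \<alpha> (?e j))"
    using assms by (intro member_le_L2_set) auto
  also have "\<dots> \<le> scalar_norm m n \<alpha>" by (rule scalar_norm_upper) (simp add: n1 assms)
  finally show ?thesis .
qed

lemma scalar_norm_zero [simp]: "scalar_norm m n (\<lambda>_ _. 0) = 0"
  by (rule antisym[OF scalar_norm_leI]) (auto simp: L2_set_def)

lemma scalar_norm_eq_0: "scalar_norm m n \<alpha> = 0 \<longleftrightarrow> (\<forall>i<m. \<forall>j<n. \<alpha> i j = 0)"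
proof
  assume "scalar_norm m n \<alpha> = 0"
  then show "\<forall>i<m. \<forall>j<n. \<alpha> i j = 0" using scalar_norm_entry[of _ m _ n \<alpha>] by force
next
  assume "\<forall>i<m. \<forall>j<n. \<alpha> i j = 0"
  then show "scalar_norm m n \<alpha> = 0" using scalar_norm_cong[of m n \<alpha> "\<lambda>_ _. 0"] by simp
qed

lemma scalar_norm_triangle:
  "scalar_norm m n (\<lambda>i j. \<alpha> i j + \<beta> i j) \<le> scalar_norm m n \<alpha> + scalar_norm m n \<beta>"
proof (rule scalar_norm_leI)
  fix z
  have "vec_norm m (mat_vec n (\<lambda>i j. \<alpha> i j + \<beta> i j) z) = vec_norm m (\<lambda>i. mat_vec n \<alpha> z i + mat_vec n \<beta> z i)"
    by (simp add: distrib_right sum.distrib)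
  also have "\<dots> \<le> vec_norm m (mat_vec n \<alpha> z) + vec_norm m (mat_vec n \<beta> z)"
    by (rule vec_norm_triangle)
  also have "\<dots> \<le> scalar_norm m n \<alpha> * vec_norm n z + scalar_norm m n \<beta> * vec_norm n z"
    by (intro add_mono scalar_norm_apply)
  finally show "vec_norm m (mat_vec n (\<lambda>i j. \<alpha> i j + \<beta> i j) z) \<le> (scalar_norm m n \<alpha> + scalar_norm m n \<beta>) * vec_norm n z"
    by (simp add: distrib_right)
qed simp

lemma scalar_norm_scale_le: "scalar_norm m n (\<lambda>i j. c * \<alpha> i j) \<le> cmod c * scalar_norm m n \<alpha>"
proof (rule scalar_norm_leI)
  fix z
  have "vec_norm m (mat_vec n (\<lambda>i j. c * \<alpha> i j) z) = vec_norm m (\<lambda>i. c * mat_vec n \<alpha> z i)"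
    by (simp add: sum_distrib_left mult.assoc)
  then show "vec_norm m (mat_vec n (\<lambda>i j. c * \<alpha> i j) z) \<le> cmod c * scalar_norm m n \<alpha> * vec_norm n z"
    using mult_left_mono[OF scalar_norm_apply[where m=m and n=n and \<alpha>=\<alpha> and z=z], of "cmod c"] by (simp only: vec_norm_scale) (simp add: mult.assoc)
qed simp

lemma scalar_norm_scale: "scalar_norm m n (\<lambda>i j. c * \<alpha> i j) = cmod c * scalar_norm m n \<alpha>"
proof (cases "c = 0")
  case False
  have "scalar_norm m n (\<lambda>i j. inverse c * (c * \<alpha> i j)) \<le> cmod (inverse c) * scalar_norm m n (\<lambda>i j. c * \<alpha> i j)"
    by (rule scalar_norm_scale_le)
  then have "cmod c * scalar_norm m n \<alpha> \<le> scalar_norm m n (\<lambda>i j. c * \<alpha> i j)"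
    using False by (simp add: norm_divide field_simps)
  then show ?thesis using scalar_norm_scale_le[of m n c \<alpha>] by linarith
qed simp

lemma scalar_norm_mult:
  "scalar_norm m k (\<lambda>i j. \<Sum>l<n. \<alpha> i l * \<beta> l j) \<le> scalar_norm m n \<alpha> * scalar_norm n k \<beta>"
proof (rule scalar_norm_leI)
  fix z
  have eq: "(\<Sum>j<k. (\<Sum>l<n. \<alpha> i l * \<beta> l j) * z j) = (\<Sum>l<n. \<alpha> i l * (\<Sum>j<k. \<beta> l j * z j))" for i
  proof -
    have "(\<Sum>j<k. (\<Sum>l<n. \<alpha> i l * \<beta> l j) * z j) = (\<Sum>j<k. \<Sum>l<n. \<alpha> i l * (\<beta> l j * z j))"
      by (simp add: sum_distrib_right mult.assoc)
    also have "\<dots> = (\<Sum>l<n. \<Sum>j<k. \<alpha> i l * (\<beta> l j * z j))" by (rule sum.swap)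
    finally show ?thesis
      by (simp add: sum_distrib_left)
  qed
  have "vec_norm m (mat_vec k (\<lambda>i j. \<Sum>l<n. \<alpha> i l * \<beta> l j) z) \<le> scalar_norm m n \<alpha> * vec_norm n (mat_vec k \<beta> z)"
    unfolding eq by (rule scalar_norm_apply)
  also have "\<dots> \<le> scalar_norm m n \<alpha> * (scalar_norm n k \<beta> * vec_norm k z)"
    by (intro mult_left_mono scalar_norm_apply) simp
  finally show "vec_norm m (mat_vec k (\<lambda>i j. \<Sum>l<n. \<alpha> i l * \<beta> l j) z) \<le> scalar_norm m n \<alpha> * scalar_norm n k \<beta> * vec_norm k z"
    by (simp add: mult.assoc)
qed simp

lemma sum_div_mod:
  fixes f :: "nat \<Rightarrow> 'a :: comm_monoid_add"
  shows "(\<Sum>k<p * q. f k) = (\<Sum>a<p. \<Sum>b<q. f (a * q + b))"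
proof -
  have "sum f {a * q..<a * q + q} = (\<Sum>b<q. f (a * q + b))" for a
    using sum.shift_bounds_nat_ivl[of f 0 "a * q" q] by (simp add: lessThan_atLeast0 add.commute)
  then show ?thesis using sum.nat_group[of f q p] by simp
qed

text \<open>The matrix is (v \<otimes> 1)(1 \<otimes> w): \<open>y\<close> is the result of applying
  \<open>w\<close> inside each block, and then \<open>v\<close> acts across the blocks for each
  fixed inner index.\<close>

lemma scalar_norm_kron:
  assumes "0 < q"
  shows "scalar_norm (p * q) (p * q) (\<lambda>k l. v (k div q) (l div q) * w (k mod q) (l mod q))
    \<le> scalar_norm p p v * scalar_norm q q w" (is "scalar_norm _ _ ?K \<le> _")
proof (rule scalar_norm_leI)
  fix z
  define y where "y = (\<lambda>a b. \<Sum>b'<q. w b b' * z (a * q + b'))"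
  have app: "mat_vec (p * q) ?K z (a * q + b) = (\<Sum>a'<p. v a a' * y a' b)" if "b < q" for a b
    using that assms by (simp add: sum_div_mod y_def sum_distrib_left mult.assoc)
  have "(vec_norm (p * q) (mat_vec (p * q) ?K z))\<^sup>2 = (\<Sum>a<p. \<Sum>b<q. (cmod (\<Sum>a'<p. v a a' * y a' b))\<^sup>2)"
    unfolding L2_set_sq sum_div_mod[of "\<lambda>k. (cmod (mat_vec (p * q) ?K z k))\<^sup>2" p q]
    by (intro sum.cong refl) (simp only: app lessThan_iff)
  also have "\<dots> = (\<Sum>b<q. \<Sum>a<p. (cmod (mat_vec p v (\<lambda>a'. y a' b) a))\<^sup>2)"
    by (rule sum.swap)
  also have "\<dots> \<le> (\<Sum>b<q. (scalar_norm p p v)\<^sup>2 * (\<Sum>a<p. (cmod (y a b))\<^sup>2))"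
  proof (rule sum_mono)
    fix b
    show "(\<Sum>a<p. (cmod (mat_vec p v (\<lambda>a'. y a' b) a))\<^sup>2) \<le> (scalar_norm p p v)\<^sup>2 * (\<Sum>a<p. (cmod (y a b))\<^sup>2)"
      using power_mono[OF scalar_norm_apply[where m=p and n=p and \<alpha>=v and z="\<lambda>a'. y a' b"], of 2]
      by (simp add: power_mult_distrib L2_set_sq)
  qed
  also have "\<dots> = (scalar_norm p p v)\<^sup>2 * (\<Sum>a<p. \<Sum>b<q. (cmod (y a b))\<^sup>2)"
    by (simp add: sum_distrib_left sum.swap[of _ "{..<q}" "{..<p}"])
  also have "\<dots> \<le> (scalar_norm p p v)\<^sup>2 * (\<Sum>a<p. (scalar_norm q q w)\<^sup>2 * (\<Sum>b<q. (cmod (z (a * q + b)))\<^sup>2))"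
  proof (intro mult_left_mono sum_mono)
    fix a
    show "(\<Sum>b<q. (cmod (y a b))\<^sup>2) \<le> (scalar_norm q q w)\<^sup>2 * (\<Sum>b<q. (cmod (z (a * q + b)))\<^sup>2)"
      using power_mono[OF scalar_norm_apply[where m=q and n=q and \<alpha>=w and z="\<lambda>b. z (a * q + b)"], of 2]
      by (simp add: power_mult_distrib L2_set_sq y_def)
  qed simp
  also have "\<dots> = (scalar_norm p p v * scalar_norm q q w * vec_norm (p * q) z)\<^sup>2"
    by (simp add: power_mult_distrib L2_set_sq sum_div_mod sum_distrib_left mult.assoc)
  finally show "vec_norm (p * q) (mat_vec (p * q) ?K z) \<le> scalar_norm p p v * scalar_norm q q w * vec_norm (p * q) z"
    by (rule power2_le_imp_le) simp
qed simp

text \<open>A crude estimate by the blocks. It serves only to show that the suprema defining matrix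
  norms are finite.\<close>

lemma scalar_norm_blocks:
  "scalar_norm (n * m) (n * m) \<alpha> \<le> (\<Sum>i<n. \<Sum>j<n. scalar_norm m m (\<lambda>k l. \<alpha> (i * m + k) (j * m + l)))"
    (is "_ \<le> ?S")
proof (rule scalar_norm_form_leI)
  fix w z
  let ?b = "\<lambda>i j k l. \<alpha> (i * m + k) (j * m + l)"
  have part: "vec_norm m (\<lambda>k. u (i * m + k)) \<le> vec_norm (n * m) u" if "i < n" for u i
  proof (rule power2_le_imp_le)
    have "(\<Sum>k<m. (cmod (u (i * m + k)))\<^sup>2) \<le> (\<Sum>i<n. \<Sum>k<m. (cmod (u (i * m + k)))\<^sup>2)"
      by (rule member_le_sum[of i "{..<n}" "\<lambda>i. \<Sum>k<m. (cmod (u (i * m + k)))\<^sup>2"])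
        (use that in \<open>auto intro: sum_nonneg\<close>)
    then show "(vec_norm m (\<lambda>k. u (i * m + k)))\<^sup>2 \<le> (vec_norm (n * m) u)\<^sup>2"
      by (simp add: L2_set_sq sum_div_mod)
  qed simp
  have "(\<Sum>i<n * m. \<Sum>j<n * m. w i * \<alpha> i j * z j)
      = (\<Sum>i<n. \<Sum>k<m. \<Sum>j<n. \<Sum>l<m. w (i * m + k) * ?b i j k l * z (j * m + l))"
    by (simp add: sum_div_mod)
  also have "\<dots> = (\<Sum>i<n. \<Sum>j<n. \<Sum>k<m. \<Sum>l<m. w (i * m + k) * ?b i j k l * z (j * m + l))"
    by (rule sum.cong[OF refl]) (rule sum.swap)
  finally have "cmod (\<Sum>i<n * m. \<Sum>j<n * m. w i * \<alpha> i j * z j)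
      = cmod (\<Sum>i<n. \<Sum>j<n. \<Sum>k<m. \<Sum>l<m. w (i * m + k) * ?b i j k l * z (j * m + l))"
    by (simp only:)
  also have "\<dots> \<le> (\<Sum>i<n. \<Sum>j<n. cmod (\<Sum>k<m. \<Sum>l<m. w (i * m + k) * ?b i j k l * z (j * m + l)))"
    by (rule order_trans[OF norm_sum]) (intro sum_mono norm_sum)
  also have "\<dots> \<le> (\<Sum>i<n. \<Sum>j<n. scalar_norm m m (?b i j) * vec_norm (n * m) w * vec_norm (n * m) z)"
  proof (intro sum_mono)
    fix i j assume ij: "i \<in> {..<n}" "j \<in> {..<n}"
    have "cmod (\<Sum>k<m. \<Sum>l<m. w (i * m + k) * ?b i j k l * z (j * m + l))
      \<le> scalar_norm m m (?b i j) * vec_norm m (\<lambda>k. w (i * m + k)) * vec_norm m (\<lambda>l. z (j * m + l))"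
      by (rule scalar_norm_form)
    also have "\<dots> \<le> scalar_norm m m (?b i j) * vec_norm (n * m) w * vec_norm (n * m) z"
      using ij by (intro mult_mono mult_left_mono part) auto
    finally show "cmod (\<Sum>k<m. \<Sum>l<m. w (i * m + k) * ?b i j k l * z (j * m + l))
      \<le> scalar_norm m m (?b i j) * vec_norm (n * m) w * vec_norm (n * m) z" .
  qed
  also have "\<dots> = ?S * vec_norm (n * m) w * vec_norm (n * m) z"
    by (simp add: sum_distrib_right)
  finally show "cmod (\<Sum>i<n * m. \<Sum>j<n * m. w i * \<alpha> i j * z j) \<le> ?S * vec_norm (n * m) w * vec_norm (n * m) z" .
qed (simp add: sum_nonneg)

lemma sum_lessThan_add: "(\<Sum>i<m + n. f i) = (\<Sum>i<m. f i) + (\<Sum>i<n. f (m + i))" for f :: "nat \<Rightarrow> 'a :: comm_monoid_add"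
  by (induction n) (auto simp: ac_simps)

text \<open>The two blocks act on orthogonal parts, so the upper bound is Pythagoras. The lower
  bounds come from vectors padded with zeros.\<close>

lemma scalar_norm_dsum:
  "scalar_norm (m + n) (m + n) (\<lambda>i j. if i < m \<and> j < m then v i j
      else if m \<le> i \<and> m \<le> j then w (i - m) (j - m) else 0)
    = max (scalar_norm m m v) (scalar_norm n n w)" (is "scalar_norm _ _ ?D = ?M")
proof (rule antisym)
  have D1: "mat_vec (m + n) ?D z i = mat_vec m v z i" if "i < m" for z i
    using that by (simp add: sum_lessThan_add)
  have D2: "mat_vec (m + n) ?D z (m + i) = mat_vec n w (\<lambda>j. z (m + j)) i" for z i
    by (simp add: sum_lessThan_add)
  have sq: "(vec_norm (m + n) z)\<^sup>2 = (vec_norm m z)\<^sup>2 + (vec_norm n (\<lambda>j. z (m + j)))\<^sup>2" for z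
    by (simp add: L2_set_sq sum_lessThan_add)
  have app: "(vec_norm (m + n) (mat_vec (m + n) ?D z))\<^sup>2
      = (vec_norm m (mat_vec m v z))\<^sup>2 + (vec_norm n (mat_vec n w (\<lambda>j. z (m + j))))\<^sup>2" for z
  proof -
    have "vec_norm m (mat_vec (m + n) ?D z) = vec_norm m (mat_vec m v z)"
      by (intro L2_set_cong refl arg_cong[of _ _ cmod] D1) simp
    then show ?thesis unfolding sq D2 by (simp only:)
  qed
  have M: "0 \<le> ?M" by (simp add: le_max_iff_disj)
  show "scalar_norm (m + n) (m + n) ?D \<le> ?M"
  proof (rule scalar_norm_leI[OF M])
    fix z
    have bd: "(vec_norm k (mat_vec k \<alpha> y))\<^sup>2 \<le> (?M * vec_norm k y)\<^sup>2" if "scalar_norm k k \<alpha> \<le> ?M" for k \<alpha> y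
      by (rule power_mono, rule order_trans[OF scalar_norm_apply], rule mult_right_mono[OF that]) auto
    have "(vec_norm (m + n) (mat_vec (m + n) ?D z))\<^sup>2 \<le> (?M * vec_norm m z)\<^sup>2 + (?M * vec_norm n (\<lambda>j. z (m + j)))\<^sup>2"
      unfolding app by (intro add_mono bd) auto
    also have "\<dots> = (?M * vec_norm (m + n) z)\<^sup>2"
      by (simp add: power_mult_distrib sq distrib_left)
    finally show "vec_norm (m + n) (mat_vec (m + n) ?D z) \<le> ?M * vec_norm (m + n) z"
      by (rule power2_le_imp_le) (simp add: M)
  qed
  have "scalar_norm m m v \<le> scalar_norm (m + n) (m + n) ?D"
  proof (rule scalar_norm_leI)
    fix z :: "nat \<Rightarrow> complex"
    define y where "y = (\<lambda>j. if j < m then z j else 0)"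
    have y: "vec_norm m y = vec_norm m z" "vec_norm m (mat_vec m v y) = vec_norm m (mat_vec m v z)"
      "vec_norm n (\<lambda>j. y (m + j)) = 0"
      by (auto simp: y_def L2_set_def)
    have "(vec_norm m (mat_vec m v z))\<^sup>2 \<le> (vec_norm (m + n) (mat_vec (m + n) ?D y))\<^sup>2"
      unfolding app y(2) by simp
    then have "vec_norm m (mat_vec m v z) \<le> vec_norm (m + n) (mat_vec (m + n) ?D y)"
      by (rule power2_le_imp_le) simp
    also have "\<dots> \<le> scalar_norm (m + n) (m + n) ?D * vec_norm (m + n) y" by (rule scalar_norm_apply)
    also have "vec_norm (m + n) y = vec_norm m z"
      by (rule power2_eq_imp_eq) (simp_all only: sq y, simp_all)
    finally show "vec_norm m (mat_vec m v z) \<le> scalar_norm (m + n) (m + n) ?D * vec_norm m z" .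
  qed simp
  moreover have "scalar_norm n n w \<le> scalar_norm (m + n) (m + n) ?D"
  proof (rule scalar_norm_leI)
    fix z :: "nat \<Rightarrow> complex"
    define y where "y = (\<lambda>j. if j < m then 0 else z (j - m))"
    have y: "vec_norm m y = 0" "\<And>j. y (m + j) = z j"
      by (auto simp: y_def L2_set_def)
    have "(vec_norm n (mat_vec n w z))\<^sup>2 \<le> (vec_norm (m + n) (mat_vec (m + n) ?D y))\<^sup>2"
      unfolding app y by simp
    then have "vec_norm n (mat_vec n w z) \<le> vec_norm (m + n) (mat_vec (m + n) ?D y)"
      by (rule power2_le_imp_le) simp
    also have "\<dots> \<le> scalar_norm (m + n) (m + n) ?D * vec_norm (m + n) y" by (rule scalar_norm_apply)
    also have "vec_norm (m + n) y = vec_norm n z"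
      by (rule power2_eq_imp_eq) (simp_all only: sq y, simp_all)
    finally show "vec_norm n (mat_vec n w z) \<le> scalar_norm (m + n) (m + n) ?D * vec_norm n z" .
  qed simp
  ultimately show "?M \<le> scalar_norm (m + n) (m + n) ?D" by simp
qed

lemma scalar_norm_1: "scalar_norm 1 1 \<alpha> = cmod (\<alpha> 0 0)"
proof (rule antisym)
  show "scalar_norm 1 1 \<alpha> \<le> cmod (\<alpha> 0 0)" by (rule scalar_norm_leI) (simp_all add: L2_set_def norm_mult)
qed (rule scalar_norm_entry, auto)

subsection \<open>Matrices of operators\<close>

abbreviation tuple_norm :: "nat \<Rightarrow> (nat \<Rightarrow> 'i \<Rightarrow> complex) \<Rightarrow> real" where
  "tuple_norm n \<xi> \<equiv> L2_set (\<lambda>j. l2_norm (\<xi> j)) {..<n}"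

lemma op_mnorm_eq:
  "op_mnorm I n T = Sup {tuple_norm n (\<lambda>i x. \<Sum>j<n. T i j (\<xi> j) x) | \<xi>. (\<forall>j<n. \<xi> j \<in> l2 I) \<and> tuple_norm n \<xi> \<le> 1}"
proof -
  have "(\<Sum>j<n. (l2_norm (\<xi> j))\<^sup>2) \<le> 1 \<longleftrightarrow> tuple_norm n \<xi> \<le> 1" for \<xi> :: "nat \<Rightarrow> 'a \<Rightarrow> complex"
    by (simp add: L2_set_def)
  then show ?thesis by (simp add: op_mnorm_def L2_set_def)
qed

lemma op_mnorm_bdd:
  assumes T: "\<And>i j. i < n \<Longrightarrow> j < n \<Longrightarrow> T i j \<in> bounded_ops I"
  shows "bdd_above {tuple_norm n (\<lambda>i x. \<Sum>j<n. T i j (\<xi> j) x) | \<xi>. (\<forall>j<n. \<xi> j \<in> l2 I) \<and> tuple_norm n \<xi> \<le> 1}"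
proof -
  have "\<forall>i j. \<exists>C. i < n \<longrightarrow> j < n \<longrightarrow> 0 \<le> C \<and> (\<forall>\<xi>\<in>l2 I. l2_norm (T i j \<xi>) \<le> C * l2_norm \<xi>)"
    using bounded_ops_bound[OF T] by metis
  then obtain C where C: "\<And>i j. i < n \<Longrightarrow> j < n \<Longrightarrow> 0 \<le> C i j"
    "\<And>i j \<xi>. i < n \<Longrightarrow> j < n \<Longrightarrow> \<xi> \<in> l2 I \<Longrightarrow> l2_norm (T i j \<xi>) \<le> C i j * l2_norm \<xi>"
    by metis
  show ?thesis
  proof (rule bdd_aboveI)
    fix r assume "r \<in> {tuple_norm n (\<lambda>i x. \<Sum>j<n. T i j (\<xi> j) x) | \<xi>. (\<forall>j<n. \<xi> j \<in> l2 I) \<and> tuple_norm n \<xi> \<le> 1}"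
    then obtain \<xi> where \<xi>: "\<And>j. j < n \<Longrightarrow> \<xi> j \<in> l2 I" "tuple_norm n \<xi> \<le> 1"
      "r = tuple_norm n (\<lambda>i x. \<Sum>j<n. T i j (\<xi> j) x)" by blast
    show "r \<le> L2_set (\<lambda>i. \<Sum>j<n. C i j) {..<n}"
      unfolding \<xi>(3)
    proof (rule L2_set_mono)
      fix i assume i: "i \<in> {..<n}"
      have "l2_norm (\<lambda>x. \<Sum>j<n. T i j (\<xi> j) x) \<le> (\<Sum>j<n. l2_norm (T i j (\<xi> j)))"
        by (rule l2_norm_sum_le[of _ _ I]) (use i \<xi>(1) bounded_ops_l2[OF T] in auto)
      also have "\<dots> \<le> (\<Sum>j<n. C i j)"
      proof (rule sum_mono)
        fix j assume j: "j \<in> {..<n}"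
        have "l2_norm (\<xi> j) \<le> tuple_norm n \<xi>" using j by (intro member_le_L2_set) auto
        then have "C i j * l2_norm (\<xi> j) \<le> C i j * 1" using \<xi>(2) C(1)[of i j] i j by (intro mult_left_mono) auto
        then show "l2_norm (T i j (\<xi> j)) \<le> C i j" using C(2)[of i j "\<xi> j"] i j \<xi>(1) by fastforce
      qed
      finally show "l2_norm (\<lambda>x. \<Sum>j<n. T i j (\<xi> j) x) \<le> (\<Sum>j<n. C i j)" .
    qed simp
  qed
qed

lemma op_mnorm_upper:
  assumes T: "\<And>i j. i < n \<Longrightarrow> j < n \<Longrightarrow> T i j \<in> bounded_ops I"
    and "\<And>j. j < n \<Longrightarrow> \<xi> j \<in> l2 I" "tuple_norm n \<xi> \<le> 1"
  shows "tuple_norm n (\<lambda>i x. \<Sum>j<n. T i j (\<xi> j) x) \<le> op_mnorm I n T"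
  unfolding op_mnorm_eq by (rule cSup_upper[OF _ op_mnorm_bdd[OF T]]) (use assms in auto)

lemma op_mnorm_nonneg:
  assumes T: "\<And>i j. i < n \<Longrightarrow> j < n \<Longrightarrow> T i j \<in> bounded_ops I"
  shows "0 \<le> op_mnorm I n T"
  using op_mnorm_upper[of n T I "\<lambda>_ _. 0", OF T] by (simp add: order_trans[OF L2_set_nonneg])

lemma tuple_norm_scale: "tuple_norm n (\<lambda>j x. c * \<xi> j x) = cmod c * tuple_norm n \<xi>"
  by (simp add: l2_norm_scale L2_set_right_distrib)

lemma op_mnorm_apply:
  assumes T: "\<And>i j. i < n \<Longrightarrow> j < n \<Longrightarrow> T i j \<in> bounded_ops I"
    and \<xi>: "\<And>j. j < n \<Longrightarrow> \<xi> j \<in> l2 I"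
  shows "tuple_norm n (\<lambda>i x. \<Sum>j<n. T i j (\<xi> j) x) \<le> op_mnorm I n T * tuple_norm n \<xi>"
proof (cases "tuple_norm n \<xi> = 0")
  case True
  then have "\<xi> j = (\<lambda>_. 0)" if "j < n" for j
    using that l2_norm_eq_0[OF \<xi>[OF that]] by (simp add: L2_set_eq_0_iff)
  then have "(\<lambda>x. \<Sum>j<n. T i j (\<xi> j) x) = (\<lambda>_. 0)" if "i < n" for i
    using that by (simp add: bounded_ops_zero[OF T])
  then have "tuple_norm n (\<lambda>i x. \<Sum>j<n. T i j (\<xi> j) x) = 0" by (simp add: L2_set_eq_0_iff)
  then show ?thesis using True by simp
next
  case False
  define r where "r = tuple_norm n \<xi>"
  have r: "0 < r" using False by (simp add: r_def less_le)
  define c where "c = complex_of_real (inverse r)"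
  define y where "y = (\<lambda>j x. c * \<xi> j x)"
  have yn: "tuple_norm n y = 1" unfolding y_def tuple_norm_scale using r by (simp add: r_def[symmetric] c_def norm_inverse)
  have "(\<lambda>x. \<Sum>j<n. T i j (y j) x) = (\<lambda>x. c * (\<Sum>j<n. T i j (\<xi> j) x))" if "i < n" for i
    using that by (simp add: y_def bounded_ops_scale[OF T \<xi>] sum_distrib_left)
  then have "tuple_norm n (\<lambda>i x. \<Sum>j<n. T i j (y j) x) = tuple_norm n (\<lambda>i x. c * (\<Sum>j<n. T i j (\<xi> j) x))"
    by (intro L2_set_cong) auto
  also have "\<dots> = inverse r * tuple_norm n (\<lambda>i x. \<Sum>j<n. T i j (\<xi> j) x)"
    unfolding tuple_norm_scale using r by (simp add: c_def norm_inverse)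
  finally have "inverse r * tuple_norm n (\<lambda>i x. \<Sum>j<n. T i j (\<xi> j) x) \<le> op_mnorm I n T"
    using op_mnorm_upper[of n T I y, OF T] yn \<xi> by (simp add: y_def l2_scale)
  then show ?thesis using r by (simp add: r_def[symmetric] field_simps)
qed

lemma op_mnorm_form:
  assumes T: "\<And>i j. i < n \<Longrightarrow> j < n \<Longrightarrow> T i j \<in> bounded_ops I"
    and \<xi>: "\<And>j. j < n \<Longrightarrow> \<xi> j \<in> l2 I" and \<eta>: "\<And>j. j < n \<Longrightarrow> \<eta> j \<in> l2 I"
  shows "cmod (\<Sum>i<n. \<Sum>j<n. l2_inner (T i j (\<xi> j)) (\<eta> i)) \<le> op_mnorm I n T * tuple_norm n \<xi> * tuple_norm n \<eta>"
proof -
  let ?z = "\<lambda>i x. \<Sum>j<n. T i j (\<xi> j) x"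
  have z: "?z i \<in> l2 I" if "i < n" for i
    using that by (intro l2_sum bounded_ops_l2[OF T] \<xi>) auto
  have "(\<Sum>i<n. \<Sum>j<n. l2_inner (T i j (\<xi> j)) (\<eta> i)) = (\<Sum>i<n. l2_inner (?z i) (\<eta> i))"
    by (intro sum.cong refl l2_inner_sum_left[symmetric, of _ _ I _ I]) (auto intro: bounded_ops_l2[OF T] \<xi> \<eta>)
  then have "cmod (\<Sum>i<n. \<Sum>j<n. l2_inner (T i j (\<xi> j)) (\<eta> i)) = cmod (\<Sum>i<n. l2_inner (?z i) (\<eta> i))"
    by (simp only:)
  also have "\<dots> \<le> (\<Sum>i<n. l2_norm (?z i) * l2_norm (\<eta> i))"
    by (rule order_trans[OF norm_sum], rule sum_mono, rule l2_CS[of _ I _ I]) (use z \<eta> in auto)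
  also have "\<dots> \<le> tuple_norm n ?z * tuple_norm n \<eta>"
    using L2_set_mult_ineq[of "\<lambda>i. l2_norm (?z i)" "\<lambda>i. l2_norm (\<eta> i)" "{..<n}"] by simp
  also have "\<dots> \<le> op_mnorm I n T * tuple_norm n \<xi> * tuple_norm n \<eta>"
    by (intro mult_right_mono op_mnorm_apply T \<xi>) auto
  finally show ?thesis .
qed

text \<open>Testing the form against the image tuple itself recovers the square of its norm, as for
  scalar matrices. Bounds on sesquilinear forms are easier to transport between operators than
  bounds on images.\<close>

lemma op_mnorm_leI:
  assumes T: "\<And>i j. i < n \<Longrightarrow> j < n \<Longrightarrow> T i j \<in> bounded_ops I" and C: "0 \<le> C"
    and bd: "\<And>\<xi> \<eta>. (\<And>j. j < n \<Longrightarrow> \<xi> j \<in> l2 I) \<Longrightarrow> (\<And>j. j < n \<Longrightarrow> \<eta> j \<in> l2 I) \<Longrightarrow>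
      cmod (\<Sum>i<n. \<Sum>j<n. l2_inner (T i j (\<xi> j)) (\<eta> i)) \<le> C * tuple_norm n \<xi> * tuple_norm n \<eta>"
  shows "op_mnorm I n T \<le> C"
  unfolding op_mnorm_eq
proof (rule cSup_least)
  have "(\<forall>j<n. (\<lambda>_. 0) \<in> l2 I) \<and> tuple_norm n (\<lambda>_ _. 0 :: complex) \<le> 1" by simp
  then have "tuple_norm n (\<lambda>i x. \<Sum>j<n. T i j (\<lambda>_. 0) x) \<in> {tuple_norm n (\<lambda>i x. \<Sum>j<n. T i j (\<xi> j) x) | \<xi>. (\<forall>j<n. \<xi> j \<in> l2 I) \<and> tuple_norm n \<xi> \<le> 1}"
    by (intro CollectI exI[of _ "\<lambda>_ _. 0"] conjI refl) auto
  then show "{tuple_norm n (\<lambda>i x. \<Sum>j<n. T i j (\<xi> j) x) | \<xi>. (\<forall>j<n. \<xi> j \<in> l2 I) \<and> tuple_norm n \<xi> \<le> 1} \<noteq> {}"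
    by auto
next
  fix r assume "r \<in> {tuple_norm n (\<lambda>i x. \<Sum>j<n. T i j (\<xi> j) x) | \<xi>. (\<forall>j<n. \<xi> j \<in> l2 I) \<and> tuple_norm n \<xi> \<le> 1}"
  then obtain \<xi> where \<xi>: "\<And>j. j < n \<Longrightarrow> \<xi> j \<in> l2 I" "tuple_norm n \<xi> \<le> 1"
    "r = tuple_norm n (\<lambda>i x. \<Sum>j<n. T i j (\<xi> j) x)" by blast
  let ?z = "\<lambda>i x. \<Sum>j<n. T i j (\<xi> j) x"
  have z: "?z i \<in> l2 I" if "i < n" for i
    using that by (intro l2_sum bounded_ops_l2[OF T] \<xi>) auto
  have "(\<Sum>i<n. \<Sum>j<n. l2_inner (T i j (\<xi> j)) (?z i)) = (\<Sum>i<n. l2_inner (?z i) (?z i))"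
    by (intro sum.cong refl l2_inner_sum_left[symmetric, of _ _ I _ I]) (auto intro: bounded_ops_l2[OF T] \<xi> z)
  also have "\<dots> = of_real (r\<^sup>2)" by (simp add: l2_inner_self \<xi>(3) L2_set_sq)
  finally have "r\<^sup>2 \<le> C * tuple_norm n \<xi> * tuple_norm n ?z"
    using bd[of \<xi> ?z] \<xi>(1) z by (simp add: norm_power)
  also have "\<dots> \<le> C * 1 * r"
    unfolding \<xi>(3) using \<xi>(2) C by (intro mult_right_mono mult_left_mono) auto
  finally have "r * r \<le> C * r" by (simp add: power2_eq_square)
  moreover have "0 \<le> r" by (simp add: \<xi>(3))
  ultimately show "r \<le> C" using C by (cases "r = 0") auto
qed

lemma op_mnorm_1_apply:
  assumes "T \<in> bounded_ops I" "\<xi> \<in> l2 I"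
  shows "l2_norm (T \<xi>) \<le> op_mnorm I 1 (\<lambda>_ _. T) * l2_norm \<xi>"
  using op_mnorm_apply[of 1 "\<lambda>_ _. T" I "\<lambda>_. \<xi>"] assms by (simp add: L2_set_def)

lemma op_mnorm_1_leI:
  assumes "T \<in> bounded_ops I" "0 \<le> C" "\<And>\<xi>. \<xi> \<in> l2 I \<Longrightarrow> l2_norm (T \<xi>) \<le> C * l2_norm \<xi>"
  shows "op_mnorm I 1 (\<lambda>_ _. T) \<le> C"
proof (rule op_mnorm_leI)
  fix \<xi> \<eta> :: "nat \<Rightarrow> 'a \<Rightarrow> complex"
  assume *: "\<And>j. j < 1 \<Longrightarrow> \<xi> j \<in> l2 I" "\<And>j. j < 1 \<Longrightarrow> \<eta> j \<in> l2 I"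
  have "cmod (l2_inner (T (\<xi> 0)) (\<eta> 0)) \<le> l2_norm (T (\<xi> 0)) * l2_norm (\<eta> 0)"
    using * by (intro l2_CS[of _ I _ I] bounded_ops_l2[OF assms(1)]) auto
  also have "\<dots> \<le> C * l2_norm (\<xi> 0) * l2_norm (\<eta> 0)"
    using * by (intro mult_right_mono assms(3)) auto
  finally show "cmod (\<Sum>i<1. \<Sum>j<1. l2_inner (T (\<xi> j)) (\<eta> i)) \<le> C * tuple_norm 1 \<xi> * tuple_norm 1 \<eta>"
    by (simp add: L2_set_def)
qed (use assms in auto)

lemma op_mnorm_scale_le:
  assumes T: "\<And>i j. i < n \<Longrightarrow> j < n \<Longrightarrow> T i j \<in> bounded_ops I"
  shows "op_mnorm I n (\<lambda>i j \<xi> x. c * T i j \<xi> x) \<le> cmod c * op_mnorm I n T"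
proof (rule op_mnorm_leI)
  fix \<xi> \<eta> :: "nat \<Rightarrow> 'a \<Rightarrow> complex"
  assume *: "\<And>j. j < n \<Longrightarrow> \<xi> j \<in> l2 I" "\<And>j. j < n \<Longrightarrow> \<eta> j \<in> l2 I"
  have "cmod (\<Sum>i<n. \<Sum>j<n. l2_inner (\<lambda>x. c * T i j (\<xi> j) x) (\<eta> i)) = cmod c * cmod (\<Sum>i<n. \<Sum>j<n. l2_inner (T i j (\<xi> j)) (\<eta> i))"
    by (simp add: l2_inner_scale_left sum_distrib_left[symmetric] norm_mult)
  also have "\<dots> \<le> cmod c * (op_mnorm I n T * tuple_norm n \<xi> * tuple_norm n \<eta>)"
    by (intro mult_left_mono op_mnorm_form T *) auto
  finally show "cmod (\<Sum>i<n. \<Sum>j<n. l2_inner (\<lambda>x. c * T i j (\<xi> j) x) (\<eta> i)) \<le> cmod c * op_mnorm I n T * tuple_norm n \<xi> * tuple_norm n \<eta>"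
    by (simp add: mult.assoc)
qed (use T op_mnorm_nonneg[of n T I] in \<open>auto intro: bounded_ops_smult\<close>)

section \<open>The group von Neumann algebra\<close>

lemma has_sum_reindex_UNIV:
  assumes "bij_betw h A B" "\<And>y. y \<notin> B \<Longrightarrow> g y = 0"
  shows "(g has_sum s) UNIV \<longleftrightarrow> ((\<lambda>x. g (h x)) has_sum s) A"
proof -
  have "(g has_sum s) UNIV \<longleftrightarrow> (g has_sum s) B"
    by (rule has_sum_cong_neutral) (use assms(2) in auto)
  also have "\<dots> \<longleftrightarrow> ((\<lambda>x. g (h x)) has_sum s) A"
    by (rule has_sum_reindex_bij_betw[OF assms(1), symmetric])
  finally show ?thesis .
qed

lemma has_sum_extend_zero:
  assumes "(g has_sum s) I" "\<And>x. x \<in> I \<Longrightarrow> f x = g x" "\<And>x. x \<notin> I \<Longrightarrow> f x = 0"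
  shows "(f has_sum s) UNIV"
  using assms by (subst has_sum_cong_neutral[where T = I and g = g]) auto

lemma l2_reindex:
  assumes h: "bij_betw h I I" and \<xi>: "\<xi> \<in> l2 I"
  defines "\<xi>' \<equiv> (\<lambda>x. if x \<in> I then \<xi> (h x) else 0)"
  shows "\<xi>' \<in> l2 I" "l2_norm \<xi>' = l2_norm \<xi>"
proof -
  have "((\<lambda>x. (cmod (\<xi> x))\<^sup>2) has_sum (l2_norm \<xi>)\<^sup>2) UNIV"
    using l2_summable[OF \<xi>] by (simp add: l2_norm_sq)
  then have "((\<lambda>x. (cmod (\<xi> (h x)))\<^sup>2) has_sum (l2_norm \<xi>)\<^sup>2) I"
    by (subst (asm) has_sum_reindex_UNIV[OF h]) (use \<xi> in \<open>auto simp: l2_def\<close>)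
  then have *: "((\<lambda>x. (cmod (\<xi>' x))\<^sup>2) has_sum (l2_norm \<xi>)\<^sup>2) UNIV"
    by (rule has_sum_extend_zero) (auto simp: \<xi>'_def)
  then show "\<xi>' \<in> l2 I" by (auto simp: l2_def \<xi>'_def dest: has_sum_imp_summable)
  have "(l2_norm \<xi>')\<^sup>2 = (l2_norm \<xi>)\<^sup>2" unfolding l2_norm_sq[of \<xi>'] by (rule infsumI[OF *])
  then show "l2_norm \<xi>' = l2_norm \<xi>" by simp
qed

section \<open>The left regular representation, its commutant and its double commutant\<close>

context group
begin

abbreviation lr :: "'a \<Rightarrow> 'a l2_op" where "lr \<equiv> left_regular G"

lemma lr_eq: "\<xi> \<in> l2 (carrier G) \<Longrightarrow> lr s \<xi> = (\<lambda>t. if t \<in> carrier G then \<xi> (inv s \<otimes> t) else 0)"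
  by (auto simp: left_regular_def)

lemma bij_mult_left: "s \<in> carrier G \<Longrightarrow> bij_betw (\<lambda>t. s \<otimes> t) (carrier G) (carrier G)"
  by (rule bij_betwI[of _ _ _ "\<lambda>t. inv s \<otimes> t"]) (auto simp: m_assoc[symmetric])

lemma bij_mult_right: "s \<in> carrier G \<Longrightarrow> bij_betw (\<lambda>t. t \<otimes> s) (carrier G) (carrier G)"
  by (rule bij_betwI[of _ _ _ "\<lambda>t. t \<otimes> inv s"]) (auto simp: m_assoc)

lemma lr_in:
  assumes "s \<in> carrier G" "\<xi> \<in> l2 (carrier G)"
  shows "lr s \<xi> \<in> l2 (carrier G)" "l2_norm (lr s \<xi>) = l2_norm \<xi>"
  using l2_reindex[OF bij_mult_left[of "inv s"] assms(2)] assms by (simp_all add: lr_eq)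

lemma lr_bounded: "s \<in> carrier G \<Longrightarrow> lr s \<in> bounded_ops (carrier G)"
proof (rule bounded_opsI[where C=1])
  fix \<xi> \<eta> assume "s \<in> carrier G" "\<xi> \<in> l2 (carrier G)" "\<eta> \<in> l2 (carrier G)"
  then show "lr s (\<lambda>x. \<xi> x + \<eta> x) = (\<lambda>x. lr s \<xi> x + lr s \<eta> x)"
    by (auto simp: lr_eq l2_add)
qed (auto simp: lr_in, auto simp: left_regular_def l2_scale)

lemma lr_delta: "s \<in> carrier G \<Longrightarrow> x \<in> carrier G \<Longrightarrow> lr s (l2_delta x) = l2_delta (s \<otimes> x)"
  by (simp add: lr_eq) (auto simp: l2_delta_def fun_eq_iff inv_solve_left')

lemma lr_mult: "s \<in> carrier G \<Longrightarrow> t \<in> carrier G \<Longrightarrow> \<xi> \<in> l2 (carrier G) \<Longrightarrow> lr s (lr t \<xi>) = lr (s \<otimes> t) \<xi>"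
  by (subst lr_eq[OF lr_in(1)]) (auto simp: lr_eq fun_eq_iff inv_mult_group m_assoc)

lemma lr_one: "\<xi> \<in> l2 (carrier G) \<Longrightarrow> lr \<one> \<xi> = \<xi>"
  by (auto simp: lr_eq fun_eq_iff l2_def)

lemma lr_inner:
  assumes s: "s \<in> carrier G" and \<xi>: "\<xi> \<in> l2 (carrier G)" and \<eta>: "\<eta> \<in> l2 (carrier G)"
  shows "l2_inner (lr s \<xi>) \<eta> = l2_inner \<xi> (lr (inv s) \<eta>)"
proof -
  have "((\<lambda>x. lr s \<xi> x * cnj (\<eta> x)) has_sum l2_inner (lr s \<xi>) \<eta>) UNIV"
    unfolding l2_inner_def using l2_inner_summable[OF lr_in(1)[OF s \<xi>] \<eta>] by simp
  then have "((\<lambda>x. lr s \<xi> (s \<otimes> x) * cnj (\<eta> (s \<otimes> x))) has_sum l2_inner (lr s \<xi>) \<eta>) (carrier G)"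
    by (subst (asm) has_sum_reindex_UNIV[OF bij_mult_left[OF s]]) (use \<eta> in \<open>auto simp: l2_def\<close>)
  then have "((\<lambda>x. \<xi> x * cnj (lr (inv s) \<eta> x)) has_sum l2_inner (lr s \<xi>) \<eta>) UNIV"
    by (rule has_sum_extend_zero)
      (use s \<xi> \<eta> in \<open>auto simp: lr_eq m_assoc[symmetric] l2_def\<close>)
  then show ?thesis unfolding l2_inner_def[of \<xi>] by (rule infsumI[symmetric])
qed

abbreviation VN' :: "'a l2_op set" where
  "VN' \<equiv> commutant (carrier G) (lr ` carrier G)"

lemma VN'_bounded: "R \<in> VN' \<Longrightarrow> R \<in> bounded_ops (carrier G)"
  by (simp add: commutant_def)

lemma VN'_iff:
  "R \<in> VN' \<longleftrightarrow> R \<in> bounded_ops (carrier G) \<and>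
     (\<forall>s\<in>carrier G. \<forall>\<xi>\<in>l2 (carrier G). R (lr s \<xi>) = lr s (R \<xi>))"
proof -
  have "R \<circ> lr s = lr s \<circ> R \<longleftrightarrow> (\<forall>\<xi>\<in>l2 (carrier G). R (lr s \<xi>) = lr s (R \<xi>))"
    if "R \<in> bounded_ops (carrier G)" "s \<in> carrier G" for s
  proof -
    \<comment> \<open>Off l2 both composites are 0, because the operators are extended by 0 there
      and map the zero vector to itself.\<close>
    have "R (lr s \<xi>) = lr s (R \<xi>)" if "\<xi> \<notin> l2 (carrier G)" for \<xi>
      using that \<open>R \<in> _\<close> \<open>s \<in> _\<close> bounded_ops_out[OF lr_bounded] bounded_ops_zero[OF lr_bounded]
      by (simp add: bounded_ops_out bounded_ops_zero)
    then show ?thesis by (auto simp: fun_eq_iff)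
  qed
  then show ?thesis by (auto simp: commutant_def)
qed

lemma VN_iff: "T \<in> carrier (VN G) \<longleftrightarrow> T \<in> bounded_ops (carrier G) \<and> (\<forall>R\<in>VN'. T \<circ> R = R \<circ> T)"
  by (simp add: VN_def commutant_def[of _ "commutant _ _"])

lemma VN_bounded: "T \<in> carrier (VN G) \<Longrightarrow> T \<in> bounded_ops (carrier G)"
  by (simp add: VN_iff)

lemma VN_commute: "T \<in> carrier (VN G) \<Longrightarrow> R \<in> VN' \<Longrightarrow> T (R \<xi>) = R (T \<xi>)"
  by (auto simp: VN_iff fun_eq_iff)

lemma VN_innerI:
  assumes "T \<in> bounded_ops (carrier G)"
    "\<And>R \<xi> \<eta>. R \<in> VN' \<Longrightarrow> \<xi> \<in> l2 (carrier G) \<Longrightarrow> \<eta> \<in> l2 (carrier G) \<Longrightarrow>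
      l2_inner (T (R \<xi>)) \<eta> = l2_inner (T \<xi>) (op_adjoint (carrier G) R \<eta>)"
  shows "T \<in> carrier (VN G)"
  using assms commute_iff_inner[OF assms(1) VN'_bounded] by (auto simp: VN_iff)

lemma VN_inner:
  assumes "T \<in> carrier (VN G)" "R \<in> VN'" "\<xi> \<in> l2 (carrier G)" "\<eta> \<in> l2 (carrier G)"
  shows "l2_inner (T (R \<xi>)) \<eta> = l2_inner (T \<xi>) (op_adjoint (carrier G) R \<eta>)"
  using assms commute_iff_inner[OF VN_bounded[OF assms(1)] VN'_bounded[OF assms(2)]] by (auto simp: VN_iff)

lemma lr_VN: "s \<in> carrier G \<Longrightarrow> lr s \<in> carrier (VN G)"
  by (auto simp: VN_iff lr_bounded commutant_def)

lemma VN_comp: "T \<in> carrier (VN G) \<Longrightarrow> S \<in> carrier (VN G) \<Longrightarrow> T \<circ> S \<in> carrier (VN G)"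
  unfolding VN_iff[of "T \<circ> S"] by (auto simp: VN_bounded bounded_ops_comp fun_eq_iff VN_commute)

lemma VN_add:
  assumes "T \<in> carrier (VN G)" "S \<in> carrier (VN G)"
  shows "(\<lambda>\<xi> x. T \<xi> x + S \<xi> x) \<in> carrier (VN G)"
proof (rule VN_innerI)
  fix R \<xi> \<eta> assume *: "R \<in> VN'" "\<xi> \<in> l2 (carrier G)" "\<eta> \<in> l2 (carrier G)"
  note b = bounded_ops_l2[OF VN_bounded[OF assms(1)]] bounded_ops_l2[OF VN_bounded[OF assms(2)]]
    bounded_ops_l2[OF VN'_bounded[OF *(1)]] bounded_ops_l2[OF op_adjoint_in[OF VN'_bounded[OF *(1)]]]
  show "l2_inner (\<lambda>x. T (R \<xi>) x + S (R \<xi>) x) \<eta> = l2_inner (\<lambda>x. T \<xi> x + S \<xi> x) (op_adjoint (carrier G) R \<eta>)"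
    by (simp add: l2_inner_add_left[of _ "carrier G" _ "carrier G" _ "carrier G"] b *
        VN_inner[OF assms(1) *] VN_inner[OF assms(2) *])
qed (rule bounded_ops_plus[OF VN_bounded[OF assms(1)] VN_bounded[OF assms(2)]])

lemma VN_smult:
  assumes "T \<in> carrier (VN G)" shows "(\<lambda>\<xi> x. c * T \<xi> x) \<in> carrier (VN G)"
proof (rule VN_innerI)
  fix R \<xi> \<eta> assume *: "R \<in> VN'" "\<xi> \<in> l2 (carrier G)" "\<eta> \<in> l2 (carrier G)"
  show "l2_inner (\<lambda>x. c * T (R \<xi>) x) \<eta> = l2_inner (\<lambda>x. c * T \<xi> x) (op_adjoint (carrier G) R \<eta>)"
    by (simp add: l2_inner_scale_left VN_inner[OF assms(1) *])
qed (rule bounded_ops_smult[OF VN_bounded[OF assms(1)]])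

text \<open>Both sides of the criterion \<open>VN_innerI\<close> are weakly continuous in the
  operator.\<close>

lemma VN_weak_limit:
  assumes T: "T \<in> bounded_ops (carrier G)" and F: "F \<noteq> bot"
    and Tn: "\<And>n. Tn n \<in> carrier (VN G)"
    and lim: "\<And>\<xi> \<eta>. \<xi> \<in> l2 (carrier G) \<Longrightarrow> \<eta> \<in> l2 (carrier G) \<Longrightarrow>
      ((\<lambda>n. l2_inner (Tn n \<xi>) \<eta>) \<longlongrightarrow> l2_inner (T \<xi>) \<eta>) F"
  shows "T \<in> carrier (VN G)"
proof (rule VN_innerI[OF T])
  fix R \<xi> \<eta> assume *: "R \<in> VN'" "\<xi> \<in> l2 (carrier G)" "\<eta> \<in> l2 (carrier G)"
  have "((\<lambda>n. l2_inner (Tn n (R \<xi>)) \<eta>) \<longlongrightarrow> l2_inner (T (R \<xi>)) \<eta>) F"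
    by (intro lim * bounded_ops_l2[OF VN'_bounded[OF *(1)]])
  then have "((\<lambda>n. l2_inner (Tn n \<xi>) (op_adjoint (carrier G) R \<eta>)) \<longlongrightarrow> l2_inner (T (R \<xi>)) \<eta>) F"
    by (simp add: VN_inner[OF Tn *])
  moreover have "((\<lambda>n. l2_inner (Tn n \<xi>) (op_adjoint (carrier G) R \<eta>))
      \<longlongrightarrow> l2_inner (T \<xi>) (op_adjoint (carrier G) R \<eta>)) F"
    by (intro lim * bounded_ops_l2[OF op_adjoint_in[OF VN'_bounded[OF *(1)]]])
  ultimately show "l2_inner (T (R \<xi>)) \<eta> = l2_inner (T \<xi>) (op_adjoint (carrier G) R \<eta>)"
    by (rule tendsto_unique[OF F])
qed

text \<open>The set of left translations is closed under adjoints, and so is its commutant.\<close>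

lemma VN'_adjoint:
  assumes R: "R \<in> VN'" shows "op_adjoint (carrier G) R \<in> VN'"
proof -
  let ?R = "op_adjoint (carrier G) R"
  note b = bounded_ops_l2[OF VN'_bounded[OF R]] bounded_ops_l2[OF op_adjoint_in[OF VN'_bounded[OF R]]]
  have "?R (lr s \<xi>) = lr s (?R \<xi>)" if s: "s \<in> carrier G" and \<xi>: "\<xi> \<in> l2 (carrier G)" for s \<xi>
  proof (rule l2_ext[of _ "carrier G"])
    fix \<eta> assume \<eta>: "\<eta> \<in> l2 (carrier G)"
    have "l2_inner (?R (lr s \<xi>)) \<eta> = l2_inner \<xi> (lr (inv s) (R \<eta>))"
      using s by (simp add: op_adjoint_left[OF VN'_bounded[OF R]] lr_in \<xi> \<eta> lr_inner b)
    also have "\<dots> = l2_inner \<xi> (R (lr (inv s) \<eta>))"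
      using R s \<eta> by (simp add: VN'_iff)
    also have "\<dots> = l2_inner (lr s (?R \<xi>)) \<eta>"
      using s by (simp add: op_adjoint_left[OF VN'_bounded[OF R]] lr_in \<xi> \<eta> lr_inner b)
    finally show "l2_inner (?R (lr s \<xi>)) \<eta> = l2_inner (lr s (?R \<xi>)) \<eta>" .
  qed (use s \<xi> b in \<open>auto simp: lr_in\<close>)
  then show ?thesis by (simp add: VN'_iff op_adjoint_in VN'_bounded[OF R])
qed

lemma VN_adjoint:
  assumes T: "T \<in> carrier (VN G)" shows "op_adjoint (carrier G) T \<in> carrier (VN G)"
proof (rule VN_innerI)
  fix R \<xi> \<eta> assume *: "R \<in> VN'" "\<xi> \<in> l2 (carrier G)" "\<eta> \<in> l2 (carrier G)"
  note Tb = VN_bounded[OF T] and Rb = VN'_bounded[OF *(1)]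
  note b = bounded_ops_l2[OF Tb] bounded_ops_l2[OF op_adjoint_in[OF Tb]]
    bounded_ops_l2[OF Rb] bounded_ops_l2[OF op_adjoint_in[OF Rb]]
  have "l2_inner (op_adjoint (carrier G) T (R \<xi>)) \<eta> = l2_inner \<xi> (op_adjoint (carrier G) R (T \<eta>))"
    by (simp add: op_adjoint_left[OF Tb] op_adjoint_right[OF Rb] * b)
  also have "\<dots> = l2_inner \<xi> (T (op_adjoint (carrier G) R \<eta>))"
    by (simp add: VN_commute[OF T VN'_adjoint[OF *(1)]])
  also have "\<dots> = l2_inner (op_adjoint (carrier G) T \<xi>) (op_adjoint (carrier G) R \<eta>)"
    by (simp add: op_adjoint_left[OF Tb] * b)
  finally show "l2_inner (op_adjoint (carrier G) T (R \<xi>)) \<eta>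
    = l2_inner (op_adjoint (carrier G) T \<xi>) (op_adjoint (carrier G) R \<eta>)" .
qed (rule op_adjoint_in[OF VN_bounded[OF T]])

text \<open>The right regular representation. It provides explicit elements of the commutant of the
  left translations.\<close>

definition rr :: "'a \<Rightarrow> 'a l2_op" where
  "rr g = (\<lambda>\<xi> t. if \<xi> \<in> l2 (carrier G) \<and> t \<in> carrier G then \<xi> (t \<otimes> g) else 0)"

lemma rr_eq: "\<xi> \<in> l2 (carrier G) \<Longrightarrow> rr s \<xi> = (\<lambda>t. if t \<in> carrier G then \<xi> (t \<otimes> s) else 0)"
  by (auto simp: rr_def)

lemma rr_in:
  assumes "s \<in> carrier G" "\<xi> \<in> l2 (carrier G)"
  shows "rr s \<xi> \<in> l2 (carrier G)" "l2_norm (rr s \<xi>) = l2_norm \<xi>"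
  using l2_reindex[OF bij_mult_right[of "s"] assms(2)] assms by (simp_all add: rr_eq)

lemma rr_VN':
  assumes "s \<in> carrier G" shows "rr s \<in> VN'"
proof -
  have "rr s \<in> bounded_ops (carrier G)"
  proof (rule bounded_opsI[where C=1])
    fix \<xi> \<eta> assume "\<xi> \<in> l2 (carrier G)" "\<eta> \<in> l2 (carrier G)"
    then show "rr s (\<lambda>x. \<xi> x + \<eta> x) = (\<lambda>x. rr s \<xi> x + rr s \<eta> x)"
      by (auto simp: rr_eq l2_add)
  qed (use assms in \<open>auto simp: rr_in\<close>, auto simp: rr_def l2_scale)
  moreover have "rr s (lr t \<xi>) = lr t (rr s \<xi>)" if "t \<in> carrier G" "\<xi> \<in> l2 (carrier G)" for t \<xi>
    unfolding rr_eq[OF lr_in(1)[OF that]] lr_eq[OF rr_in(1)[OF assms that(2)]]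
    using that assms by (auto simp: lr_eq rr_eq m_assoc fun_eq_iff)
  ultimately show ?thesis by (simp add: VN'_iff)
qed

text \<open>Right translations are isometric, commute with \<open>T\<close> and carry the point mass
  at the unit to every other one. Thus smallness of one column of an operator in \<open>VN G\<close>
  is smallness of all columns.\<close>

lemma VN_delta_norm:
  assumes T: "T \<in> carrier (VN G)" and x: "x \<in> carrier G"
  shows "l2_norm (T (l2_delta x)) = l2_norm (T (l2_delta \<one>))"
proof -
  have "l2_delta x = rr (inv x) (l2_delta \<one>)"
    using x by (simp add: rr_eq) (auto simp: l2_delta_def fun_eq_iff inv_solve_right')
  then have "T (l2_delta x) = rr (inv x) (T (l2_delta \<one>))"
    using VN_commute[OF T rr_VN'[of "inv x"]] x by simp
  then show ?thesis
    using rr_in(2)[of "inv x" "T (l2_delta \<one>)"] bounded_ops_l2[OF VN_bounded[OF T]] x by simp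
qed

text \<open>
  A normal functional that kills \<open>\<lambda>(G)\<close> kills \<open>VN(G)\<close>. This is the double commutant argument:
  the projection \<open>P\<close> onto the closed span of \<open>(1 \<otimes> \<lambda>(s)) \<Xi>\<close> has matrix entries in \<open>\<lambda>(G)'\<close>, hence
  commutes with \<open>1 \<otimes> T\<close>, so that \<open>(1 \<otimes> T) \<Xi>\<close> stays in this span.
\<close>

lemma normal_zero:
  fixes \<Xi> \<Theta> :: "'k \<times> 'a \<Rightarrow> complex"
  assumes T: "T \<in> carrier (VN G)"
    and \<Xi>: "\<Xi> \<in> l2 (UNIV \<times> carrier G)" and \<Theta>: "\<Theta> \<in> l2 (UNIV \<times> carrier G)"
    and zero: "\<And>s. s \<in> carrier G \<Longrightarrow> l2_inner (amp (lr s) \<Xi>) \<Theta> = 0"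
  shows "l2_inner (amp T \<Xi>) \<Theta> = 0"
proof -
  let ?L = "l2 (UNIV \<times> carrier G) :: ('k \<times> 'a \<Rightarrow> complex) set"
  let ?T = "op_adjoint (carrier G) T"
  note Tb = VN_bounded[OF T]
  have lrL: "amp (lr s) \<Phi> \<in> ?L" if "s \<in> carrier G" "\<Phi> \<in> ?L" for s \<Phi>
    using amp_in[OF lr_bounded] that by blast
  have lradj: "l2_inner (amp (lr s) \<Phi>) \<Psi> = l2_inner \<Phi> (amp (lr (inv s)) \<Psi>)"
    if s: "s \<in> carrier G" and \<Phi>: "\<Phi> \<in> ?L" and \<Psi>: "\<Psi> \<in> ?L" for s \<Phi> \<Psi>
  proof -
    have "((\<lambda>k. l2_inner (lr s (slice \<Phi> k)) (slice \<Psi> k)) has_sum l2_inner (amp (lr s) \<Phi>) \<Psi>) UNIV"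
      using inner_slices[OF lrL[OF s \<Phi>] \<Psi>] by simp
    moreover have "((\<lambda>k. l2_inner (slice \<Phi> k) (lr (inv s) (slice \<Psi> k))) has_sum l2_inner \<Phi> (amp (lr (inv s)) \<Psi>)) UNIV"
      using inner_slices[OF \<Phi> lrL[of "inv s", OF _ \<Psi>]] s by simp
    ultimately show ?thesis
      using has_sum_unique by (simp add: lr_inner[OF s slice_in[OF \<Phi>] slice_in[OF \<Psi>]])
  qed
  have lrmult: "amp (lr s) (amp (lr t) \<Phi>) = amp (lr (s \<otimes> t)) \<Phi>"
    if "s \<in> carrier G" "t \<in> carrier G" "\<Phi> \<in> ?L" for s t \<Phi>
    using that slice_in[OF that(3)]
    by (auto simp: fun_eq_iff amp_def[of "lr s"] amp_def[of "lr (s \<otimes> t)"] lr_mult)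
  \<comment> \<open>The closed span of the orbit, encoded as its double annihilator. In this form
    the goal follows for any vector of \<open>M\<close>, as \<Theta> annihilates the orbit.\<close>
  define M where "M = {m \<in> ?L. \<forall>\<theta>\<in>?L. (\<forall>s\<in>carrier G. l2_inner (amp (lr s) \<Xi>) \<theta> = 0) \<longrightarrow> l2_inner m \<theta> = 0}"
  have inL: "m \<in> ?L" if "m \<in> M" for m using that by (simp add: M_def)
  have MD: "l2_inner m \<theta> = 0" if "m \<in> M" "\<theta> \<in> ?L" "\<And>s. s \<in> carrier G \<Longrightarrow> l2_inner (amp (lr s) \<Xi>) \<theta> = 0" for m \<theta>
    using that by (simp add: M_def)
  have M0: "amp (lr s) \<Xi> \<in> M" if "s \<in> carrier G" for s
    using that lrL[OF that \<Xi>] by (simp add: M_def)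
  have Madd: "(\<lambda>p. u p + v p) \<in> M" if "u \<in> M" "v \<in> M" for u v
    using that by (simp add: M_def l2_add l2_inner_add_left[of _ "UNIV \<times> carrier G" _ "UNIV \<times> carrier G" _ "UNIV \<times> carrier G"])
  have Mscale: "(\<lambda>p. c * u p) \<in> M" if "u \<in> M" for c u
    using that by (simp add: M_def l2_scale l2_inner_scale_left)
  have Mlr: "amp (lr t) m \<in> M" if t: "t \<in> carrier G" and m: "m \<in> M" for t m
  proof -
    have "l2_inner (amp (lr t) m) \<theta> = 0"
      if \<theta>: "\<theta> \<in> ?L" and z: "\<And>s. s \<in> carrier G \<Longrightarrow> l2_inner (amp (lr s) \<Xi>) \<theta> = 0" for \<theta>
    proof -
      have it: "inv t \<in> carrier G" using t by simp
      have "l2_inner (amp (lr s) \<Xi>) (amp (lr (inv t)) \<theta>) = 0" if s: "s \<in> carrier G" for s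
        using lradj[OF t lrL[OF s \<Xi>] \<theta>] z[of "t \<otimes> s"] lrmult[OF t s \<Xi>] s t by simp
      then show ?thesis using lradj[OF t inL[OF m] \<theta>] MD[OF m lrL[OF it \<theta>]] by simp
    qed
    then show ?thesis using lrL[OF t inL[OF m]] by (simp add: M_def)
  qed
  have Mne: "M \<noteq> {}" using M0[OF one_closed] by blast
  have MsubL: "M \<subseteq> ?L" using inL by blast
  have ex: "\<exists>y. \<zeta> \<in> ?L \<longrightarrow> y \<in> M \<and> (\<forall>m\<in>M. l2_inner y m = l2_inner \<zeta> m)" for \<zeta>
  proof (cases "\<zeta> \<in> ?L")
    case True
    show ?thesis
    proof (rule projection_exists[OF MsubL Mne Madd Mscale True])
      fix y assume y: "y \<in> ?L" "\<And>m. m \<in> M \<Longrightarrow> l2_inner y m = l2_inner \<zeta> m"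
        "\<And>\<theta>. \<theta> \<in> ?L \<Longrightarrow> (\<And>m. m \<in> M \<Longrightarrow> l2_inner m \<theta> = 0) \<Longrightarrow> l2_inner y \<theta> = 0"
      have "l2_inner y \<theta> = 0" if "\<theta> \<in> ?L" "\<forall>s\<in>carrier G. l2_inner (amp (lr s) \<Xi>) \<theta> = 0" for \<theta>
        using y(3)[OF that(1)] MD[OF _ that(1)] that(2) by blast
      then have "y \<in> M" using y(1) by (simp add: M_def)
      then show ?thesis using y(2) by blast
    qed
  qed auto
  then obtain P where P: "\<And>\<zeta>. \<zeta> \<in> ?L \<Longrightarrow> P \<zeta> \<in> M" "\<And>\<zeta> m. \<zeta> \<in> ?L \<Longrightarrow> m \<in> M \<Longrightarrow> l2_inner (P \<zeta>) m = l2_inner \<zeta> m"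
    by metis
  have PL: "P \<zeta> \<in> ?L" if "\<zeta> \<in> ?L" for \<zeta> using P(1)[OF that] inL by blast
  have Puniq: "P \<zeta> = y" if \<zeta>: "\<zeta> \<in> ?L" and y: "y \<in> M" "\<And>m. m \<in> M \<Longrightarrow> l2_inner y m = l2_inner \<zeta> m" for \<zeta> y
  proof -
    let ?d = "\<lambda>p. P \<zeta> p + (-1) * y p"
    have dM: "?d \<in> M" by (intro Madd Mscale P(1) \<zeta> y)
    have "l2_inner ?d ?d = l2_inner (P \<zeta>) ?d + l2_inner (\<lambda>p. (-1) * y p) ?d"
      by (rule l2_inner_add_left[OF PL[OF \<zeta>] inL[OF Mscale[OF y(1)]] inL[OF dM]])
    also have "\<dots> = 0" using P(2)[OF \<zeta> dM] y(2)[OF dM] l2_inner_scale_left[of "-1" y ?d] by simp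
    finally have "l2_norm ?d = 0" by (simp add: l2_inner_self)
    then have "?d = (\<lambda>_. 0)" by (rule l2_norm_eq_0[OF inL[OF dM]])
    then have "\<forall>p. ?d p = 0" by (simp only: fun_eq_iff simp_thms)
    then show ?thesis by (simp add: fun_eq_iff)
  qed
  have Pid: "P m = m" if "m \<in> M" for m by (rule Puniq[OF inL[OF that] that]) simp
  have Padd: "P (\<lambda>p. \<zeta> p + \<zeta>' p) = (\<lambda>p. P \<zeta> p + P \<zeta>' p)" if "\<zeta> \<in> ?L" "\<zeta>' \<in> ?L" for \<zeta> \<zeta>'
    using that P PL inL
    by (intro Puniq Madd l2_add) (simp_all add: l2_inner_add_left[of _ "UNIV \<times> carrier G" _ "UNIV \<times> carrier G" _ "UNIV \<times> carrier G"])
  have Pscale: "P (\<lambda>p. c * \<zeta> p) = (\<lambda>p. c * P \<zeta> p)" if "\<zeta> \<in> ?L" for c \<zeta>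
    using that P by (intro Puniq Mscale l2_scale) (simp_all add: l2_inner_scale_left)
  have Pnorm: "l2_norm (P \<zeta>) \<le> l2_norm \<zeta>" if \<zeta>: "\<zeta> \<in> ?L" for \<zeta>
  proof -
    have e: "l2_inner \<zeta> (P \<zeta>) = of_real ((l2_norm (P \<zeta>))\<^sup>2)"
      using P(2)[OF \<zeta> P(1)[OF \<zeta>]] by (simp add: l2_inner_self)
    have "(l2_norm (P \<zeta>))\<^sup>2 = cmod (l2_inner \<zeta> (P \<zeta>))" unfolding e by (simp add: norm_power)
    also have "\<dots> \<le> l2_norm \<zeta> * l2_norm (P \<zeta>)" by (rule l2_CS[OF \<zeta> PL[OF \<zeta>]])
    finally have "l2_norm (P \<zeta>) * l2_norm (P \<zeta>) \<le> l2_norm \<zeta> * l2_norm (P \<zeta>)" by (simp add: power2_eq_square)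
    then show ?thesis by (cases "l2_norm (P \<zeta>) = 0") (auto simp: less_le)
  qed
  have Psa: "l2_inner (P \<zeta>) \<zeta>' = l2_inner \<zeta> (P \<zeta>')" if z: "\<zeta> \<in> ?L" "\<zeta>' \<in> ?L" for \<zeta> \<zeta>'
    using P(2)[OF z(2) P(1)[OF z(1)]] P(2)[OF z(1) P(1)[OF z(2)]] l2_inner_commute by metis
  have Plr: "P (amp (lr t) \<zeta>) = amp (lr t) (P \<zeta>)" if t: "t \<in> carrier G" and \<zeta>: "\<zeta> \<in> ?L" for t \<zeta>
  proof (rule Puniq[OF lrL[OF t \<zeta>] Mlr[OF t P(1)[OF \<zeta>]]])
    fix m assume m: "m \<in> M"
    have it: "inv t \<in> carrier G" using t by simp
    show "l2_inner (amp (lr t) (P \<zeta>)) m = l2_inner (amp (lr t) \<zeta>) m"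
      unfolding lradj[OF t PL[OF \<zeta>] inL[OF m]] lradj[OF t \<zeta> inL[OF m]]
      by (rule P(2)[OF \<zeta> Mlr[OF it m]])
  qed
  \<comment> \<open>The isometric embedding of \<ell>2(G) as the \<open>k\<close>-th copy.\<close>
  define emb :: "'k \<Rightarrow> ('a \<Rightarrow> complex) \<Rightarrow> 'k \<times> 'a \<Rightarrow> complex" where
    "emb = (\<lambda>k \<xi> (k', x). if k' = k then \<xi> x else 0)"
  have slemb: "slice (emb k \<xi>) k' = (if k' = k then \<xi> else (\<lambda>_. 0))" for k \<xi> k'
    by (auto simp: slice_def emb_def)
  have embL: "emb k \<xi> \<in> ?L" if "\<xi> \<in> l2 (carrier G)" for k \<xi>
  proof (rule l2_prodI)
    show "(\<lambda>k'. (l2_norm (slice (emb k \<xi>) k'))\<^sup>2) summable_on UNIV"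
      unfolding slemb by (rule finite_nonzero_values_imp_summable_on) (auto intro: finite_subset[of _ "{k}"])
  qed (use that in \<open>auto simp: slemb\<close>)
  have embnorm: "l2_norm (emb k \<xi>) = l2_norm \<xi>" if "\<xi> \<in> l2 (carrier G)" for k \<xi>
  proof -
    have "(l2_norm (emb k \<xi>))\<^sup>2 = (\<Sum>\<^sub>\<infinity>k'. (l2_norm (slice (emb k \<xi>) k'))\<^sup>2)"
      by (rule slice_norm_summable(2)[OF embL[OF that], symmetric])
    also have "\<dots> = (\<Sum>\<^sub>\<infinity>k'\<in>{k}. (l2_norm \<xi>)\<^sup>2)"
      by (rule infsum_cong_neutral) (auto simp: slemb)
    finally show ?thesis by simp
  qed
  have ampemb: "amp S (emb k \<xi>) = emb k (S \<xi>)" if "S \<in> bounded_ops (carrier G)" for S k \<xi>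
  proof
    fix p show "amp S (emb k \<xi>) p = emb k (S \<xi>) p"
      by (cases p, cases "fst p = k") (simp_all add: amp_def slemb bounded_ops_zero[OF that], simp_all add: emb_def)
  qed
  \<comment> \<open>The matrix entry of \<open>P\<close> from copy \<open>k\<close> to copy
    \<open>l\<close>. It lies in the commutant because \<open>P\<close> commutes with the amplified
    translations.\<close>
  define Q where "Q = (\<lambda>k l \<xi>. if \<xi> \<in> l2 (carrier G) then slice (P (emb k \<xi>)) l else (\<lambda>_. 0))"
  have Q: "Q k l \<in> VN'" for k l
  proof -
    have 1: "Q k l \<in> bounded_ops (carrier G)"
    proof (rule bounded_opsI[where C=1])
      fix \<xi> \<eta> assume *: "\<xi> \<in> l2 (carrier G)" "\<eta> \<in> l2 (carrier G)"
      have "emb k (\<lambda>x. \<xi> x + \<eta> x) = (\<lambda>p. emb k \<xi> p + emb k \<eta> p)" by (auto simp: emb_def fun_eq_iff)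
      then show "Q k l (\<lambda>x. \<xi> x + \<eta> x) = (\<lambda>x. Q k l \<xi> x + Q k l \<eta> x)"
        using * by (simp add: Q_def l2_add Padd embL slice_add)
    next
      fix c \<xi> assume *: "\<xi> \<in> l2 (carrier G)"
      have "emb k (\<lambda>x. c * \<xi> x) = (\<lambda>p. c * emb k \<xi> p)" by (auto simp: emb_def fun_eq_iff)
      then show "Q k l (\<lambda>x. c * \<xi> x) = (\<lambda>x. c * Q k l \<xi> x)"
        using * by (simp add: Q_def l2_scale Pscale embL slice_scale)
    next
      fix \<xi> assume *: "\<xi> \<in> l2 (carrier G)"
      have "(l2_norm (slice (P (emb k \<xi>)) l))\<^sup>2 = sum (\<lambda>l. (l2_norm (slice (P (emb k \<xi>)) l))\<^sup>2) {l}" by simp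
      also have "\<dots> \<le> (\<Sum>\<^sub>\<infinity>l. (l2_norm (slice (P (emb k \<xi>)) l))\<^sup>2)"
        by (rule finite_sum_le_infsum) (auto intro: slice_norm_summable(1)[OF PL[OF embL[OF *]]])
      also have "\<dots> = (l2_norm (P (emb k \<xi>)))\<^sup>2"
        by (rule slice_norm_summable(2)[OF PL[OF embL[OF *]]])
      finally have "l2_norm (slice (P (emb k \<xi>)) l) \<le> l2_norm (P (emb k \<xi>))"
        by (rule power2_le_imp_le) simp
      also have "\<dots> \<le> l2_norm \<xi>" using Pnorm[OF embL[OF *], of k] embnorm[OF *, of k] by simp
      finally show "l2_norm (Q k l \<xi>) \<le> 1 * l2_norm \<xi>" using * by (simp add: Q_def)
    qed (auto simp: Q_def intro: slice_in PL embL)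
    have "Q k l (lr s \<xi>) = lr s (Q k l \<xi>)" if s: "s \<in> carrier G" and \<xi>: "\<xi> \<in> l2 (carrier G)" for s \<xi>
    proof -
      have "P (emb k (lr s \<xi>)) = amp (lr s) (P (emb k \<xi>))"
        using Plr[OF s embL[OF \<xi>], of k] ampemb[OF lr_bounded[OF s], of k \<xi>] by simp
      then show ?thesis using s \<xi> by (simp add: Q_def lr_in)
    qed
    with 1 show ?thesis by (simp add: VN'_iff)
  qed
  note T'b = VN_bounded[OF VN_adjoint[OF T]]
  have ampadj: "l2_inner (amp T \<Phi>) \<Psi> = l2_inner \<Phi> (amp ?T \<Psi>)" if "\<Phi> \<in> ?L" "\<Psi> \<in> ?L" for \<Phi> \<Psi>
    using op_adjoint_amp[OF Tb that(2,1)] by (simp add: l2_inner_commute[of "amp T \<Phi>"] l2_inner_commute[of \<Phi>])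
  have TP: "amp ?T (P (emb l \<eta>)) = P (emb l (?T \<eta>))" if \<eta>: "\<eta> \<in> l2 (carrier G)" for l \<eta>
  proof
    fix p :: "'k \<times> 'a"
    have "amp ?T (P (emb l \<eta>)) p = ?T (Q l (fst p) \<eta>) (snd p)"
      using \<eta> by (simp add: amp_def Q_def case_prod_unfold)
    also have "\<dots> = Q l (fst p) (?T \<eta>) (snd p)"
      by (simp add: VN_commute[OF VN_adjoint[OF T] Q])
    also have "\<dots> = P (emb l (?T \<eta>)) p"
      using bounded_ops_l2[OF T'b \<eta>] by (simp add: Q_def slice_def)
    finally show "amp ?T (P (emb l \<eta>)) p = P (emb l (?T \<eta>)) p" .
  qed
  have \<psi>L: "amp T \<Xi> \<in> ?L" by (rule amp_in[OF Tb \<Xi>])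
  have "amp (lr \<one>) \<Xi> = \<Xi>"
    by (auto simp: amp_def lr_one slice_in[OF \<Xi>] fun_eq_iff) (simp add: slice_def)
  then have P\<Xi>: "P \<Xi> = \<Xi>" using Pid[OF M0[OF one_closed]] by simp
  \<comment> \<open>\<open>P\<close> is moved onto the test vector, exchanged with the amplified
    adjoint of \<open>T\<close>, and moved back onto \<Xi>, which it fixes.\<close>
  have inner_eq: "l2_inner (P (amp T \<Xi>)) (emb l \<eta>) = l2_inner (amp T \<Xi>) (emb l \<eta>)" if \<eta>: "\<eta> \<in> l2 (carrier G)" for l \<eta>
  proof -
    note e = embL[OF \<eta>, of l] embL[OF bounded_ops_l2[OF T'b \<eta>], of l]
    have "l2_inner (P (amp T \<Xi>)) (emb l \<eta>) = l2_inner (amp T \<Xi>) (P (emb l \<eta>))"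
      by (rule Psa[OF \<psi>L e(1)])
    also have "\<dots> = l2_inner \<Xi> (P (emb l (?T \<eta>)))"
      using ampadj[OF \<Xi> PL[OF e(1)]] TP[OF \<eta>, of l] by simp
    also have "\<dots> = l2_inner \<Xi> (emb l (?T \<eta>))"
      using Psa[OF \<Xi> e(2)] P\<Xi> by simp
    also have "\<dots> = l2_inner (amp T \<Xi>) (emb l \<eta>)"
      using ampadj[OF \<Xi> e(1)] ampemb[OF T'b, of l \<eta>] by simp
    finally show ?thesis .
  qed
  have "P (amp T \<Xi>) = amp T \<Xi>"
  proof
    fix p :: "'k \<times> 'a"
    obtain l x where p: "p = (l, x)" by fastforce
    show "P (amp T \<Xi>) p = amp T \<Xi> p"
    proof (cases "x \<in> carrier G")
      case True
      have "emb l (l2_delta x) = l2_delta (l, x)" by (auto simp: emb_def l2_delta_def fun_eq_iff)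
      then show ?thesis using inner_eq[of "l2_delta x" l] True by (simp add: p)
    next
      case False
      then show ?thesis using l2_D[OF PL[OF \<psi>L]] l2_D[OF \<psi>L] by (simp add: p)
    qed
  qed
  then have "amp T \<Xi> \<in> M" using P(1)[OF \<psi>L] by simp
  then show ?thesis using MD[OF _ \<Theta> zero] by blast
qed

end

section \<open>The Fourier algebra\<close>

lemma has_sum_sum_type:
  fixes f :: "'k + 'l \<Rightarrow> 'c :: topological_comm_monoid_add"
  assumes "((\<lambda>k. f (Inl k)) has_sum a) UNIV" "((\<lambda>l. f (Inr l)) has_sum b) UNIV"
  shows "(f has_sum (a + b)) UNIV"
proof -
  have 1: "(f has_sum a) (range Inl)"
    by (subst has_sum_reindex) (use assms(1) in \<open>simp_all add: o_def\<close>)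
  have 2: "(f has_sum b) (range Inr)"
    by (subst has_sum_reindex) (use assms(2) in \<open>simp_all add: o_def\<close>)
  have "(f has_sum (a + b)) (range Inl \<union> range Inr)"
    by (rule has_sum_Un_disjoint[OF 1 2]) auto
  moreover have "range Inl \<union> range Inr = (UNIV :: ('k + 'l) set)" by (auto simp: UNIV_sum)
  ultimately show ?thesis by simp
qed

text \<open>The direct sum of two vectors over the disjoint union of their index sets. It makes the
  sum of two vector functionals a single one.\<close>

definition csum :: "('k \<times> 'i \<Rightarrow> complex) \<Rightarrow> ('l \<times> 'i \<Rightarrow> complex) \<Rightarrow> ('k + 'l) \<times> 'i \<Rightarrow> complex" where
  "csum \<Xi> \<Xi>' = (\<lambda>(k, x). case k of Inl a \<Rightarrow> \<Xi> (a, x) | Inr b \<Rightarrow> \<Xi>' (b, x))"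

lemma slice_csum [simp]:
  "slice (csum \<Xi> \<Xi>') (Inl a) = slice \<Xi> a" "slice (csum \<Xi> \<Xi>') (Inr b) = slice \<Xi>' b"
  by (simp_all add: slice_def csum_def)

lemma csum_in:
  assumes "\<Xi> \<in> l2 (UNIV \<times> I)" "\<Xi>' \<in> l2 (UNIV \<times> I)"
  shows "csum \<Xi> \<Xi>' \<in> l2 (UNIV \<times> I)"
proof (rule l2_prodI)
  fix k show "slice (csum \<Xi> \<Xi>') k \<in> l2 I"
    using slice_in[OF assms(1)] slice_in[OF assms(2)] by (cases k) simp_all
  have "((\<lambda>k. (l2_norm (slice (csum \<Xi> \<Xi>') k))\<^sup>2) has_sum ((l2_norm \<Xi>)\<^sup>2 + (l2_norm \<Xi>')\<^sup>2)) UNIV"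
    by (rule has_sum_sum_type) (use slice_norm_summable[OF assms(1)] slice_norm_summable[OF assms(2)] in \<open>simp_all add: has_sum_iff\<close>)
  then show "(\<lambda>k. (l2_norm (slice (csum \<Xi> \<Xi>') k))\<^sup>2) summable_on UNIV" by (rule has_sum_imp_summable)
qed

lemma csum_inner:
  assumes "\<Xi> \<in> l2 (UNIV \<times> I)" "\<Xi>' \<in> l2 (UNIV \<times> I)" "\<Theta> \<in> l2 (UNIV \<times> I)" "\<Theta>' \<in> l2 (UNIV \<times> I)"
  shows "l2_inner (csum \<Xi> \<Xi>') (csum \<Theta> \<Theta>') = l2_inner \<Xi> \<Theta> + l2_inner \<Xi>' \<Theta>'"
proof -
  have "((\<lambda>k. l2_inner (slice (csum \<Xi> \<Xi>') k) (slice (csum \<Theta> \<Theta>') k)) has_sum (l2_inner \<Xi> \<Theta> + l2_inner \<Xi>' \<Theta>')) UNIV"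
    by (rule has_sum_sum_type) (use inner_slices[OF assms(1,3)] inner_slices[OF assms(2,4)] in simp_all)
  then show ?thesis
    using inner_slices[OF csum_in[OF assms(1,2)] csum_in[OF assms(3,4)]] has_sum_unique by blast
qed

lemma slice_ext: "(\<And>k. slice \<Xi> k = slice \<Theta> k) \<Longrightarrow> \<Xi> = \<Theta>"
  by (auto simp: slice_def fun_eq_iff)

lemma amp_csum: "amp T (csum \<Xi> \<Xi>') = csum (amp T \<Xi>) (amp T \<Xi>')"
proof (rule slice_ext)
  fix k show "slice (amp T (csum \<Xi> \<Xi>')) k = slice (csum (amp T \<Xi>) (amp T \<Xi>')) k"
    by (cases k) simp_all
qed

text \<open>Only countably many fibres are nonzero, so any index type may be replaced by the natural numbers.\<close>

lemma amp_reindex_nat: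
  fixes \<Xi> \<Theta> :: "'k \<times> 'i \<Rightarrow> complex"
  assumes \<Xi>: "\<Xi> \<in> l2 (UNIV \<times> I)" and \<Theta>: "\<Theta> \<in> l2 (UNIV \<times> I)"
  obtains \<Xi>' \<Theta>' :: "nat \<times> 'i \<Rightarrow> complex" where "\<Xi>' \<in> l2 (UNIV \<times> I)" "\<Theta>' \<in> l2 (UNIV \<times> I)"
    "\<And>T. T \<in> bounded_ops I \<Longrightarrow> l2_inner (amp T \<Xi>') \<Theta>' = l2_inner (amp T \<Xi>) \<Theta>"
proof -
  \<comment> \<open>Fibres in which \<Xi> vanishes contribute nothing to the inner product, whatever
    \<Theta> is there, so the support of \<Xi> alone decides.\<close>
  define K where "K = {k. slice \<Xi> k \<noteq> (\<lambda>_. 0)}"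
  have "countable {k\<in>UNIV. (l2_norm (slice \<Xi> k))\<^sup>2 \<noteq> 0}"
    by (rule summable_countable_real[OF slice_norm_summable(1)[OF \<Xi>]])
  then have K: "countable K"
    by (rule countable_subset[rotated]) (use l2_norm_eq_0[OF slice_in[OF \<Xi>]] in \<open>auto simp: K_def\<close>)
  define e where "e = to_nat_on K"
  define g where "g = inv_into K e"
  have e: "inj_on e K" unfolding e_def by (rule inj_on_to_nat_on[OF K])
  have g: "bij_betw g (e ` K) K"
    unfolding g_def using bij_betw_inv_into[OF inj_on_imp_bij_betw[OF e]] .
  have reidx: "((\<lambda>n. if n \<in> e ` K then F (g n) else 0) has_sum s) UNIV"
    if "(F has_sum s) UNIV" "\<And>k. k \<notin> K \<Longrightarrow> F k = 0" for F :: "'k \<Rightarrow> 'c :: {comm_monoid_add, topological_space}" and s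
  proof -
    have "((\<lambda>n. F (g n)) has_sum s) (e ` K)"
      using has_sum_reindex_UNIV[OF g, of F s] that by blast
    then show ?thesis by (rule has_sum_extend_zero) auto
  qed
  define R where "R = (\<lambda>\<Phi> :: 'k \<times> 'i \<Rightarrow> complex. \<lambda>(n, x). if n \<in> e ` K then \<Phi> (g n, x) else 0)"
  have slR: "slice (R \<Phi>) n = (if n \<in> e ` K then slice \<Phi> (g n) else (\<lambda>_. 0))" for \<Phi> n
    by (auto simp: slice_def R_def)
  have RL: "R \<Phi> \<in> l2 (UNIV \<times> I)" if \<Phi>: "\<Phi> \<in> l2 (UNIV \<times> I)" for \<Phi>
  proof (rule l2_prodI)
    fix n show "slice (R \<Phi>) n \<in> l2 I" using slice_in[OF \<Phi>] by (simp add: slR)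
  next
    define F where "F = (\<lambda>k. if k \<in> K then (l2_norm (slice \<Phi> k))\<^sup>2 else 0)"
    have "F summable_on UNIV"
      by (rule summable_on_comparison_test[OF slice_norm_summable(1)[OF \<Phi>]]) (auto simp: F_def)
    then have "((\<lambda>n. if n \<in> e ` K then F (g n) else 0) has_sum infsum F UNIV) UNIV"
      by (intro reidx has_sum_infsum) (simp_all add: F_def)
    moreover have "(if n \<in> e ` K then F (g n) else 0) = (l2_norm (slice (R \<Phi>) n))\<^sup>2" for n
      using bij_betw_apply[OF g, of n] by (cases "n \<in> e ` K") (simp_all add: slR F_def)
    ultimately show "(\<lambda>n. (l2_norm (slice (R \<Phi>) n))\<^sup>2) summable_on UNIV"
      by (simp add: has_sum_imp_summable)
  qed
  show ?thesis
  proof (rule that[OF RL[OF \<Xi>] RL[OF \<Theta>]])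
    fix T assume T: "T \<in> bounded_ops I"
    have "((\<lambda>k. l2_inner (T (slice \<Xi> k)) (slice \<Theta> k)) has_sum l2_inner (amp T \<Xi>) \<Theta>) UNIV"
      using inner_slices[OF amp_in[OF T \<Xi>] \<Theta>] by simp
    from reidx[OF this]
    have "((\<lambda>n. if n \<in> e ` K then l2_inner (T (slice \<Xi> (g n))) (slice \<Theta> (g n)) else 0) has_sum l2_inner (amp T \<Xi>) \<Theta>) UNIV"
      by (simp add: K_def bounded_ops_zero[OF T])
    moreover have "(if n \<in> e ` K then l2_inner (T (slice \<Xi> (g n))) (slice \<Theta> (g n)) else 0)
        = l2_inner (slice (amp T (R \<Xi>)) n) (slice (R \<Theta>) n)" for n
      by (simp add: slR)
    ultimately have "((\<lambda>n. l2_inner (slice (amp T (R \<Xi>)) n) (slice (R \<Theta>) n)) has_sum l2_inner (amp T \<Xi>) \<Theta>) UNIV"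
      by simp
    then show "l2_inner (amp T (R \<Xi>)) (R \<Theta>) = l2_inner (amp T \<Xi>) \<Theta>"
      using inner_slices[OF amp_in[OF T RL[OF \<Xi>]] RL[OF \<Theta>]] has_sum_unique by blast
  qed
qed

lemma amp_form:
  fixes \<Xi> \<Theta> :: "nat \<Rightarrow> 'k \<times> 'i \<Rightarrow> complex"
  assumes T: "\<And>i j. i < n \<Longrightarrow> j < n \<Longrightarrow> T i j \<in> bounded_ops I"
    and \<Xi>: "\<And>j. j < n \<Longrightarrow> \<Xi> j \<in> l2 (UNIV \<times> I)" and \<Theta>: "\<And>j. j < n \<Longrightarrow> \<Theta> j \<in> l2 (UNIV \<times> I)"
  shows "cmod (\<Sum>i<n. \<Sum>j<n. l2_inner (amp (T i j) (\<Xi> j)) (\<Theta> i))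
    \<le> op_mnorm I n T * tuple_norm n \<Xi> * tuple_norm n \<Theta>"
proof -
  let ?z = "\<lambda>i p. \<Sum>j<n. amp (T i j) (\<Xi> j) p"
  have b: "(\<Sum>i<n. (l2_norm (\<lambda>x. \<Sum>j<n. T i j (\<xi> j) x))\<^sup>2) \<le> (op_mnorm I n T)\<^sup>2 * (\<Sum>j<n. (l2_norm (\<xi> j))\<^sup>2)"
    if "\<And>j. j \<in> {..<n} \<Longrightarrow> \<xi> j \<in> l2 I" for \<xi>
    using power_mono[OF op_mnorm_apply[of n T I \<xi>, OF T], of 2] that
    by (simp add: L2_set_sq power_mult_distrib)
  have T': "T i j \<in> bounded_ops I" if "i \<in> {..<n}" "j \<in> {..<n}" for i j using T that by simp
  have \<Xi>': "\<Xi> j \<in> l2 (UNIV \<times> I)" if "j \<in> {..<n}" for j using \<Xi> that by simp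
  note m = amp_matrix_bound[of "{..<n}" "{..<n}" T I "(op_mnorm I n T)\<^sup>2" \<Xi>, OF T' b \<Xi>' finite_lessThan finite_lessThan]
  have z: "?z i \<in> l2 (UNIV \<times> I)" if "i < n" for i using m(1)[of i] that by simp
  have "(tuple_norm n ?z)\<^sup>2 \<le> (op_mnorm I n T * tuple_norm n \<Xi>)\<^sup>2"
    using m(2) by (simp add: L2_set_sq power_mult_distrib)
  then have zn: "tuple_norm n ?z \<le> op_mnorm I n T * tuple_norm n \<Xi>"
    by (rule power2_le_imp_le) (use op_mnorm_nonneg[of n T I, OF T] in simp)
  have "(\<Sum>i<n. \<Sum>j<n. l2_inner (amp (T i j) (\<Xi> j)) (\<Theta> i)) = (\<Sum>i<n. l2_inner (?z i) (\<Theta> i))"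
    by (intro sum.cong refl l2_inner_sum_left[symmetric, of _ _ "UNIV \<times> I" _ "UNIV \<times> I"])
      (auto intro: amp_in[OF T] \<Xi> \<Theta>)
  then have "cmod (\<Sum>i<n. \<Sum>j<n. l2_inner (amp (T i j) (\<Xi> j)) (\<Theta> i)) = cmod (\<Sum>i<n. l2_inner (?z i) (\<Theta> i))"
    by (simp only:)
  also have "\<dots> \<le> (\<Sum>i<n. l2_norm (?z i) * l2_norm (\<Theta> i))"
    by (rule order_trans[OF norm_sum], rule sum_mono, rule l2_CS[of _ "UNIV \<times> I" _ "UNIV \<times> I"]) (use z \<Theta> in auto)
  also have "\<dots> \<le> tuple_norm n ?z * tuple_norm n \<Theta>"
    using L2_set_mult_ineq[of "\<lambda>i. l2_norm (?z i)" "\<lambda>i. l2_norm (\<Theta> i)" "{..<n}"] by simp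
  also have "\<dots> \<le> op_mnorm I n T * tuple_norm n \<Xi> * tuple_norm n \<Theta>"
    by (rule mult_right_mono[OF zn]) simp
  finally show ?thesis .
qed

text \<open>Coefficient functions of multiples of the left regular representation. The index type is
  left free because sums and products change it; \<open>coef_in\<close> returns to the natural
  numbers used in the definition of normal functionals.\<close>

definition coef :: "('g, 'b) monoid_scheme \<Rightarrow> ('k \<times> 'g \<Rightarrow> complex) \<Rightarrow> ('k \<times> 'g \<Rightarrow> complex) \<Rightarrow> 'g \<Rightarrow> complex" where
  "coef G \<Xi> \<Theta> = (\<lambda>s. if s \<in> carrier G then l2_inner (amp (left_regular G s) \<Xi>) \<Theta> else 0)"

abbreviation Fourier :: "('g, 'b) monoid_scheme \<Rightarrow> ('g \<Rightarrow> complex) set" where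
  "Fourier G \<equiv> carrier (Fourier_algebra G)"

section \<open>Normal functionals and the pairing of A(G) with VN(G)\<close>

context group
begin

abbreviation VNs :: "'a l2_op set" where "VNs \<equiv> carrier (VN G)"

definition normal_form :: "('k \<times> 'a \<Rightarrow> complex) \<Rightarrow> ('k \<times> 'a \<Rightarrow> complex) \<Rightarrow> 'a l2_op \<Rightarrow> complex" where
  "normal_form \<Xi> \<Theta> = (\<lambda>T. if T \<in> VNs then l2_inner (amp T \<Xi>) \<Theta> else 0)"

lemma normal_form_nat:
  fixes \<Xi> \<Theta> :: "nat \<times> 'a \<Rightarrow> complex"
  assumes "\<Xi> \<in> l2 (UNIV \<times> carrier G)" "\<Theta> \<in> l2 (UNIV \<times> carrier G)"
  shows "normal_form \<Xi> \<Theta> \<in> normal_functionals G"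
proof -
  have "suminf (\<lambda>k. l2_inner (T (slice \<Xi> k)) (slice \<Theta> k)) = l2_inner (amp T \<Xi>) \<Theta>" if "T \<in> VNs" for T
  proof -
    have "((\<lambda>k. l2_inner (T (slice \<Xi> k)) (slice \<Theta> k)) has_sum l2_inner (amp T \<Xi>) \<Theta>) UNIV"
      using inner_slices[OF amp_in[OF VN_bounded[OF that] assms(1)] assms(2)] by simp
    then show ?thesis by (rule sums_unique[OF has_sum_imp_sums, symmetric])
  qed
  then have "normal_form \<Xi> \<Theta> = (\<lambda>T. if T \<in> VNs then suminf (\<lambda>k. l2_inner (T (slice \<Xi> k)) (slice \<Theta> k)) else 0)"
    by (auto simp: normal_form_def)
  moreover have "summable (\<lambda>k. (l2_norm (slice \<Xi> k))\<^sup>2)" "summable (\<lambda>k. (l2_norm (slice \<Theta> k))\<^sup>2)"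
    using slice_norm_summable(1)[OF assms(1)] slice_norm_summable(1)[OF assms(2)]
    by (auto intro: summable_on_imp_summable)
  moreover have "range (slice \<Xi>) \<subseteq> l2 (carrier G)" "range (slice \<Theta>) \<subseteq> l2 (carrier G)"
    using slice_in[OF assms(1)] slice_in[OF assms(2)] by auto
  ultimately show ?thesis
    unfolding normal_functionals_def by (intro CollectI exI[of _ "slice \<Xi>"] exI[of _ "slice \<Theta>"]) simp
qed

lemma normal_functionals_form:
  assumes "\<omega> \<in> normal_functionals G"
  obtains \<Xi> \<Theta> :: "nat \<times> 'a \<Rightarrow> complex" where
    "\<Xi> \<in> l2 (UNIV \<times> carrier G)" "\<Theta> \<in> l2 (UNIV \<times> carrier G)" "\<omega> = normal_form \<Xi> \<Theta>"
proof -
  obtain \<xi> \<eta> where w: "\<omega> = (\<lambda>T. if T \<in> VNs then suminf (\<lambda>k. l2_inner (T (\<xi> k)) (\<eta> k)) else 0)"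
    and r: "range \<xi> \<subseteq> l2 (carrier G)" "range \<eta> \<subseteq> l2 (carrier G)"
    and s: "summable (\<lambda>k::nat. (l2_norm (\<xi> k))\<^sup>2)" "summable (\<lambda>k. (l2_norm (\<eta> k))\<^sup>2)"
    using assms unfolding normal_functionals_def by auto
  define \<Xi> where "\<Xi> = (\<lambda>(k, x). \<xi> k x)"
  define \<Theta> where "\<Theta> = (\<lambda>(k, x). \<eta> k x)"
  have sl: "slice \<Xi> k = \<xi> k" "slice \<Theta> k = \<eta> k" for k by (simp_all add: \<Xi>_def \<Theta>_def slice_def)
  have \<Xi>: "\<Xi> \<in> l2 (UNIV \<times> carrier G)"
    by (rule l2_prodI) (use r s in \<open>auto simp: sl summable_on_UNIV_nonneg_real_iff\<close>)
  have \<Theta>: "\<Theta> \<in> l2 (UNIV \<times> carrier G)"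
    by (rule l2_prodI) (use r s in \<open>auto simp: sl summable_on_UNIV_nonneg_real_iff\<close>)
  have "suminf (\<lambda>k. l2_inner (T (\<xi> k)) (\<eta> k)) = l2_inner (amp T \<Xi>) \<Theta>" if "T \<in> VNs" for T
  proof -
    have "((\<lambda>k. l2_inner (T (\<xi> k)) (\<eta> k)) has_sum l2_inner (amp T \<Xi>) \<Theta>) UNIV"
      using inner_slices[OF amp_in[OF VN_bounded[OF that] \<Xi>] \<Theta>] by (simp add: sl)
    then show ?thesis by (rule sums_unique[OF has_sum_imp_sums, symmetric])
  qed
  then have "\<omega> = normal_form \<Xi> \<Theta>" by (auto simp: w normal_form_def)
  with \<Xi> \<Theta> show ?thesis by (rule that)
qed

lemma coefficient_normal_form: "coefficient_function G (normal_form \<Xi> \<Theta>) = coef G \<Xi> \<Theta>"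
  by (auto simp: coefficient_function_def normal_form_def coef_def lr_VN)

lemma Fourier_rep:
  assumes "u \<in> Fourier G"
  obtains \<Xi> \<Theta> :: "nat \<times> 'a \<Rightarrow> complex" where
    "\<Xi> \<in> l2 (UNIV \<times> carrier G)" "\<Theta> \<in> l2 (UNIV \<times> carrier G)" "u = coef G \<Xi> \<Theta>"
proof -
  obtain \<omega> where "\<omega> \<in> normal_functionals G" "u = coefficient_function G \<omega>"
    using assms by (auto simp: Fourier_algebra_def)
  then show ?thesis
    by (elim normal_functionals_form) (use that coefficient_normal_form in auto)
qed

lemma coef_in:
  fixes \<Xi> \<Theta> :: "'k \<times> 'a \<Rightarrow> complex"
  assumes "\<Xi> \<in> l2 (UNIV \<times> carrier G)" "\<Theta> \<in> l2 (UNIV \<times> carrier G)"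
  shows "coef G \<Xi> \<Theta> \<in> Fourier G"
proof (rule amp_reindex_nat[OF assms])
  fix \<Xi>' \<Theta>' :: "nat \<times> 'a \<Rightarrow> complex"
  assume *: "\<Xi>' \<in> l2 (UNIV \<times> carrier G)" "\<Theta>' \<in> l2 (UNIV \<times> carrier G)"
    "\<And>T. T \<in> bounded_ops (carrier G) \<Longrightarrow> l2_inner (amp T \<Xi>') \<Theta>' = l2_inner (amp T \<Xi>) \<Theta>"
  then have "coef G \<Xi> \<Theta> = coefficient_function G (normal_form \<Xi>' \<Theta>')"
    by (auto simp: coefficient_normal_form coef_def lr_bounded)
  then show ?thesis using normal_form_nat[OF *(1,2)] by (simp add: Fourier_algebra_def)
qed

text \<open>The difference of the two functionals is a single vector functional over the disjoint
  union of the index sets, and it kills all left translations, so \<open>normal_zero\<close>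
  applies.\<close>

lemma coef_unique:
  fixes \<Xi> \<Theta> :: "'k \<times> 'a \<Rightarrow> complex" and \<Xi>' \<Theta>' :: "'l \<times> 'a \<Rightarrow> complex"
  assumes \<Xi>: "\<Xi> \<in> l2 (UNIV \<times> carrier G)" and \<Theta>: "\<Theta> \<in> l2 (UNIV \<times> carrier G)"
    and \<Xi>': "\<Xi>' \<in> l2 (UNIV \<times> carrier G)" and \<Theta>': "\<Theta>' \<in> l2 (UNIV \<times> carrier G)"
    and eq: "coef G \<Xi> \<Theta> = coef G \<Xi>' \<Theta>'" and T: "T \<in> VNs"
  shows "l2_inner (amp T \<Xi>) \<Theta> = l2_inner (amp T \<Xi>') \<Theta>'"
proof -
  let ?m = "\<lambda>p. - \<Theta>' p"
  have m: "?m \<in> l2 (UNIV \<times> carrier G)" by (rule l2_uminus[OF \<Theta>'])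
  have f: "l2_inner (amp S (csum \<Xi> \<Xi>')) (csum \<Theta> ?m) = l2_inner (amp S \<Xi>) \<Theta> - l2_inner (amp S \<Xi>') \<Theta>'"
    if "S \<in> bounded_ops (carrier G)" for S
    by (simp add: amp_csum csum_inner[OF amp_in[OF that \<Xi>] amp_in[OF that \<Xi>'] \<Theta> m] l2_inner_minus_right)
  have "l2_inner (amp (lr s) (csum \<Xi> \<Xi>')) (csum \<Theta> ?m) = 0" if s: "s \<in> carrier G" for s
    using fun_cong[OF eq, of s] s by (simp add: f[OF lr_bounded[OF s]] coef_def)
  from normal_zero[OF T csum_in[OF \<Xi> \<Xi>'] csum_in[OF \<Theta> m] this]
  show ?thesis by (simp add: f[OF VN_bounded[OF T]])
qed

text \<open>The functional picked by \<open>inv_into\<close> may come from other vectors than the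
  given ones. By \<open>coef_unique\<close> its values are the same.\<close>

lemma duality_coef:
  fixes \<Xi> \<Theta> :: "'k \<times> 'a \<Rightarrow> complex"
  assumes \<Xi>: "\<Xi> \<in> l2 (UNIV \<times> carrier G)" and \<Theta>: "\<Theta> \<in> l2 (UNIV \<times> carrier G)" and T: "T \<in> VNs"
  shows "duality G T (coef G \<Xi> \<Theta>) = l2_inner (amp T \<Xi>) \<Theta>"
proof -
  define \<omega> where "\<omega> = inv_into (normal_functionals G) (coefficient_function G) (coef G \<Xi> \<Theta>)"
  have im: "coef G \<Xi> \<Theta> \<in> coefficient_function G ` normal_functionals G"
    using coef_in[OF \<Xi> \<Theta>] by (simp add: Fourier_algebra_def)
  have "\<omega> \<in> normal_functionals G" unfolding \<omega>_def by (rule inv_into_into[OF im])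
  then obtain \<Xi>' \<Theta>' :: "nat \<times> 'a \<Rightarrow> complex" where *:
    "\<Xi>' \<in> l2 (UNIV \<times> carrier G)" "\<Theta>' \<in> l2 (UNIV \<times> carrier G)" "\<omega> = normal_form \<Xi>' \<Theta>'"
    by (rule normal_functionals_form)
  have "coefficient_function G \<omega> = coef G \<Xi> \<Theta>" unfolding \<omega>_def by (rule f_inv_into_f[OF im])
  then have "coef G \<Xi>' \<Theta>' = coef G \<Xi> \<Theta>" by (simp add: *(3) coefficient_normal_form)
  then have "l2_inner (amp T \<Xi>') \<Theta>' = l2_inner (amp T \<Xi>) \<Theta>"
    by (rule coef_unique[OF *(1,2) \<Xi> \<Theta> _ T])
  moreover have "duality G T (coef G \<Xi> \<Theta>) = \<omega> T" by (simp add: duality_def \<omega>_def)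
  ultimately show ?thesis using T by (simp add: *(3) normal_form_def)
qed

lemma Fourier_outside: "u \<in> Fourier G \<Longrightarrow> s \<notin> carrier G \<Longrightarrow> u s = 0"
  by (auto simp: Fourier_algebra_def coefficient_function_def)

lemma duality_lr: "s \<in> carrier G \<Longrightarrow> u \<in> Fourier G \<Longrightarrow> duality G (lr s) u = u s"
  by (erule Fourier_rep) (simp add: duality_coef lr_VN, simp add: coef_def)

lemma coef_add:
  assumes "\<Xi> \<in> l2 (UNIV \<times> carrier G)" "\<Theta> \<in> l2 (UNIV \<times> carrier G)"
    "\<Xi>' \<in> l2 (UNIV \<times> carrier G)" "\<Theta>' \<in> l2 (UNIV \<times> carrier G)"
  shows "(\<lambda>x. coef G \<Xi> \<Theta> x + coef G \<Xi>' \<Theta>' x) = coef G (csum \<Xi> \<Xi>') (csum \<Theta> \<Theta>')"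
  using assms by (auto simp: coef_def amp_csum csum_inner[OF amp_in[OF lr_bounded] amp_in[OF lr_bounded]])

lemma coef_scale:
  assumes "\<Xi> \<in> l2 (UNIV \<times> carrier G)"
  shows "(\<lambda>x. c * coef G \<Xi> \<Theta> x) = coef G (\<lambda>p. c * \<Xi> p) \<Theta>"
  using assms by (auto simp: coef_def amp_scale[OF lr_bounded] l2_inner_scale_left)

lemma Fourier_add:
  assumes "u \<in> Fourier G" "v \<in> Fourier G"
  shows "(\<lambda>x. u x + v x) \<in> Fourier G"
    and "T \<in> VNs \<Longrightarrow> duality G T (\<lambda>x. u x + v x) = duality G T u + duality G T v"
proof -
  obtain \<Xi> \<Theta> :: "nat \<times> 'a \<Rightarrow> complex" where 1:
    "\<Xi> \<in> l2 (UNIV \<times> carrier G)" "\<Theta> \<in> l2 (UNIV \<times> carrier G)" "u = coef G \<Xi> \<Theta>"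
    using assms(1) by (rule Fourier_rep)
  obtain \<Xi>' \<Theta>' :: "nat \<times> 'a \<Rightarrow> complex" where 2:
    "\<Xi>' \<in> l2 (UNIV \<times> carrier G)" "\<Theta>' \<in> l2 (UNIV \<times> carrier G)" "v = coef G \<Xi>' \<Theta>'"
    using assms(2) by (rule Fourier_rep)
  have eq: "(\<lambda>x. u x + v x) = coef G (csum \<Xi> \<Xi>') (csum \<Theta> \<Theta>')"
    unfolding 1(3) 2(3) by (rule coef_add[OF 1(1,2) 2(1,2)])
  show "(\<lambda>x. u x + v x) \<in> Fourier G" unfolding eq by (intro coef_in csum_in 1 2)
  assume T: "T \<in> VNs"
  have "duality G T (\<lambda>x. u x + v x) = l2_inner (amp T (csum \<Xi> \<Xi>')) (csum \<Theta> \<Theta>')"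
    unfolding eq by (intro duality_coef csum_in 1 2 T)
  also have "\<dots> = duality G T u + duality G T v"
    using 1 2 T by (simp add: amp_csum csum_inner[OF amp_in[OF VN_bounded[OF T]] amp_in[OF VN_bounded[OF T]]] duality_coef)
  finally show "duality G T (\<lambda>x. u x + v x) = duality G T u + duality G T v" .
qed

lemma Fourier_scale:
  assumes "u \<in> Fourier G"
  shows "(\<lambda>x. c * u x) \<in> Fourier G"
    and "T \<in> VNs \<Longrightarrow> duality G T (\<lambda>x. c * u x) = c * duality G T u"
proof -
  obtain \<Xi> \<Theta> :: "nat \<times> 'a \<Rightarrow> complex" where 1:
    "\<Xi> \<in> l2 (UNIV \<times> carrier G)" "\<Theta> \<in> l2 (UNIV \<times> carrier G)" "u = coef G \<Xi> \<Theta>"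
    using assms(1) by (rule Fourier_rep)
  have eq: "(\<lambda>x. c * u x) = coef G (\<lambda>p. c * \<Xi> p) \<Theta>"
    unfolding 1(3) by (rule coef_scale[OF 1(1)])
  show "(\<lambda>x. c * u x) \<in> Fourier G" unfolding eq by (intro coef_in l2_scale 1)
  assume T: "T \<in> VNs"
  show "duality G T (\<lambda>x. c * u x) = c * duality G T u"
    unfolding eq unfolding 1(3) using 1(1,2) T
    by (simp add: duality_coef l2_scale amp_scale[OF VN_bounded[OF T]] l2_inner_scale_left)
qed

section \<open>The matrix norms of the Fourier algebra\<close>

abbreviation nA :: "nat \<Rightarrow> (nat \<Rightarrow> nat \<Rightarrow> 'a \<Rightarrow> complex) \<Rightarrow> real" where
  "nA \<equiv> mnorm (Fourier_algebra G)"

abbreviation "opn \<equiv> op_mnorm (carrier G)"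

lemma nA_eq:
  "nA n u = Sup {scalar_norm (n * m) (n * m) (\<lambda>p q. duality G (w (p mod m) (q mod m)) (u (p div m) (q div m))) | m w.
     0 < m \<and> w \<in> mats (VN G) m \<and> opn m w \<le> 1}"
  by (simp add: Fourier_algebra_def cb_mnorm_def complex_opspace_def VN_def)

lemma mats_VN: "w \<in> mats (VN G) m \<Longrightarrow> i < m \<Longrightarrow> j < m \<Longrightarrow> w i j \<in> VNs"
  by (simp add: mats_def)

lemma mats_Fourier: "w \<in> mats (Fourier_algebra G) m \<Longrightarrow> i < m \<Longrightarrow> j < m \<Longrightarrow> w i j \<in> Fourier G"
  by (simp add: mats_def)

text \<open>The scalars of the quadratic form can be absorbed into \<Xi> and \<Theta>, which turns
  it into the form of the amplified operator matrix \<open>w\<close>. So a normal functional is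
  completely bounded by the product of the norms of its vectors.\<close>

lemma normal_cb:
  fixes \<Xi> \<Theta> :: "'k \<times> 'a \<Rightarrow> complex"
  assumes \<Xi>: "\<Xi> \<in> l2 (UNIV \<times> carrier G)" and \<Theta>: "\<Theta> \<in> l2 (UNIV \<times> carrier G)"
    and w: "w \<in> mats (VN G) m" "opn m w \<le> 1"
  shows "scalar_norm m m (\<lambda>k l. duality G (w k l) (coef G \<Xi> \<Theta>)) \<le> l2_norm \<Xi> * l2_norm \<Theta>"
proof (rule scalar_norm_form_leI)
  fix a b :: "nat \<Rightarrow> complex"
  have wb: "w k l \<in> bounded_ops (carrier G)" if "k < m" "l < m" for k l
    using VN_bounded[OF mats_VN[OF w(1) that]] .
  have "(\<Sum>k<m. \<Sum>l<m. a k * duality G (w k l) (coef G \<Xi> \<Theta>) * b l)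
    = (\<Sum>k<m. \<Sum>l<m. l2_inner (amp (w k l) (\<lambda>p. b l * \<Xi> p)) (\<lambda>p. cnj (a k) * \<Theta> p))"
  proof (intro sum.cong refl)
    fix k l assume "k \<in> {..<m}" "l \<in> {..<m}"
    then have kl: "k < m" "l < m" by auto
    show "a k * duality G (w k l) (coef G \<Xi> \<Theta>) * b l
        = l2_inner (amp (w k l) (\<lambda>p. b l * \<Xi> p)) (\<lambda>p. cnj (a k) * \<Theta> p)"
      unfolding amp_scale[OF wb[OF kl] \<Xi>] l2_inner_scale_left l2_inner_scale_right
        duality_coef[OF \<Xi> \<Theta> mats_VN[OF w(1) kl]] by simp
  qed
  then have "cmod (\<Sum>k<m. \<Sum>l<m. a k * duality G (w k l) (coef G \<Xi> \<Theta>) * b l)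
    = cmod (\<Sum>k<m. \<Sum>l<m. l2_inner (amp (w k l) (\<lambda>p. b l * \<Xi> p)) (\<lambda>p. cnj (a k) * \<Theta> p))"
    by (simp only:)
  also have "\<dots> \<le> opn m w * tuple_norm m (\<lambda>l p. b l * \<Xi> p) * tuple_norm m (\<lambda>k p. cnj (a k) * \<Theta> p)"
    by (rule amp_form) (auto intro: wb l2_scale \<Xi> \<Theta>)
  also have "\<dots> = opn m w * (l2_norm \<Xi> * l2_norm \<Theta> * vec_norm m a * vec_norm m b)"
    unfolding l2_norm_scale L2_set_left_distrib[OF l2_norm_nonneg, symmetric] complex_mod_cnj by simp
  also have "\<dots> \<le> 1 * (l2_norm \<Xi> * l2_norm \<Theta> * vec_norm m a * vec_norm m b)"
    by (rule mult_right_mono[OF w(2)]) simp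
  finally show "cmod (\<Sum>k<m. \<Sum>l<m. a k * duality G (w k l) (coef G \<Xi> \<Theta>) * b l)
    \<le> l2_norm \<Xi> * l2_norm \<Theta> * vec_norm m a * vec_norm m b" by simp
qed simp

lemma Fourier_cb:
  assumes "u \<in> Fourier G"
  obtains C where "\<And>m w. w \<in> mats (VN G) m \<Longrightarrow> opn m w \<le> 1 \<Longrightarrow> scalar_norm m m (\<lambda>k l. duality G (w k l) u) \<le> C"
  using assms by (rule Fourier_rep) (use normal_cb that in blast)

lemma nA_bdd:
  assumes u: "\<And>i j. i < n \<Longrightarrow> j < n \<Longrightarrow> u i j \<in> Fourier G"
  shows "bdd_above {scalar_norm (n * m) (n * m) (\<lambda>p q. duality G (w (p mod m) (q mod m)) (u (p div m) (q div m))) | m w.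
     0 < m \<and> w \<in> mats (VN G) m \<and> opn m w \<le> 1}"
proof -
  have "\<forall>i j. \<exists>C. i < n \<longrightarrow> j < n \<longrightarrow> (\<forall>m. \<forall>w\<in>mats (VN G) m. opn m w \<le> 1 \<longrightarrow> scalar_norm m m (\<lambda>k l. duality G (w k l) (u i j)) \<le> C)"
  proof (intro allI)
    fix i j show "\<exists>C. i < n \<longrightarrow> j < n \<longrightarrow> (\<forall>m. \<forall>w\<in>mats (VN G) m. opn m w \<le> 1 \<longrightarrow> scalar_norm m m (\<lambda>k l. duality G (w k l) (u i j)) \<le> C)"
    proof (cases "i < n \<and> j < n")
      case True
      then have "u i j \<in> Fourier G" using u by simp
      then show ?thesis by (rule Fourier_cb) metis
    qed auto
  qed
  then obtain C where C: "\<And>i j m w. i < n \<Longrightarrow> j < n \<Longrightarrow> w \<in> mats (VN G) m \<Longrightarrow> opn m w \<le> 1 \<Longrightarrow>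
      scalar_norm m m (\<lambda>k l. duality G (w k l) (u i j)) \<le> C i j" by metis
  show ?thesis
  proof (rule bdd_aboveI[of _ "\<Sum>i<n. \<Sum>j<n. C i j"], clarify)
    fix m w assume m: "0 < m" and w: "w \<in> mats (VN G) m" "opn m w \<le> 1"
    let ?D = "\<lambda>p q. duality G (w (p mod m) (q mod m)) (u (p div m) (q div m))"
    have "scalar_norm (n * m) (n * m) ?D \<le> (\<Sum>i<n. \<Sum>j<n. scalar_norm m m (\<lambda>k l. ?D (i * m + k) (j * m + l)))"
      by (rule scalar_norm_blocks)
    also have "\<dots> \<le> (\<Sum>i<n. \<Sum>j<n. C i j)"
    proof (intro sum_mono)
      fix i j assume ij: "i \<in> {..<n}" "j \<in> {..<n}"
      have "scalar_norm m m (\<lambda>k l. ?D (i * m + k) (j * m + l)) = scalar_norm m m (\<lambda>k l. duality G (w k l) (u i j))"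
        using m by (intro scalar_norm_cong) simp
      then show "scalar_norm m m (\<lambda>k l. ?D (i * m + k) (j * m + l)) \<le> C i j" using C[OF _ _ w] ij by simp
    qed
    finally show "scalar_norm (n * m) (n * m) ?D \<le> (\<Sum>i<n. \<Sum>j<n. C i j)" .
  qed
qed

lemma nA_upper:
  assumes u: "\<And>i j. i < n \<Longrightarrow> j < n \<Longrightarrow> u i j \<in> Fourier G"
    and m: "0 < m" "w \<in> mats (VN G) m" "opn m w \<le> 1"
  shows "scalar_norm (n * m) (n * m) (\<lambda>p q. duality G (w (p mod m) (q mod m)) (u (p div m) (q div m))) \<le> nA n u"
  unfolding nA_eq by (rule cSup_upper[OF _ nA_bdd[OF u]]) (use m in auto)

lemma zero_VN: "(\<lambda>_ _. 0) \<in> VNs"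
  using VN_smult[OF lr_VN[OF one_closed], of 0] by simp

lemma opn_zero: "opn m (\<lambda>_ _ _ _. 0) \<le> 0"
  by (rule op_mnorm_leI) (auto intro: VN_bounded zero_VN)

lemma nA_least:
  assumes "\<And>m w. 0 < m \<Longrightarrow> w \<in> mats (VN G) m \<Longrightarrow> opn m w \<le> 1 \<Longrightarrow>
    scalar_norm (n * m) (n * m) (\<lambda>p q. duality G (w (p mod m) (q mod m)) (u (p div m) (q div m))) \<le> C"
  shows "nA n u \<le> C"
  unfolding nA_eq
proof (rule cSup_least)
  have "(\<lambda>_ _ _ _. 0) \<in> mats (VN G) 1" "opn 1 (\<lambda>_ _ _ _. 0) \<le> 1" "(0::nat) < 1"
    using zero_VN opn_zero[of 1] by (auto simp: mats_def)
  then have "scalar_norm (n * 1) (n * 1) (\<lambda>p q. duality G (\<lambda>_ _. 0) (u (p div 1) (q div 1)))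
    \<in> {scalar_norm (n * m) (n * m) (\<lambda>p q. duality G (w (p mod m) (q mod m)) (u (p div m) (q div m))) | m w.
     0 < m \<and> w \<in> mats (VN G) m \<and> opn m w \<le> 1}"
    by (intro CollectI exI[of _ 1] exI[of _ "\<lambda>_ _ _ _. 0"] conjI refl)
  then show "{scalar_norm (n * m) (n * m) (\<lambda>p q. duality G (w (p mod m) (q mod m)) (u (p div m) (q div m))) | m w.
     0 < m \<and> w \<in> mats (VN G) m \<and> opn m w \<le> 1} \<noteq> {}" by auto
qed (use assms in auto)

lemma nA_nonneg:
  assumes u: "\<And>i j. i < n \<Longrightarrow> j < n \<Longrightarrow> u i j \<in> Fourier G"
  shows "0 \<le> nA n u"
proof -
  have "(\<lambda>_ _ _ _. 0) \<in> mats (VN G) 1" "opn 1 (\<lambda>_ _ _ _. 0) \<le> 1"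
    using zero_VN opn_zero[of 1] by (auto simp: mats_def)
  from nA_upper[of n u 1 "\<lambda>_ _ _ _. 0", OF u zero_less_one this]
  show ?thesis by (rule order_trans[OF scalar_norm_nonneg])
qed

text \<open>Rescaling from the unit ball. A positive bound \<open>c\<close> in place of the norm of
  \<open>w\<close> avoids a division by zero.\<close>

lemma nA_apply:
  assumes u: "\<And>i j. i < n \<Longrightarrow> j < n \<Longrightarrow> u i j \<in> Fourier G"
    and m: "0 < m" and w: "w \<in> mats (VN G) m" and c: "0 < c" "opn m w \<le> c"
  shows "scalar_norm (n * m) (n * m) (\<lambda>p q. duality G (w (p mod m) (q mod m)) (u (p div m) (q div m))) \<le> c * nA n u"
proof -
  define d where "d = complex_of_real (inverse c)"
  define w' where "w' = (\<lambda>i j \<xi> x. d * w i j \<xi> x)"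
  have wb: "w k l \<in> bounded_ops (carrier G)" if "k < m" "l < m" for k l
    using VN_bounded[OF mats_VN[OF w(1) that]] .
  have w': "w' \<in> mats (VN G) m" using mats_VN[OF w] by (auto simp: mats_def w'_def intro: VN_smult)
  have "opn m w' \<le> cmod d * opn m w" unfolding w'_def by (rule op_mnorm_scale_le[OF wb])
  also have "\<dots> \<le> cmod d * c" by (rule mult_left_mono[OF c(2)]) simp
  also have "\<dots> = 1" using c(1) by (simp add: d_def norm_inverse)
  finally have n: "opn m w' \<le> 1" .
  have dual: "duality G (w' k l) v = d * duality G (w k l) v" if "k < m" "l < m" "v \<in> Fourier G" for k l v
  proof (rule Fourier_rep[OF that(3)])
    fix \<Xi> \<Theta> :: "nat \<times> 'a \<Rightarrow> complex"
    assume *: "\<Xi> \<in> l2 (UNIV \<times> carrier G)" "\<Theta> \<in> l2 (UNIV \<times> carrier G)" "v = coef G \<Xi> \<Theta>"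
    have "amp (w' k l) \<Xi> = (\<lambda>p. d * amp (w k l) \<Xi> p)" by (auto simp: amp_def w'_def)
    then show ?thesis
      using * mats_VN[OF w that(1,2)] mats_VN[OF w' that(1,2)] by (simp add: duality_coef l2_inner_scale_left)
  qed
  let ?D = "\<lambda>w p q. duality G (w (p mod m) (q mod m)) (u (p div m) (q div m))"
  have "scalar_norm (n * m) (n * m) (?D w') = scalar_norm (n * m) (n * m) (\<lambda>p q. d * ?D w p q)"
    by (rule scalar_norm_cong) (use m in \<open>auto intro!: dual u simp: less_mult_imp_div_less\<close>)
  then have "cmod d * scalar_norm (n * m) (n * m) (?D w) \<le> nA n u"
    using nA_upper[of n u m w', OF u m w' n] by (simp add: scalar_norm_scale)
  then show ?thesis using c(1) by (simp add: d_def norm_divide field_simps)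
qed

abbreviation vA :: "('a \<Rightarrow> complex) \<Rightarrow> real" where "vA u \<equiv> nA 1 (\<lambda>_ _. u)"

lemma vA_coef_le:
  fixes \<Xi> \<Theta> :: "'k \<times> 'a \<Rightarrow> complex"
  assumes "\<Xi> \<in> l2 (UNIV \<times> carrier G)" "\<Theta> \<in> l2 (UNIV \<times> carrier G)"
  shows "vA (coef G \<Xi> \<Theta>) \<le> l2_norm \<Xi> * l2_norm \<Theta>"
proof (rule nA_least)
  fix m w assume *: "0 < (m::nat)" "w \<in> mats (VN G) m" "opn m w \<le> 1"
  have "scalar_norm (1 * m) (1 * m) (\<lambda>p q. duality G (w (p mod m) (q mod m)) (coef G \<Xi> \<Theta>))
     = scalar_norm m m (\<lambda>p q. duality G (w p q) (coef G \<Xi> \<Theta>))"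
    unfolding mult_1 by (rule scalar_norm_cong) simp
  then show "scalar_norm (1 * m) (1 * m) (\<lambda>p q. duality G (w (p mod m) (q mod m)) (coef G \<Xi> \<Theta>)) \<le> l2_norm \<Xi> * l2_norm \<Theta>"
    using normal_cb[OF assms *(2,3)] by simp
qed

lemma duality_le:
  assumes T: "T \<in> VNs" and c: "0 < c" "\<And>\<xi>. \<xi> \<in> l2 (carrier G) \<Longrightarrow> l2_norm (T \<xi>) \<le> c * l2_norm \<xi>"
    and u: "u \<in> Fourier G"
  shows "cmod (duality G T u) \<le> c * vA u"
proof -
  have "opn 1 (\<lambda>_ _. T) \<le> c" by (rule op_mnorm_1_leI[OF VN_bounded[OF T]]) (use c in auto)
  then have "scalar_norm (1 * 1) (1 * 1) (\<lambda>p q. duality G T u) \<le> c * vA u"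
    using nA_apply[of 1 "\<lambda>_ _. u" 1 "\<lambda>_ _. T" c] u T c(1) by (simp add: mats_def)
  then show ?thesis by (simp add: scalar_norm_1[simplified])
qed

lemma nA_triangle:
  assumes u: "\<And>i j. i < n \<Longrightarrow> j < n \<Longrightarrow> u i j \<in> Fourier G"
    and v: "\<And>i j. i < n \<Longrightarrow> j < n \<Longrightarrow> v i j \<in> Fourier G"
  shows "nA n (\<lambda>i j x. u i j x + v i j x) \<le> nA n u + nA n v"
proof (rule nA_least)
  fix m w assume *: "0 < (m::nat)" "w \<in> mats (VN G) m" "opn m w \<le> 1"
  let ?D = "\<lambda>u p q. duality G (w (p mod m) (q mod m)) (u (p div m) (q div m))"
  have "scalar_norm (n * m) (n * m) (?D (\<lambda>i j x. u i j x + v i j x)) = scalar_norm (n * m) (n * m) (\<lambda>p q. ?D u p q + ?D v p q)"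
    by (rule scalar_norm_cong) (use *(1) in \<open>auto intro!: Fourier_add(2) u v mats_VN[OF *(2)] simp: less_mult_imp_div_less\<close>)
  also have "\<dots> \<le> scalar_norm (n * m) (n * m) (?D u) + scalar_norm (n * m) (n * m) (?D v)"
    by (rule scalar_norm_triangle)
  also have "\<dots> \<le> nA n u + nA n v"
    by (intro add_mono nA_upper u v *)
  finally show "scalar_norm (n * m) (n * m) (?D (\<lambda>i j x. u i j x + v i j x)) \<le> nA n u + nA n v" .
qed

lemma nA_scale_le:
  assumes u: "\<And>i j. i < n \<Longrightarrow> j < n \<Longrightarrow> u i j \<in> Fourier G"
  shows "nA n (\<lambda>i j x. c * u i j x) \<le> cmod c * nA n u"
proof (rule nA_least)
  fix m w assume *: "0 < (m::nat)" "w \<in> mats (VN G) m" "opn m w \<le> 1"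
  let ?D = "\<lambda>u p q. duality G (w (p mod m) (q mod m)) (u (p div m) (q div m))"
  have "scalar_norm (n * m) (n * m) (?D (\<lambda>i j x. c * u i j x)) = scalar_norm (n * m) (n * m) (\<lambda>p q. c * ?D u p q)"
    by (rule scalar_norm_cong) (use *(1) in \<open>auto intro!: Fourier_scale(2) u mats_VN[OF *(2)] simp: less_mult_imp_div_less\<close>)
  also have "\<dots> \<le> cmod c * nA n u"
    unfolding scalar_norm_scale by (intro mult_left_mono nA_upper u * norm_ge_zero)
  finally show "scalar_norm (n * m) (n * m) (?D (\<lambda>i j x. c * u i j x)) \<le> cmod c * nA n u" .
qed

end

section \<open>Multipliers of the Fourier algebra\<close>

text \<open>A single vector placed in the fibre 0, so that functionals given by one pair of vectors
  fall under \<open>coef\<close>.\<close>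

definition fibre :: "('g \<Rightarrow> complex) \<Rightarrow> nat \<times> 'g \<Rightarrow> complex" where
  "fibre \<xi> = (\<lambda>(n, x). if n = 0 then \<xi> x else 0)"

lemma slice_fibre: "slice (fibre \<xi>) n = (if n = 0 then \<xi> else (\<lambda>_. 0))"
  by (simp add: slice_def fibre_def)

lemma fibre_in: "\<xi> \<in> l2 I \<Longrightarrow> fibre \<xi> \<in> l2 (UNIV \<times> I)"
proof (rule l2_prodI)
  show "(\<lambda>n. (l2_norm (slice (fibre \<xi>) n))\<^sup>2) summable_on UNIV"
    unfolding slice_fibre by (rule finite_nonzero_values_imp_summable_on) (auto intro: finite_subset[of _ "{0}"])
qed (auto simp: slice_fibre)

lemma fibre_inner_right:
  assumes "\<Xi> \<in> l2 (UNIV \<times> I)" "\<eta> \<in> l2 I"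
  shows "l2_inner \<Xi> (fibre \<eta>) = l2_inner (slice \<Xi> 0) \<eta>"
proof -
  have "l2_inner \<Xi> (fibre \<eta>) = (\<Sum>\<^sub>\<infinity>n. l2_inner (slice \<Xi> n) (slice (fibre \<eta>) n))"
    by (rule infsumI[OF inner_slices[OF assms(1) fibre_in[OF assms(2)]], symmetric])
  also have "\<dots> = (\<Sum>\<^sub>\<infinity>n\<in>{0}. l2_inner (slice \<Xi> n) \<eta>)"
    by (rule infsum_cong_neutral) (auto simp: slice_fibre)
  finally show ?thesis by simp
qed

lemma fibre_inner: "\<xi> \<in> l2 I \<Longrightarrow> \<eta> \<in> l2 I \<Longrightarrow> l2_inner (fibre \<xi>) (fibre \<eta>) = l2_inner \<xi> \<eta>"
  by (simp add: fibre_inner_right[OF fibre_in] slice_fibre)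

lemma fibre_norm:
  assumes "\<xi> \<in> l2 I" shows "l2_norm (fibre \<xi>) = l2_norm \<xi>"
proof -
  have "complex_of_real ((l2_norm (fibre \<xi>))\<^sup>2) = of_real ((l2_norm \<xi>)\<^sup>2)"
    unfolding l2_inner_self[symmetric] by (rule fibre_inner[OF assms assms])
  then have "(l2_norm (fibre \<xi>))\<^sup>2 = (l2_norm \<xi>)\<^sup>2" by (simp only: of_real_eq_iff)
  then show ?thesis by simp
qed

lemma amp_fibre:
  assumes "T \<in> bounded_ops I" shows "amp T (fibre \<xi>) = fibre (T \<xi>)"
  by (rule slice_ext) (simp add: slice_fibre bounded_ops_zero[OF assms])

lemma has_sum_product:
  fixes a :: "'p \<Rightarrow> 'c :: {real_normed_field, banach}" and b :: "'q \<Rightarrow> 'c"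
  assumes a: "(\<lambda>p. norm (a p)) summable_on UNIV" and b: "(\<lambda>q. norm (b q)) summable_on UNIV"
  shows "((\<lambda>(p, q). a p * b q) has_sum (infsum a UNIV * infsum b UNIV)) UNIV"
proof -
  define f where "f = (\<lambda>z. a (fst z) * b (snd z))"
  have "(\<lambda>p. norm (a p) * infsum (\<lambda>q. norm (b q)) UNIV) summable_on UNIV"
    by (rule summable_on_cmult_left[OF a])
  moreover have "(\<lambda>q. norm (a p) * norm (b q)) summable_on UNIV" for p
    by (rule summable_on_cmult_right[OF b])
  ultimately have "(\<lambda>z. norm (f z)) summable_on (UNIV \<times> UNIV)"
    using Infinite_Sum.abs_summable_on_Sigma_iff[where f = f and A = UNIV and B = "\<lambda>_. UNIV"]
    by (simp add: f_def norm_mult infsum_cmult_right' infsum_nonneg)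
  then have "f summable_on (UNIV \<times> UNIV)" by (rule abs_summable_summable)
  then have s: "(\<lambda>(p, q). a p * b q) summable_on (UNIV \<times> UNIV)" by (simp add: f_def case_prod_unfold)
  have "((\<lambda>(p, q). a p * b q) has_sum (infsum a UNIV * infsum b UNIV)) (UNIV \<times> UNIV)"
  proof (rule has_sum_SigmaI[OF _ _ s])
    fix p
    show "((\<lambda>q. case (p, q) of (p, q) \<Rightarrow> a p * b q) has_sum (a p * infsum b UNIV)) UNIV"
      using has_sum_cmult_right[OF has_sum_infsum[OF abs_summable_summable[OF b]], of "a p"] by simp
  next
    show "((\<lambda>p. a p * infsum b UNIV) has_sum (infsum a UNIV * infsum b UNIV)) UNIV"
      by (rule has_sum_cmult_left[OF has_sum_infsum[OF abs_summable_summable[OF a]]])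
  qed
  then show ?thesis by simp
qed

lemma l2_functional_eq:
  assumes add: "\<And>\<xi> \<eta>. \<xi> \<in> l2 I \<Longrightarrow> \<eta> \<in> l2 I \<Longrightarrow> F (\<lambda>x. \<xi> x + \<eta> x) = F \<xi> + F \<eta>"
    and scale: "\<And>c \<xi>. \<xi> \<in> l2 I \<Longrightarrow> F (\<lambda>x. c * \<xi> x) = c * F \<xi>"
    and bound: "\<And>\<xi>. \<xi> \<in> l2 I \<Longrightarrow> cmod (F \<xi>) \<le> C * l2_norm \<xi>"
    and zero: "\<And>x. x \<in> I \<Longrightarrow> F (l2_delta x) = 0"
    and \<xi>: "\<xi> \<in> l2 I"
  shows "F \<xi> = 0"
proof (rule Riesz_l2[of I "\<lambda>\<xi>. cnj (F \<xi>)" C])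
  fix y assume y: "y \<in> l2 I" "\<And>\<eta>. \<eta> \<in> l2 I \<Longrightarrow> l2_inner y \<eta> = cnj (F \<eta>)"
  have "y x = 0" for x
    using y(2)[of "l2_delta x"] zero[of x] l2_D[OF y(1), of x] by (cases "x \<in> I") auto
  then have "y = (\<lambda>_. 0)" by (simp add: fun_eq_iff)
  then show "F \<xi> = 0" using y(2)[OF \<xi>] by simp
qed (use add scale bound in auto)

text \<open>Subtraction is defined by a definite description over the carrier. Evaluating it
  directly requires no module axioms, only that the pointwise negative lies in the carrier.\<close>

lemma minus_pointwise:
  fixes V :: "('i \<Rightarrow> complex, 'm) opspace_scheme"
  assumes "\<And>u v. u \<oplus>\<^bsub>V\<^esub> v = (\<lambda>x. u x + v x)" "\<zero>\<^bsub>V\<^esub> = (\<lambda>_. 0)" "(\<lambda>x. - y x) \<in> carrier V"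
  shows "u \<ominus>\<^bsub>V\<^esub> y = (\<lambda>x. u x - y x)"
proof -
  have "\<ominus>\<^bsub>V\<^esub> y = (\<lambda>x. - y x)"
    unfolding a_inv_def m_inv_def
  proof (rule the_equality)
    fix z assume "z \<in> carrier (add_monoid V) \<and> y \<otimes>\<^bsub>add_monoid V\<^esub> z = \<one>\<^bsub>add_monoid V\<^esub> \<and>
      z \<otimes>\<^bsub>add_monoid V\<^esub> y = \<one>\<^bsub>add_monoid V\<^esub>"
    then have "(\<lambda>x. y x + z x) = (\<lambda>_. 0)" by (simp add: assms)
    then have "y x + z x = 0" for x by (rule fun_cong)
    then show "z = (\<lambda>x. - y x)" by (auto simp: fun_eq_iff add_eq_0_iff)
  qed (simp add: assms)
  then show ?thesis by (simp add: a_minus_def assms)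
qed

text \<open>
  Fell's absorption principle: after the substitution \<open>z = x y\<close> the product of two coefficient
  functions is again a coefficient function, with the index set enlarged by \<open>G\<close>.
\<close>

definition fell :: "('g, 'b) monoid_scheme \<Rightarrow> ('k \<times> 'g \<Rightarrow> complex) \<Rightarrow> ('l \<times> 'g \<Rightarrow> complex)
    \<Rightarrow> ('k \<times> 'l \<times> 'g) \<times> 'g \<Rightarrow> complex" where
  "fell G \<Xi> \<Phi> = (\<lambda>((k, l, y), x). if x \<in> carrier G \<and> y \<in> carrier G then \<Xi> (k, x) * \<Phi> (l, x \<otimes>\<^bsub>G\<^esub> y) else 0)"

context group
begin

text \<open>The map W is the substitution z = x y. The scalar field is left open because both the
  norm of \<open>fell\<close> (real summands) and its inner products (complex summands) are of this
  form.\<close>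

lemma fell_has_sum:
  fixes a :: "'k \<times> 'a \<Rightarrow> 'c :: {real_normed_field, banach}" and b :: "'l \<times> 'a \<Rightarrow> 'c"
  assumes a: "(\<lambda>p. norm (a p)) summable_on UNIV" and b: "(\<lambda>q. norm (b q)) summable_on UNIV"
    and a0: "\<And>k x. x \<notin> carrier G \<Longrightarrow> a (k, x) = 0" and b0: "\<And>l z. z \<notin> carrier G \<Longrightarrow> b (l, z) = 0"
    and f: "\<And>k l y x. f ((k, l, y), x) = (if x \<in> carrier G \<and> y \<in> carrier G then a (k, x) * b (l, x \<otimes> y) else 0)"
  shows "(f has_sum (infsum a UNIV * infsum b UNIV)) UNIV"
proof -
  define D where "D = {((k::'k, l::'l, y), x). x \<in> carrier G \<and> y \<in> carrier G}"
  define R where "R = {((k::'k, x), (l::'l, z)). x \<in> carrier G \<and> z \<in> carrier G}"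
  define W where "W = (\<lambda>((k::'k, l::'l, y), x). ((k, x), (l, x \<otimes> y)))"
  have W: "bij_betw W D R"
    by (rule bij_betwI[of _ _ _ "\<lambda>((k, x), (l, z)). ((k, l, inv x \<otimes> z), x)"])
      (auto simp: W_def D_def R_def m_assoc[symmetric])
  have "((\<lambda>(p, q). a p * b q) has_sum (infsum a UNIV * infsum b UNIV)) UNIV"
    by (rule has_sum_product[OF a b])
  then have "((\<lambda>d. case W d of (p, q) \<Rightarrow> a p * b q) has_sum (infsum a UNIV * infsum b UNIV)) D"
    by (subst (asm) has_sum_reindex_UNIV[OF W]) (use a0 b0 in \<open>force simp: R_def\<close>)
  then show ?thesis
    by (rule has_sum_extend_zero) (auto simp: D_def W_def f split: if_splits)
qed

lemma fell_in:
  fixes \<Xi> :: "'k \<times> 'a \<Rightarrow> complex" and \<Phi> :: "'l \<times> 'a \<Rightarrow> complex"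
  assumes "\<Xi> \<in> l2 (UNIV \<times> carrier G)" "\<Phi> \<in> l2 (UNIV \<times> carrier G)"
  shows "fell G \<Xi> \<Phi> \<in> l2 (UNIV \<times> carrier G)" "l2_norm (fell G \<Xi> \<Phi>) = l2_norm \<Xi> * l2_norm \<Phi>"
proof -
  have "((\<lambda>d. (cmod (fell G \<Xi> \<Phi> d))\<^sup>2) has_sum
      (infsum (\<lambda>p. (cmod (\<Xi> p))\<^sup>2) UNIV * infsum (\<lambda>q. (cmod (\<Phi> q))\<^sup>2) UNIV)) UNIV"
    by (rule fell_has_sum) (use assms in \<open>auto simp: l2_def fell_def norm_mult power_mult_distrib\<close>)
  then have h: "((\<lambda>d. (cmod (fell G \<Xi> \<Phi> d))\<^sup>2) has_sum (l2_norm \<Xi> * l2_norm \<Phi>)\<^sup>2) UNIV"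
    by (simp add: l2_norm_sq power_mult_distrib)
  from h show "fell G \<Xi> \<Phi> \<in> l2 (UNIV \<times> carrier G)"
    by (auto simp: l2_def fell_def dest: has_sum_imp_summable)
  have "(l2_norm (fell G \<Xi> \<Phi>))\<^sup>2 = (l2_norm \<Xi> * l2_norm \<Phi>)\<^sup>2"
    unfolding l2_norm_sq[of "fell G \<Xi> \<Phi>"] by (rule infsumI[OF h])
  then show "l2_norm (fell G \<Xi> \<Phi>) = l2_norm \<Xi> * l2_norm \<Phi>"
    by (rule power2_eq_imp_eq) simp_all
qed

lemma fell_inner:
  fixes \<Xi> \<Theta> :: "'k \<times> 'a \<Rightarrow> complex" and \<Phi> \<Psi> :: "'l \<times> 'a \<Rightarrow> complex"
  assumes "\<Xi> \<in> l2 (UNIV \<times> carrier G)" "\<Theta> \<in> l2 (UNIV \<times> carrier G)"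
    "\<Phi> \<in> l2 (UNIV \<times> carrier G)" "\<Psi> \<in> l2 (UNIV \<times> carrier G)"
  shows "l2_inner (fell G \<Xi> \<Phi>) (fell G \<Theta> \<Psi>) = l2_inner \<Xi> \<Theta> * l2_inner \<Phi> \<Psi>"
  unfolding l2_inner_def
proof (rule infsumI, rule fell_has_sum)
  show "(\<lambda>p. cmod (\<Xi> p * cnj (\<Theta> p))) summable_on UNIV" "(\<lambda>p. cmod (\<Phi> p * cnj (\<Psi> p))) summable_on UNIV"
    using l2_inner_abs_summable assms by (auto simp: norm_mult)
qed (use assms in \<open>auto simp: fell_def l2_def\<close>)

lemma amp_lr_eq:
  assumes "\<Xi> \<in> l2 (UNIV \<times> carrier G)"
  shows "amp (lr s) \<Xi> (k, x) = (if x \<in> carrier G then \<Xi> (k, inv s \<otimes> x) else 0)"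
  using lr_eq[OF slice_in[OF assms], of s k] by (simp add: amp_def) (simp add: slice_def)

text \<open>Translating x on the left translates x y in the same way and leaves y alone. Hence y can
  be part of the index.\<close>

lemma amp_lr_fell:
  fixes \<Xi> :: "'k \<times> 'a \<Rightarrow> complex" and \<Phi> :: "'l \<times> 'a \<Rightarrow> complex"
  assumes "\<Xi> \<in> l2 (UNIV \<times> carrier G)" "\<Phi> \<in> l2 (UNIV \<times> carrier G)" "s \<in> carrier G"
  shows "amp (lr s) (fell G \<Xi> \<Phi>) = fell G (amp (lr s) \<Xi>) (amp (lr s) \<Phi>)"
proof
  fix d :: "('k \<times> 'l \<times> 'a) \<times> 'a"
  obtain k l y x where d: "d = ((k, l, y), x)" by (metis surj_pair)
  show "amp (lr s) (fell G \<Xi> \<Phi>) d = fell G (amp (lr s) \<Xi>) (amp (lr s) \<Phi>) d"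
    unfolding d amp_lr_eq[OF fell_in(1)[OF assms(1,2)]]
    using assms(3) by (auto simp: fell_def amp_lr_eq[OF assms(1)] amp_lr_eq[OF assms(2)] m_assoc)
qed

lemma coef_mult:
  fixes \<Xi> \<Theta> :: "'k \<times> 'a \<Rightarrow> complex" and \<Phi> \<Psi> :: "'l \<times> 'a \<Rightarrow> complex"
  assumes "\<Xi> \<in> l2 (UNIV \<times> carrier G)" "\<Theta> \<in> l2 (UNIV \<times> carrier G)"
    "\<Phi> \<in> l2 (UNIV \<times> carrier G)" "\<Psi> \<in> l2 (UNIV \<times> carrier G)"
  shows "(\<lambda>x. coef G \<Xi> \<Theta> x * coef G \<Phi> \<Psi> x) = coef G (fell G \<Xi> \<Phi>) (fell G \<Theta> \<Psi>)"
  using assms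
  by (auto simp: coef_def amp_lr_fell fell_inner[OF amp_in[OF lr_bounded] _ amp_in[OF lr_bounded]])

lemma Fourier_mult:
  assumes "u \<in> Fourier G" "v \<in> Fourier G" shows "(\<lambda>x. u x * v x) \<in> Fourier G"
proof -
  obtain \<Xi> \<Theta> :: "nat \<times> 'a \<Rightarrow> complex" where 1:
    "\<Xi> \<in> l2 (UNIV \<times> carrier G)" "\<Theta> \<in> l2 (UNIV \<times> carrier G)" "u = coef G \<Xi> \<Theta>"
    using assms(1) by (rule Fourier_rep)
  obtain \<Xi>' \<Theta>' :: "nat \<times> 'a \<Rightarrow> complex" where 2:
    "\<Xi>' \<in> l2 (UNIV \<times> carrier G)" "\<Theta>' \<in> l2 (UNIV \<times> carrier G)" "v = coef G \<Xi>' \<Theta>'"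
    using assms(2) by (rule Fourier_rep)
  show ?thesis unfolding 1(3) 2(3) coef_mult[OF 1(1,2) 2(1,2)] by (intro coef_in fell_in 1 2)
qed

text \<open>The functional T \<mapsto> \<langle>T \<xi>, \<eta>\<rangle> as an element of
  A(G).\<close>

definition vfun :: "('a \<Rightarrow> complex) \<Rightarrow> ('a \<Rightarrow> complex) \<Rightarrow> 'a \<Rightarrow> complex" where
  "vfun \<xi> \<eta> = coef G (fibre \<xi>) (fibre \<eta>)"

lemma vfun_in: "\<xi> \<in> l2 (carrier G) \<Longrightarrow> \<eta> \<in> l2 (carrier G) \<Longrightarrow> vfun \<xi> \<eta> \<in> Fourier G"
  unfolding vfun_def by (intro coef_in fibre_in)

lemma vfun_eq:
  "\<xi> \<in> l2 (carrier G) \<Longrightarrow> \<eta> \<in> l2 (carrier G) \<Longrightarrow>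
     vfun \<xi> \<eta> s = (if s \<in> carrier G then l2_inner (lr s \<xi>) \<eta> else 0)"
  by (simp add: vfun_def coef_def amp_fibre[OF lr_bounded] fibre_inner[OF lr_in(1)])

lemma duality_vfun:
  "T \<in> VNs \<Longrightarrow> \<xi> \<in> l2 (carrier G) \<Longrightarrow> \<eta> \<in> l2 (carrier G) \<Longrightarrow> duality G T (vfun \<xi> \<eta>) = l2_inner (T \<xi>) \<eta>"
  by (simp add: vfun_def duality_coef fibre_in amp_fibre[OF VN_bounded]
      fibre_inner[OF bounded_ops_l2[OF VN_bounded]])

lemma vA_vfun_le:
  assumes "\<xi> \<in> l2 (carrier G)" "\<eta> \<in> l2 (carrier G)"
  shows "vA (vfun \<xi> \<eta>) \<le> l2_norm \<xi> * l2_norm \<eta>"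
  using vA_coef_le[OF fibre_in[OF assms(1)] fibre_in[OF assms(2)]]
  by (simp add: vfun_def fibre_norm[OF assms(1)] fibre_norm[OF assms(2)])

lemma VN_pos_bound:
  assumes "T \<in> VNs"
  obtains c where "0 < c" "\<And>\<xi>. \<xi> \<in> l2 (carrier G) \<Longrightarrow> l2_norm (T \<xi>) \<le> c * l2_norm \<xi>"
proof (rule bounded_ops_bound[OF VN_bounded[OF assms]])
  fix C assume C: "0 \<le> C" "\<And>\<xi>. \<xi> \<in> l2 (carrier G) \<Longrightarrow> l2_norm (T \<xi>) \<le> C * l2_norm \<xi>"
  have "l2_norm (T \<xi>) \<le> (C + 1) * l2_norm \<xi>" if "\<xi> \<in> l2 (carrier G)" for \<xi>
    using C(2)[OF that] l2_norm_nonneg[of \<xi>] by (simp only: distrib_right mult_1)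
  then show ?thesis using that[of "C + 1"] C(1) by simp
qed

lemma vfun_add_left:
  "\<lbrakk>\<xi> \<in> l2 (carrier G); \<xi>' \<in> l2 (carrier G); \<eta> \<in> l2 (carrier G)\<rbrakk> \<Longrightarrow>
    vfun (\<lambda>x. \<xi> x + \<xi>' x) \<eta> = (\<lambda>s. vfun \<xi> \<eta> s + vfun \<xi>' \<eta> s)"
  by (auto simp: vfun_eq l2_add fun_eq_iff bounded_ops_add[OF lr_bounded] l2_inner_add_left[OF lr_in(1) lr_in(1)])

lemma vfun_add_right:
  "\<lbrakk>\<xi> \<in> l2 (carrier G); \<xi>' \<in> l2 (carrier G); \<eta> \<in> l2 (carrier G)\<rbrakk> \<Longrightarrow>
    vfun \<eta> (\<lambda>x. \<xi> x + \<xi>' x) = (\<lambda>s. vfun \<eta> \<xi> s + vfun \<eta> \<xi>' s)"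
  by (auto simp: vfun_eq l2_add fun_eq_iff l2_inner_add_right[OF _ _ lr_in(1)])

lemma vfun_scale_left:
  "\<lbrakk>\<xi> \<in> l2 (carrier G); \<eta> \<in> l2 (carrier G)\<rbrakk> \<Longrightarrow> vfun (\<lambda>x. c * \<xi> x) \<eta> = (\<lambda>s. c * vfun \<xi> \<eta> s)"
  by (auto simp: vfun_eq l2_scale fun_eq_iff bounded_ops_scale[OF lr_bounded] l2_inner_scale_left)

lemma vfun_scale_right:
  "\<lbrakk>\<xi> \<in> l2 (carrier G); \<eta> \<in> l2 (carrier G)\<rbrakk> \<Longrightarrow> vfun \<eta> (\<lambda>x. c * \<xi> x) = (\<lambda>s. cnj c * vfun \<eta> \<xi> s)"
  by (auto simp: vfun_eq l2_scale fun_eq_iff l2_inner_scale_right)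

lemma vfun_VN':
  assumes "R \<in> VN'" "\<xi> \<in> l2 (carrier G)" "\<eta> \<in> l2 (carrier G)"
  shows "vfun (R \<xi>) \<eta> = vfun \<xi> (op_adjoint (carrier G) R \<eta>)"
  using assms bounded_ops_l2[OF VN'_bounded[OF assms(1)]]
    bounded_ops_l2[OF op_adjoint_in[OF VN'_bounded[OF assms(1)]]]
  by (auto simp: vfun_eq fun_eq_iff VN_inner[OF lr_VN])

lemma coef_add_left:
  assumes "\<Phi> \<in> l2 (UNIV \<times> carrier G)" "\<Phi>' \<in> l2 (UNIV \<times> carrier G)" "\<Psi> \<in> l2 (UNIV \<times> carrier G)"
  shows "coef G (\<lambda>p. \<Phi> p + \<Phi>' p) \<Psi> = (\<lambda>s. coef G \<Phi> \<Psi> s + coef G \<Phi>' \<Psi> s)"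
  using assms by (auto simp: coef_def fun_eq_iff amp_add[OF lr_bounded] l2_inner_add_left[OF amp_in[OF lr_bounded] amp_in[OF lr_bounded]])

lemma coef_delta:
  fixes k :: 'k and \<Psi> :: "'k \<times> 'a \<Rightarrow> complex"
  assumes "\<Psi> \<in> l2 (UNIV \<times> carrier G)" "x \<in> carrier G"
  shows "coef G (l2_delta (k, x)) \<Psi> = vfun (l2_delta x) (slice \<Psi> k)"
proof
  fix s
  show "coef G (l2_delta (k, x)) \<Psi> s = vfun (l2_delta x) (slice \<Psi> k) s"
  proof (cases "s \<in> carrier G")
    case True
    have "amp (lr s) (l2_delta (k, x)) = l2_delta (k, s \<otimes> x)"
    proof
      fix p :: "'k \<times> 'a"
      obtain l y where p: "p = (l, y)" by fastforce
      have d: "l2_delta (k, x) \<in> l2 (UNIV \<times> carrier G)" using assms(2) by simp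
      show "amp (lr s) (l2_delta (k, x)) p = l2_delta (k, s \<otimes> x) p"
        unfolding p amp_lr_eq[OF d] using True assms(2) by (auto simp: l2_delta_def inv_solve_left')
    qed
    then show ?thesis
      using True assms slice_in[OF assms(1), of k] by (simp add: coef_def vfun_eq lr_delta) (simp add: slice_def)
  qed (use assms slice_in[OF assms(1), of k] in \<open>simp add: coef_def vfun_eq\<close>)
qed

text \<open>The adjoint on VN(G) of multiplication by \<open>f\<close>. The sesquilinear form F(vfun
  \<xi> \<eta>) defines \<open>S\<close>, and moving an operator of the commutant from \<xi> to
  \<eta> does not change \<open>vfun\<close>, which puts \<open>S\<close> into VN(G). What remains
  is to pass from single pairs of vectors to all of A(G).\<close>

lemma multiplier_adjoint:
  assumes fA: "\<And>v. v \<in> Fourier G \<Longrightarrow> (\<lambda>x. f x * v x) \<in> Fourier G"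
    and H: "\<And>\<Phi> \<Psi> :: nat \<times> 'a \<Rightarrow> complex. \<Phi> \<in> l2 (UNIV \<times> carrier G) \<Longrightarrow> \<Psi> \<in> l2 (UNIV \<times> carrier G) \<Longrightarrow>
      vA (\<lambda>x. f x * coef G \<Phi> \<Psi> x) \<le> K * l2_norm \<Phi> * l2_norm \<Psi>"
    and K: "0 \<le> K" and T: "T \<in> VNs"
  obtains S where "S \<in> VNs" "\<And>v. v \<in> Fourier G \<Longrightarrow> duality G S v = duality G T (\<lambda>x. f x * v x)"
proof -
  obtain c where c: "0 < c" "\<And>\<xi>. \<xi> \<in> l2 (carrier G) \<Longrightarrow> l2_norm (T \<xi>) \<le> c * l2_norm \<xi>"
    by (rule VN_pos_bound[OF T]) (rule that)
  define F where "F = (\<lambda>v. duality G T (\<lambda>x. f x * v x))"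
  have Fadd: "F (\<lambda>x. u x + v x) = F u + F v" if "u \<in> Fourier G" "v \<in> Fourier G" for u v
    using Fourier_add(2)[OF fA[OF that(1)] fA[OF that(2)] T] by (simp add: F_def distrib_left)
  have Fscale: "F (\<lambda>x. a * u x) = a * F u" if "u \<in> Fourier G" for a u
    using Fourier_scale(2)[OF fA[OF that] T, of a] by (simp add: F_def mult.left_commute)
  have Fbound: "cmod (F (coef G \<Phi> \<Psi>)) \<le> c * K * l2_norm \<Phi> * l2_norm \<Psi>"
    if "\<Phi> \<in> l2 (UNIV \<times> carrier G)" "\<Psi> \<in> l2 (UNIV \<times> carrier G)" for \<Phi> \<Psi> :: "nat \<times> 'a \<Rightarrow> complex"
  proof -
    have "cmod (F (coef G \<Phi> \<Psi>)) \<le> c * vA (\<lambda>x. f x * coef G \<Phi> \<Psi> x)"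
      unfolding F_def by (intro duality_le T c fA coef_in that)
    also have "\<dots> \<le> c * (K * l2_norm \<Phi> * l2_norm \<Psi>)"
      using c(1) by (intro mult_left_mono H that) simp
    finally show ?thesis by (simp add: mult.assoc)
  qed
  have cK: "0 \<le> c * K" using c(1) K by simp
  have Bb: "cmod (F (vfun \<xi> \<eta>)) \<le> c * K * l2_norm \<xi> * l2_norm \<eta>"
    if "\<xi> \<in> l2 (carrier G)" "\<eta> \<in> l2 (carrier G)" for \<xi> \<eta>
    using Fbound[OF fibre_in[OF that(1)] fibre_in[OF that(2)]]
    by (simp add: vfun_def fibre_norm[OF that(1)] fibre_norm[OF that(2)])
  have "\<exists>S. S \<in> bounded_ops (carrier G) \<and> (\<forall>\<xi>\<in>l2 (carrier G). \<forall>\<eta>\<in>l2 (carrier G). l2_inner (S \<xi>) \<eta> = F (vfun \<xi> \<eta>))"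
    by (rule form_operator[of "carrier G" "\<lambda>\<xi> \<eta>. F (vfun \<xi> \<eta>)" "c * K"])
      (auto simp: vfun_add_left vfun_add_right vfun_scale_left vfun_scale_right Fadd Fscale vfun_in Bb cK)
  then obtain S where S: "S \<in> bounded_ops (carrier G)"
    "\<And>\<xi> \<eta>. \<xi> \<in> l2 (carrier G) \<Longrightarrow> \<eta> \<in> l2 (carrier G) \<Longrightarrow> l2_inner (S \<xi>) \<eta> = F (vfun \<xi> \<eta>)"
    by (elim exE conjE) (rule that, assumption, drule (1) bspec, drule (1) bspec)
  have SV: "S \<in> VNs"
  proof (rule VN_innerI[OF S(1)])
    fix R \<xi> \<eta> assume *: "R \<in> VN'" "\<xi> \<in> l2 (carrier G)" "\<eta> \<in> l2 (carrier G)"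
    show "l2_inner (S (R \<xi>)) \<eta> = l2_inner (S \<xi>) (op_adjoint (carrier G) R \<eta>)"
      using bounded_ops_l2[OF VN'_bounded[OF *(1)]] bounded_ops_l2[OF op_adjoint_in[OF VN'_bounded[OF *(1)]]]
      by (simp add: S(2) * vfun_VN'[OF *])
  qed
  obtain d where d: "0 < d" "\<And>\<xi>. \<xi> \<in> l2 (carrier G) \<Longrightarrow> l2_norm (S \<xi>) \<le> d * l2_norm \<xi>"
    by (rule VN_pos_bound[OF SV]) (rule that)
  show ?thesis
  proof (rule that[OF SV])
    fix v assume "v \<in> Fourier G"
    then obtain \<Phi> \<Psi> :: "nat \<times> 'a \<Rightarrow> complex" where v:
      "\<Phi> \<in> l2 (UNIV \<times> carrier G)" "\<Psi> \<in> l2 (UNIV \<times> carrier G)" "v = coef G \<Phi> \<Psi>"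
      by (rule Fourier_rep)
    \<comment> \<open>This defect is linear and bounded in the left vector. At a point mass only one
      fibre of \<Psi> enters, and there \<open>S\<close> agrees with \<open>F\<close> by
      construction.\<close>
    let ?E = "\<lambda>\<Phi>. duality G S (coef G \<Phi> \<Psi>) - F (coef G \<Phi> \<Psi>)"
    have "?E \<Phi> = 0"
    proof (rule l2_functional_eq[of "UNIV \<times> carrier G" ?E "d * l2_norm \<Psi> + c * K * l2_norm \<Psi>"])
      fix \<xi> \<eta> :: "nat \<times> 'a \<Rightarrow> complex" assume *: "\<xi> \<in> l2 (UNIV \<times> carrier G)" "\<eta> \<in> l2 (UNIV \<times> carrier G)"
      show "?E (\<lambda>x. \<xi> x + \<eta> x) = ?E \<xi> + ?E \<eta>"
        by (simp add: coef_add_left * v Fadd Fourier_add(2) coef_in SV)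
    next
      fix a and \<xi> :: "nat \<times> 'a \<Rightarrow> complex" assume *: "\<xi> \<in> l2 (UNIV \<times> carrier G)"
      show "?E (\<lambda>x. a * \<xi> x) = a * ?E \<xi>"
        by (simp add: coef_scale[symmetric] * v Fscale Fourier_scale(2) coef_in SV right_diff_distrib)
    next
      fix \<xi> :: "nat \<times> 'a \<Rightarrow> complex" assume *: "\<xi> \<in> l2 (UNIV \<times> carrier G)"
      have "cmod (?E \<xi>) \<le> cmod (duality G S (coef G \<xi> \<Psi>)) + cmod (F (coef G \<xi> \<Psi>))"
        by (rule norm_triangle_ineq4)
      also have "cmod (duality G S (coef G \<xi> \<Psi>)) \<le> d * vA (coef G \<xi> \<Psi>)"
        by (intro duality_le SV d coef_in * v)
      also have "\<dots> \<le> d * (l2_norm \<xi> * l2_norm \<Psi>)"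
        using d(1) by (intro mult_left_mono vA_coef_le * v) simp
      finally show "cmod (?E \<xi>) \<le> (d * l2_norm \<Psi> + c * K * l2_norm \<Psi>) * l2_norm \<xi>"
        using Fbound[OF * v(2)] by (simp add: algebra_simps)
    next
      fix p :: "nat \<times> 'a" assume "p \<in> UNIV \<times> carrier G"
      then obtain k x where p: "p = (k, x)" "x \<in> carrier G" by auto
      have "duality G S (vfun (l2_delta x) (slice \<Psi> k)) = F (vfun (l2_delta x) (slice \<Psi> k))"
        using duality_vfun[OF SV, of "l2_delta x" "slice \<Psi> k"] slice_in[OF v(2), of k] p(2) by (simp add: S(2))
      then show "?E (l2_delta p) = 0" using coef_delta[OF v(2) p(2), of k] by (simp add: p(1))
    qed (rule v(1))
    then show "duality G S v = duality G T (\<lambda>x. f x * v x)" by (simp add: v(3) F_def)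
  qed
qed

text \<open>By Fell absorption the form of the adjoint multiplier of \<open>w k l\<close> at (\<xi>,
  \<eta>) is that of the amplified \<open>w k l\<close> at the \<open>fell\<close> products with
  \<Xi> and \<Theta>. These products multiply norms, so \<open>amp_form\<close> bounds the whole
  matrix of adjoints by \<open>c\<close>, and pairing with it gives the estimate on A(G).\<close>

lemma Fourier_multiplier_bound:
  fixes \<Xi> \<Theta> :: "'k \<times> 'a \<Rightarrow> complex"
  assumes \<Xi>: "\<Xi> \<in> l2 (UNIV \<times> carrier G)" and \<Theta>: "\<Theta> \<in> l2 (UNIV \<times> carrier G)"
    and c: "0 < c" "l2_norm \<Xi> * l2_norm \<Theta> \<le> c"
    and v: "\<And>i j. i < n \<Longrightarrow> j < n \<Longrightarrow> v i j \<in> Fourier G"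
  shows "nA n (\<lambda>i j x. coef G \<Xi> \<Theta> x * v i j x) \<le> c * nA n v"
proof (rule nA_least)
  fix m w assume m: "0 < (m::nat)" and w: "w \<in> mats (VN G) m" "opn m w \<le> 1"
  let ?u = "coef G \<Xi> \<Theta>"
  have u: "?u \<in> Fourier G" by (rule coef_in[OF \<Xi> \<Theta>])
  have ex: "\<exists>S. k < m \<longrightarrow> l < m \<longrightarrow> S \<in> VNs \<and> (\<forall>v\<in>Fourier G. duality G S v = duality G (w k l) (\<lambda>x. ?u x * v x))" for k l
  proof (cases "k < m \<and> l < m")
    case True
    then have wV: "w k l \<in> VNs" using mats_VN[OF w(1)] by blast
    show ?thesis
    proof (rule multiplier_adjoint[OF _ _ _ wV, of ?u "l2_norm \<Xi> * l2_norm \<Theta>"])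
      fix \<Phi> \<Psi> :: "nat \<times> 'a \<Rightarrow> complex"
      assume *: "\<Phi> \<in> l2 (UNIV \<times> carrier G)" "\<Psi> \<in> l2 (UNIV \<times> carrier G)"
      show "vA (\<lambda>x. ?u x * coef G \<Phi> \<Psi> x) \<le> l2_norm \<Xi> * l2_norm \<Theta> * l2_norm \<Phi> * l2_norm \<Psi>"
        unfolding coef_mult[OF \<Xi> \<Theta> *]
        using vA_coef_le[OF fell_in(1)[OF \<Xi> *(1)] fell_in(1)[OF \<Theta> *(2)]]
        by (simp add: fell_in[OF \<Xi> *(1)] fell_in[OF \<Theta> *(2)] mult_ac)
    next
      fix S assume "S \<in> VNs" "\<And>v. v \<in> Fourier G \<Longrightarrow> duality G S v = duality G (w k l) (\<lambda>x. ?u x * v x)"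
      then show ?thesis by blast
    qed (auto intro: Fourier_mult[OF u])
  qed auto
  then have "\<forall>k l. \<exists>S. k < m \<longrightarrow> l < m \<longrightarrow> S \<in> VNs \<and> (\<forall>v\<in>Fourier G. duality G S v = duality G (w k l) (\<lambda>x. ?u x * v x))"
    by (intro allI)
  then obtain S where S': "\<forall>k l. k < m \<longrightarrow> l < m \<longrightarrow> S k l \<in> VNs \<and>
      (\<forall>v\<in>Fourier G. duality G (S k l) v = duality G (w k l) (\<lambda>x. ?u x * v x))"
    unfolding choice_iff by (rule exE)
  have S: "S k l \<in> VNs" "\<And>v. v \<in> Fourier G \<Longrightarrow> duality G (S k l) v = duality G (w k l) (\<lambda>x. ?u x * v x)"
    if "k < m" "l < m" for k l
    using S'[THEN spec, THEN spec, THEN mp, THEN mp, OF that] by simp_all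
  have wb: "w k l \<in> bounded_ops (carrier G)" if "k < m" "l < m" for k l
    using VN_bounded[OF mats_VN[OF w(1) that]] .
  have "opn m S \<le> c"
  proof (rule op_mnorm_leI)
    fix \<xi> \<eta> :: "nat \<Rightarrow> 'a \<Rightarrow> complex"
    assume *: "\<And>j. j < m \<Longrightarrow> \<xi> j \<in> l2 (carrier G)" "\<And>j. j < m \<Longrightarrow> \<eta> j \<in> l2 (carrier G)"
    let ?P = "\<lambda>j. fell G \<Xi> (fibre (\<xi> j))" and ?Q = "\<lambda>i. fell G \<Theta> (fibre (\<eta> i))"
    have "l2_inner (S i j (\<xi> j)) (\<eta> i) = l2_inner (amp (w i j) (?P j)) (?Q i)" if ij: "i < m" "j < m" for i j
    proof -
      have "l2_inner (S i j (\<xi> j)) (\<eta> i) = duality G (w i j) (\<lambda>x. ?u x * vfun (\<xi> j) (\<eta> i) x)"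
        using duality_vfun[OF S(1)[OF ij] *(1)[OF ij(2)] *(2)[OF ij(1)]] S(2)[OF ij vfun_in[OF *(1)[OF ij(2)] *(2)[OF ij(1)]]]
        by simp
      also have "\<dots> = l2_inner (amp (w i j) (?P j)) (?Q i)"
        unfolding vfun_def coef_mult[OF \<Xi> \<Theta> fibre_in[OF *(1)[OF ij(2)]] fibre_in[OF *(2)[OF ij(1)]]]
        by (intro duality_coef fell_in \<Xi> \<Theta> fibre_in * ij mats_VN[OF w(1)])
      finally show ?thesis .
    qed
    then have "cmod (\<Sum>i<m. \<Sum>j<m. l2_inner (S i j (\<xi> j)) (\<eta> i)) = cmod (\<Sum>i<m. \<Sum>j<m. l2_inner (amp (w i j) (?P j)) (?Q i))"
      by simp
    also have "\<dots> \<le> opn m w * tuple_norm m ?P * tuple_norm m ?Q"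
      by (rule amp_form) (auto intro: wb fell_in \<Xi> \<Theta> fibre_in *)
    also have "tuple_norm m ?P = l2_norm \<Xi> * tuple_norm m \<xi>"
      unfolding L2_set_right_distrib[OF l2_norm_nonneg]
      by (intro L2_set_cong refl) (use * in \<open>simp add: fell_in(2)[OF \<Xi> fibre_in[OF *(1)]] fibre_norm[OF *(1)]\<close>)
    also have "tuple_norm m ?Q = l2_norm \<Theta> * tuple_norm m \<eta>"
      unfolding L2_set_right_distrib[OF l2_norm_nonneg]
      by (intro L2_set_cong refl) (use * in \<open>simp add: fell_in(2)[OF \<Theta> fibre_in[OF *(2)]] fibre_norm[OF *(2)]\<close>)
    also have "opn m w * (l2_norm \<Xi> * tuple_norm m \<xi>) * (l2_norm \<Theta> * tuple_norm m \<eta>)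
        \<le> 1 * (l2_norm \<Xi> * tuple_norm m \<xi>) * (l2_norm \<Theta> * tuple_norm m \<eta>)"
      by (intro mult_right_mono w(2)) auto
    also have "\<dots> = (l2_norm \<Xi> * l2_norm \<Theta>) * (tuple_norm m \<xi> * tuple_norm m \<eta>)" by simp
    also have "\<dots> \<le> c * (tuple_norm m \<xi> * tuple_norm m \<eta>)" by (intro mult_right_mono c(2)) auto
    finally show "cmod (\<Sum>i<m. \<Sum>j<m. l2_inner (S i j (\<xi> j)) (\<eta> i)) \<le> c * tuple_norm m \<xi> * tuple_norm m \<eta>"
      by (simp add: mult.assoc)
  qed (use S(1) c(1) VN_bounded in auto)
  moreover have "S \<in> mats (VN G) m" using S(1) by (simp add: mats_def)
  ultimately have "scalar_norm (n * m) (n * m) (\<lambda>p q. duality G (S (p mod m) (q mod m)) (v (p div m) (q div m))) \<le> c * nA n v"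
    using v m c(1) by (intro nA_apply) auto
  moreover have "scalar_norm (n * m) (n * m) (\<lambda>p q. duality G (w (p mod m) (q mod m)) (\<lambda>x. ?u x * v (p div m) (q div m) x))
    = scalar_norm (n * m) (n * m) (\<lambda>p q. duality G (S (p mod m) (q mod m)) (v (p div m) (q div m)))"
    by (rule scalar_norm_cong) (use m in \<open>simp add: S(2) v less_mult_imp_div_less\<close>)
  ultimately show "scalar_norm (n * m) (n * m) (\<lambda>p q. duality G (w (p mod m) (q mod m)) (\<lambda>x. ?u x * v (p div m) (q div m) x)) \<le> c * nA n v"
    by simp
qed

end

section \<open>Completely bounded multipliers\<close>

context group
begin

lemma Fourier_simps:
  "u \<oplus>\<^bsub>Fourier_algebra G\<^esub> v = (\<lambda>x. u x + v x)" "\<zero>\<^bsub>Fourier_algebra G\<^esub> = (\<lambda>_. 0)"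
  "c \<odot>\<^bsub>Fourier_algebra G\<^esub> u = (\<lambda>x. c * u x)" "u \<otimes>\<^bsub>Fourier_algebra G\<^esub> v = (\<lambda>x. u x * v x)"
  by (simp_all add: Fourier_algebra_def)

abbreviation Mcb :: "('a \<Rightarrow> complex) set" where "Mcb \<equiv> carrier (Mcb_Fourier G)"

abbreviation nM :: "nat \<Rightarrow> (nat \<Rightarrow> nat \<Rightarrow> 'a \<Rightarrow> complex) \<Rightarrow> real" where
  "nM \<equiv> mnorm (Mcb_Fourier G)"

lemma Mcb_simps:
  "u \<oplus>\<^bsub>Mcb_Fourier G\<^esub> v = (\<lambda>x. u x + v x)" "\<zero>\<^bsub>Mcb_Fourier G\<^esub> = (\<lambda>_. 0)"
  "c \<odot>\<^bsub>Mcb_Fourier G\<^esub> u = (\<lambda>x. c * u x)" "u \<otimes>\<^bsub>Mcb_Fourier G\<^esub> v = (\<lambda>x. u x * v x)"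
  by (simp_all add: Mcb_Fourier_def Fourier_algebra_def)

lemma McbI:
  assumes "\<And>x. x \<notin> carrier G \<Longrightarrow> f x = 0" "\<And>u. u \<in> Fourier G \<Longrightarrow> (\<lambda>x. f x * u x) \<in> Fourier G"
    "\<And>n v. 0 < n \<Longrightarrow> v \<in> mats (Fourier_algebra G) n \<Longrightarrow> nA n (\<lambda>i j x. f x * v i j x) \<le> C * nA n v"
  shows "f \<in> Mcb"
  using assms
  by (auto simp: Mcb_Fourier_def completely_bounded_def linear_map_def Fourier_simps distrib_left
      mult.left_commute intro!: exI[of _ C])

lemma McbD:
  assumes "f \<in> Mcb"
  shows Mcb_outside: "\<And>x. x \<notin> carrier G \<Longrightarrow> f x = 0"
    and Mcb_mult: "\<And>u. u \<in> Fourier G \<Longrightarrow> (\<lambda>x. f x * u x) \<in> Fourier G"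
    and Mcb_bound: "\<exists>C\<ge>0. \<forall>n>0. \<forall>v\<in>mats (Fourier_algebra G) n. nA n (\<lambda>i j x. f x * v i j x) \<le> C * nA n v"
proof -
  have cb: "completely_bounded (Fourier_algebra G) (Fourier_algebra G) (\<lambda>u x. f x * u x)"
    and 1: "\<And>x. x \<notin> carrier G \<Longrightarrow> f x = 0"
    using assms by (auto simp: Mcb_Fourier_def)
  show "\<And>x. x \<notin> carrier G \<Longrightarrow> f x = 0" by (rule 1)
  show "\<And>u. u \<in> Fourier G \<Longrightarrow> (\<lambda>x. f x * u x) \<in> Fourier G"
    using cb by (simp add: completely_bounded_def linear_map_def)
  obtain C where C: "\<And>n v. 0 < n \<Longrightarrow> v \<in> mats (Fourier_algebra G) n \<Longrightarrow> nA n (\<lambda>i j x. f x * v i j x) \<le> C * nA n v"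
    using cb unfolding completely_bounded_def by blast
  have "nA n (\<lambda>i j x. f x * v i j x) \<le> \<bar>C\<bar> * nA n v" if "0 < n" "v \<in> mats (Fourier_algebra G) n" for n v
  proof -
    have "0 \<le> nA n v" by (rule nA_nonneg) (rule mats_Fourier[OF that(2)])
    then have "C * nA n v \<le> \<bar>C\<bar> * nA n v" by (intro mult_right_mono) auto
    then show ?thesis using C[OF that] by linarith
  qed
  then show "\<exists>C\<ge>0. \<forall>n>0. \<forall>v\<in>mats (Fourier_algebra G) n. nA n (\<lambda>i j x. f x * v i j x) \<le> C * nA n v"
    by (intro exI[of _ "\<bar>C\<bar>"]) auto
qed

lemma Fourier_Mcb:
  assumes "u \<in> Fourier G" shows "u \<in> Mcb"
proof -
  obtain \<Xi> \<Theta> :: "nat \<times> 'a \<Rightarrow> complex" where 1: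
    "\<Xi> \<in> l2 (UNIV \<times> carrier G)" "\<Theta> \<in> l2 (UNIV \<times> carrier G)" "u = coef G \<Xi> \<Theta>"
    using assms by (rule Fourier_rep)
  have c: "0 < l2_norm \<Xi> * l2_norm \<Theta> + 1" by (simp add: add_nonneg_pos)
  show ?thesis
  proof (rule McbI[where C = "l2_norm \<Xi> * l2_norm \<Theta> + 1"])
    fix n v assume "0 < (n::nat)" and v: "v \<in> mats (Fourier_algebra G) n"
    show "nA n (\<lambda>i j x. u x * v i j x) \<le> (l2_norm \<Xi> * l2_norm \<Theta> + 1) * nA n v"
      unfolding 1(3) by (rule Fourier_multiplier_bound[OF 1(1,2) c]) (auto intro: mats_Fourier[OF v])
  qed (auto intro: Fourier_outside[OF assms] Fourier_mult[OF assms])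
qed

lemma Mcb_add:
  assumes "f \<in> Mcb" "g \<in> Mcb" shows "(\<lambda>x. f x + g x) \<in> Mcb"
proof -
  obtain C where C: "\<And>n v. 0 < n \<Longrightarrow> v \<in> mats (Fourier_algebra G) n \<Longrightarrow> nA n (\<lambda>i j x. f x * v i j x) \<le> C * nA n v"
    using Mcb_bound[OF assms(1)] by blast
  obtain D where D: "\<And>n v. 0 < n \<Longrightarrow> v \<in> mats (Fourier_algebra G) n \<Longrightarrow> nA n (\<lambda>i j x. g x * v i j x) \<le> D * nA n v"
    using Mcb_bound[OF assms(2)] by blast
  show ?thesis
  proof (rule McbI[where C = "C + D"])
    fix u assume "u \<in> Fourier G"
    then show "(\<lambda>x. (f x + g x) * u x) \<in> Fourier G"
      using Fourier_add(1)[OF Mcb_mult[OF assms(1)] Mcb_mult[OF assms(2)]] by (simp add: distrib_right)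
  next
    fix n v assume n: "0 < (n::nat)" and v: "v \<in> mats (Fourier_algebra G) n"
    have "nA n (\<lambda>i j x. f x * v i j x + g x * v i j x) \<le> nA n (\<lambda>i j x. f x * v i j x) + nA n (\<lambda>i j x. g x * v i j x)"
      by (intro nA_triangle Mcb_mult assms mats_Fourier[OF v])
    then show "nA n (\<lambda>i j x. (f x + g x) * v i j x) \<le> (C + D) * nA n v"
      using C[OF n v] D[OF n v] by (simp add: distrib_right)
  qed (use Mcb_outside[OF assms(1)] Mcb_outside[OF assms(2)] in simp)
qed

lemma Mcb_scale:
  assumes "f \<in> Mcb" shows "(\<lambda>x. c * f x) \<in> Mcb"
proof -
  obtain C where C: "\<And>n v. 0 < n \<Longrightarrow> v \<in> mats (Fourier_algebra G) n \<Longrightarrow> nA n (\<lambda>i j x. f x * v i j x) \<le> C * nA n v"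
    using Mcb_bound[OF assms(1)] by blast
  show ?thesis
  proof (rule McbI[where C = "cmod c * C"])
    fix u assume "u \<in> Fourier G"
    then show "(\<lambda>x. (c * f x) * u x) \<in> Fourier G"
      using Fourier_scale(1)[OF Mcb_mult[OF assms(1)], of u c] by (simp add: mult.assoc)
  next
    fix n v assume n: "0 < (n::nat)" and v: "v \<in> mats (Fourier_algebra G) n"
    have "nA n (\<lambda>i j x. c * (f x * v i j x)) \<le> cmod c * nA n (\<lambda>i j x. f x * v i j x)"
      by (intro nA_scale_le Mcb_mult assms mats_Fourier[OF v])
    also have "\<dots> \<le> cmod c * (C * nA n v)" by (intro mult_left_mono C n v norm_ge_zero)
    finally show "nA n (\<lambda>i j x. (c * f x) * v i j x) \<le> (cmod c * C) * nA n v"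
      by (simp add: mult.assoc)
  qed (use Mcb_outside[OF assms(1)] in simp)
qed

lemma Mcb_diff: "f \<in> Mcb \<Longrightarrow> g \<in> Mcb \<Longrightarrow> (\<lambda>x. f x - g x) \<in> Mcb"
  using Mcb_add[of f "\<lambda>x. -1 * g x"] Mcb_scale[of g "-1"] by simp

lemma Mcb_minus: "g \<in> Mcb \<Longrightarrow> f \<ominus>\<^bsub>Mcb_Fourier G\<^esub> g = (\<lambda>x. f x - g x)"
  using Mcb_scale[of g "-1"] by (intro minus_pointwise) (simp_all add: Mcb_simps)

lemma nM_eq:
  "nM n f = Sup {nA (n * m) (\<lambda>p q x. f (p div m) (q div m) x * v (p mod m) (q mod m) x) | m v.
     0 < m \<and> v \<in> mats (Fourier_algebra G) m \<and> nA m v \<le> 1}"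
  by (simp add: Mcb_Fourier_def cb_mnorm_def)

lemma nM_bdd:
  assumes f: "\<And>i j. i < n \<Longrightarrow> j < n \<Longrightarrow> f i j \<in> Mcb"
  shows "bdd_above {nA (n * m) (\<lambda>p q x. f (p div m) (q div m) x * v (p mod m) (q mod m) x) | m v.
     0 < m \<and> v \<in> mats (Fourier_algebra G) m \<and> nA m v \<le> 1}"
proof -
  define Q where "Q = (\<lambda>i j C. 0 \<le> C \<and> (\<forall>m>0. \<forall>v\<in>mats (Fourier_algebra G) m.
    nA m (\<lambda>k l x. f i j x * v k l x) \<le> C * nA m v))"
  have "\<exists>C. Q i j C" if "i < n" "j < n" for i j
    using Mcb_bound[OF f[OF that]] by (simp add: Q_def)
  then obtain C where "\<And>i j. i < n \<Longrightarrow> j < n \<Longrightarrow> Q i j (C i j)" by metis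
  then have C: "\<And>i j. i < n \<Longrightarrow> j < n \<Longrightarrow> 0 \<le> C i j"
    "\<And>i j m v. i < n \<Longrightarrow> j < n \<Longrightarrow> 0 < m \<Longrightarrow> v \<in> mats (Fourier_algebra G) m \<Longrightarrow>
      nA m (\<lambda>k l x. f i j x * v k l x) \<le> C i j * nA m v"
    by (simp_all add: Q_def)
  show ?thesis
  proof (rule bdd_aboveI[of _ "\<Sum>i<n. \<Sum>j<n. C i j"], clarify)
    fix m v assume m: "0 < (m::nat)" and v: "v \<in> mats (Fourier_algebra G) m" "nA m v \<le> 1"
    let ?u = "\<lambda>p q x. f (p div m) (q div m) x * v (p mod m) (q mod m) x"
    show "nA (n * m) ?u \<le> (\<Sum>i<n. \<Sum>j<n. C i j)"
    proof (rule nA_least)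
      fix M w assume M: "0 < (M::nat)" and w: "w \<in> mats (VN G) M" "opn M w \<le> 1"
      let ?D = "\<lambda>p q. duality G (w (p mod M) (q mod M)) (?u (p div M) (q div M))"
      have "scalar_norm (n * (m * M)) (n * (m * M)) ?D
          \<le> (\<Sum>i<n. \<Sum>j<n. scalar_norm (m * M) (m * M) (\<lambda>k l. ?D (i * (m * M) + k) (j * (m * M) + l)))"
        by (rule scalar_norm_blocks)
      also have "\<dots> \<le> (\<Sum>i<n. \<Sum>j<n. C i j)"
      proof (intro sum_mono)
        fix i j assume ij: "i \<in> {..<n}" "j \<in> {..<n}"
        \<comment> \<open>An index is a triple of digits with bases \<open>n\<close>,
          \<open>m\<close> and \<open>M\<close>. Splitting off the first digit or the last one first
          must give the same triple.\<close>
        have idx: "(i * (m * M) + k) mod M = k mod M" "(i * (m * M) + k) div M div m = i"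
          "(i * (m * M) + k) div M mod m = k div M" if "k < m * M" for i k
        proof -
          have "(i * (m * M) + k) div M = i * m + k div M"
            using M by (metis add.commute div_mult_self1 less_numeral_extra(3) mult.assoc)
          moreover have "k div M < m" using that by (simp add: less_mult_imp_div_less)
          ultimately show "(i * (m * M) + k) div M div m = i" "(i * (m * M) + k) div M mod m = k div M"
            by simp_all
          show "(i * (m * M) + k) mod M = k mod M" by (simp add: mult.assoc[symmetric])
        qed
        have "scalar_norm (m * M) (m * M) (\<lambda>k l. ?D (i * (m * M) + k) (j * (m * M) + l))
          = scalar_norm (m * M) (m * M) (\<lambda>k l. duality G (w (k mod M) (l mod M)) (\<lambda>x. f i j x * v (k div M) (l div M) x))"
          by (intro scalar_norm_cong) (simp only: idx)
        also have "\<dots> \<le> nA m (\<lambda>k l x. f i j x * v k l x)"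
          by (rule nA_upper[OF _ M w]) (use ij in \<open>auto intro!: Mcb_mult f mats_Fourier[OF v(1)]\<close>)
        also have "\<dots> \<le> C i j * nA m v" using ij m v(1) by (intro C) auto
        also have "\<dots> \<le> C i j * 1" using ij by (intro mult_left_mono v(2) C) auto
        finally show "scalar_norm (m * M) (m * M) (\<lambda>k l. ?D (i * (m * M) + k) (j * (m * M) + l)) \<le> C i j" by simp
      qed
      finally show "scalar_norm (n * m * M) (n * m * M) ?D \<le> (\<Sum>i<n. \<Sum>j<n. C i j)"
        by (simp add: mult.assoc)
    qed
  qed
qed

lemma nM_upper:
  assumes f: "\<And>i j. i < n \<Longrightarrow> j < n \<Longrightarrow> f i j \<in> Mcb"
    and m: "0 < m" "v \<in> mats (Fourier_algebra G) m" "nA m v \<le> 1"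
  shows "nA (n * m) (\<lambda>p q x. f (p div m) (q div m) x * v (p mod m) (q mod m) x) \<le> nM n f"
  unfolding nM_eq by (rule cSup_upper[OF _ nM_bdd[OF f]]) (use m in auto)

abbreviation vM :: "('a \<Rightarrow> complex) \<Rightarrow> real" where "vM f \<equiv> nM 1 (\<lambda>_ _. f)"

lemma vM_apply:
  assumes "f \<in> Mcb" "v \<in> Fourier G" "vA v \<le> 1"
  shows "vA (\<lambda>x. f x * v x) \<le> vM f"
  using nM_upper[of 1 "\<lambda>_ _. f" 1 "\<lambda>_ _. v"] assms by (simp add: mats_def)

text \<open>The point mass in the guise of a coefficient function, from which its membership in
  A(G), its norm and its pairing are read off.\<close>

definition dl :: "'a \<Rightarrow> 'a \<Rightarrow> complex" where "dl s = vfun (l2_delta \<one>) (l2_delta s)"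

lemma dl_eq: "s \<in> carrier G \<Longrightarrow> dl s = l2_delta s"
  unfolding dl_def by (auto simp: vfun_eq fun_eq_iff lr_delta) (auto simp: l2_delta_def)

lemma delta_Fourier: "s \<in> carrier G \<Longrightarrow> l2_delta s \<in> Fourier G"
  using vfun_in[of "l2_delta \<one>" "l2_delta s"] dl_eq[of s] by (simp add: dl_def)

lemma vA_delta: "s \<in> carrier G \<Longrightarrow> vA (l2_delta s) \<le> 1"
  using vA_vfun_le[of "l2_delta \<one>" "l2_delta s"] dl_eq[of s] by (simp add: dl_def)

lemma duality_delta: "T \<in> VNs \<Longrightarrow> s \<in> carrier G \<Longrightarrow> duality G T (l2_delta s) = T (l2_delta \<one>) s"
  using duality_vfun[of T "l2_delta \<one>" "l2_delta s"] dl_eq[of s] by (simp add: dl_def)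

lemma opn_lr: "s \<in> carrier G \<Longrightarrow> opn 1 (\<lambda>_ _. lr s) \<le> 1"
  by (rule op_mnorm_1_leI[OF lr_bounded]) (simp_all add: lr_in)

text \<open>Evaluation at s is multiplication with the point mass at s, of norm at most 1 in A(G),
  followed by the pairing with the unitary \<lambda>(s). Both are completely contractive.\<close>

lemma nM_eval:
  assumes f: "\<And>i j. i < n \<Longrightarrow> j < n \<Longrightarrow> f i j \<in> Mcb" and s: "s \<in> carrier G"
  shows "scalar_norm n n (\<lambda>i j. f i j s) \<le> nM n f"
proof -
  have fd: "(\<lambda>x. f i j x * l2_delta s x) \<in> Fourier G" if "i < n" "j < n" for i j
    by (rule Mcb_mult[OF f[OF that] delta_Fourier[OF s]])
  have "scalar_norm n n (\<lambda>i j. f i j s) = scalar_norm n n (\<lambda>i j. duality G (lr s) (\<lambda>x. f i j x * l2_delta s x))"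
    by (rule scalar_norm_cong) (simp add: duality_lr[OF s fd], simp add: l2_delta_def)
  also have "\<dots> \<le> nA n (\<lambda>i j x. f i j x * l2_delta s x)"
    using nA_upper[of n "\<lambda>i j x. f i j x * l2_delta s x" 1 "\<lambda>_ _. lr s"] fd opn_lr[OF s] lr_VN[OF s]
    by (simp add: mats_def)
  also have "\<dots> \<le> nM n f"
    using nM_upper[of n f 1 "\<lambda>_ _. l2_delta s"] f vA_delta[OF s] delta_Fourier[OF s]
    by (simp add: mats_def)
  finally show ?thesis .
qed

section \<open>The algebra \<open>Acb G\<close> and approximation by finitely supported
  functions\<close>

abbreviation Acbs :: "('a \<Rightarrow> complex) set" where "Acbs \<equiv> carrier (Acb G)"

lemma mnorm_Acb: "mnorm (Acb G) = nM"
  by (simp add: Acb_def)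

lemma Acb_simps:
  "u \<oplus>\<^bsub>Acb G\<^esub> v = (\<lambda>x. u x + v x)" "c \<odot>\<^bsub>Acb G\<^esub> u = (\<lambda>x. c * u x)" "u \<otimes>\<^bsub>Acb G\<^esub> v = (\<lambda>x. u x * v x)"
  by (simp_all add: Acb_def Mcb_Fourier_def Fourier_algebra_def)

lemma Acb_iff:
  "f \<in> Acbs \<longleftrightarrow> f \<in> Mcb \<and> (\<forall>e>0. \<exists>u\<in>Fourier G. vM (\<lambda>x. f x - u x) < e)"
  by (auto simp: Acb_def norm_closure_def vnorm_def Mcb_minus[OF Fourier_Mcb])

lemma Acb_Mcb: "f \<in> Acbs \<Longrightarrow> f \<in> Mcb"
  by (simp add: Acb_iff)

lemma nM_zero_le: "vM (\<lambda>_. 0) \<le> 0"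
  unfolding nM_eq
proof (rule cSup_least)
  have z: "(\<lambda>_. 0) \<in> Fourier G" using Fourier_scale(1)[OF delta_Fourier[OF one_closed], of 0] by simp
  have "vA (\<lambda>_. 0) \<le> cmod 0 * vA (l2_delta \<one>)"
    using nA_scale_le[of 1 "\<lambda>_ _. l2_delta \<one>" 0] delta_Fourier[OF one_closed] by simp
  then have z1: "vA (\<lambda>_. 0) \<le> 1" by simp
  have "nA (1 * 1) (\<lambda>p q x. 0 * (\<lambda>_ _ _. 0) (p mod 1) (q mod 1) x)
    \<in> {nA (1 * m) (\<lambda>p q x. 0 * v (p mod m) (q mod m) x) | m v. 0 < m \<and> v \<in> mats (Fourier_algebra G) m \<and> nA m v \<le> 1}"
    by (intro CollectI exI[of _ 1] exI[of _ "\<lambda>_ _ _. 0"] conjI refl) (use z z1 in \<open>auto simp: mats_def\<close>)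
  then show "{nA (1 * m) (\<lambda>p q x. 0 * v (p mod m) (q mod m) x) | m v. 0 < m \<and> v \<in> mats (Fourier_algebra G) m \<and> nA m v \<le> 1} \<noteq> {}"
    by auto
  fix r assume "r \<in> {nA (1 * m) (\<lambda>p q x. 0 * v (p mod m) (q mod m) x) | m v. 0 < m \<and> v \<in> mats (Fourier_algebra G) m \<and> nA m v \<le> 1}"
  then obtain m where r: "r = nA m (\<lambda>p q x. 0)" by auto
  show "r \<le> 0" using nA_scale_le[of m "\<lambda>_ _ _. 0" 0] z by (simp add: r)
qed

lemma Fourier_Acb:
  assumes "u \<in> Fourier G" shows "u \<in> Acbs"
  unfolding Acb_iff
proof (intro conjI allI impI)
  fix e :: real assume "0 < e"
  then show "\<exists>v\<in>Fourier G. vM (\<lambda>x. u x - v x) < e"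
    using assms nM_zero_le by (intro bexI[of _ u]) auto
qed (rule Fourier_Mcb[OF assms])

text \<open>A nonzero value at s requires a translation by s that takes a point of \<open>Y\<close>
  to a point of \<open>Y\<close> with the same index, so s is a quotient of two of finitely many
  group elements.\<close>

lemma coef_finite_support:
  assumes "finite Y" "\<Xi> \<in> l2 (UNIV \<times> carrier G)" "\<Theta> \<in> l2 (UNIV \<times> carrier G)" "Y \<subseteq> UNIV \<times> carrier G"
  shows "finite {s. coef G (l2_trunc Y \<Xi>) (l2_trunc Y \<Theta>) s \<noteq> 0}"
proof (rule finite_subset)
  show "finite ((\<lambda>(p, q). snd q \<otimes> inv (snd p)) ` (Y \<times> Y))" using assms(1) by simp
  show "{s. coef G (l2_trunc Y \<Xi>) (l2_trunc Y \<Theta>) s \<noteq> 0} \<subseteq> (\<lambda>(p, q). snd q \<otimes> inv (snd p)) ` (Y \<times> Y)"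
  proof
    fix s assume "s \<in> {s. coef G (l2_trunc Y \<Xi>) (l2_trunc Y \<Theta>) s \<noteq> 0}"
    then have s: "s \<in> carrier G" "l2_inner (amp (lr s) (l2_trunc Y \<Xi>)) (l2_trunc Y \<Theta>) \<noteq> 0"
      by (auto simp: coef_def split: if_splits)
    have "\<exists>q. amp (lr s) (l2_trunc Y \<Xi>) q * cnj (l2_trunc Y \<Theta> q) \<noteq> 0"
    proof (rule ccontr)
      assume "\<not> ?thesis"
      then have "l2_inner (amp (lr s) (l2_trunc Y \<Xi>)) (l2_trunc Y \<Theta>) = 0"
        unfolding l2_inner_def by (intro infsum_0) blast
      then show False using s(2) by simp
    qed
    then obtain k x where q: "amp (lr s) (l2_trunc Y \<Xi>) (k, x) * cnj (l2_trunc Y \<Theta> (k, x)) \<noteq> 0" by auto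
    have q2: "(k, x) \<in> Y" using q by (auto simp: l2_trunc_def split: if_splits)
    then have x: "x \<in> carrier G" using assms(4) by auto
    have "l2_trunc Y \<Xi> (k, inv s \<otimes> x) \<noteq> 0"
      using q x by (simp add: amp_lr_eq[OF l2_trunc_in[OF assms(2)]])
    then have p: "(k, inv s \<otimes> x) \<in> Y" by (auto simp: l2_trunc_def split: if_splits)
    have "s = x \<otimes> inv (inv s \<otimes> x)"
      using s(1) x by (simp add: inv_mult_group m_assoc[symmetric])
    then show "s \<in> (\<lambda>(p, q). snd q \<otimes> inv (snd p)) ` (Y \<times> Y)"
      using p q2 by (intro image_eqI[of _ _ "((k, inv s \<otimes> x), (k, x))"]) auto
  qed
qed

lemma coef_diff:
  assumes "\<Xi> \<in> l2 (UNIV \<times> carrier G)" "\<Xi>' \<in> l2 (UNIV \<times> carrier G)"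
    "\<Theta> \<in> l2 (UNIV \<times> carrier G)" "\<Theta>' \<in> l2 (UNIV \<times> carrier G)"
  shows "coef G \<Xi> \<Theta> s - coef G \<Xi>' \<Theta>' s = coef G (\<lambda>p. \<Xi> p - \<Xi>' p) \<Theta> s + coef G \<Xi>' (\<lambda>p. \<Theta> p - \<Theta>' p) s"
proof (cases "s \<in> carrier G")
  case True
  note a = amp_in[OF lr_bounded[OF True]]
  show ?thesis
    using True by (simp add: coef_def amp_diff[OF lr_bounded[OF True] assms(1,2)]
        l2_inner_diff_left[OF a[OF assms(1)] a[OF assms(2)] assms(3)]
        l2_inner_diff_right[OF assms(3,4) a[OF assms(2)]])
qed (simp add: coef_def)

text \<open>Truncating both vectors to a finite set gives \<open>g\<close>. The difference from
  \<open>u\<close> splits into two coefficient functions with one short vector each. Closeness is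
  measured by the action on the unit ball of A(G), the form in which it also extends to
  \<open>Acb G\<close>.\<close>

lemma Fourier_approx:
  assumes u: "u \<in> Fourier G" and e: "0 < e"
  obtains g where "g \<in> Fourier G" "finite {s. g s \<noteq> 0}"
    "\<And>v. v \<in> Fourier G \<Longrightarrow> vA v \<le> 1 \<Longrightarrow> vA (\<lambda>x. (u x - g x) * v x) \<le> e"
proof -
  obtain \<Xi> \<Theta> :: "nat \<times> 'a \<Rightarrow> complex" where 1:
    "\<Xi> \<in> l2 (UNIV \<times> carrier G)" "\<Theta> \<in> l2 (UNIV \<times> carrier G)" "u = coef G \<Xi> \<Theta>"
    using u by (rule Fourier_rep)
  define K where "K = l2_norm \<Xi> + l2_norm \<Theta> + 1"
  have K: "0 < K" by (simp add: K_def add_nonneg_pos)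
  \<comment> \<open>\<open>K\<close> exceeds the norms of both vectors, so an error \<open>d\<close>
    in one of them costs at most d K = e / 2.\<close>
  define d where "d = e / (2 * K)"
  have d: "0 < d" using e K by (simp add: d_def)
  obtain Y1 where Y1: "finite Y1" "Y1 \<subseteq> UNIV \<times> carrier G" "l2_norm (\<lambda>p. \<Xi> p - l2_trunc Y1 \<Xi> p) < d"
    using l2_trunc_approx[OF 1(1) d] by blast
  obtain Y2 where Y2: "finite Y2" "Y2 \<subseteq> UNIV \<times> carrier G" "l2_norm (\<lambda>p. \<Theta> p - l2_trunc Y2 \<Theta> p) < d"
    using l2_trunc_approx[OF 1(2) d] by blast
  define Y where "Y = Y1 \<union> Y2"
  have Y: "finite Y" "Y \<subseteq> UNIV \<times> carrier G" using Y1 Y2 by (auto simp: Y_def)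
  let ?X = "l2_trunc Y \<Xi>" and ?T = "l2_trunc Y \<Theta>"
  have X: "?X \<in> l2 (UNIV \<times> carrier G)" "?T \<in> l2 (UNIV \<times> carrier G)" using 1 by (auto intro: l2_trunc_in)
  have dX: "l2_norm (\<lambda>p. \<Xi> p - ?X p) \<le> d"
    by (rule order_trans[OF l2_norm_mono[OF l2_diff[OF 1(1) l2_trunc_in[OF 1(1), of Y1]]] less_imp_le[OF Y1(3)]])
      (auto simp: l2_trunc_def Y_def)
  have dT: "l2_norm (\<lambda>p. \<Theta> p - ?T p) \<le> d"
    by (rule order_trans[OF l2_norm_mono[OF l2_diff[OF 1(2) l2_trunc_in[OF 1(2), of Y2]]] less_imp_le[OF Y2(3)]])
      (auto simp: l2_trunc_def Y_def)
  have dXl: "(\<lambda>p. \<Xi> p - ?X p) \<in> l2 (UNIV \<times> carrier G)" "(\<lambda>p. \<Theta> p - ?T p) \<in> l2 (UNIV \<times> carrier G)"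
    using 1 X by (auto intro: l2_diff)
  have half: "d * K = e / 2" using K by (simp add: d_def)
  have b1: "l2_norm (\<lambda>p. \<Xi> p - ?X p) * l2_norm \<Theta> \<le> e / 2"
    unfolding half[symmetric] using d by (intro mult_mono dX) (auto simp: K_def)
  have b2: "l2_norm ?X * l2_norm (\<lambda>p. \<Theta> p - ?T p) \<le> e / 2"
  proof -
    have "l2_norm ?X \<le> K" using l2_norm_trunc_le[OF 1(1), of Y] l2_norm_nonneg[of \<Theta>] unfolding K_def by linarith
    then have "l2_norm ?X * l2_norm (\<lambda>p. \<Theta> p - ?T p) \<le> K * d" using K by (intro mult_mono dT) auto
    then show ?thesis using half by (simp add: mult.commute)
  qed
  show ?thesis
  proof (rule that[of "coef G ?X ?T"])
    show "coef G ?X ?T \<in> Fourier G" by (rule coef_in[OF X])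
    show "finite {s. coef G ?X ?T s \<noteq> 0}" by (rule coef_finite_support[OF Y(1) 1(1,2) Y(2)])
    fix v assume v: "v \<in> Fourier G" "vA v \<le> 1"
    let ?a = "coef G (\<lambda>p. \<Xi> p - ?X p) \<Theta>" and ?b = "coef G ?X (\<lambda>p. \<Theta> p - ?T p)"
    have e2: "0 < e / 2" using e by simp
    have "(\<lambda>x. (u x - coef G ?X ?T x) * v x) = (\<lambda>x. ?a x * v x + ?b x * v x)"
      unfolding 1(3) coef_diff[OF 1(1) X(1) 1(2) X(2)] by (simp add: distrib_right)
    then have "vA (\<lambda>x. (u x - coef G ?X ?T x) * v x) = vA (\<lambda>x. ?a x * v x + ?b x * v x)"
      by (simp only:)
    also have "\<dots> \<le> vA (\<lambda>x. ?a x * v x) + vA (\<lambda>x. ?b x * v x)"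
      by (rule nA_triangle[where n = 1]) (intro Fourier_mult coef_in v(1) dXl X 1)+
    also have "\<dots> \<le> e / 2 * vA v + e / 2 * vA v"
      by (intro add_mono Fourier_multiplier_bound[where n = 1] e2 dXl X 1 b1 b2 v(1))
    also have "\<dots> \<le> e" using mult_left_mono[OF v(2), of e] e by simp
    finally show "vA (\<lambda>x. (u x - coef G ?X ?T x) * v x) \<le> e" .
  qed
qed

lemma Acb_approx:
  assumes f: "f \<in> Acbs" and e: "0 < e"
  obtains g where "g \<in> Fourier G" "finite {s. g s \<noteq> 0}"
    "\<And>v. v \<in> Fourier G \<Longrightarrow> vA v \<le> 1 \<Longrightarrow> vA (\<lambda>x. (f x - g x) * v x) \<le> e"
proof -
  obtain u where u: "u \<in> Fourier G" "vM (\<lambda>x. f x - u x) < e / 2"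
    using f e unfolding Acb_iff by (meson half_gt_zero)
  have e2: "0 < e / 2" using e by simp
  obtain g where g: "g \<in> Fourier G" "finite {s. g s \<noteq> 0}"
    "\<And>v. v \<in> Fourier G \<Longrightarrow> vA v \<le> 1 \<Longrightarrow> vA (\<lambda>x. (u x - g x) * v x) \<le> e / 2"
    by (rule Fourier_approx[OF u(1) e2]) blast
  have M: "(\<lambda>x. f x - u x) \<in> Mcb" "(\<lambda>x. u x - g x) \<in> Mcb"
    using Acb_Mcb[OF f] Fourier_Mcb[OF u(1)] Fourier_Mcb[OF g(1)] by (auto intro: Mcb_diff)
  show ?thesis
  proof (rule that[OF g(1,2)])
    fix v assume v: "v \<in> Fourier G" "vA v \<le> 1"
    have "(\<lambda>x. (f x - g x) * v x) = (\<lambda>x. (f x - u x) * v x + (u x - g x) * v x)"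
      by (simp add: algebra_simps)
    then have "vA (\<lambda>x. (f x - g x) * v x) = vA (\<lambda>x. (f x - u x) * v x + (u x - g x) * v x)"
      by (simp only:)
    also have "\<dots> \<le> vA (\<lambda>x. (f x - u x) * v x) + vA (\<lambda>x. (u x - g x) * v x)"
      by (rule nA_triangle[where n = 1]) (rule Mcb_mult[OF M(1) v(1)] Mcb_mult[OF M(2) v(1)])+
    also have "\<dots> \<le> e / 2 + e / 2"
      using vM_apply[OF M(1) v] u(2) by (intro add_mono g(3) v) simp
    finally show "vA (\<lambda>x. (f x - g x) * v x) \<le> e" by simp
  qed
qed

text \<open>Off the finite support of the approximation \<open>g\<close>, the value f(s) is
  recovered from (f - g) \<delta>_s by pairing with \<lambda>(s), so it is at most the distance e /
  2.\<close>

lemma Acb_vanishes_at_infinity: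
  assumes f: "f \<in> Acbs" and e: "0 < e"
  shows "finite {s. e \<le> cmod (f s)}"
proof -
  have e2: "0 < e / 2" using e by simp
  obtain g where g: "g \<in> Fourier G" "finite {s. g s \<noteq> 0}"
    "\<And>v. v \<in> Fourier G \<Longrightarrow> vA v \<le> 1 \<Longrightarrow> vA (\<lambda>x. (f x - g x) * v x) \<le> e / 2"
    by (rule Acb_approx[OF f e2]) blast
  have M: "(\<lambda>x. f x - g x) \<in> Mcb" using Acb_Mcb[OF f] Fourier_Mcb[OF g(1)] by (rule Mcb_diff)
  have "cmod (f s) < e" if "g s = 0" for s
  proof (cases "s \<in> carrier G")
    case True
    let ?v = "\<lambda>x. (f x - g x) * l2_delta s x"
    have v: "?v \<in> Fourier G" by (rule Mcb_mult[OF M delta_Fourier[OF True]])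
    have "cmod (duality G (lr s) ?v) \<le> 1 * vA ?v"
      by (rule duality_le[OF lr_VN[OF True] _ _ v]) (simp_all add: lr_in True)
    also have "duality G (lr s) ?v = f s"
      using that by (simp add: duality_lr[OF True v], simp add: l2_delta_def)
    also have "1 * vA ?v \<le> e / 2" using g(3)[OF delta_Fourier[OF True] vA_delta[OF True]] by simp
    finally show ?thesis using e by simp
  qed (use Mcb_outside[OF Acb_Mcb[OF f]] e in simp)
  then have "{s. e \<le> cmod (f s)} \<subseteq> {s. g s \<noteq> 0}" by force
  then show ?thesis using g(2) finite_subset by blast
qed

section \<open>The action of multipliers on VN(G)\<close>

lemma VN_duality_unique:
  assumes "S \<in> VNs" "S' \<in> VNs" "\<And>v. v \<in> Fourier G \<Longrightarrow> duality G S v = duality G S' v"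
  shows "S = S'"
proof (rule bounded_ops_ext[OF VN_bounded[OF assms(1)] VN_bounded[OF assms(2)]])
  fix \<xi> \<eta> assume *: "\<xi> \<in> l2 (carrier G)" "\<eta> \<in> l2 (carrier G)"
  show "l2_inner (S \<xi>) \<eta> = l2_inner (S' \<xi>) \<eta>"
    using assms(3)[OF vfun_in[OF *]] duality_vfun[OF assms(1) *] duality_vfun[OF assms(2) *] by simp
qed

lemma VN_act_unique:
  assumes "S \<in> VNs" "\<And>v. v \<in> Fourier G \<Longrightarrow> duality G S v = duality G T (\<lambda>x. f x * v x)"
  shows "VN_act G f T = S"
  unfolding VN_act_def by (rule the_equality) (use assms VN_duality_unique in auto)

lemma VN_act_duality:
  assumes f: "f \<in> Mcb" and T: "T \<in> VNs"
  shows "VN_act G f T \<in> VNs"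
    and "\<And>v. v \<in> Fourier G \<Longrightarrow> duality G (VN_act G f T) v = duality G T (\<lambda>x. f x * v x)"
proof -
  obtain C where C: "0 \<le> C" "\<And>n v. 0 < n \<Longrightarrow> v \<in> mats (Fourier_algebra G) n \<Longrightarrow> nA n (\<lambda>i j x. f x * v i j x) \<le> C * nA n v"
    using Mcb_bound[OF f] by blast
  have "\<exists>S. S \<in> VNs \<and> (\<forall>v\<in>Fourier G. duality G S v = duality G T (\<lambda>x. f x * v x))"
  proof (rule multiplier_adjoint[OF Mcb_mult[OF f] _ C(1) T])
    fix \<Phi> \<Psi> :: "nat \<times> 'a \<Rightarrow> complex"
    assume *: "\<Phi> \<in> l2 (UNIV \<times> carrier G)" "\<Psi> \<in> l2 (UNIV \<times> carrier G)"
    have "vA (\<lambda>x. f x * coef G \<Phi> \<Psi> x) \<le> C * vA (coef G \<Phi> \<Psi>)"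
      using C(2)[of 1 "\<lambda>_ _. coef G \<Phi> \<Psi>"] coef_in[OF *] by (simp add: mats_def)
    also have "\<dots> \<le> C * (l2_norm \<Phi> * l2_norm \<Psi>)" by (rule mult_left_mono[OF vA_coef_le[OF *] C(1)])
    finally show "vA (\<lambda>x. f x * coef G \<Phi> \<Psi> x) \<le> C * l2_norm \<Phi> * l2_norm \<Psi>" by (simp add: mult.assoc)
  next
    fix S assume "S \<in> VNs" "\<And>v. v \<in> Fourier G \<Longrightarrow> duality G S v = duality G T (\<lambda>x. f x * v x)"
    then show ?thesis by blast
  qed
  then obtain S where S: "S \<in> VNs" "\<And>v. v \<in> Fourier G \<Longrightarrow> duality G S v = duality G T (\<lambda>x. f x * v x)" by blast
  have eq: "VN_act G f T = S" by (rule VN_act_unique[OF S])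
  show "VN_act G f T \<in> VNs"
    "\<And>v. v \<in> Fourier G \<Longrightarrow> duality G (VN_act G f T) v = duality G T (\<lambda>x. f x * v x)"
    unfolding eq by (rule S(1), rule S(2))
qed

lemma duality_smult:
  assumes T: "T \<in> VNs" and v: "v \<in> Fourier G"
  shows "duality G (\<lambda>\<xi> x. c * T \<xi> x) v = c * duality G T v"
proof (rule Fourier_rep[OF v])
  fix \<Xi> \<Theta> :: "nat \<times> 'a \<Rightarrow> complex"
  assume *: "\<Xi> \<in> l2 (UNIV \<times> carrier G)" "\<Theta> \<in> l2 (UNIV \<times> carrier G)" "v = coef G \<Xi> \<Theta>"
  have "amp (\<lambda>\<xi> x. c * T \<xi> x) \<Xi> = (\<lambda>p. c * amp T \<Xi> p)" by (auto simp: amp_def)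
  then show ?thesis using * T VN_smult[OF T] by (simp add: duality_coef l2_inner_scale_left)
qed

text \<open>For every v, the product \<delta>_s v is v(s) \<delta>_s. The factor v(s) is the pairing
  with \<lambda>(s), and T pairs with \<delta>_s as the coordinate at s of its column at the
  unit.\<close>

lemma VN_act_delta:
  assumes T: "T \<in> VNs" and s: "s \<in> carrier G"
  shows "VN_act G (l2_delta s) T = (\<lambda>\<xi> x. T (l2_delta \<one>) s * lr s \<xi> x)"
proof (rule VN_act_unique[OF VN_smult[OF lr_VN[OF s]]])
  fix v assume v: "v \<in> Fourier G"
  have "(\<lambda>x. l2_delta s x * v x) = (\<lambda>x. v s * l2_delta s x)" by (auto simp: l2_delta_def)
  then have "duality G T (\<lambda>x. l2_delta s x * v x) = v s * T (l2_delta \<one>) s"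
    using Fourier_scale(2)[OF delta_Fourier[OF s] T, of "v s"] duality_delta[OF T s] by simp
  then show "duality G (\<lambda>\<xi> x. T (l2_delta \<one>) s * lr s \<xi> x) v = duality G T (\<lambda>x. l2_delta s x * v x)"
    by (simp add: duality_smult[OF lr_VN[OF s] v] duality_lr[OF s v])
qed

end

section \<open>Operator spaces of functions\<close>

text \<open>The operator space structure inherited from the bounded functions on \<open>J\<close>,
  that is, the minimal one. Everything about it reduces to scalar matrices at each point.\<close>

definition sup_space :: "'i set \<Rightarrow> ('i \<Rightarrow> complex) set \<Rightarrow> ('i \<Rightarrow> complex) opspace" where
  "sup_space J C =
     \<lparr>carrier = C, mult = undefined, one = undefined, ring.zero = (\<lambda>_. 0),
      add = (\<lambda>f g x. f x + g x), smult = (\<lambda>c f x. c * f x),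
      mnorm = (\<lambda>n v. SUP x\<in>J. scalar_norm n n (\<lambda>i j. v i j x))\<rparr>"

lemma sup_space_simps:
  "carrier (sup_space J C) = C" "f \<oplus>\<^bsub>sup_space J C\<^esub> g = (\<lambda>x. f x + g x)"
  "\<zero>\<^bsub>sup_space J C\<^esub> = (\<lambda>_. 0)" "c \<odot>\<^bsub>sup_space J C\<^esub> f = (\<lambda>x. c * f x)"
  "mnorm (sup_space J C) n v = (SUP x\<in>J. scalar_norm n n (\<lambda>i j. v i j x))"
  by (simp_all add: sup_space_def)

lemma finsum_pointwise:
  fixes V :: "('i \<Rightarrow> complex, 'm) opspace_scheme"
  assumes "abelian_monoid V" and add: "\<And>u v. u \<oplus>\<^bsub>V\<^esub> v = (\<lambda>x. u x + v x)" "\<zero>\<^bsub>V\<^esub> = (\<lambda>_. 0)"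
    and "finite A" "\<And>a. a \<in> A \<Longrightarrow> f a \<in> carrier V"
  shows "finsum V f A = (\<lambda>x. \<Sum>a\<in>A. f a x)"
  using assms(4,5)
proof induction
  case empty
  then show ?case by (simp add: abelian_monoid.finsum_empty[OF assms(1)] add)
next
  case (insert a A)
  then have "finsum V f (insert a A) = f a \<oplus>\<^bsub>V\<^esub> finsum V f A"
    by (intro abelian_monoid.finsum_insert[OF assms(1)]) auto
  with insert show ?case by (simp add: add)
qed

lemma scalar_norm_le_sum: "scalar_norm n n \<alpha> \<le> (\<Sum>i<n. \<Sum>j<n. cmod (\<alpha> i j))"
  using scalar_norm_blocks[of n 1 \<alpha>] by (simp add: scalar_norm_1[simplified])

lemma scalar_norm_sandwich:
  "scalar_norm m m (\<lambda>i j. \<Sum>p\<in>{..<n} \<times> {..<n}. (\<alpha> i (fst p) * \<beta> (snd p) j) * c (fst p) (snd p))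
    \<le> scalar_norm m n \<alpha> * scalar_norm n n c * scalar_norm n m \<beta>"
proof -
  have "(\<Sum>p\<in>{..<n} \<times> {..<n}. (\<alpha> i (fst p) * \<beta> (snd p) j) * c (fst p) (snd p))
    = (\<Sum>l<n. (\<Sum>k<n. \<alpha> i k * c k l) * \<beta> l j)" for i j
  proof -
    have "(\<Sum>p\<in>{..<n} \<times> {..<n}. (\<alpha> i (fst p) * \<beta> (snd p) j) * c (fst p) (snd p))
      = (\<Sum>k<n. \<Sum>l<n. \<alpha> i k * c k l * \<beta> l j)"
      by (simp add: sum.cartesian_product case_prod_unfold mult_ac)
    also have "\<dots> = (\<Sum>l<n. \<Sum>k<n. \<alpha> i k * c k l * \<beta> l j)" by (rule sum.swap)
    finally show ?thesis by (simp add: sum_distrib_right)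
  qed
  then have "scalar_norm m m (\<lambda>i j. \<Sum>p\<in>{..<n} \<times> {..<n}. (\<alpha> i (fst p) * \<beta> (snd p) j) * c (fst p) (snd p))
    = scalar_norm m m (\<lambda>i j. \<Sum>l<n. (\<Sum>k<n. \<alpha> i k * c k l) * \<beta> l j)" by (simp only:)
  also have "\<dots> \<le> scalar_norm m n (\<lambda>i l. \<Sum>k<n. \<alpha> i k * c k l) * scalar_norm n m \<beta>"
    by (rule scalar_norm_mult)
  also have "\<dots> \<le> (scalar_norm m n \<alpha> * scalar_norm n n c) * scalar_norm n m \<beta>"
    by (intro mult_right_mono scalar_norm_mult scalar_norm_nonneg)
  finally show ?thesis .
qed

text \<open>The last assumption is closedness under uniform limits, from which completeness will
  follow.\<close>

locale fun_space =
  fixes J :: "'i set" and C :: "('i \<Rightarrow> complex) set"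
  assumes J: "J \<noteq> {}"
    and outside: "f \<in> C \<Longrightarrow> x \<notin> J \<Longrightarrow> f x = 0"
    and bounded: "f \<in> C \<Longrightarrow> \<exists>B. \<forall>x\<in>J. cmod (f x) \<le> B"
    and zero_in: "(\<lambda>_. 0) \<in> C"
    and add_in: "f \<in> C \<Longrightarrow> g \<in> C \<Longrightarrow> (\<lambda>x. f x + g x) \<in> C"
    and scale_in: "f \<in> C \<Longrightarrow> (\<lambda>x. c * f x) \<in> C"
    and limit_in: "(\<And>k::nat. F k \<in> C) \<Longrightarrow> (\<And>x. x \<notin> J \<Longrightarrow> g x = 0) \<Longrightarrow>
      (\<And>e. 0 < e \<Longrightarrow> \<exists>k. \<forall>x\<in>J. cmod (F k x - g x) \<le> e) \<Longrightarrow> g \<in> C"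
begin

abbreviation "V \<equiv> sup_space J C"

lemma uminus_in: "f \<in> C \<Longrightarrow> (\<lambda>x. - f x) \<in> C"
  using scale_in[of f "-1"] by simp

lemma sum_in: "(\<And>a. a \<in> A \<Longrightarrow> f a \<in> C) \<Longrightarrow> (\<lambda>x. \<Sum>a\<in>A. f a x) \<in> C"
  by (induction A rule: infinite_finite_induct) (auto intro: add_in zero_in)

lemma abelian_group_V: "abelian_group V"
proof (rule abelian_groupI)
  fix x assume "x \<in> carrier V"
  then show "\<exists>y\<in>carrier V. y \<oplus>\<^bsub>V\<^esub> x = \<zero>\<^bsub>V\<^esub>"
    by (intro bexI[of _ "\<lambda>t. - x t"]) (simp_all add: sup_space_simps uminus_in)
qed (auto simp: sup_space_simps add_in zero_in add_ac)

lemma module_V: "Module.module complex_ring V"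
proof (rule moduleI)
  show "cring complex_ring" by (rule cring_from_type_algebra)
  show "abelian_group V" by (rule abelian_group_V)
qed (simp_all add: ring_of_type_algebra_def sup_space_simps scale_in algebra_simps)

lemma minus_V: "g \<in> C \<Longrightarrow> f \<ominus>\<^bsub>V\<^esub> g = (\<lambda>x. f x - g x)"
  by (rule minus_pointwise) (simp_all add: sup_space_simps uminus_in)

lemma mats_V: "v \<in> mats V n \<Longrightarrow> i < n \<Longrightarrow> j < n \<Longrightarrow> v i j \<in> C"
  by (simp add: mats_def sup_space_simps)

lemma mnorm_bdd:
  assumes v: "v \<in> mats V n"
  shows "bdd_above ((\<lambda>x. scalar_norm n n (\<lambda>i j. v i j x)) ` J)"
proof -
  have "\<exists>B. \<forall>x\<in>J. cmod (v i j x) \<le> B" if "i < n" "j < n" for i j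
    by (rule bounded[OF mats_V[OF v that]])
  then obtain B where B: "\<And>i j x. i < n \<Longrightarrow> j < n \<Longrightarrow> x \<in> J \<Longrightarrow> cmod (v i j x) \<le> B i j" by metis
  show ?thesis
  proof (rule bdd_aboveI2)
    fix x assume x: "x \<in> J"
    show "scalar_norm n n (\<lambda>i j. v i j x) \<le> (\<Sum>i<n. \<Sum>j<n. B i j)"
      by (rule order_trans[OF scalar_norm_le_sum]) (intro sum_mono, use B x in auto)
  qed
qed

lemma mnorm_upper: "v \<in> mats V n \<Longrightarrow> x \<in> J \<Longrightarrow> scalar_norm n n (\<lambda>i j. v i j x) \<le> mnorm V n v"
  unfolding sup_space_simps by (rule cSUP_upper[OF _ mnorm_bdd])

lemma mnorm_least: "(\<And>x. x \<in> J \<Longrightarrow> scalar_norm n n (\<lambda>i j. v i j x) \<le> B) \<Longrightarrow> mnorm V n v \<le> B"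
  unfolding sup_space_simps by (rule cSUP_least[OF J])

lemma mnorm_ge_0: "v \<in> mats V n \<Longrightarrow> 0 \<le> mnorm V n v"
  using J mnorm_upper scalar_norm_nonneg order_trans by (metis ex_in_conv)

lemma vnorm_upper: "f \<in> C \<Longrightarrow> x \<in> J \<Longrightarrow> cmod (f x) \<le> vnorm V f"
  using mnorm_upper[of "\<lambda>_ _. f" 1 x] by (simp add: mats_def sup_space_simps(1) vnorm_def scalar_norm_1[simplified])

lemma vnorm_least: "(\<And>x. x \<in> J \<Longrightarrow> cmod (f x) \<le> B) \<Longrightarrow> vnorm V f \<le> B"
  unfolding vnorm_def by (rule mnorm_least) (simp add: scalar_norm_1[simplified])

lemma diff_in: "f \<in> C \<Longrightarrow> g \<in> C \<Longrightarrow> (\<lambda>x. f x - g x) \<in> C"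
  using add_in[of f "\<lambda>x. - g x"] uminus_in[of g] by simp

lemma vnorm_nonneg: "f \<in> C \<Longrightarrow> 0 \<le> vnorm V f"
  unfolding vnorm_def by (rule mnorm_ge_0) (simp add: mats_def sup_space_simps)

lemma mat_sandwich_V:
  assumes "v \<in> mats V n"
  shows "mat_sandwich V n \<alpha> v \<beta> i j x = (\<Sum>p\<in>{..<n} \<times> {..<n}. (\<alpha> i (fst p) * \<beta> (snd p) j) * v (fst p) (snd p) x)"
proof -
  have "abelian_monoid V" using abelian_group_V by (rule abelian_group.axioms)
  then show ?thesis
    unfolding mat_sandwich_def
    by (subst finsum_pointwise) (auto simp: sup_space_simps intro!: scale_in mats_V[OF assms])
qed

text \<open>Ruan's axioms hold at each point by the corresponding facts on scalar matrices and pass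
  to the supremum. A Cauchy sequence converges uniformly to its pointwise limit.\<close>

lemma operator_space_V: "operator_space V"
proof -
  interpret Module.module complex_ring V by (rule module_V)
  show ?thesis
  proof
    fix n and v w :: "nat \<Rightarrow> nat \<Rightarrow> 'i \<Rightarrow> complex"
    assume eq: "\<And>i j. i < n \<Longrightarrow> j < n \<Longrightarrow> v i j = w i j"
    have "scalar_norm n n (\<lambda>i j. v i j x) = scalar_norm n n (\<lambda>i j. w i j x)" for x
      by (rule scalar_norm_cong) (simp add: eq)
    then show "mnorm V n v = mnorm V n w" by (simp add: sup_space_simps)
  next
    fix n v assume "0 < (n::nat)" "v \<in> mats V n"
    then show "0 \<le> mnorm V n v" by (intro mnorm_ge_0)
  next
    fix n v assume n: "0 < (n::nat)" and v: "v \<in> mats V n"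
    show "mnorm V n v = 0 \<longleftrightarrow> (\<forall>i<n. \<forall>j<n. v i j = \<zero>\<^bsub>V\<^esub>)"
    proof
      assume 0: "mnorm V n v = 0"
      show "\<forall>i<n. \<forall>j<n. v i j = \<zero>\<^bsub>V\<^esub>"
      proof (intro allI impI)
        fix i j assume ij: "i < n" "j < n"
        have "v i j x = 0" for x
        proof (cases "x \<in> J")
          case True
          then have "scalar_norm n n (\<lambda>i j. v i j x) = 0"
            using mnorm_upper[OF v True] 0 scalar_norm_nonneg[of n n "\<lambda>i j. v i j x"] by linarith
          then show ?thesis using ij by (simp add: scalar_norm_eq_0)
        qed (rule outside[OF mats_V[OF v ij]])
        then show "v i j = \<zero>\<^bsub>V\<^esub>" by (simp add: sup_space_simps fun_eq_iff)
      qed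
    next
      assume 0: "\<forall>i<n. \<forall>j<n. v i j = \<zero>\<^bsub>V\<^esub>"
      have "scalar_norm n n (\<lambda>i j. v i j x) = 0" for x
        using 0 by (simp add: scalar_norm_eq_0 sup_space_simps)
      then have "mnorm V n v \<le> 0" by (intro mnorm_least) simp
      then show "mnorm V n v = 0" using mnorm_ge_0[OF v] by simp
    qed
  next
    fix n v w assume "0 < (n::nat)" and vw: "v \<in> mats V n" "w \<in> mats V n"
    show "mnorm V n (\<lambda>i j. v i j \<oplus>\<^bsub>V\<^esub> w i j) \<le> mnorm V n v + mnorm V n w"
    proof (rule mnorm_least)
      fix x assume x: "x \<in> J"
      have "scalar_norm n n (\<lambda>i j. v i j x + w i j x) \<le> scalar_norm n n (\<lambda>i j. v i j x) + scalar_norm n n (\<lambda>i j. w i j x)"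
        by (rule scalar_norm_triangle)
      also have "\<dots> \<le> mnorm V n v + mnorm V n w" by (intro add_mono mnorm_upper vw x)
      finally show "scalar_norm n n (\<lambda>i j. (v i j \<oplus>\<^bsub>V\<^esub> w i j) x) \<le> mnorm V n v + mnorm V n w"
        by (simp add: sup_space_simps(2))
    qed
  next
    fix n c v assume "0 < (n::nat)" and v: "v \<in> mats V n"
    have cv: "(\<lambda>i j. c \<odot>\<^bsub>V\<^esub> v i j) \<in> mats V n" for c
      using v by (auto simp: mats_def sup_space_simps scale_in)
    have le: "mnorm V n (\<lambda>i j. c \<odot>\<^bsub>V\<^esub> v i j) \<le> cmod c * mnorm V n v" if "v \<in> mats V n" for c v
    proof (rule mnorm_least)
      fix x assume x: "x \<in> J"
      show "scalar_norm n n (\<lambda>i j. (c \<odot>\<^bsub>V\<^esub> v i j) x) \<le> cmod c * mnorm V n v"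
        unfolding sup_space_simps(4) scalar_norm_scale by (intro mult_left_mono mnorm_upper that x norm_ge_zero)
    qed
    show "mnorm V n (\<lambda>i j. c \<odot>\<^bsub>V\<^esub> v i j) = cmod c * mnorm V n v"
    proof (cases "c = 0")
      case True
      then show ?thesis using le[OF v, of c] mnorm_ge_0[OF cv, of c] by simp
    next
      case False
      have "mnorm V n (\<lambda>i j. inverse c \<odot>\<^bsub>V\<^esub> (c \<odot>\<^bsub>V\<^esub> v i j)) \<le> cmod (inverse c) * mnorm V n (\<lambda>i j. c \<odot>\<^bsub>V\<^esub> v i j)"
        by (rule le[OF cv])
      moreover have "(\<lambda>i j. inverse c \<odot>\<^bsub>V\<^esub> (c \<odot>\<^bsub>V\<^esub> v i j)) = v"
        using False by (simp add: sup_space_simps mult.assoc[symmetric])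
      ultimately have "mnorm V n v \<le> inverse (cmod c) * mnorm V n (\<lambda>i j. c \<odot>\<^bsub>V\<^esub> v i j)"
        by (simp add: norm_inverse)
      then have "cmod c * mnorm V n v \<le> mnorm V n (\<lambda>i j. c \<odot>\<^bsub>V\<^esub> v i j)"
        using False by (simp add: field_simps)
      then show ?thesis using le[OF v, of c] by simp
    qed
  next
    fix m n v w assume "0 < (m::nat)" "0 < (n::nat)" and v: "v \<in> mats V m" and w: "w \<in> mats V n"
    have d: "mat_dsum V m v w i j x = (if i < m \<and> j < m then v i j x else if m \<le> i \<and> m \<le> j then w (i - m) (j - m) x else 0)" for i j x
      by (simp add: mat_dsum_def sup_space_simps)
    have dm: "mat_dsum V m v w \<in> mats V (m + n)"
      using v w by (auto simp: mats_def mat_dsum_def sup_space_simps zero_in)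
    have e: "scalar_norm (m + n) (m + n) (\<lambda>i j. mat_dsum V m v w i j x)
      = max (scalar_norm m m (\<lambda>i j. v i j x)) (scalar_norm n n (\<lambda>i j. w i j x))" for x
      unfolding d by (rule scalar_norm_dsum)
    show "mnorm V (m + n) (mat_dsum V m v w) = max (mnorm V m v) (mnorm V n w)"
    proof (rule antisym)
      show "mnorm V (m + n) (mat_dsum V m v w) \<le> max (mnorm V m v) (mnorm V n w)"
        by (rule mnorm_least) (unfold e, intro max.mono mnorm_upper v w)
      have "mnorm V m v \<le> mnorm V (m + n) (mat_dsum V m v w)"
        by (rule mnorm_least) (use mnorm_upper[OF dm] e in \<open>metis max.boundedE\<close>)
      moreover have "mnorm V n w \<le> mnorm V (m + n) (mat_dsum V m v w)"
        by (rule mnorm_least) (use mnorm_upper[OF dm] e in \<open>metis max.boundedE\<close>)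
      ultimately show "max (mnorm V m v) (mnorm V n w) \<le> mnorm V (m + n) (mat_dsum V m v w)" by simp
    qed
  next
    fix m n \<alpha> v \<beta> assume "0 < (m::nat)" "0 < (n::nat)" and v: "v \<in> mats V n"
    show "mnorm V m (mat_sandwich V n \<alpha> v \<beta>) \<le> scalar_norm m n \<alpha> * mnorm V n v * scalar_norm n m \<beta>"
    proof (rule mnorm_least)
      fix x assume x: "x \<in> J"
      have "scalar_norm m m (\<lambda>i j. mat_sandwich V n \<alpha> v \<beta> i j x)
        \<le> scalar_norm m n \<alpha> * scalar_norm n n (\<lambda>i j. v i j x) * scalar_norm n m \<beta>"
        unfolding mat_sandwich_V[OF v] by (rule scalar_norm_sandwich)
      also have "\<dots> \<le> scalar_norm m n \<alpha> * mnorm V n v * scalar_norm n m \<beta>"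
        by (intro mult_right_mono mult_left_mono mnorm_upper v x scalar_norm_nonneg)
      finally show "scalar_norm m m (\<lambda>i j. mat_sandwich V n \<alpha> v \<beta> i j x)
        \<le> scalar_norm m n \<alpha> * mnorm V n v * scalar_norm n m \<beta>" .
    qed
  next
    fix F :: "nat \<Rightarrow> 'i \<Rightarrow> complex"
    assume ran: "range F \<subseteq> carrier V"
      and cauchy: "\<forall>e>0. \<exists>N. \<forall>k\<ge>N. \<forall>l\<ge>N. vnorm V (F k \<ominus>\<^bsub>V\<^esub> F l) < e"
    have F: "F k \<in> C" for k using ran by (auto simp: sup_space_simps)
    have c: "\<exists>N. \<forall>k\<ge>N. \<forall>l\<ge>N. \<forall>x\<in>J. cmod (F k x - F l x) < e" if e: "0 < e" for e
    proof -
      obtain N where N: "\<And>k l. k \<ge> N \<Longrightarrow> l \<ge> N \<Longrightarrow> vnorm V (F k \<ominus>\<^bsub>V\<^esub> F l) < e"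
        using cauchy e by blast
      have "cmod (F k x - F l x) < e" if "k \<ge> N" "l \<ge> N" "x \<in> J" for k l x
        using N[OF that(1,2)] vnorm_upper[OF diff_in[OF F F] that(3), of k l] by (simp add: minus_V[OF F])
      then show ?thesis by blast
    qed
    have "Cauchy (\<lambda>k. F k x)" for x
    proof (cases "x \<in> J")
      case True
      show ?thesis
      proof (rule CauchyI)
        fix e :: real assume "0 < e"
        then obtain N where "\<And>k l. k \<ge> N \<Longrightarrow> l \<ge> N \<Longrightarrow> cmod (F k x - F l x) < e" using c True by meson
        then show "\<exists>M. \<forall>m\<ge>M. \<forall>n\<ge>M. norm (F m x - F n x) < e" by blast
      qed
    qed (simp add: outside[OF F] convergent_Cauchy[OF convergent_const])
    then have "convergent (\<lambda>k. F k x)" for x by (simp add: Cauchy_convergent_iff)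
    then have lim: "(\<lambda>k. F k x) \<longlonglongrightarrow> lim (\<lambda>k. F k x)" for x by (simp add: convergent_LIMSEQ_iff)
    define g where "g = (\<lambda>x. lim (\<lambda>k. F k x))"
    have unif: "\<exists>N. \<forall>k\<ge>N. \<forall>x\<in>J. cmod (F k x - g x) \<le> e" if e: "0 < e" for e
    proof -
      obtain N where N: "\<And>k l x. k \<ge> N \<Longrightarrow> l \<ge> N \<Longrightarrow> x \<in> J \<Longrightarrow> cmod (F k x - F l x) < e"
        using c[OF e] by blast
      have "cmod (F k x - g x) \<le> e" if k: "k \<ge> N" and x: "x \<in> J" for k x
      proof (rule LIMSEQ_le_const2)
        show "(\<lambda>l. cmod (F k x - F l x)) \<longlonglongrightarrow> cmod (F k x - g x)"
          unfolding g_def by (intro tendsto_norm tendsto_diff tendsto_const lim)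
        show "\<exists>M. \<forall>l\<ge>M. cmod (F k x - F l x) \<le> e"
          using N[OF k _ x] less_imp_le by blast
      qed
      then show ?thesis by blast
    qed
    have g0: "g x = 0" if "x \<notin> J" for x
      using lim[of x] that by (simp add: g_def outside[OF F] LIMSEQ_const_iff)
    have g: "g \<in> C"
    proof (rule limit_in[of F g, OF F g0])
      fix e :: real assume "0 < e"
      from unif[OF this] obtain N where N: "\<forall>k\<ge>N. \<forall>x\<in>J. cmod (F k x - g x) \<le> e" ..
      have "\<forall>x\<in>J. cmod (F N x - g x) \<le> e" using N by simp
      then show "\<exists>k. \<forall>x\<in>J. cmod (F k x - g x) \<le> e" by (rule exI[of _ N])
    qed
    have "(\<lambda>k. vnorm V (F k \<ominus>\<^bsub>V\<^esub> g)) \<longlonglongrightarrow> 0"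
    proof (rule LIMSEQ_I)
      fix e :: real assume e: "0 < e"
      then obtain N where N: "\<And>k x. k \<ge> N \<Longrightarrow> x \<in> J \<Longrightarrow> cmod (F k x - g x) \<le> e / 2"
        using unif[of "e / 2"] by auto
      have "norm (vnorm V (F k \<ominus>\<^bsub>V\<^esub> g) - 0) < e" if "k \<ge> N" for k
      proof -
        have "vnorm V (\<lambda>x. F k x - g x) \<le> e / 2" by (rule vnorm_least) (use N that in auto)
        then show ?thesis using vnorm_nonneg[OF diff_in[OF F g], of k] e by (simp add: minus_V[OF g])
      qed
      then show "\<exists>no. \<forall>n\<ge>no. norm (vnorm V (F n \<ominus>\<^bsub>V\<^esub> g) - 0) < e" by blast
    qed
    with g show "\<exists>y\<in>carrier V. (\<lambda>k. vnorm V (F k \<ominus>\<^bsub>V\<^esub> y)) \<longlonglongrightarrow> 0"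
      by (auto simp: sup_space_simps(1))
  qed
qed

end

subsection \<open>Pointwise actions on function spaces\<close>

lemma alg_tensor_simps:
  "s \<oplus>\<^bsub>alg_tensor V W\<^esub> t = (\<lambda>\<phi>. s \<phi> + t \<phi>)" "\<zero>\<^bsub>alg_tensor V W\<^esub> = (\<lambda>_. 0)"
  "c \<odot>\<^bsub>alg_tensor V W\<^esub> s = (\<lambda>\<phi>. c * s \<phi>)"
  by (simp_all add: alg_tensor_def)

lemma alg_tensor_carrier:
  "u \<in> carrier (alg_tensor V W) \<longleftrightarrow> (\<exists>(N::nat) v w. (\<forall>k<N. v k \<in> carrier V \<and> w k \<in> carrier W) \<and>
     u = (\<lambda>\<phi>. \<Sum>k<N. elem_tensor V W (v k) (w k) \<phi>))"
  by (auto simp: alg_tensor_def)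

lemma elem_tensor_in:
  assumes "v \<in> carrier V" "w \<in> carrier W" shows "elem_tensor V W v w \<in> carrier (alg_tensor V W)"
  unfolding alg_tensor_carrier
  by (rule exI[of _ 1], rule exI[of _ "\<lambda>_. v"], rule exI[of _ "\<lambda>_. w"]) (use assms in auto)

lemma alg_tensor_add:
  assumes "s \<in> carrier (alg_tensor V W)" "t \<in> carrier (alg_tensor V W)"
  shows "(\<lambda>\<phi>. s \<phi> + t \<phi>) \<in> carrier (alg_tensor V W)"
proof -
  obtain N v w where 1: "\<forall>k<N. v k \<in> carrier V \<and> w k \<in> carrier W"
    "s = (\<lambda>\<phi>. \<Sum>k<(N::nat). elem_tensor V W (v k) (w k) \<phi>)"
    using assms(1) unfolding alg_tensor_carrier by auto
  obtain M v' w' where 2: "\<forall>k<M. v' k \<in> carrier V \<and> w' k \<in> carrier W"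
    "t = (\<lambda>\<phi>. \<Sum>k<(M::nat). elem_tensor V W (v' k) (w' k) \<phi>)"
    using assms(2) unfolding alg_tensor_carrier by auto
  show ?thesis
    unfolding alg_tensor_carrier
    by (rule exI[of _ "N + M"], rule exI[of _ "\<lambda>k. if k < N then v k else v' (k - N)"],
        rule exI[of _ "\<lambda>k. if k < N then w k else w' (k - N)"])
      (use 1 2 in \<open>auto simp: sum_lessThan_add\<close>)
qed

lemma abelian_monoid_alg_tensor: "abelian_monoid (alg_tensor V W)"
proof (rule abelian_monoidI)
  show "\<zero>\<^bsub>alg_tensor V W\<^esub> \<in> carrier (alg_tensor V W)"
    unfolding alg_tensor_carrier alg_tensor_simps by (rule exI[of _ 0]) auto
qed (auto simp: alg_tensor_simps alg_tensor_add add_ac)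

lemma proj_tensor_simps:
  "carrier (proj_tensor V W) = carrier (alg_tensor V W)"
  "s \<oplus>\<^bsub>proj_tensor V W\<^esub> t = (\<lambda>\<phi>. s \<phi> + t \<phi>)" "c \<odot>\<^bsub>proj_tensor V W\<^esub> s = (\<lambda>\<phi>. c * s \<phi>)"
  by (simp_all add: proj_tensor_def alg_tensor_def)

section \<open>Tensors with a function space, and modules on which an algebra acts through its
  characters\<close>

context fun_space
begin

lemma elem_tensor_scale:
  assumes "a \<in> carrier A" "f \<in> C"
  shows "(\<lambda>\<phi>. c * elem_tensor A V a f \<phi>) = elem_tensor A V a (\<lambda>x. c * f x)"
proof
  fix \<phi>
  have "\<phi> a (\<lambda>x. c * f x) = c * \<phi> a f" if "\<phi> \<in> bilinear_forms A V"
    using that assms by (auto simp: bilinear_forms_def linear_map_def sup_space_simps complex_opspace_def)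
  then show "c * elem_tensor A V a f \<phi> = elem_tensor A V a (\<lambda>x. c * f x) \<phi>"
    by (auto simp: elem_tensor_def)
qed

lemma elem_tensor_zero:
  assumes "a \<in> carrier A" shows "elem_tensor A V a (\<lambda>_. 0) = (\<lambda>_. 0)"
  using elem_tensor_scale[OF assms zero_in, of 0] by simp

lemma mat_sandwich_tensor:
  assumes "\<And>k l. k < n \<Longrightarrow> l < n \<Longrightarrow> v k l \<in> carrier A" "\<And>k l. k < n \<Longrightarrow> l < n \<Longrightarrow> w k l \<in> C"
  shows "mat_sandwich (alg_tensor A V) n \<alpha> (\<lambda>k l. elem_tensor A V (v k l) (w k l)) \<beta> i j
    = (\<lambda>\<phi>. \<Sum>p\<in>{..<n} \<times> {..<n}. (\<alpha> i (fst p) * \<beta> (snd p) j) * elem_tensor A V (v (fst p) (snd p)) (w (fst p) (snd p)) \<phi>)"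
  unfolding mat_sandwich_def
proof (subst finsum_pointwise[OF abelian_monoid_alg_tensor])
  fix p assume p: "p \<in> {..<n} \<times> {..<n}"
  then have *: "v (fst p) (snd p) \<in> carrier A" "w (fst p) (snd p) \<in> C" using assms by auto
  show "(\<alpha> i (fst p) * \<beta> (snd p) j) \<odot>\<^bsub>alg_tensor A V\<^esub> elem_tensor A V (v (fst p) (snd p)) (w (fst p) (snd p))
      \<in> carrier (alg_tensor A V)"
    unfolding alg_tensor_simps elem_tensor_scale[OF *]
    by (rule elem_tensor_in) (use * scale_in in \<open>auto simp: sup_space_simps\<close>)
qed (simp_all add: alg_tensor_simps)

text \<open>The index encodes a pair of numbers below \<open>M\<close>. The bracket keeps the
  diagonal pairs that satisfy \<open>P\<close>.\<close>

lemma sum_filter_div: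
  "(\<Sum>k<M * M. (if k div M = k mod M \<and> P (k div M) then 1 else 0) * g k) = (\<Sum>a<M. if P a then g (a * M + a) else 0)"
  for g :: "nat \<Rightarrow> complex"
proof -
  have "(\<Sum>k<M * M. (if k div M = k mod M \<and> P (k div M) then 1 else 0) * g k)
    = (\<Sum>a<M. \<Sum>b<M. (if (a * M + b) div M = (a * M + b) mod M \<and> P ((a * M + b) div M) then 1 else 0) * g (a * M + b))"
    by (rule sum_div_mod)
  also have "\<dots> = (\<Sum>a<M. if P a then g (a * M + a) else 0)"
  proof (rule sum.cong[OF refl])
    fix a assume a: "a \<in> {..<M}"
    have "(\<Sum>b<M. (if (a * M + b) div M = (a * M + b) mod M \<and> P ((a * M + b) div M) then 1 else 0) * g (a * M + b))
      = (\<Sum>b<M. if b = a then (if P a then g (a * M + a) else 0) else 0)"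
      by (rule sum.cong[OF refl]) auto
    also have "\<dots> = (if P a then g (a * M + a) else 0)" using a by simp
    finally show "(\<Sum>b<M. (if (a * M + b) div M = (a * M + b) mod M \<and> P ((a * M + b) div M) then 1 else 0) * g (a * M + b))
      = (if P a then g (a * M + a) else 0)" .
  qed
  finally show ?thesis .
qed

text \<open>
  The representations over which the infimum in the projective norm is taken exist: list all
  elementary tensors occurring in the entries of \<open>u\<close> on the diagonals of \<open>v\<close> and \<open>w\<close>, and let
  \<open>\<alpha>\<close> and \<open>\<beta>\<close> select the row and the column of each of them.
\<close>

lemma proj_tensor_representation:
  assumes u: "\<And>i j. i < n \<Longrightarrow> j < n \<Longrightarrow> u i j \<in> carrier (alg_tensor A V)" and a0: "a0 \<in> carrier A"
  obtains M \<alpha> v w \<beta> where "0 < M" "v \<in> mats A M" "w \<in> mats V M"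
    "\<And>i j. i < n \<Longrightarrow> j < n \<Longrightarrow> u i j = mat_sandwich (alg_tensor A V) (M * M) \<alpha>
       (\<lambda>k l. elem_tensor A V (v (k div M) (l div M)) (w (k mod M) (l mod M))) \<beta> i j"
proof -
  define Q where "Q = (\<lambda>i j N y z. (\<forall>k<(N::nat). y k \<in> carrier A \<and> z k \<in> C) \<and>
    u i j = (\<lambda>\<phi>. \<Sum>k<N. elem_tensor A V (y k) (z k) \<phi>))"
  have "\<exists>N y z. Q i j N y z" if "i < n" "j < n" for i j
    using u[OF that] unfolding alg_tensor_carrier Q_def sup_space_simps(1) .
  then obtain N y z where "\<And>i j. i < n \<Longrightarrow> j < n \<Longrightarrow> Q i j (N i j) (y i j) (z i j)" by metis
  then have yz: "\<And>i j k. i < n \<Longrightarrow> j < n \<Longrightarrow> k < N i j \<Longrightarrow> y i j k \<in> carrier A \<and> z i j k \<in> C"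
    and ueq: "\<And>i j. i < n \<Longrightarrow> j < n \<Longrightarrow> u i j = (\<lambda>\<phi>. \<Sum>k<N i j. elem_tensor A V (y i j k) (z i j k) \<phi>)"
    by (auto simp: Q_def)
  define I where "I = (SIGMA p : {..<n} \<times> {..<n}. {..<N (fst p) (snd p)})"
  have finI: "finite I" by (auto simp: I_def)
  define L where "L = card I"
  obtain b where b: "bij_betw b {..<L} I"
    using ex_bij_betw_nat_finite[OF finI] by (auto simp: L_def atLeast0LessThan)
  \<comment> \<open>One spare index makes \<open>M\<close> positive even if no elementary tensor
    occurs.\<close>
  define M where "M = Suc L"
  \<comment> \<open>The spare index gets the row \<open>n\<close>, which does not exist, so it is
    never selected.\<close>
  define row where "row = (\<lambda>t. if t < L then fst (fst (b t)) else n)"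
  define col where "col = (\<lambda>t. if t < L then snd (fst (b t)) else n)"
  define tv where "tv = (\<lambda>t. if t < L then y (row t) (col t) (snd (b t)) else a0)"
  define tw where "tw = (\<lambda>t. if t < L then z (row t) (col t) (snd (b t)) else (\<lambda>_. 0))"
  have bt: "row t < n" "col t < n" "snd (b t) < N (row t) (col t)" if "t < L" for t
    using bij_betw_apply[OF b, of t] that by (auto simp: I_def row_def col_def)
  have tv: "tv t \<in> carrier A" and tw: "tw t \<in> C" for t
    using yz bt a0 zero_in by (auto simp: tv_def tw_def)
  \<comment> \<open>Off the diagonal the tensors vanish because of the entries of \<open>w\<close>;
    for \<open>v\<close> any element of the carrier will do as a filler.\<close>
  define v where "v = (\<lambda>s t. if s = t then tv t else a0)"
  define w where "w = (\<lambda>s t. if s = t then tw t else (\<lambda>_. 0))"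
  define \<alpha> where "\<alpha> = (\<lambda>i k. if k div M = k mod M \<and> row (k div M) = i then 1 else 0 :: complex)"
  define \<beta> where "\<beta> = (\<lambda>k j. if k div M = k mod M \<and> col (k div M) = j then 1 else 0 :: complex)"
  have vA: "v s t \<in> carrier A" and wC: "w s t \<in> C" for s t
    using tv tw a0 zero_in by (auto simp: v_def w_def)
  show ?thesis
  proof (rule that[of M v w])
    show "0 < M" by (simp add: M_def)
    show "v \<in> mats A M" "w \<in> mats V M" using vA wC by (auto simp: mats_def sup_space_simps)
    fix i j assume ij: "i < n" "j < n"
    show "u i j = mat_sandwich (alg_tensor A V) (M * M) \<alpha>
       (\<lambda>k l. elem_tensor A V (v (k div M) (l div M)) (w (k mod M) (l mod M))) \<beta> i j"
    proof (subst mat_sandwich_tensor)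
      show "u i j = (\<lambda>\<phi>. \<Sum>p\<in>{..<M * M} \<times> {..<M * M}. (\<alpha> i (fst p) * \<beta> (snd p) j) *
        elem_tensor A V (v (fst p div M) (snd p div M)) (w (fst p mod M) (snd p mod M)) \<phi>)"
      proof
        fix \<phi>
        define T where "T = (\<lambda>k l. elem_tensor A V (v (k div M) (l div M)) (w (k mod M) (l mod M)) \<phi>)"
        have Tdiag: "T (a * M + a) (c * M + c) = (if a = c then elem_tensor A V (tv a) (tw a) \<phi> else 0)"
          if "a < M" "c < M" for a c
          using that elem_tensor_zero[OF a0] by (simp add: T_def v_def w_def)
        have "(\<Sum>p\<in>{..<M * M} \<times> {..<M * M}. (\<alpha> i (fst p) * \<beta> (snd p) j) * T (fst p) (snd p))
          = (\<Sum>k<M * M. \<Sum>l<M * M. \<alpha> i k * (\<beta> l j * T k l))"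
          by (simp add: sum.cartesian_product case_prod_unfold mult.assoc)
        also have "\<dots> = (\<Sum>k<M * M. \<alpha> i k * (\<Sum>l<M * M. \<beta> l j * T k l))"
          by (simp add: sum_distrib_left)
        also have "\<dots> = (\<Sum>a<M. if row a = i then (\<Sum>l<M * M. \<beta> l j * T (a * M + a) l) else 0)"
          unfolding \<alpha>_def by (rule sum_filter_div)
        also have "\<dots> = (\<Sum>a<M. if row a = i then (\<Sum>c<M. if col c = j then T (a * M + a) (c * M + c) else 0) else 0)"
          by (simp only: \<beta>_def sum_filter_div[where P = "\<lambda>c. col c = j"])
        also have "\<dots> = (\<Sum>a<M. if row a = i \<and> col a = j then elem_tensor A V (tv a) (tw a) \<phi> else 0)"
        proof (rule sum.cong[OF refl])
          fix a assume a: "a \<in> {..<M}"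
          have "(\<Sum>c<M. if col c = j then T (a * M + a) (c * M + c) else 0)
            = (\<Sum>c<M. if c = a then (if col a = j then elem_tensor A V (tv a) (tw a) \<phi> else 0) else 0)"
            by (rule sum.cong[OF refl]) (use a Tdiag in auto)
          also have "\<dots> = (if col a = j then elem_tensor A V (tv a) (tw a) \<phi> else 0)" using a by simp
          finally show "(if row a = i then (\<Sum>c<M. if col c = j then T (a * M + a) (c * M + c) else 0) else 0)
            = (if row a = i \<and> col a = j then elem_tensor A V (tv a) (tw a) \<phi> else 0)" by simp
        qed
        also have "\<dots> = (\<Sum>a<L. if row a = i \<and> col a = j then elem_tensor A V (tv a) (tw a) \<phi> else 0)"
          using ij by (simp add: M_def row_def)
        also have "\<dots> = (\<Sum>a<L. if fst (b a) = (i, j) then elem_tensor A V (y i j (snd (b a))) (z i j (snd (b a))) \<phi> else 0)"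
          by (rule sum.cong[OF refl]) (auto simp: row_def col_def tv_def tw_def prod_eq_iff)
        also have "\<dots> = (\<Sum>q\<in>I. if fst q = (i, j) then elem_tensor A V (y i j (snd q)) (z i j (snd q)) \<phi> else 0)"
          by (rule sum.reindex_bij_betw[OF b])
        also have "\<dots> = (\<Sum>q\<in>(\<lambda>k. ((i, j), k)) ` {..<N i j}. elem_tensor A V (y i j (snd q)) (z i j (snd q)) \<phi>)"
          by (rule sum.mono_neutral_cong_right[OF finI]) (use ij in \<open>auto simp: I_def\<close>)
        also have "\<dots> = (\<Sum>k<N i j. elem_tensor A V (y i j k) (z i j k) \<phi>)"
          by (subst sum.reindex) (auto simp: inj_on_def)
        also have "\<dots> = u i j \<phi>" by (simp add: ueq[OF ij])
        finally show "u i j \<phi> = (\<Sum>p\<in>{..<M * M} \<times> {..<M * M}. (\<alpha> i (fst p) * \<beta> (snd p) j) *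
          elem_tensor A V (v (fst p div M) (snd p div M)) (w (fst p mod M) (snd p mod M)) \<phi>)"
          by (simp add: T_def)
      qed
    qed (simp_all add: vA wC)
  qed
qed

text \<open>The algebra acts at \<open>x\<close> through the character \<open>ch x\<close>, which
  \<open>bound\<close> makes completely contractive. As tensors are functionals on bilinear forms,
  the linearised action at \<open>x\<close> is evaluation at one bilinear form. Each representation
  of a tensor matrix then bounds the action by the estimates for Kronecker products and for \<alpha>
  c \<beta>.\<close>

lemma pointwise_cb_left_module:
  fixes A :: "('a, 'm) opspace_scheme" and ch :: "'i \<Rightarrow> 'a \<Rightarrow> complex"
  assumes ne: "carrier A \<noteq> {}"
    and act: "\<And>a f. a \<in> carrier A \<Longrightarrow> f \<in> C \<Longrightarrow> (\<lambda>x. ch x a * f x) \<in> C"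
    and add: "\<And>x a b. a \<in> carrier A \<Longrightarrow> b \<in> carrier A \<Longrightarrow> ch x (a \<oplus>\<^bsub>A\<^esub> b) = ch x a + ch x b"
    and scale: "\<And>x c a. a \<in> carrier A \<Longrightarrow> ch x (c \<odot>\<^bsub>A\<^esub> a) = c * ch x a"
    and mult: "\<And>x a b. a \<in> carrier A \<Longrightarrow> b \<in> carrier A \<Longrightarrow> ch x (a \<otimes>\<^bsub>A\<^esub> b) = ch x a * ch x b"
    and bound: "\<And>x n v. x \<in> J \<Longrightarrow> 0 < n \<Longrightarrow> v \<in> mats A n \<Longrightarrow> scalar_norm n n (\<lambda>k l. ch x (v k l)) \<le> mnorm A n v"
  shows "cb_left_module A V (\<lambda>a f x. ch x a * f x)"
proof -
  let ?act = "\<lambda>a f x. ch x a * f x"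
  define \<phi> where "\<phi> = (\<lambda>x a f. ch x a * (f x :: complex))"
  have \<phi>: "\<phi> x \<in> bilinear_forms A V" for x
    by (auto simp: bilinear_forms_def linear_map_def complex_opspace_def \<phi>_def sup_space_simps add scale algebra_simps)
  have et: "elem_tensor A V a f (\<phi> x) = ch x a * f x" for a f x
    by (simp add: elem_tensor_def \<phi>) (simp add: \<phi>_def)
  define \<Phi> where "\<Phi> = (\<lambda>u x. u (\<phi> x) :: complex)"
  have \<Phi>C: "\<Phi> u \<in> C" if u: "u \<in> carrier (alg_tensor A V)" for u
  proof -
    obtain N v w where 1: "\<forall>k<N. v k \<in> carrier A \<and> w k \<in> carrier V"
      "u = (\<lambda>\<phi>. \<Sum>k<(N::nat). elem_tensor A V (v k) (w k) \<phi>)"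
      using u unfolding alg_tensor_carrier by auto
    have "\<Phi> u = (\<lambda>x. \<Sum>k<N. ch x (v k) * w k x)" by (simp add: \<Phi>_def 1(2) et)
    then show ?thesis using 1(1) by (auto intro!: sum_in act simp: sup_space_simps)
  qed
  have "completely_bounded (proj_tensor A V) V \<Phi>"
    unfolding completely_bounded_def
  proof (intro conjI exI[of _ 1] allI impI ballI)
    show "linear_map (proj_tensor A V) V \<Phi>"
      by (auto simp: linear_map_def proj_tensor_simps sup_space_simps \<Phi>C) (auto simp: \<Phi>_def)
  next
    fix n u assume n: "0 < (n::nat)" and u: "u \<in> mats (proj_tensor A V) n"
    have uc: "u i j \<in> carrier (alg_tensor A V)" if "i < n" "j < n" for i j
      using u that by (simp add: mats_def proj_tensor_simps)
    define S where "S = {scalar_norm n (p * q) \<alpha> * mnorm A p v * mnorm V q w * scalar_norm (p * q) n \<beta>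
             | p q \<alpha> v w \<beta>.
             0 < p \<and> 0 < q \<and> v \<in> mats A p \<and> w \<in> mats V q \<and>
             (\<forall>i<n. \<forall>j<n. u i j =
                mat_sandwich (alg_tensor A V) (p * q) \<alpha>
                  (\<lambda>k l. elem_tensor A V (v (k div q) (l div q)) (w (k mod q) (l mod q))) \<beta> i j)}"
    have eq: "mnorm (proj_tensor A V) n u = Inf S" by (simp add: proj_tensor_def S_def)
    \<comment> \<open>A real infimum is controlled from below only over a nonempty set.\<close>
    have "S \<noteq> {}"
    proof -
      obtain a0 where a0: "a0 \<in> carrier A" using ne by blast
      show ?thesis
      proof (rule proj_tensor_representation[OF uc a0])
        fix M \<alpha> v w \<beta>
        assume *: "0 < M" "v \<in> mats A M" "w \<in> mats V M"
          "\<And>i j. i < n \<Longrightarrow> j < n \<Longrightarrow> u i j = mat_sandwich (alg_tensor A V) (M * M) \<alpha>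
           (\<lambda>k l. elem_tensor A V (v (k div M) (l div M)) (w (k mod M) (l mod M))) \<beta> i j"
        then have "scalar_norm n (M * M) \<alpha> * mnorm A M v * mnorm V M w * scalar_norm (M * M) n \<beta> \<in> S"
          unfolding S_def by blast
        then show ?thesis by blast
      qed
    qed
    moreover have "mnorm V n (\<lambda>i j. \<Phi> (u i j)) \<le> r" if rS: "r \<in> S" for r
    proof -
      obtain p q \<alpha> v w \<beta> where r: "r = scalar_norm n (p * q) \<alpha> * mnorm A p v * mnorm V q w * scalar_norm (p * q) n \<beta>"
        and pq: "0 < p" "0 < q" and v: "v \<in> mats A p" and w: "w \<in> mats V q"
        and ueq: "\<And>i j. i < n \<Longrightarrow> j < n \<Longrightarrow> u i j =
                mat_sandwich (alg_tensor A V) (p * q) \<alpha>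
                  (\<lambda>k l. elem_tensor A V (v (k div q) (l div q)) (w (k mod q) (l mod q))) \<beta> i j"
        using rS unfolding S_def by blast
      have vA: "v (k div q) (l div q) \<in> carrier A" if "k < p * q" "l < p * q" for k l
        using v that by (auto simp: mats_def less_mult_imp_div_less)
      have wC: "w (k mod q) (l mod q) \<in> C" for k l
        using w pq by (auto simp: mats_def sup_space_simps)
      show ?thesis
      proof (rule mnorm_least)
        fix x assume x: "x \<in> J"
        let ?c = "\<lambda>k l. ch x (v (k div q) (l div q)) * w (k mod q) (l mod q) x"
        have "scalar_norm n n (\<lambda>i j. \<Phi> (u i j) x) = scalar_norm n n (\<lambda>i j. \<Sum>d\<in>{..<p * q} \<times> {..<p * q}.
            (\<alpha> i (fst d) * \<beta> (snd d) j) * ?c (fst d) (snd d))"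
        proof (rule scalar_norm_cong)
          fix i j assume ij: "i < n" "j < n"
          show "\<Phi> (u i j) x = (\<Sum>d\<in>{..<p * q} \<times> {..<p * q}. (\<alpha> i (fst d) * \<beta> (snd d) j) * ?c (fst d) (snd d))"
            unfolding \<Phi>_def ueq[OF ij]
            by (subst mat_sandwich_tensor) (simp_all add: vA wC et)
        qed
        also have "\<dots> \<le> scalar_norm n (p * q) \<alpha> * scalar_norm (p * q) (p * q) ?c * scalar_norm (p * q) n \<beta>"
          by (rule scalar_norm_sandwich)
        also have "\<dots> \<le> scalar_norm n (p * q) \<alpha> * (mnorm A p v * mnorm V q w) * scalar_norm (p * q) n \<beta>"
        proof (intro mult_right_mono mult_left_mono scalar_norm_nonneg)
          have "scalar_norm (p * q) (p * q) ?c \<le> scalar_norm p p (\<lambda>k l. ch x (v k l)) * scalar_norm q q (\<lambda>k l. w k l x)"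
            by (rule scalar_norm_kron[OF pq(2)])
          also have "\<dots> \<le> mnorm A p v * mnorm V q w"
            by (intro mult_mono bound mnorm_upper x pq v w scalar_norm_nonneg
                order_trans[OF scalar_norm_nonneg bound[OF x pq(1) v]])
          finally show "scalar_norm (p * q) (p * q) ?c \<le> mnorm A p v * mnorm V q w" .
        qed
        finally show "scalar_norm n n (\<lambda>i j. \<Phi> (u i j) x) \<le> r" by (simp add: r mult.assoc)
      qed
    qed
    ultimately have "mnorm V n (\<lambda>i j. \<Phi> (u i j)) \<le> Inf S" by (rule cInf_greatest)
    then show "mnorm V n (\<lambda>i j. \<Phi> (u i j)) \<le> 1 * mnorm (proj_tensor A V) n u" by (simp add: eq)
  qed
  moreover have "\<Phi> (elem_tensor A V a f) = ?act a f" for a f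
    by (simp add: \<Phi>_def et)
  ultimately show ?thesis
    unfolding cb_left_module_def
    by (intro conjI operator_space_V exI[of _ \<Phi>])
      (auto simp: linear_map_def sup_space_simps act add scale mult distrib_left distrib_right mult.assoc mult.left_commute)
qed

end

section \<open>Elements of norm one and small trace\<close>

lemma l2_vanishes_at_infinity:
  assumes "\<xi> \<in> l2 I" "0 < e" shows "finite {x. e \<le> cmod (\<xi> x)}"
proof -
  obtain Y where Y: "finite Y" "l2_norm (\<lambda>x. \<xi> x - l2_trunc Y \<xi> x) < e"
    by (rule l2_trunc_approx[OF assms])
  have "cmod (\<xi> x) < e" if "x \<notin> Y" for x
    using l2_coord_le[OF l2_diff[OF assms(1) l2_trunc_in[OF assms(1), of Y]], of x] Y(2) that
    by (simp add: l2_trunc_def)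
  then have "{x. e \<le> cmod (\<xi> x)} \<subseteq> Y" by force
  then show ?thesis using Y(1) finite_subset by blast
qed

section \<open>Normalised convolution operators on a countable subgroup\<close>

context group
begin

text \<open>Countability is wanted because only a countable set carries a summable weight that is
  positive everywhere on it.\<close>

lemma countable_infinite_subgroup:
  assumes "infinite (carrier G)"
  obtains \<Gamma> where "subgroup \<Gamma> G" "countable \<Gamma>" "infinite \<Gamma>"
proof -
  obtain g :: "nat \<Rightarrow> 'a" where g: "inj g" "range g \<subseteq> carrier G"
    using infinite_countable_subset[OF assms] by blast
  define F where "F = (\<lambda>S. S \<union> (\<lambda>x. inv x) ` S \<union> (\<lambda>(x, y). x \<otimes> y) ` (S \<times> S))"
  define S where "S = (\<lambda>n. (F ^^ n) (insert \<one> (range g)))"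
  have Suc: "S (Suc n) = F (S n)" for n by (simp add: S_def)
  have cnt: "countable (S n)" for n
    by (induction n) (simp add: S_def, auto simp: Suc F_def intro!: countable_SIGMA)
  have car: "S n \<subseteq> carrier G" for n
    by (induction n) (use g(2) in \<open>force simp: S_def\<close>, auto simp: Suc F_def)
  have mono: "S m \<subseteq> S n" if "m \<le> n" for m n
    using that by (induction rule: dec_induct) (auto simp: Suc F_def)
  define \<Gamma> where "\<Gamma> = (\<Union>n. S n)"
  have "subgroup \<Gamma> G"
  proof
    show "\<Gamma> \<subseteq> carrier G" using car by (auto simp: \<Gamma>_def)
    show "\<one> \<in> \<Gamma>" unfolding \<Gamma>_def by (rule UN_I[of 0]) (simp_all add: S_def)
  next
    fix x y assume "x \<in> \<Gamma>" "y \<in> \<Gamma>"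
    then obtain m n where "x \<in> S m" "y \<in> S n" by (auto simp: \<Gamma>_def)
    then have "x \<in> S (max m n)" "y \<in> S (max m n)" using mono[of m "max m n"] mono[of n "max m n"] by auto
    then have "x \<otimes> y \<in> S (Suc (max m n))" by (force simp: Suc F_def)
    then show "x \<otimes> y \<in> \<Gamma>" by (auto simp: \<Gamma>_def)
  next
    fix x assume "x \<in> \<Gamma>"
    then obtain m where "x \<in> S m" by (auto simp: \<Gamma>_def)
    then have "inv x \<in> S (Suc m)" by (simp add: Suc F_def)
    then show "inv x \<in> \<Gamma>" by (auto simp: \<Gamma>_def)
  qed
  moreover have "countable \<Gamma>" using cnt by (auto simp: \<Gamma>_def)
  moreover have "range g \<subseteq> \<Gamma>"
  proof (rule subset_trans)
    show "range g \<subseteq> S 0" by (auto simp: S_def)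
    show "S 0 \<subseteq> \<Gamma>" by (auto simp: \<Gamma>_def)
  qed
  then have "infinite \<Gamma>" using range_inj_infinite[OF g(1)] finite_subset by blast
  ultimately show ?thesis by (rule that)
qed

text \<open>Geometric weights along an enumeration, made symmetric by adding the weight of the
  inverse. Symmetry will make the convolution self-adjoint, and positivity on all of \<Gamma> will
  make it irreducible there.\<close>

lemma symmetric_weight:
  assumes \<Gamma>: "subgroup \<Gamma> G" "countable \<Gamma>"
  obtains f :: "'a \<Rightarrow> real" where "f summable_on UNIV" "\<And>s. s \<in> \<Gamma> \<Longrightarrow> 0 < f s" "\<And>s. s \<notin> \<Gamma> \<Longrightarrow> f s = 0"
    "\<And>s. s \<in> \<Gamma> \<Longrightarrow> f (inv s) = f s"
proof -
  define e where "e = to_nat_on \<Gamma>"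
  have e: "inj_on e \<Gamma>" unfolding e_def by (rule inj_on_to_nat_on[OF \<Gamma>(2)])
  define g where "g = (\<lambda>s. if s \<in> \<Gamma> then (1 / 2 :: real) ^ e s else 0)"
  define f where "f = (\<lambda>s. if s \<in> \<Gamma> then g s + g (inv s) else 0)"
  have "(\<lambda>n. (1 / 2 :: real) ^ n) summable_on UNIV"
    by (rule summable_nonneg_imp_summable_on) (auto intro: summable_geometric)
  then have "(\<lambda>n. (1 / 2 :: real) ^ n) summable_on (e ` \<Gamma>)" by (rule summable_on_subset_banach) simp
  then have sg: "(\<lambda>s. (1 / 2 :: real) ^ e s) summable_on \<Gamma>"
    using summable_on_reindex[OF e, of "\<lambda>n. (1 / 2 :: real) ^ n"] by (simp add: o_def)
  have inv\<Gamma>: "inv s \<in> \<Gamma>" if "s \<in> \<Gamma>" for s using subgroup.m_inv_closed[OF \<Gamma>(1) that] .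
  have car: "s \<in> carrier G" if "s \<in> \<Gamma>" for s using subgroup.mem_carrier[OF \<Gamma>(1) that] .
  have bij: "bij_betw (\<lambda>s. inv s) \<Gamma> \<Gamma>"
    by (rule bij_betwI[of _ _ _ "\<lambda>s. inv s"]) (use inv\<Gamma> car in auto)
  have si: "(\<lambda>s. (1 / 2 :: real) ^ e (inv s)) summable_on \<Gamma>"
    using summable_on_reindex_bij_betw[OF bij, of "\<lambda>s. (1 / 2 :: real) ^ e s"] sg by simp
  have "(\<lambda>s. (1 / 2 :: real) ^ e s + (1 / 2 :: real) ^ e (inv s)) summable_on \<Gamma>"
    by (rule summable_on_add[OF sg si])
  then have "((\<lambda>s. (1 / 2 :: real) ^ e s + (1 / 2 :: real) ^ e (inv s)) has_sum
      infsum (\<lambda>s. (1 / 2 :: real) ^ e s + (1 / 2 :: real) ^ e (inv s)) \<Gamma>) \<Gamma>" by (rule has_sum_infsum)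
  then have "(f has_sum infsum (\<lambda>s. (1 / 2 :: real) ^ e s + (1 / 2 :: real) ^ e (inv s)) \<Gamma>) UNIV"
    by (rule has_sum_extend_zero) (auto simp: f_def g_def inv\<Gamma>)
  then have "f summable_on UNIV" by (rule has_sum_imp_summable)
  then show ?thesis
    by (rule that) (auto simp: f_def g_def inv\<Gamma> car add_pos_pos)
qed

text \<open>The operator is the sum of f(s) \<lambda>(s), defined through its form, self-adjoint
  because f is symmetric, and divided by its norm. The pointwise formula is kept because the
  positivity arguments need it.\<close>

lemma convolution_operator:
  assumes \<Gamma>: "subgroup \<Gamma> G" "countable \<Gamma>"
  obtains h and k :: "'a \<Rightarrow> real" where "h \<in> VNs"
    "\<And>\<xi> \<eta>. \<xi> \<in> l2 (carrier G) \<Longrightarrow> \<eta> \<in> l2 (carrier G) \<Longrightarrow> l2_inner (h \<xi>) \<eta> = l2_inner \<xi> (h \<eta>)"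
    "\<And>\<xi>. \<xi> \<in> l2 (carrier G) \<Longrightarrow> l2_norm (h \<xi>) \<le> l2_norm \<xi>"
    "\<And>t. t < 1 \<Longrightarrow> \<exists>\<xi>\<in>l2 (carrier G). l2_norm \<xi> = 1 \<and> t < l2_norm (h \<xi>)"
    "\<And>\<xi> x. \<xi> \<in> l2 (carrier G) \<Longrightarrow> x \<in> carrier G \<Longrightarrow>
       ((\<lambda>s. complex_of_real (k s) * \<xi> (inv s \<otimes> x)) has_sum h \<xi> x) UNIV"
    "\<And>s. s \<in> \<Gamma> \<Longrightarrow> 0 < k s" "\<And>s. s \<notin> \<Gamma> \<Longrightarrow> k s = 0" "k summable_on UNIV"
proof -
  obtain f :: "'a \<Rightarrow> real" where f: "f summable_on UNIV" "\<And>s. s \<in> \<Gamma> \<Longrightarrow> 0 < f s" "\<And>s. s \<notin> \<Gamma> \<Longrightarrow> f s = 0"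
    "\<And>s. s \<in> \<Gamma> \<Longrightarrow> f (inv s) = f s"
    by (rule symmetric_weight[OF \<Gamma>]) (rule that)
  have f0: "0 \<le> f s" for s using f(2,3)[of s] by (cases "s \<in> \<Gamma>") auto
  have car: "s \<in> carrier G" if "s \<in> \<Gamma>" for s using subgroup.mem_carrier[OF \<Gamma>(1) that] .
  have inv\<Gamma>: "inv s \<in> \<Gamma>" if "s \<in> \<Gamma>" for s using subgroup.m_inv_closed[OF \<Gamma>(1) that] .
  let ?L = "l2 (carrier G)"
  let ?t = "\<lambda>\<xi> \<eta> s. complex_of_real (f s) * l2_inner (lr s \<xi>) \<eta>"
  define F where "F = infsum f UNIV"
  have F0: "0 \<le> F" unfolding F_def by (rule infsum_nonneg) (rule f0)
  have tb: "cmod (?t \<xi> \<eta> s) \<le> f s * (l2_norm \<xi> * l2_norm \<eta>)" if "\<xi> \<in> ?L" "\<eta> \<in> ?L" for \<xi> \<eta> s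
  proof (cases "s \<in> \<Gamma>")
    case True
    have "cmod (l2_inner (lr s \<xi>) \<eta>) \<le> l2_norm (lr s \<xi>) * l2_norm \<eta>"
      by (rule l2_CS[OF lr_in(1)[OF car[OF True] that(1)] that(2)])
    then show ?thesis using f0[of s] that by (simp add: norm_mult lr_in[OF car[OF True]] mult_left_mono)
  qed (simp add: f(3))
  have fs: "(\<lambda>s. f s * c) summable_on UNIV" for c by (rule summable_on_cmult_left[OF f(1)])
  have ts: "(\<lambda>s. cmod (?t \<xi> \<eta> s)) summable_on UNIV" if "\<xi> \<in> ?L" "\<eta> \<in> ?L" for \<xi> \<eta>
    by (rule summable_on_comparison_test[OF fs]) (use tb[OF that] in auto)
  define B where "B = (\<lambda>\<xi> \<eta>. infsum (?t \<xi> \<eta>) UNIV)"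
  have hs: "(?t \<xi> \<eta> has_sum B \<xi> \<eta>) UNIV" if "\<xi> \<in> ?L" "\<eta> \<in> ?L" for \<xi> \<eta>
    unfolding B_def by (rule has_sum_infsum[OF abs_summable_summable[OF ts[OF that]]])
  have Bb: "cmod (B \<xi> \<eta>) \<le> F * l2_norm \<xi> * l2_norm \<eta>" if "\<xi> \<in> ?L" "\<eta> \<in> ?L" for \<xi> \<eta>
  proof -
    have "cmod (B \<xi> \<eta>) \<le> (\<Sum>\<^sub>\<infinity>s. cmod (?t \<xi> \<eta> s))"
      unfolding B_def by (rule norm_infsum_bound[OF ts[OF that]])
    also have "\<dots> \<le> (\<Sum>\<^sub>\<infinity>s. f s * (l2_norm \<xi> * l2_norm \<eta>))"
      by (rule infsum_mono[OF ts[OF that] fs]) (rule tb[OF that])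
    also have "\<dots> = F * (l2_norm \<xi> * l2_norm \<eta>)" unfolding F_def by (rule infsum_cmult_left') 
    finally show ?thesis by (simp add: mult.assoc)
  qed
  have "\<exists>h0. h0 \<in> bounded_ops (carrier G) \<and> (\<forall>\<xi>\<in>?L. \<forall>\<eta>\<in>?L. l2_inner (h0 \<xi>) \<eta> = B \<xi> \<eta>)"
  proof (rule form_operator[of "carrier G" B F])
    fix \<xi> \<xi>' \<eta> assume *: "\<xi> \<in> ?L" "\<xi>' \<in> ?L" "\<eta> \<in> ?L"
    have "?t (\<lambda>x. \<xi> x + \<xi>' x) \<eta> s = ?t \<xi> \<eta> s + ?t \<xi>' \<eta> s" for s
    proof (cases "s \<in> \<Gamma>")
      case True
      note c = car[OF True]
      show ?thesis
        by (simp add: bounded_ops_add[OF lr_bounded[OF c] *(1,2)] l2_inner_add_left[OF lr_in(1)[OF c *(1)] lr_in(1)[OF c *(2)] *(3)] distrib_left)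
    qed (simp add: f(3))
    then show "B (\<lambda>x. \<xi> x + \<xi>' x) \<eta> = B \<xi> \<eta> + B \<xi>' \<eta>"
      unfolding B_def using infsumI[OF has_sum_add[OF hs[OF *(1,3)] hs[OF *(2,3)]]] by (simp add: B_def)
    have "?t \<eta> (\<lambda>x. \<xi> x + \<xi>' x) s = ?t \<eta> \<xi> s + ?t \<eta> \<xi>' s" for s
    proof (cases "s \<in> \<Gamma>")
      case True
      note c = car[OF True]
      show ?thesis by (simp add: l2_inner_add_right[OF *(1,2) lr_in(1)[OF c *(3)]] distrib_left)
    qed (simp add: f(3))
    then show "B \<eta> (\<lambda>x. \<xi> x + \<xi>' x) = B \<eta> \<xi> + B \<eta> \<xi>'"
      unfolding B_def using infsumI[OF has_sum_add[OF hs[OF *(3,1)] hs[OF *(3,2)]]] by (simp add: B_def)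
  next
    fix c \<xi> \<eta> assume *: "\<xi> \<in> ?L" "\<eta> \<in> ?L"
    have "?t (\<lambda>x. c * \<xi> x) \<eta> s = c * ?t \<xi> \<eta> s" for s
      by (cases "s \<in> \<Gamma>") (simp_all add: f(3) bounded_ops_scale[OF lr_bounded[OF car] *(1)] l2_inner_scale_left)
    then show "B (\<lambda>x. c * \<xi> x) \<eta> = c * B \<xi> \<eta>" unfolding B_def by (simp only: infsum_cmult_right')
    have "?t \<eta> (\<lambda>x. c * \<xi> x) s = cnj c * ?t \<eta> \<xi> s" for s
      by (simp add: l2_inner_scale_right)
    then show "B \<eta> (\<lambda>x. c * \<xi> x) = cnj c * B \<eta> \<xi>" unfolding B_def by (simp only: infsum_cmult_right')
  next
    fix T assume "T \<in> bounded_ops (carrier G)" "\<And>\<xi> \<eta>. \<xi> \<in> ?L \<Longrightarrow> \<eta> \<in> ?L \<Longrightarrow> l2_inner (T \<xi>) \<eta> = B \<xi> \<eta>"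
    then show ?thesis by blast
  qed (use Bb F0 in auto)
  then obtain h0 where h0: "h0 \<in> bounded_ops (carrier G)" "\<And>\<xi> \<eta>. \<xi> \<in> ?L \<Longrightarrow> \<eta> \<in> ?L \<Longrightarrow> l2_inner (h0 \<xi>) \<eta> = B \<xi> \<eta>"
    by blast
  have h0V: "h0 \<in> VNs"
  proof (rule VN_innerI[OF h0(1)])
    fix R \<xi> \<eta> assume *: "R \<in> VN'" "\<xi> \<in> ?L" "\<eta> \<in> ?L"
    note b = bounded_ops_l2[OF VN'_bounded[OF *(1)]] bounded_ops_l2[OF op_adjoint_in[OF VN'_bounded[OF *(1)]]]
    have "?t (R \<xi>) \<eta> s = ?t \<xi> (op_adjoint (carrier G) R \<eta>) s" for s
      by (cases "s \<in> \<Gamma>") (simp_all add: f(3) VN_inner[OF lr_VN[OF car] *])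
    then have "B (R \<xi>) \<eta> = B \<xi> (op_adjoint (carrier G) R \<eta>)" by (simp only: B_def)
    then show "l2_inner (h0 (R \<xi>)) \<eta> = l2_inner (h0 \<xi>) (op_adjoint (carrier G) R \<eta>)"
      by (simp add: h0(2) b *)
  qed
  have bij: "bij_betw (\<lambda>s. inv s) \<Gamma> \<Gamma>"
    by (rule bij_betwI[of _ _ _ "\<lambda>s. inv s"]) (use inv\<Gamma> car in auto)
  have sa0: "l2_inner (h0 \<xi>) \<eta> = l2_inner \<xi> (h0 \<eta>)" if *: "\<xi> \<in> ?L" "\<eta> \<in> ?L" for \<xi> \<eta>
  proof -
    have "((\<lambda>s. cnj (?t \<eta> \<xi> s)) has_sum cnj (B \<eta> \<xi>)) UNIV"
      using hs[OF *(2,1)] by (simp only: has_sum_cnj_iff)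
    then have r: "((\<lambda>s. cnj (?t \<eta> \<xi> (inv s))) has_sum cnj (B \<eta> \<xi>)) \<Gamma>"
      by (subst (asm) has_sum_reindex_UNIV[OF bij]) (auto simp: f(3))
    have c: "cnj (?t \<eta> \<xi> (inv s)) = ?t \<xi> \<eta> s" if s: "s \<in> \<Gamma>" for s
      using lr_inner[OF inv_closed[OF car[OF s]] *(2,1)] car[OF s]
      by (simp add: f(4)[OF s] l2_inner_commute[of "lr s \<xi>"])
    have "(?t \<xi> \<eta> has_sum cnj (B \<eta> \<xi>)) UNIV"
      by (rule has_sum_extend_zero[OF r]) (simp_all only: c, simp add: f(3))
    then have "B \<xi> \<eta> = cnj (B \<eta> \<xi>)" by (rule has_sum_unique[OF hs[OF *]])
    then show ?thesis using h0(2)[OF *] h0(2)[OF *(2,1)] by (simp add: l2_inner_commute[of \<xi>])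
  qed
  have h0sum: "((\<lambda>s. complex_of_real (f s) * \<xi> (inv s \<otimes> x)) has_sum h0 \<xi> x) UNIV"
    if \<xi>: "\<xi> \<in> ?L" and x: "x \<in> carrier G" for \<xi> x
  proof -
    have "?t \<xi> (l2_delta x) s = complex_of_real (f s) * \<xi> (inv s \<otimes> x)" for s
      using \<xi> x by (cases "s \<in> \<Gamma>") (simp_all add: f(3) lr_eq)
    then have "?t \<xi> (l2_delta x) = (\<lambda>s. complex_of_real (f s) * \<xi> (inv s \<otimes> x))" by (rule ext)
    moreover have "h0 \<xi> x = B \<xi> (l2_delta x)" using h0(2)[OF \<xi>, of "l2_delta x"] x by simp
    ultimately show ?thesis using hs[OF \<xi> l2_delta_in[OF x]] by (simp only:)
  qed
  define N where "N = opn 1 (\<lambda>_ _. h0)"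
  have Nb: "l2_norm (h0 \<xi>) \<le> N * l2_norm \<xi>" if "\<xi> \<in> ?L" for \<xi>
    unfolding N_def by (rule op_mnorm_1_apply[OF h0(1) that])
  have one: "\<one> \<in> \<Gamma>" by (rule subgroup.one_closed[OF \<Gamma>(1)])
  \<comment> \<open>The entry at the unit is f(\<one>), which is positive, so the operator can be
    normalised.\<close>
  have N: "0 < N"
  proof -
    have "l2_inner (h0 (l2_delta \<one>)) (l2_delta \<one>) = complex_of_real (f \<one>)"
    proof -
      have "((\<lambda>s. complex_of_real (f s) * l2_delta \<one> (inv s \<otimes> \<one>)) has_sum complex_of_real (f \<one>)) UNIV"
      proof (rule has_sum_extend_zero)
        show "((\<lambda>s. complex_of_real (f s)) has_sum complex_of_real (f \<one>)) {\<one>}"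
          by (rule has_sum_finiteI) simp_all
        fix s assume "s \<notin> {\<one>}"
        then show "complex_of_real (f s) * l2_delta \<one> (inv s \<otimes> \<one>) = 0"
          using car[of s] by (cases "s \<in> \<Gamma>") (auto simp: f(3) l2_delta_def inv_eq_1_iff)
      qed (simp add: l2_delta_def)
      then show ?thesis using h0sum[of "l2_delta \<one>" \<one>] has_sum_unique by fastforce
    qed
    then have "f \<one> \<le> l2_norm (h0 (l2_delta \<one>))"
      using l2_coord_le[OF bounded_ops_l2[OF h0(1)], of "l2_delta \<one>" \<one>] f0[of \<one>] by simp
    also have "\<dots> \<le> N" using Nb[of "l2_delta \<one>"] by simp
    finally show ?thesis using f(2)[OF one] by simp
  qed
  define h where "h = (\<lambda>\<xi> x. complex_of_real (inverse N) * h0 \<xi> x)"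
  have hn: "l2_norm (h \<xi>) = l2_norm (h0 \<xi>) / N" for \<xi>
    unfolding h_def l2_norm_scale using N by (simp add: norm_inverse divide_inverse mult.commute)
  show ?thesis
  proof (rule that[of h "\<lambda>s. inverse N * f s"])
    show "h \<in> VNs" unfolding h_def by (rule VN_smult[OF h0V])
    show "l2_inner (h \<xi>) \<eta> = l2_inner \<xi> (h \<eta>)" if "\<xi> \<in> ?L" "\<eta> \<in> ?L" for \<xi> \<eta>
      unfolding h_def l2_inner_scale_left l2_inner_scale_right by (simp add: sa0[OF that])
    show "l2_norm (h \<xi>) \<le> l2_norm \<xi>" if "\<xi> \<in> ?L" for \<xi>
      using Nb[OF that] N by (simp add: hn field_simps)
    show "\<exists>\<xi>\<in>?L. l2_norm \<xi> = 1 \<and> t < l2_norm (h \<xi>)" if t: "t < 1" for t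
    proof (rule ccontr)
      assume neg: "\<not> ?thesis"
      \<comment> \<open>If the norm stayed below t' < 1 on the unit sphere, then \<open>N\<close>,
        as the least bound of \<open>h0\<close>, would be at most N t'. The maximum with 0 makes N
        t' a legitimate bound.\<close>
      define t' where "t' = max t 0"
      have t': "0 \<le> t'" "t' < 1" using t by (auto simp: t'_def)
      have "l2_norm (h0 \<xi>) \<le> (N * t') * l2_norm \<xi>" if \<xi>: "\<xi> \<in> ?L" for \<xi>
      proof (cases "l2_norm \<xi> = 0")
        case True
        then show ?thesis using Nb[OF \<xi>] by simp
      next
        case False
        define r where "r = l2_norm \<xi>"
        have r: "0 < r" using False by (simp add: r_def less_le)
        let ?y = "\<lambda>x. complex_of_real (inverse r) * \<xi> x"
        have y: "?y \<in> ?L" by (rule l2_scale[OF \<xi>])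
        have yn: "l2_norm ?y = 1" unfolding l2_norm_scale using r by (simp add: r_def[symmetric] norm_inverse)
        have "l2_norm (h ?y) \<le> t'" using neg y yn by (auto simp: t'_def not_less max_def)
        moreover have "l2_norm (h0 ?y) = inverse r * l2_norm (h0 \<xi>)"
          unfolding bounded_ops_scale[OF h0(1) \<xi>] l2_norm_scale using r by (simp add: norm_inverse)
        ultimately have "inverse r * l2_norm (h0 \<xi>) / N \<le> t'" by (simp add: hn)
        then show ?thesis using r N by (simp add: r_def[symmetric] field_simps)
      qed
      then have "N \<le> N * t'" unfolding N_def by (intro op_mnorm_1_leI h0(1)) (use N t' in \<open>auto simp: N_def\<close>)
      then show False using N t' by simp
    qed
    show "((\<lambda>s. complex_of_real (inverse N * f s) * \<xi> (inv s \<otimes> x)) has_sum h \<xi> x) UNIV"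
      if "\<xi> \<in> ?L" "x \<in> carrier G" for \<xi> x
      using has_sum_cmult_right[OF h0sum[OF that], of "complex_of_real (inverse N)"] by (simp add: h_def mult.assoc)
    show "(\<lambda>s. inverse N * f s) summable_on UNIV" by (rule summable_on_cmult_right[OF f(1)])
  qed (use f(2,3) N in auto)
qed

end

context group
begin

text \<open>
  A Perron--Frobenius argument. If \<open>\<parallel>h\<^sup>n \<delta>\<^sub>1\<parallel>\<close> does not tend to \<open>0\<close>, then the weak limit \<open>p\<close> of
  \<open>h\<^sup>2\<^sup>n \<delta>\<^sub>1\<close> is a nonzero nonnegative fixed vector of \<open>h\<^sup>2\<close>. For \<open>v = p - \<rho>(g) p\<close> the vectors
  \<open>\<bar>v\<bar> \<plusminus> v\<close> are fixed as well, and a nonnegative fixed vector with one zero on \<open>\<Gamma>\<close> vanishes on \<open>\<Gamma>\<close>.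
  Evaluating at a maximum of \<open>p\<close> gives \<open>v = 0\<close> on \<open>\<Gamma>\<close>, so that \<open>p\<close> is constant on the infinite set \<open>\<Gamma>\<close>.
\<close>

lemma convolution_powers_tendsto_0:
  fixes k :: "'a \<Rightarrow> real"
  assumes \<Gamma>: "subgroup \<Gamma> G" "infinite \<Gamma>" and h: "h \<in> VNs"
    and sa: "\<And>\<xi> \<eta>. \<xi> \<in> l2 (carrier G) \<Longrightarrow> \<eta> \<in> l2 (carrier G) \<Longrightarrow> l2_inner (h \<xi>) \<eta> = l2_inner \<xi> (h \<eta>)"
    and contr: "\<And>\<xi>. \<xi> \<in> l2 (carrier G) \<Longrightarrow> l2_norm (h \<xi>) \<le> l2_norm \<xi>"
    and hsum: "\<And>\<xi> x. \<xi> \<in> l2 (carrier G) \<Longrightarrow> x \<in> carrier G \<Longrightarrow>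
       ((\<lambda>s. complex_of_real (k s) * \<xi> (inv s \<otimes> x)) has_sum h \<xi> x) UNIV"
    and k: "\<And>s. s \<in> \<Gamma> \<Longrightarrow> 0 < k s" "\<And>s. s \<notin> \<Gamma> \<Longrightarrow> k s = 0"
  shows "(\<lambda>n. l2_norm ((h ^^ n) (l2_delta \<one>))) \<longlonglongrightarrow> 0"
proof -
  let ?L = "l2 (carrier G)"
  have car: "s \<in> carrier G" if "s \<in> \<Gamma>" for s using subgroup.mem_carrier[OF \<Gamma>(1) that] .
  have inv\<Gamma>: "inv s \<in> \<Gamma>" if "s \<in> \<Gamma>" for s using subgroup.m_inv_closed[OF \<Gamma>(1) that] .
  have mult\<Gamma>: "s \<otimes> t \<in> \<Gamma>" if "s \<in> \<Gamma>" "t \<in> \<Gamma>" for s t using subgroup.m_closed[OF \<Gamma>(1) that] .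
  have one: "\<one> \<in> \<Gamma>" by (rule subgroup.one_closed[OF \<Gamma>(1)])
  have k0: "0 \<le> k s" for s using k[of s] by (cases "s \<in> \<Gamma>") auto
  have hL: "h \<xi> \<in> ?L" if "\<xi> \<in> ?L" for \<xi> by (rule bounded_ops_l2[OF VN_bounded[OF h] that])
  \<comment> \<open>Support in \<Gamma> is part of the notion, since the weight connects only points
    of the same coset of \<Gamma>.\<close>
  define pos where "pos = (\<lambda>\<xi>. (\<forall>x. Im (\<xi> x) = 0 \<and> 0 \<le> Re (\<xi> x)) \<and> (\<forall>x. x \<notin> \<Gamma> \<longrightarrow> \<xi> x = (0 :: complex)))"
  have hRe: "((\<lambda>s. k s * Re (\<xi> (inv s \<otimes> x))) has_sum Re (h \<xi> x)) UNIV"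
    and hIm: "((\<lambda>s. k s * Im (\<xi> (inv s \<otimes> x))) has_sum Im (h \<xi> x)) UNIV"
    if "\<xi> \<in> ?L" "x \<in> carrier G" for \<xi> x
    using has_sum_Re[OF hsum[OF that]] has_sum_Im[OF hsum[OF that]] by simp_all
  have pos_h: "pos (h \<xi>)" if \<xi>: "\<xi> \<in> ?L" "pos \<xi>" for \<xi>
  proof -
    have "Im (h \<xi> x) = 0 \<and> 0 \<le> Re (h \<xi> x)" for x
    proof (cases "x \<in> carrier G")
      case True
      have "0 \<le> Re (h \<xi> x)"
        by (rule has_sum_nonneg[OF hRe[OF \<xi>(1) True]]) (use \<xi>(2) k0 in \<open>auto simp: pos_def\<close>)
      moreover have "((\<lambda>s :: 'a. 0 :: real) has_sum Im (h \<xi> x)) UNIV"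
        using hIm[OF \<xi>(1) True] \<xi>(2) by (simp add: pos_def)
      then have "Im (h \<xi> x) = 0" using has_sum_0_simp has_sum_unique by blast
      ultimately show ?thesis by simp
    qed (use l2_D[OF hL[OF \<xi>(1)]] in simp)
    moreover have "h \<xi> x = 0" if x: "x \<notin> \<Gamma>" for x
    proof (cases "x \<in> carrier G")
      case True
      have "complex_of_real (k s) * \<xi> (inv s \<otimes> x) = 0" for s
      proof (cases "s \<in> \<Gamma>")
        case s: True
        have "inv s \<otimes> x \<notin> \<Gamma>"
        proof
          assume "inv s \<otimes> x \<in> \<Gamma>"
          then have "s \<otimes> (inv s \<otimes> x) \<in> \<Gamma>" by (rule mult\<Gamma>[OF s])
          then show False using x car[OF s] True by (simp add: m_assoc[symmetric])
        qed
        then show ?thesis using \<xi>(2) by (simp add: pos_def)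
      qed (simp add: k(2))
      then have "((\<lambda>s :: 'a. 0 :: complex) has_sum h \<xi> x) UNIV" using hsum[OF \<xi>(1) True] by (simp only:)
      then show ?thesis using has_sum_0_simp has_sum_unique by blast
    qed (use l2_D[OF hL[OF \<xi>(1)]] in simp)
    ultimately show ?thesis by (simp add: pos_def)
  qed
  \<comment> \<open>The value of \<open>h q\<close> at x is a sum of nonnegative terms, and q(y)
    occurs in it with the positive weight of x y^-1.\<close>
  have zero_h: "q y = 0" if q: "q \<in> ?L" "pos q" and x: "x \<in> \<Gamma>" "h q x = 0" and y: "y \<in> \<Gamma>" for q x y
  proof -
    let ?s = "x \<otimes> inv y"
    have s: "?s \<in> \<Gamma>" by (intro mult\<Gamma> inv\<Gamma> x y)
    have "((\<lambda>s. k s * Re (q (inv s \<otimes> x))) has_sum 0) UNIV"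
      using hRe[OF q(1) car[OF x(1)]] x(2) by simp
    then have "k ?s * Re (q (inv ?s \<otimes> x)) = 0"
      by (rule nonneg_has_sum_le_0D) (use q(2) k0 in \<open>auto simp: pos_def\<close>)
    moreover have "inv ?s \<otimes> x = y"
      using car[OF x(1)] car[OF y] by (simp add: inv_mult_group m_assoc)
    ultimately have "Re (q y) = 0" using k(1)[OF s] by simp
    then show ?thesis using q(2) by (simp add: pos_def complex_eq_iff)
  qed
  have zero_fix: "q y = 0" if q: "q \<in> ?L" "pos q" "h (h q) = q" and x: "x \<in> \<Gamma>" "q x = 0" and y: "y \<in> \<Gamma>" for q x y
  proof -
    have "h (h q) x = 0" using q(3) x(2) by simp
    then have "h q x = 0" using zero_h[OF hL[OF q(1)] pos_h[OF q(1,2)] x(1)] x(1) by blast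
    then show ?thesis using zero_h[OF q(1,2) x(1)] y by blast
  qed
  define w where "w = (\<lambda>n. (h ^^ n) (l2_delta \<one>))"
  have wS: "w (Suc n) = h (w n)" for n by (simp add: w_def)
  have wL: "w n \<in> ?L" for n by (induction n) (simp add: w_def, simp add: wS hL)
  have wpos: "pos (w n)" for n
  proof (induction n)
    case 0 show ?case using one by (auto simp: w_def pos_def l2_delta_def)
  qed (simp add: wS pos_h wL)
  have shift: "l2_inner (w (m + j)) (w n) = l2_inner (w m) (w (n + j))" for m n j
  proof (induction j arbitrary: n)
    case (Suc j)
    have "l2_inner (w (m + Suc j)) (w n) = l2_inner (w (m + j)) (w (Suc n))"
      using sa[OF wL wL, of "m + j" n] by (simp add: wS)
    then show ?case using Suc[of "Suc n"] by simp
  qed simp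
  define a where "a = (\<lambda>n. (l2_norm (w n))\<^sup>2)"
  have dec: "decseq a"
    unfolding decseq_Suc_iff a_def wS by (intro allI power_mono contr wL) simp
  obtain l where l: "a \<longlonglongrightarrow> l"
    using decseq_convergent[OF dec, of 0] by (auto simp: a_def)
  have l0: "0 \<le> l" by (rule LIMSEQ_le_const[OF l]) (auto simp: a_def)
  have "l = 0"
  proof (rule ccontr)
    assume "l \<noteq> 0"
    then have lpos: "0 < l" using l0 by simp
    have wb: "l2_norm (w n) \<le> 1" for n
      by (induction n) (simp add: w_def, use order_trans[OF contr[OF wL]] in \<open>simp add: wS\<close>)
    obtain \<U> p where U: "\<U> \<noteq> bot" "\<U> \<le> sequentially" and p: "p \<in> ?L"
      and plim: "\<And>\<eta>. \<eta> \<in> ?L \<Longrightarrow> ((\<lambda>i. l2_inner (w (2 * i)) \<eta>) \<longlongrightarrow> l2_inner p \<eta>) \<U>"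
      by (rule weak_limit_l2[of "\<lambda>i. w (2 * i)" "carrier G" 1, OF wL wb]) (rule that)
    \<comment> \<open>This is why the limit is taken along even powers: by self-adjointness the
      coordinate of h^(2i) \<delta>_1 at the unit is the squared norm of h^i \<delta>_1.\<close>
    have pe: "p \<one> = complex_of_real l"
    proof -
      have "l2_inner (w (2 * i)) (l2_delta \<one>) = complex_of_real (a i)" for i
        using shift[of i i 0] by (simp add: w_def[THEN fun_cong, of 0, simplified, symmetric] a_def l2_inner_self mult_2)
      then have "((\<lambda>i. complex_of_real (a i)) \<longlongrightarrow> p \<one>) \<U>"
        using plim[of "l2_delta \<one>"] by simp
      moreover have "((\<lambda>i. complex_of_real (a i)) \<longlongrightarrow> complex_of_real l) \<U>"
        by (rule tendsto_of_real[OF filterlim_mono[OF l order_refl U(2)]])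
      ultimately show ?thesis by (rule tendsto_unique[OF U(1)])
    qed
    have ppos: "pos p"
    proof -
      have lim: "((\<lambda>i. w (2 * i) x) \<longlongrightarrow> p x) \<U>" if "x \<in> carrier G" for x
        using plim[of "l2_delta x"] that by simp
      have "Im (p x) = 0 \<and> 0 \<le> Re (p x)" for x
      proof (cases "x \<in> carrier G")
        case True
        have "((\<lambda>i. Im (w (2 * i) x)) \<longlongrightarrow> Im (p x)) \<U>" by (rule tendsto_Im[OF lim[OF True]])
        then have "((\<lambda>i. 0) \<longlongrightarrow> Im (p x)) \<U>" using wpos by (simp add: pos_def)
        then have "Im (p x) = 0" using tendsto_unique[OF U(1) _ tendsto_const] by blast
        moreover have "0 \<le> Re (p x)"
          by (rule tendsto_lowerbound[OF tendsto_Re[OF lim[OF True]] _ U(1)]) (use wpos in \<open>simp add: pos_def\<close>)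
        ultimately show ?thesis by simp
      qed (use l2_D[OF p] in simp)
      moreover have "p x = 0" if x: "x \<notin> \<Gamma>" for x
      proof (cases "x \<in> carrier G")
        case True
        have "((\<lambda>i. 0) \<longlongrightarrow> p x) \<U>" using lim[OF True] wpos x by (simp add: pos_def)
        then show ?thesis using tendsto_unique[OF U(1) _ tendsto_const] by blast
      qed (use l2_D[OF p] in simp)
      ultimately show ?thesis by (simp add: pos_def)
    qed
    have pfix: "h (h p) = p"
    proof (rule l2_ext[OF hL[OF hL[OF p]] p])
      fix \<eta> assume \<eta>: "\<eta> \<in> ?L"
      have "((\<lambda>i. l2_inner (w (2 * i)) (h (h \<eta>))) \<longlongrightarrow> l2_inner p (h (h \<eta>))) \<U>"
        by (rule plim[OF hL[OF hL[OF \<eta>]]])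
      moreover have "l2_inner (w (2 * i)) (h (h \<eta>)) = l2_inner (w (Suc (Suc (2 * i)))) \<eta>" for i
        using sa[OF hL[OF wL] \<eta>, of "2 * i"] sa[OF wL hL[OF \<eta>], of "2 * i"] by (simp add: wS)
      ultimately have 1: "((\<lambda>i. l2_inner (w (Suc (Suc (2 * i)))) \<eta>) \<longlongrightarrow> l2_inner p (h (h \<eta>))) \<U>" by simp
      \<comment> \<open>The squared distance is a combination of three values of \<open>a\<close>
        with coefficients 1, -2, 1, so it tends to 0 and the weak limit is fixed by h h.\<close>
      let ?d = "\<lambda>i. (\<lambda>x. w (Suc (Suc (2 * i))) x - w (2 * i) x)"
      have dn: "(l2_norm (?d i))\<^sup>2 = a (Suc (Suc (2 * i))) - 2 * a (Suc (2 * i)) + a (2 * i)" for i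
      proof -
        have "l2_inner (w (Suc (Suc (2 * i)))) (w (2 * i)) = complex_of_real (a (Suc (2 * i)))"
          using shift[of "Suc (2 * i)" 1 "2 * i"] by (simp add: a_def l2_inner_self)
        then show ?thesis using l2_norm_diff_sq[OF wL wL, of "Suc (Suc (2 * i))" "2 * i"] by (simp add: a_def)
      qed
      have "(\<lambda>i. a (Suc (Suc (2 * i))) - 2 * a (Suc (2 * i)) + a (2 * i)) \<longlonglongrightarrow> l - 2 * l + l"
      proof -
        have sub: "filterlim (\<lambda>i::nat. Suc (Suc (2 * i))) sequentially sequentially"
          "filterlim (\<lambda>i::nat. Suc (2 * i)) sequentially sequentially"
          "filterlim (\<lambda>i::nat. 2 * i) sequentially sequentially"
          by (auto intro!: filterlim_subseq simp: strict_mono_def)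
        show ?thesis
          by (intro tendsto_intros filterlim_compose[OF l] sub)
      qed
      then have "(\<lambda>i. (l2_norm (?d i))\<^sup>2) \<longlonglongrightarrow> 0" unfolding dn by simp
      then have "(\<lambda>i. sqrt ((l2_norm (?d i))\<^sup>2)) \<longlonglongrightarrow> sqrt 0" by (rule tendsto_real_sqrt)
      then have "(\<lambda>i. l2_norm (?d i)) \<longlonglongrightarrow> 0" by simp
      then have "(\<lambda>i. l2_norm (?d i) * l2_norm \<eta>) \<longlonglongrightarrow> 0" by (rule tendsto_mult_left_zero)
      then have "(\<lambda>i. l2_inner (?d i) \<eta>) \<longlonglongrightarrow> 0"
        by (rule Lim_null_comparison[rotated]) (auto intro!: always_eventually l2_CS[OF l2_diff[OF wL wL] \<eta>])
      then have 2: "((\<lambda>i. l2_inner (?d i) \<eta>) \<longlongrightarrow> 0) \<U>" by (rule filterlim_mono) (simp_all add: U)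
      have "((\<lambda>i. l2_inner (?d i) \<eta> + l2_inner (w (2 * i)) \<eta>) \<longlongrightarrow> 0 + l2_inner p \<eta>) \<U>"
        by (rule tendsto_add[OF 2 plim[OF \<eta>]])
      then have "((\<lambda>i. l2_inner (w (Suc (Suc (2 * i)))) \<eta>) \<longlongrightarrow> l2_inner p \<eta>) \<U>"
        by (simp add: l2_inner_diff_left[OF wL wL \<eta>])
      with 1 have "l2_inner p (h (h \<eta>)) = l2_inner p \<eta>" by (rule tendsto_unique[OF U(1)])
      then show "l2_inner (h (h p)) \<eta> = l2_inner p \<eta>"
        using sa[OF hL[OF p] \<eta>] sa[OF p hL[OF \<eta>]] by simp
    qed
    \<comment> \<open>Pointwise |h v| \<le> h |v|, and \<open>h\<close> preserves the norm of
      \<open>v\<close>. Hence \<open>h\<close> cannot shorten u = |v|, and a self-adjoint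
      contraction that preserves the norm of u satisfies h (h u) = u.\<close>
    have fix_abs: "h (h u) = u" if v: "v \<in> ?L" "h (h v) = v" and u: "u = (\<lambda>x. complex_of_real (cmod (v x)))" for u v
    proof -
      have uL: "u \<in> ?L" using v(1) by (simp add: u l2_def)
      have un: "l2_norm u = l2_norm v" by (simp add: u l2_norm_def)
      have "cmod (h v x) \<le> cmod (h u x)" for x
      proof (cases "x \<in> carrier G")
        case True
        have "((\<lambda>s. k s * cmod (v (inv s \<otimes> x))) has_sum Re (h u x)) UNIV"
          using hRe[OF uL True] by (simp add: u)
        then have "((\<lambda>s. cmod (complex_of_real (k s) * v (inv s \<otimes> x))) has_sum Re (h u x)) UNIV"
          using k0 by (simp add: norm_mult)
        from norm_has_sum_bound[OF this hsum[OF v(1) True]]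
        show ?thesis using complex_Re_le_cmod order_trans by blast
      qed (use l2_D[OF hL[OF v(1)]] in simp)
      then have "l2_norm (h v) \<le> l2_norm (h u)" by (rule l2_norm_mono[OF hL[OF uL]])
      moreover have "(l2_norm (h v))\<^sup>2 = (l2_norm v)\<^sup>2"
      proof -
        have "complex_of_real ((l2_norm (h v))\<^sup>2) = of_real ((l2_norm v)\<^sup>2)"
          unfolding l2_inner_self[symmetric] using sa[OF hL[OF v(1)] v(1)] v(2) by simp
        then show ?thesis by (simp only: of_real_eq_iff)
      qed
      then have "l2_norm (h v) = l2_norm v" by simp
      ultimately have ge: "(l2_norm u)\<^sup>2 \<le> (l2_norm (h u))\<^sup>2" using un by (intro power_mono) auto
      have hu: "h u \<in> ?L" "h (h u) \<in> ?L" by (intro hL uL)+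
      have "l2_inner (h (h u)) u = complex_of_real ((l2_norm (h u))\<^sup>2)"
        using sa[OF hu(1) uL] by (simp add: l2_inner_self)
      then have "(l2_norm (\<lambda>x. h (h u) x - u x))\<^sup>2 = (l2_norm (h (h u)))\<^sup>2 - 2 * (l2_norm (h u))\<^sup>2 + (l2_norm u)\<^sup>2"
        using l2_norm_diff_sq[OF hu(2) uL] by simp
      moreover have "(l2_norm (h (h u)))\<^sup>2 \<le> (l2_norm u)\<^sup>2"
        by (intro power_mono order_trans[OF contr[OF hu(1)] contr[OF uL]]) simp
      ultimately have "(l2_norm (\<lambda>x. h (h u) x - u x))\<^sup>2 \<le> 0" using ge by linarith
      then have "l2_norm (\<lambda>x. h (h u) x - u x) = 0" by simp
      then have "(\<lambda>x. h (h u) x - u x) = (\<lambda>_. 0)" by (rule l2_norm_eq_0[OF l2_diff[OF hu(2) uL]])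
      then show ?thesis by (simp add: fun_eq_iff)
    qed
    \<comment> \<open>Finite because \<open>p\<close> is square summable, and it contains the unit.
      So a maximum over this set is one over the whole group. It would also contain \<Gamma> if
      \<open>p\<close> were constant there, which is the final contradiction.\<close>
    let ?S = "{x. l \<le> cmod (p x)}"
    have finS: "finite ?S" by (rule l2_vanishes_at_infinity[OF p lpos])
    have oneS: "\<one> \<in> ?S" using pe l0 by simp
    obtain xm where xm: "xm \<in> ?S" "\<And>x. x \<in> ?S \<Longrightarrow> cmod (p x) \<le> cmod (p xm)"
    proof -
      have ne: "(\<lambda>x. cmod (p x)) ` ?S \<noteq> {}" using oneS by blast
      have "Max ((\<lambda>x. cmod (p x)) ` ?S) \<in> (\<lambda>x. cmod (p x)) ` ?S" by (rule Max_in[OF _ ne]) (use finS in simp)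
      then obtain xm where "xm \<in> ?S" "cmod (p xm) = Max ((\<lambda>x. cmod (p x)) ` ?S)" by auto
      then show ?thesis using that[of xm] finS by simp
    qed
    have xmax: "cmod (p x) \<le> cmod (p xm)" for x
      using xm by (cases "x \<in> ?S") auto
    have pRe: "p x = complex_of_real (cmod (p x))" for x
      using ppos by (simp add: pos_def complex_eq_iff cmod_def)
    have xm\<Gamma>: "xm \<in> \<Gamma>" using xm(1) lpos ppos by (auto simp: pos_def intro: ccontr)
    have const: "p g = p \<one>" if g: "g \<in> \<Gamma>" for g
    proof -
      note gc = car[OF g]
      define v where "v = (\<lambda>x. p x - rr g p x)"
      define u where "u = (\<lambda>x. complex_of_real (cmod (v x)))"
      have rL: "rr g p \<in> ?L" by (rule rr_in(1)[OF gc p])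
      have vL: "v \<in> ?L" unfolding v_def by (rule l2_diff[OF p rL])
      have uL: "u \<in> ?L" using vL by (simp add: u_def l2_def)
      note hb = VN_bounded[OF h]
      have "h (h (rr g p)) = rr g p" using VN_commute[OF h rr_VN'[OF gc]] pfix by simp
      then have vfix: "h (h v) = v"
        unfolding v_def bounded_ops_diff[OF hb p rL] bounded_ops_diff[OF hb hL[OF p] hL[OF rL]] using pfix by simp
      have ufix: "h (h u) = u" by (rule fix_abs[OF vL vfix u_def])
      have vr: "v x = complex_of_real (Re (v x))" for x
      proof -
        have "Im (rr g p x) = 0" using ppos by (auto simp: rr_eq[OF p] pos_def)
        then show ?thesis using ppos by (simp add: v_def pos_def complex_eq_iff)
      qed
      have v0: "v x = 0" if x: "x \<notin> \<Gamma>" for x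
      proof -
        have "x \<otimes> g \<notin> \<Gamma>" if xc: "x \<in> carrier G"
        proof
          assume "x \<otimes> g \<in> \<Gamma>"
          then have "x \<otimes> g \<otimes> inv g \<in> \<Gamma>" by (rule mult\<Gamma>[OF _ inv\<Gamma>[OF g]])
          then show False using x xc gc by (simp add: m_assoc)
        qed
        then show ?thesis using x ppos by (auto simp: v_def rr_eq[OF p] pos_def)
      qed
      have cv: "cmod (v x) = \<bar>Re (v x)\<bar>" for x by (subst vr) simp
      have q1: "(\<lambda>x. u x + v x) \<in> ?L" "pos (\<lambda>x. u x + v x)" "h (h (\<lambda>x. u x + v x)) = (\<lambda>x. u x + v x)"
      proof -
        show "(\<lambda>x. u x + v x) \<in> ?L" by (rule l2_add[OF uL vL])
        show "pos (\<lambda>x. u x + v x)" using vr v0 by (auto simp: pos_def u_def cv) (metis Im_complex_of_real)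
        show "h (h (\<lambda>x. u x + v x)) = (\<lambda>x. u x + v x)"
          by (simp add: bounded_ops_add[OF hb uL vL] bounded_ops_add[OF hb hL[OF uL] hL[OF vL]] ufix vfix)
      qed
      have q2: "(\<lambda>x. u x - v x) \<in> ?L" "pos (\<lambda>x. u x - v x)" "h (h (\<lambda>x. u x - v x)) = (\<lambda>x. u x - v x)"
      proof -
        show "(\<lambda>x. u x - v x) \<in> ?L" by (rule l2_diff[OF uL vL])
        show "pos (\<lambda>x. u x - v x)" using vr v0 by (auto simp: pos_def u_def cv) (metis Im_complex_of_real)
        show "h (h (\<lambda>x. u x - v x)) = (\<lambda>x. u x - v x)"
          by (simp add: bounded_ops_diff[OF hb uL vL] bounded_ops_diff[OF hb hL[OF uL] hL[OF vL]] ufix vfix)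
      qed
      \<comment> \<open>Here the translate of \<open>p\<close> takes the maximal value, so v \<le> 0
        and |v| + v vanishes. At \<open>xm\<close> it is \<open>p\<close> that takes it, so v \<ge>
        0 and |v| - v vanishes. By \<open>zero_fix\<close> both functions then vanish at the
        unit.\<close>
      let ?y = "xm \<otimes> inv g"
      have y\<Gamma>: "?y \<in> \<Gamma>" by (intro mult\<Gamma> inv\<Gamma> xm\<Gamma> g)
      have ev: "u x = complex_of_real \<bar>Re (v x)\<bar>" for x by (simp add: u_def cv)
      have "rr g p ?y = p xm" using car[OF xm\<Gamma>] gc by (simp add: rr_eq[OF p] m_assoc)
      then have "Re (v ?y) = cmod (p ?y) - cmod (p xm)"
        unfolding v_def using arg_cong[OF pRe[of ?y], of Re] arg_cong[OF pRe[of xm], of Re] by simp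
      then have "Re (v ?y) \<le> 0" using xmax[of ?y] by simp
      then have "u ?y + v ?y = 0" by (subst vr) (simp add: ev)
      from zero_fix[OF q1 y\<Gamma> this one] have 1: "u \<one> + v \<one> = 0" .
      have "rr g p xm = p (xm \<otimes> g)" using car[OF xm\<Gamma>] by (simp add: rr_eq[OF p])
      then have "Re (v xm) = cmod (p xm) - cmod (p (xm \<otimes> g))"
        unfolding v_def using arg_cong[OF pRe[of "xm \<otimes> g"], of Re] arg_cong[OF pRe[of xm], of Re] by simp
      then have "0 \<le> Re (v xm)" using xmax[of "xm \<otimes> g"] by simp
      then have "u xm - v xm = 0" by (subst vr) (simp add: ev)
      from zero_fix[OF q2 xm\<Gamma> this one] have 2: "u \<one> - v \<one> = 0" .
      have "2 * v \<one> = (u \<one> + v \<one>) - (u \<one> - v \<one>)" by simp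
      then have "v \<one> = 0" unfolding 1 2 by simp
      then show ?thesis using gc by (simp add: v_def rr_eq[OF p])
    qed
    have "\<Gamma> \<subseteq> ?S" using const pe l0 by auto
    then show False using finS \<Gamma>(2) finite_subset by blast
  qed
  then have "(\<lambda>n. sqrt (a n)) \<longlonglongrightarrow> sqrt 0" using tendsto_real_sqrt[OF l] by simp
  then show ?thesis by (simp add: a_def w_def)
qed

text \<open>For self-adjoint b one has |b \<xi>|^2 \<le> |b b \<xi>| on unit vectors, so norm one
  persists under repeated squaring, while the column at the unit tends to 0. Truncating a nearly
  norming vector makes its support finite.\<close>

lemma small_trace_element:
  assumes inf: "infinite (carrier G)" and \<epsilon>: "0 < \<epsilon>"
  obtains b \<zeta> where "b \<in> VNs"
    "\<And>\<xi> \<eta>. \<xi> \<in> l2 (carrier G) \<Longrightarrow> \<eta> \<in> l2 (carrier G) \<Longrightarrow> l2_inner (b \<xi>) \<eta> = l2_inner \<xi> (b \<eta>)"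
    "\<And>\<xi>. \<xi> \<in> l2 (carrier G) \<Longrightarrow> l2_norm (b \<xi>) \<le> l2_norm \<xi>"
    "l2_norm (b (l2_delta \<one>)) < \<epsilon>"
    "\<zeta> \<in> l2 (carrier G)" "finite {x. \<zeta> x \<noteq> 0}" "l2_norm \<zeta> = 1" "3 / 4 \<le> (l2_norm (b \<zeta>))\<^sup>2"
proof -
  let ?L = "l2 (carrier G)"
  obtain \<Gamma> where \<Gamma>: "subgroup \<Gamma> G" "countable \<Gamma>" "infinite \<Gamma>" by (rule countable_infinite_subgroup[OF inf])
  obtain h and k :: "'a \<Rightarrow> real" where h: "h \<in> VNs"
    and sa: "\<And>\<xi> \<eta>. \<xi> \<in> ?L \<Longrightarrow> \<eta> \<in> ?L \<Longrightarrow> l2_inner (h \<xi>) \<eta> = l2_inner \<xi> (h \<eta>)"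
    and contr: "\<And>\<xi>. \<xi> \<in> ?L \<Longrightarrow> l2_norm (h \<xi>) \<le> l2_norm \<xi>"
    and one: "\<And>t. t < 1 \<Longrightarrow> \<exists>\<xi>\<in>?L. l2_norm \<xi> = 1 \<and> t < l2_norm (h \<xi>)"
    and hsum: "\<And>\<xi> x. \<xi> \<in> ?L \<Longrightarrow> x \<in> carrier G \<Longrightarrow>
       ((\<lambda>s. complex_of_real (k s) * \<xi> (inv s \<otimes> x)) has_sum h \<xi> x) UNIV"
    and k: "\<And>s. s \<in> \<Gamma> \<Longrightarrow> 0 < k s" "\<And>s. s \<notin> \<Gamma> \<Longrightarrow> k s = 0"
    by (rule convolution_operator[OF \<Gamma>(1,2)]) (rule that)
  have hL: "h \<xi> \<in> ?L" if "\<xi> \<in> ?L" for \<xi> by (rule bounded_ops_l2[OF VN_bounded[OF h] that])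
  have hnL: "(h ^^ n) \<xi> \<in> ?L" if "\<xi> \<in> ?L" for n \<xi> by (induction n) (simp_all add: that hL)
  have hnV: "h ^^ Suc n \<in> VNs" for n
  proof (induction n)
    case (Suc n)
    then show ?case using VN_comp[OF h Suc] by (simp add: comp_def)
  qed (simp add: h)
  have hnsa: "l2_inner ((h ^^ n) \<xi>) \<eta> = l2_inner \<xi> ((h ^^ n) \<eta>)" if "\<xi> \<in> ?L" "\<eta> \<in> ?L" for n \<xi> \<eta>
    using that
  proof (induction n arbitrary: \<eta>)
    case (Suc n)
    have "l2_inner ((h ^^ Suc n) \<xi>) \<eta> = l2_inner ((h ^^ n) \<xi>) (h \<eta>)"
      using sa[OF hnL[OF Suc.prems(1)] Suc.prems(2)] by simp
    also have "\<dots> = l2_inner \<xi> ((h ^^ n) (h \<eta>))" by (rule Suc.IH[OF Suc.prems(1) hL[OF Suc.prems(2)]])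
    finally show ?case by (simp add: funpow_swap1)
  qed simp
  have hncontr: "l2_norm ((h ^^ n) \<xi>) \<le> l2_norm \<xi>" if "\<xi> \<in> ?L" for n \<xi>
    by (induction n) (use order_trans[OF contr[OF hnL[OF that]]] in auto)
  have hnone: "\<exists>\<xi>\<in>?L. l2_norm \<xi> = 1 \<and> t < l2_norm ((h ^^ (2 ^ j)) \<xi>)" if "t < 1" for t j
    using that
  proof (induction j arbitrary: t)
    case 0 then show ?case using one by simp
  next
    case (Suc j)
    define r where "r = sqrt (max t 0)"
    have r: "r < 1" "0 \<le> r" using Suc.prems by (auto simp: r_def)
    obtain \<xi> where \<xi>: "\<xi> \<in> ?L" "l2_norm \<xi> = 1" "r < l2_norm ((h ^^ (2 ^ j)) \<xi>)" using Suc.IH[OF r(1)] by blast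
    let ?b = "h ^^ (2 ^ j)"
    have "(l2_norm (?b \<xi>))\<^sup>2 = cmod (l2_inner (?b \<xi>) (?b \<xi>))" by (simp add: l2_inner_self norm_power)
    also have "\<dots> = cmod (l2_inner (?b (?b \<xi>)) \<xi>)" using hnsa[OF hnL[OF \<xi>(1)] \<xi>(1)] by simp
    also have "\<dots> \<le> l2_norm (?b (?b \<xi>)) * l2_norm \<xi>" by (rule l2_CS[OF hnL[OF hnL[OF \<xi>(1)]] \<xi>(1)])
    finally have "(l2_norm (?b \<xi>))\<^sup>2 \<le> l2_norm (?b (?b \<xi>))" using \<xi>(2) by simp
    moreover have "r\<^sup>2 < (l2_norm (?b \<xi>))\<^sup>2" using \<xi>(3) r(2) by (intro power_strict_mono) auto
    moreover have "t \<le> r\<^sup>2" by (simp add: r_def)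
    ultimately have "t < l2_norm (?b (?b \<xi>))" by linarith
    moreover have "?b (?b \<xi>) = (h ^^ (2 ^ Suc j)) \<xi>" by (simp add: mult_2 funpow_add)
    ultimately show ?case using \<xi>(1,2) by auto
  qed
  have "(\<lambda>n. l2_norm ((h ^^ n) (l2_delta \<one>))) \<longlonglongrightarrow> 0"
    by (rule convolution_powers_tendsto_0[OF \<Gamma>(1,3) h sa contr hsum k])
  then have "eventually (\<lambda>n. l2_norm ((h ^^ n) (l2_delta \<one>)) < \<epsilon>) sequentially"
    by (rule order_tendstoD(2)) (rule \<epsilon>)
  then obtain N where N: "\<And>n. n \<ge> N \<Longrightarrow> l2_norm ((h ^^ n) (l2_delta \<one>)) < \<epsilon>"
    by (auto simp: eventually_sequentially)
  \<comment> \<open>A power of two, for which the norm is known to be one; its exponent is at least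
    \<open>N\<close>, so the column is small as well.\<close>
  define b where "b = h ^^ (2 ^ N)"
  have bV: "b \<in> VNs" using hnV[of "2 ^ N - 1"] by (simp add: b_def)
  \<comment> \<open>From 9/10 the truncation error below 1/100 leaves 89/100, whose square exceeds
    3/4. Normalising the truncated vector can only help, as its norm is at most 1.\<close>
  obtain \<xi> where \<xi>: "\<xi> \<in> ?L" "l2_norm \<xi> = 1" "9 / 10 < l2_norm (b \<xi>)"
    using hnone[of "9 / 10" N] by (auto simp: b_def)
  obtain Y where Y: "finite Y" "Y \<subseteq> carrier G" "l2_norm (\<lambda>x. \<xi> x - l2_trunc Y \<xi> x) < 1 / 100"
    by (rule l2_trunc_approx[OF \<xi>(1), of "1 / 100"]) auto
  let ?y = "l2_trunc Y \<xi>"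
  have y: "?y \<in> ?L" by (rule l2_trunc_in[OF \<xi>(1)])
  have d: "(\<lambda>x. \<xi> x - ?y x) \<in> ?L" by (rule l2_diff[OF \<xi>(1) y])
  have bcontr: "l2_norm (b \<xi>) \<le> l2_norm \<xi>" if "\<xi> \<in> ?L" for \<xi> using hncontr[OF that] by (simp add: b_def)
  have bL: "b \<xi> \<in> ?L" if "\<xi> \<in> ?L" for \<xi> using hnL[OF that] by (simp add: b_def)
  have "b \<xi> = b (\<lambda>x. (\<xi> x - ?y x) + ?y x)" by simp
  also have "\<dots> = (\<lambda>x. b (\<lambda>x. \<xi> x - ?y x) x + b ?y x)" by (rule bounded_ops_add[OF VN_bounded[OF bV] d y])
  finally have "l2_norm (b \<xi>) \<le> l2_norm (b (\<lambda>x. \<xi> x - ?y x)) + l2_norm (b ?y)"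
    using l2_triangle[OF bL[OF d] bL[OF y]] by simp
  then have by_: "89 / 100 < l2_norm (b ?y)" using \<xi>(3) Y(3) bcontr[OF d] by linarith
  have yn: "l2_norm ?y \<le> 1" using l2_norm_trunc_le[OF \<xi>(1), of Y] \<xi>(2) by simp
  define r where "r = l2_norm ?y"
  have r: "0 < r" "r \<le> 1" using by_ bcontr[OF y] yn by (auto simp: r_def)
  define \<zeta> where "\<zeta> = (\<lambda>x. complex_of_real (inverse r) * ?y x)"
  have \<zeta>L: "\<zeta> \<in> ?L" unfolding \<zeta>_def by (rule l2_scale[OF y])
  have \<zeta>n: "l2_norm \<zeta> = 1" unfolding \<zeta>_def l2_norm_scale using r by (simp add: r_def[symmetric] norm_inverse)
  have "l2_norm (b \<zeta>) = inverse r * l2_norm (b ?y)"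
    unfolding \<zeta>_def bounded_ops_scale[OF VN_bounded[OF bV] y] l2_norm_scale using r by (simp add: norm_inverse)
  moreover have "1 * l2_norm (b ?y) \<le> inverse r * l2_norm (b ?y)"
    using r by (intro mult_right_mono) (auto simp: one_le_inverse_iff)
  ultimately have "89 / 100 \<le> l2_norm (b \<zeta>)" using by_ by linarith
  then have "(89 / 100)\<^sup>2 \<le> (l2_norm (b \<zeta>))\<^sup>2" by (intro power_mono) auto
  then have "3 / 4 \<le> (l2_norm (b \<zeta>))\<^sup>2" by (simp add: power2_eq_square)
  moreover have "finite {x. \<zeta> x \<noteq> 0}"
    by (rule finite_subset[OF _ Y(1)]) (auto simp: \<zeta>_def l2_trunc_def split: if_splits)
  moreover have "l2_norm (b (l2_delta \<one>)) < \<epsilon>" unfolding b_def by (rule N) (simp add: less_imp_le)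
  ultimately show ?thesis
    using that[OF bV _ bcontr _ \<zeta>L _ \<zeta>n] hnsa by (simp add: b_def)
qed

end

section \<open>Functionals that vanish on the range of the action\<close>

lemma two_term_CS:
  fixes a b c d s t :: real
  assumes "a\<^sup>2 + b\<^sup>2 \<le> s\<^sup>2" "c\<^sup>2 + d\<^sup>2 \<le> t\<^sup>2" "0 \<le> s" "0 \<le> t"
  shows "a * c + b * d \<le> s * t"
proof (rule power2_le_imp_le)
  have "(a * c + b * d)\<^sup>2 = (a\<^sup>2 + b\<^sup>2) * (c\<^sup>2 + d\<^sup>2) - (a * d - b * c)\<^sup>2"
    by (simp add: power2_eq_square algebra_simps)
  also have "\<dots> \<le> (a\<^sup>2 + b\<^sup>2) * (c\<^sup>2 + d\<^sup>2)" by simp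
  also have "\<dots> \<le> s\<^sup>2 * t\<^sup>2" by (intro mult_mono assms) auto
  finally show "(a * c + b * d)\<^sup>2 \<le> (s * t)\<^sup>2" by (simp add: power_mult_distrib)
qed (use assms in simp)

section \<open>One perturbation step\<close>

context group
begin

text \<open>A nonzero coefficient at s requires s d1 = g d2 with d1, d2 in the support of \<zeta>.
  For s in \<open>A\<close> this excludes finitely many g, and for a fixed g it admits finitely many
  s.\<close>

lemma translate_away:
  assumes inf: "infinite (carrier G)" and \<zeta>: "\<zeta> \<in> l2 (carrier G)" "finite {x. \<zeta> x \<noteq> 0}" and A: "finite A"
  obtains g where "g \<in> carrier G" "\<And>s. s \<in> A \<Longrightarrow> vfun \<zeta> (lr g \<zeta>) s = 0" "finite {s. vfun \<zeta> (lr g \<zeta>) s \<noteq> 0}"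
proof -
  let ?D = "{x. \<zeta> x \<noteq> 0}"
  have DG: "?D \<subseteq> carrier G" using l2_D[OF \<zeta>(1)] by auto
  have nz: "\<exists>d1\<in>?D. \<exists>d2\<in>?D. s \<in> carrier G \<and> s \<otimes> d1 = g \<otimes> d2"
    if g: "g \<in> carrier G" and s: "vfun \<zeta> (lr g \<zeta>) s \<noteq> 0" for g s
  proof -
    have sG: "s \<in> carrier G" and ne: "l2_inner (lr s \<zeta>) (lr g \<zeta>) \<noteq> 0"
      using s unfolding vfun_eq[OF \<zeta>(1) lr_in(1)[OF g \<zeta>(1)]] by (simp_all split: if_splits)
    have "\<exists>d. lr s \<zeta> d \<noteq> 0 \<and> lr g \<zeta> d \<noteq> 0"
    proof (rule ccontr)
      assume "\<nexists>d. lr s \<zeta> d \<noteq> 0 \<and> lr g \<zeta> d \<noteq> 0"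
      then have "lr s \<zeta> d * cnj (lr g \<zeta> d) = 0" for d by auto
      then have "l2_inner (lr s \<zeta>) (lr g \<zeta>) = 0" unfolding l2_inner_def by (simp only: infsum_0_simp)
      then show False using ne by contradiction
    qed
    then obtain d where d: "lr s \<zeta> d \<noteq> 0" "lr g \<zeta> d \<noteq> 0" by (elim exE conjE) (rule that)
    have dG: "d \<in> carrier G" "\<zeta> (inv s \<otimes> d) \<noteq> 0" "\<zeta> (inv g \<otimes> d) \<noteq> 0"
      using d by (auto simp: lr_eq[OF \<zeta>(1)] split: if_splits)
    have "s \<otimes> (inv s \<otimes> d) = g \<otimes> (inv g \<otimes> d)" using sG g dG(1) by (simp add: m_assoc[symmetric])
    then show ?thesis using sG dG(2,3) by (intro bexI[of _ "inv s \<otimes> d"] bexI[of _ "inv g \<otimes> d"]) auto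
  qed
  let ?bad = "(\<lambda>(s, d1, d2). s \<otimes> d1 \<otimes> inv d2) ` (A \<times> ?D \<times> ?D)"
  have "finite ?bad" using A \<zeta>(2) by auto
  then obtain g where g: "g \<in> carrier G" "g \<notin> ?bad"
    using inf by (meson finite_subset subsetI)
  show ?thesis
  proof (rule that[OF g(1)])
    fix s assume s: "s \<in> A"
    show "vfun \<zeta> (lr g \<zeta>) s = 0"
    proof (rule ccontr)
      assume "vfun \<zeta> (lr g \<zeta>) s \<noteq> 0"
      then obtain d1 d2 where d: "d1 \<in> ?D" "d2 \<in> ?D" "s \<in> carrier G" "s \<otimes> d1 = g \<otimes> d2"
        using nz[OF g(1)] by blast
      have c: "d2 \<in> carrier G" using d(2) DG by blast
      have "g = s \<otimes> d1 \<otimes> inv d2" unfolding d(4) using g(1) c by (simp add: m_assoc)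
      then have "g \<in> ?bad" using s d(1,2) by (intro image_eqI[of _ _ "(s, d1, d2)"]) auto
      then show False using g(2) by simp
    qed
  next
    have "{s. vfun \<zeta> (lr g \<zeta>) s \<noteq> 0} \<subseteq> (\<lambda>(d1, d2). g \<otimes> d2 \<otimes> inv d1) ` (?D \<times> ?D)"
    proof
      fix s assume "s \<in> {s. vfun \<zeta> (lr g \<zeta>) s \<noteq> 0}"
      then obtain d1 d2 where d: "d1 \<in> ?D" "d2 \<in> ?D" "s \<in> carrier G" "s \<otimes> d1 = g \<otimes> d2"
        using nz[OF g(1)] by blast
      have c: "d1 \<in> carrier G" using d(1) DG by blast
      have "s = g \<otimes> d2 \<otimes> inv d1" unfolding d(4)[symmetric] using d(3) c by (simp add: m_assoc)
      then show "s \<in> (\<lambda>(d1, d2). g \<otimes> d2 \<otimes> inv d1) ` (?D \<times> ?D)"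
        using d(1,2) by (intro image_eqI[of _ _ "(d1, d2)"]) auto
    qed
    then show "finite {s. vfun \<zeta> (lr g \<zeta>) s \<noteq> 0}" by (rule finite_subset) (use \<zeta>(2) in auto)
  qed
qed

text \<open>
  The perturbed operator is \<open>\<lambda>(g) c \<lambda>(g)\<^sup>* T c + \<lambda>(g) b\<^sup>2\<close> with \<open>c = 1 - b\<^sup>2\<close>. It is contractive since
  \<open>\<parallel>c \<xi>\<parallel>\<^sup>2 + \<parallel>b \<xi>\<parallel>\<^sup>2 \<le> \<parallel>\<xi>\<parallel>\<^sup>2\<close>, and its matrix entries are close to those of \<open>T\<close> since \<open>\<parallel>b \<delta>\<^sub>1\<parallel>\<close> is small,
  whereas it nearly acts as \<open>\<lambda>(g)\<close> on a vector \<open>\<zeta>\<close> nearly fixed by \<open>b\<^sup>2\<close>.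
\<close>

lemma perturb_contraction:
  assumes inf: "infinite (carrier G)" and T: "T \<in> VNs"
    and contr: "\<And>\<xi>. \<xi> \<in> l2 (carrier G) \<Longrightarrow> l2_norm (T \<xi>) \<le> l2_norm \<xi>" and A: "finite A" and \<epsilon>: "0 < \<epsilon>"
  obtains T' \<zeta> g where "T' \<in> VNs" "\<And>\<xi>. \<xi> \<in> l2 (carrier G) \<Longrightarrow> l2_norm (T' \<xi>) \<le> l2_norm \<xi>"
    "\<zeta> \<in> l2 (carrier G)" "l2_norm \<zeta> = 1" "finite {x. \<zeta> x \<noteq> 0}" "g \<in> carrier G"
    "\<And>s. s \<in> A \<Longrightarrow> vfun \<zeta> (lr g \<zeta>) s = 0" "finite {s. vfun \<zeta> (lr g \<zeta>) s \<noteq> 0}"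
    "1 / 2 \<le> Re (l2_inner (T' \<zeta>) (lr g \<zeta>))"
    "\<And>x y. x \<in> carrier G \<Longrightarrow> y \<in> carrier G \<Longrightarrow> cmod (T' (l2_delta x) y - T (l2_delta x) y) \<le> \<epsilon>"
proof -
  let ?L = "l2 (carrier G)"
  \<comment> \<open>A third of \<epsilon> for each of the three error terms in a matrix
    entry.\<close>
  obtain b \<zeta> where b: "b \<in> VNs"
    and sa: "\<And>\<xi> \<eta>. \<xi> \<in> ?L \<Longrightarrow> \<eta> \<in> ?L \<Longrightarrow> l2_inner (b \<xi>) \<eta> = l2_inner \<xi> (b \<eta>)"
    and bc: "\<And>\<xi>. \<xi> \<in> ?L \<Longrightarrow> l2_norm (b \<xi>) \<le> l2_norm \<xi>"
    and bs: "l2_norm (b (l2_delta \<one>)) < \<epsilon> / 3"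
    and \<zeta>: "\<zeta> \<in> ?L" "finite {x. \<zeta> x \<noteq> 0}" "l2_norm \<zeta> = 1" "3 / 4 \<le> (l2_norm (b \<zeta>))\<^sup>2"
    by (rule small_trace_element[OF inf, of "\<epsilon> / 3"]) (use \<epsilon> in simp, rule that)
  obtain g where g: "g \<in> carrier G" "\<And>s. s \<in> A \<Longrightarrow> vfun \<zeta> (lr g \<zeta>) s = 0" "finite {s. vfun \<zeta> (lr g \<zeta>) s \<noteq> 0}"
    by (rule translate_away[OF inf \<zeta>(1,2) A]) (rule that)
  have ig: "inv g \<in> carrier G" using g(1) by simp
  define c where "c = (\<lambda>\<xi> x. lr \<one> \<xi> x + (-1) * (b \<circ> b) \<xi> x)"
  have cV: "c \<in> VNs" unfolding c_def by (rule VN_add[OF lr_VN[OF one_closed] VN_smult[OF VN_comp[OF b b]]])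
  have bL: "b \<xi> \<in> ?L" if "\<xi> \<in> ?L" for \<xi> by (rule bounded_ops_l2[OF VN_bounded[OF b] that])
  have cL: "c \<xi> \<in> ?L" if "\<xi> \<in> ?L" for \<xi> by (rule bounded_ops_l2[OF VN_bounded[OF cV] that])
  have TL: "T \<xi> \<in> ?L" if "\<xi> \<in> ?L" for \<xi> by (rule bounded_ops_l2[OF VN_bounded[OF T] that])
  have lL: "lr g \<xi> \<in> ?L" "lr (inv g) \<xi> \<in> ?L" if "\<xi> \<in> ?L" for \<xi> using lr_in(1)[OF _ that] g(1) by auto
  have ceq: "c \<xi> = (\<lambda>x. \<xi> x - b (b \<xi>) x)" if "\<xi> \<in> ?L" for \<xi> by (simp add: c_def lr_one[OF that])
  have csa: "l2_inner (c \<xi>) \<eta> = l2_inner \<xi> (c \<eta>)" if "\<xi> \<in> ?L" "\<eta> \<in> ?L" for \<xi> \<eta>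
    unfolding ceq[OF that(1)] ceq[OF that(2)] l2_inner_diff_left[OF that(1) bL[OF bL[OF that(1)]] that(2)]
      l2_inner_diff_right[OF that(2) bL[OF bL[OF that(2)]] that(1)]
    using sa[OF bL[OF that(1)] that(2)] sa[OF that(1) bL[OF that(2)]] by simp
  \<comment> \<open>Expanding the square gives |c \<xi>|^2 = |\<xi>|^2 - 2 |b \<xi>|^2 + |b b
    \<xi>|^2, and the last term is at most |b \<xi>|^2.\<close>
  have cn: "(l2_norm (c \<xi>))\<^sup>2 + (l2_norm (b \<xi>))\<^sup>2 \<le> (l2_norm \<xi>)\<^sup>2" if \<xi>: "\<xi> \<in> ?L" for \<xi>
  proof -
    have "(l2_norm (c \<xi>))\<^sup>2 = (l2_norm \<xi>)\<^sup>2 - 2 * Re (l2_inner \<xi> (b (b \<xi>))) + (l2_norm (b (b \<xi>)))\<^sup>2"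
      unfolding ceq[OF \<xi>] by (rule l2_norm_diff_sq[OF \<xi> bL[OF bL[OF \<xi>]]])
    moreover have "Re (l2_inner \<xi> (b (b \<xi>))) = (l2_norm (b \<xi>))\<^sup>2"
      unfolding sa[OF \<xi> bL[OF \<xi>], symmetric] l2_inner_self by simp
    moreover have "(l2_norm (b (b \<xi>)))\<^sup>2 \<le> (l2_norm (b \<xi>))\<^sup>2"
      by (rule power_mono[OF bc[OF bL[OF \<xi>]]]) simp
    ultimately show ?thesis by linarith
  qed
  have cc: "l2_norm (c \<xi>) \<le> l2_norm \<xi>" if "\<xi> \<in> ?L" for \<xi>
    by (rule power2_le_imp_le) (use cn[OF that] zero_le_power2[of "l2_norm (b \<xi>)"] in linarith, simp)
  define T' where "T' = (\<lambda>\<xi> x. (lr g \<circ> (c \<circ> (lr (inv g) \<circ> (T \<circ> c)))) \<xi> x + (lr g \<circ> (b \<circ> b)) \<xi> x)"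
  have T'V: "T' \<in> VNs" unfolding T'_def
    by (intro VN_add VN_comp lr_VN g(1) ig T b cV)
  define w where "w = (\<lambda>\<xi>. lr (inv g) (T (c \<xi>)))"
  have wL: "w \<xi> \<in> ?L" if "\<xi> \<in> ?L" for \<xi> unfolding w_def by (intro lL TL cL that)
  have wn: "l2_norm (w \<xi>) \<le> l2_norm (c \<xi>)" if "\<xi> \<in> ?L" for \<xi>
    unfolding w_def lr_in(2)[OF ig TL[OF cL[OF that]]] by (rule contr[OF cL[OF that]])
  have form: "l2_inner (T' \<xi>) \<eta> = l2_inner (w \<xi>) (c (lr (inv g) \<eta>)) + l2_inner (b \<xi>) (b (lr (inv g) \<eta>))"
    if \<xi>: "\<xi> \<in> ?L" and \<eta>: "\<eta> \<in> ?L" for \<xi> \<eta>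
  proof -
    have "T' \<xi> = (\<lambda>x. lr g (c (w \<xi>)) x + lr g (b (b \<xi>)) x)" by (simp add: T'_def w_def)
    then have "l2_inner (T' \<xi>) \<eta> = l2_inner (lr g (c (w \<xi>))) \<eta> + l2_inner (lr g (b (b \<xi>))) \<eta>"
      by (simp only: l2_inner_add_left[OF lL(1)[OF cL[OF wL[OF \<xi>]]] lL(1)[OF bL[OF bL[OF \<xi>]]] \<eta>])
    then show ?thesis
      unfolding lr_inner[OF g(1) cL[OF wL[OF \<xi>]] \<eta>] lr_inner[OF g(1) bL[OF bL[OF \<xi>]] \<eta>]
        csa[OF wL[OF \<xi>] lL(2)[OF \<eta>]] sa[OF bL[OF \<xi>] lL(2)[OF \<eta>]] .
  qed
  show ?thesis
  proof (rule that[OF T'V _ \<zeta>(1,3,2) g])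
    fix \<xi> assume \<xi>: "\<xi> \<in> ?L"
    show "l2_norm (T' \<xi>) \<le> l2_norm \<xi>"
    proof (rule l2_norm_le_inner[OF bounded_ops_l2[OF VN_bounded[OF T'V] \<xi>]])
      fix \<eta> assume \<eta>: "\<eta> \<in> ?L"
      note l = lL(2)[OF \<eta>]
      have "cmod (l2_inner (T' \<xi>) \<eta>) \<le> cmod (l2_inner (w \<xi>) (c (lr (inv g) \<eta>))) + cmod (l2_inner (b \<xi>) (b (lr (inv g) \<eta>)))"
        unfolding form[OF \<xi> \<eta>] by (rule norm_triangle_ineq)
      moreover have "cmod (l2_inner (w \<xi>) (c (lr (inv g) \<eta>))) \<le> l2_norm (c \<xi>) * l2_norm (c (lr (inv g) \<eta>))"
        by (rule order_trans[OF l2_CS[OF wL[OF \<xi>] cL[OF l]] mult_right_mono[OF wn[OF \<xi>]]]) simp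
      moreover have "cmod (l2_inner (b \<xi>) (b (lr (inv g) \<eta>))) \<le> l2_norm (b \<xi>) * l2_norm (b (lr (inv g) \<eta>))"
        by (rule l2_CS[OF bL[OF \<xi>] bL[OF l]])
      moreover have "l2_norm (c \<xi>) * l2_norm (c (lr (inv g) \<eta>)) + l2_norm (b \<xi>) * l2_norm (b (lr (inv g) \<eta>))
          \<le> l2_norm \<xi> * l2_norm \<eta>"
        by (rule two_term_CS[OF cn[OF \<xi>] cn[OF l, unfolded lr_in(2)[OF ig \<eta>]]]) simp_all
      ultimately show "cmod (l2_inner (T' \<xi>) \<eta>) \<le> l2_norm \<xi> * l2_norm \<eta>" by linarith
    qed simp
  next
    have gg: "lr (inv g) (lr g \<zeta>) = \<zeta>" using lr_mult[OF ig g(1) \<zeta>(1)] g(1) by (simp add: lr_one[OF \<zeta>(1)])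
    have "cmod (l2_inner (w \<zeta>) (c \<zeta>)) \<le> l2_norm (c \<zeta>) * l2_norm (c \<zeta>)"
      by (rule order_trans[OF l2_CS[OF wL[OF \<zeta>(1)] cL[OF \<zeta>(1)]] mult_right_mono[OF wn[OF \<zeta>(1)]]]) simp
    then have "- (l2_norm (c \<zeta>))\<^sup>2 \<le> Re (l2_inner (w \<zeta>) (c \<zeta>))"
      using abs_Re_le_cmod[of "l2_inner (w \<zeta>) (c \<zeta>)"] by (simp add: power2_eq_square)
    moreover have "Re (l2_inner (T' \<zeta>) (lr g \<zeta>)) = Re (l2_inner (w \<zeta>) (c \<zeta>)) + (l2_norm (b \<zeta>))\<^sup>2"
      unfolding form[OF \<zeta>(1) lL(1)[OF \<zeta>(1)]] gg by (simp add: l2_inner_self flip: of_real_power)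
    \<comment> \<open>On the unit vector \<zeta> the value is at least |b \<zeta>|^2 - |c
      \<zeta>|^2, which by \<open>cn\<close> is at least twice 3/4 minus 1.\<close>
    ultimately show "1 / 2 \<le> Re (l2_inner (T' \<zeta>) (lr g \<zeta>))" using cn[OF \<zeta>(1)] \<zeta>(3,4) by simp
  next
    fix x y assume x: "x \<in> carrier G" and y: "y \<in> carrier G"
    let ?x = "l2_delta x" and ?y = "l2_delta y"
    let ?y' = "lr (inv g) ?y"
    have X: "?x \<in> ?L" and Y: "?y \<in> ?L" using x y by simp_all
    have Y': "?y' \<in> ?L" by (rule lL(2)[OF Y])
    have bd: "l2_norm (b (l2_delta z)) \<le> \<epsilon> / 3" if "z \<in> carrier G" for z
      using bs VN_delta_norm[OF b that] by simp
    have y'd: "?y' = l2_delta (inv g \<otimes> y)" by (rule lr_delta[OF ig y])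
    have by': "l2_norm (b ?y') \<le> \<epsilon> / 3" unfolding y'd using bd ig y by simp
    have "l2_inner (w ?x) ?y' = l2_inner (T (c ?x)) ?y"
      unfolding w_def using lr_inner[OF ig TL[OF cL[OF X]] Y'] lr_mult[OF g(1) ig Y] g(1) by (simp add: lr_one[OF Y])
    moreover have "T (c ?x) = (\<lambda>z. T ?x z - T (b (b ?x)) z)"
      unfolding ceq[OF X] by (rule bounded_ops_diff[OF VN_bounded[OF T] X bL[OF bL[OF X]]])
    moreover have "l2_inner (w ?x) (c ?y') = l2_inner (w ?x) ?y' - l2_inner (w ?x) (b (b ?y'))"
      unfolding ceq[OF Y'] by (rule l2_inner_diff_right[OF Y' bL[OF bL[OF Y']] wL[OF X]])
    \<comment> \<open>Writing c = 1 - b b on both sides isolates the entry of \<open>T\<close>.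
      Every remaining term contains \<open>b\<close> applied to a point mass, whose norm is at most
      \<epsilon> / 3 for all points by \<open>VN_delta_norm\<close>.\<close>
    ultimately have e: "T' ?x y - T ?x y = l2_inner (b ?x) (b ?y') - T (b (b ?x)) y - l2_inner (w ?x) (b (b ?y'))"
      using form[OF X Y] by simp
    have "cmod (l2_inner (b ?x) (b ?y')) \<le> l2_norm (b ?x) * l2_norm (b ?y')" by (rule l2_CS[OF bL[OF X] bL[OF Y']])
    also have "\<dots> \<le> (\<epsilon> / 3) * 1"
      by (rule mult_mono[OF bd[OF x] order_trans[OF bc[OF Y']]]) (use \<epsilon> lr_in(2)[OF ig Y] in simp_all)
    finally have 1: "cmod (l2_inner (b ?x) (b ?y')) \<le> \<epsilon> / 3" by simp
    have 2: "cmod (T (b (b ?x)) y) \<le> \<epsilon> / 3"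
      using l2_coord_le[OF TL[OF bL[OF bL[OF X]]], of y] contr[OF bL[OF bL[OF X]]] bc[OF bL[OF X]] bd[OF x] by linarith
    have "cmod (l2_inner (w ?x) (b (b ?y'))) \<le> l2_norm (w ?x) * l2_norm (b (b ?y'))"
      by (rule l2_CS[OF wL[OF X] bL[OF bL[OF Y']]])
    also have "\<dots> \<le> 1 * (\<epsilon> / 3)"
      using wn[OF X] cc[OF X] bc[OF bL[OF Y']] by' by (intro mult_mono) auto
    finally have 3: "cmod (l2_inner (w ?x) (b (b ?y'))) \<le> \<epsilon> / 3" by simp
    show "cmod (T' ?x y - T ?x y) \<le> \<epsilon>"
      unfolding e using 1 2 3 norm_triangle_ineq4[of "l2_inner (b ?x) (b ?y') - T (b (b ?x)) y" "l2_inner (w ?x) (b (b ?y'))"]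
        norm_triangle_ineq4[of "l2_inner (b ?x) (b ?y')" "T (b (b ?x)) y"] by linarith
  qed
qed

end

lemma l2_inner_expand:
  assumes T: "T \<in> bounded_ops I" and \<zeta>: "\<zeta> \<in> l2 I" and A: "finite A" "A \<subseteq> I"
    and supp: "\<And>x. x \<notin> A \<Longrightarrow> \<zeta> x = 0" "\<And>x. x \<notin> A \<Longrightarrow> \<eta> x = 0"
  shows "l2_inner (T \<zeta>) \<eta> = (\<Sum>x\<in>A. \<Sum>y\<in>A. \<zeta> x * cnj (\<eta> y) * T (l2_delta x) y)"
proof -
  have dl: "l2_delta x \<in> l2 I" if "x \<in> A" for x using A(2) that by auto
  have \<eta>: "\<eta> \<in> l2 I" by (rule l2_finite_support[OF A supp(2)])
  have 1: "\<zeta> = (\<lambda>z. \<Sum>x\<in>A. \<zeta> x * l2_delta x z)"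
  proof
    fix z show "\<zeta> z = (\<Sum>x\<in>A. \<zeta> x * l2_delta x z)"
    proof (cases "z \<in> A")
      case True
      have "(\<Sum>x\<in>A. \<zeta> x * l2_delta x z) = (\<Sum>x\<in>A. if x = z then \<zeta> z else 0)"
        by (rule sum.cong) (auto simp: l2_delta_def)
      then show ?thesis using True A(1) by simp
    next
      case False
      then have "(\<Sum>x\<in>A. \<zeta> x * l2_delta x z) = 0" by (intro sum.neutral) (auto simp: l2_delta_def)
      then show ?thesis using supp(1)[OF False] by simp
    qed
  qed
  have "T (\<lambda>z. \<Sum>x\<in>A. \<zeta> x * l2_delta x z) = (\<lambda>z. \<Sum>x\<in>A. T (\<lambda>z. \<zeta> x * l2_delta x z) z)"
    by (rule bounded_ops_sum[OF T l2_scale[OF dl]])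
  then have "T \<zeta> = (\<lambda>z. \<Sum>x\<in>A. T (\<lambda>z. \<zeta> x * l2_delta x z) z)" unfolding 1[symmetric] .
  then have "l2_inner (T \<zeta>) \<eta> = (\<Sum>x\<in>A. l2_inner (T (\<lambda>z. \<zeta> x * l2_delta x z)) \<eta>)"
    by (simp only: l2_inner_sum_left[OF bounded_ops_l2[OF T l2_scale[OF dl]] \<eta>])
  also have "\<dots> = (\<Sum>x\<in>A. \<zeta> x * l2_inner (T (l2_delta x)) \<eta>)"
    by (rule sum.cong) (simp_all add: bounded_ops_scale[OF T dl] l2_inner_scale_left)
  also have "\<dots> = (\<Sum>x\<in>A. \<Sum>y\<in>A. \<zeta> x * cnj (\<eta> y) * T (l2_delta x) y)"
  proof (rule sum.cong)
    fix x
    have "l2_inner (T (l2_delta x)) \<eta> = infsum (\<lambda>y. T (l2_delta x) y * cnj (\<eta> y)) A"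
      unfolding l2_inner_def by (rule infsum_cong_neutral) (use supp(2) in auto)
    also have "\<dots> = (\<Sum>y\<in>A. T (l2_delta x) y * cnj (\<eta> y))" by (rule infsum_finite[OF A(1)])
    finally show "\<zeta> x * l2_inner (T (l2_delta x)) \<eta> = (\<Sum>y\<in>A. \<zeta> x * cnj (\<eta> y) * T (l2_delta x) y)"
      by (simp add: sum_distrib_left mult_ac)
  qed simp
  finally show ?thesis .
qed

text \<open>Only the entries indexed by \<open>A\<close> in both places enter, with coefficients of
  modulus at most 1.\<close>

lemma l2_inner_entries_le:
  assumes "S \<in> bounded_ops I" "T \<in> bounded_ops I" and \<zeta>: "\<zeta> \<in> l2 I" "l2_norm \<zeta> \<le> 1"
    and \<eta>: "\<eta> \<in> l2 I" "l2_norm \<eta> \<le> 1" and A: "finite A" "A \<subseteq> I"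
    and supp: "\<And>x. x \<notin> A \<Longrightarrow> \<zeta> x = 0" "\<And>x. x \<notin> A \<Longrightarrow> \<eta> x = 0"
    and e: "\<And>x y. x \<in> I \<Longrightarrow> y \<in> I \<Longrightarrow> cmod (S (l2_delta x) y - T (l2_delta x) y) \<le> e"
  shows "cmod (l2_inner (S \<zeta>) \<eta> - l2_inner (T \<zeta>) \<eta>) \<le> (real (card A))\<^sup>2 * e"
proof -
  have ex: "l2_inner (R \<zeta>) \<eta> = (\<Sum>x\<in>A. \<Sum>y\<in>A. \<zeta> x * cnj (\<eta> y) * R (l2_delta x) y)" if "R \<in> bounded_ops I" for R
    by (rule l2_inner_expand[OF that \<zeta>(1) A]) (simp_all add: supp)
  have "l2_inner (S \<zeta>) \<eta> - l2_inner (T \<zeta>) \<eta>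
      = (\<Sum>x\<in>A. \<Sum>y\<in>A. \<zeta> x * cnj (\<eta> y) * (S (l2_delta x) y - T (l2_delta x) y))"
    unfolding ex[OF assms(1)] ex[OF assms(2)]
    by (simp add: sum_subtractf right_diff_distrib)
  then have "cmod (l2_inner (S \<zeta>) \<eta> - l2_inner (T \<zeta>) \<eta>)
      \<le> (\<Sum>x\<in>A. cmod (\<Sum>y\<in>A. \<zeta> x * cnj (\<eta> y) * (S (l2_delta x) y - T (l2_delta x) y)))"
    by (simp only: norm_sum)
  also have "\<dots> \<le> (\<Sum>x\<in>A. \<Sum>y\<in>A. e)"
  proof (rule sum_mono, rule order_trans[OF norm_sum], rule sum_mono)
    fix x y assume "x \<in> A" "y \<in> A"
    then have xy: "x \<in> I" "y \<in> I" using A(2) by auto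
    have "cmod (\<zeta> x) * cmod (\<eta> y) \<le> 1 * 1"
      using l2_coord_le[OF \<zeta>(1), of x] l2_coord_le[OF \<eta>(1), of y] \<zeta>(2) \<eta>(2) by (intro mult_mono) auto
    then have "cmod (\<zeta> x) * cmod (\<eta> y) * cmod (S (l2_delta x) y - T (l2_delta x) y) \<le> 1 * e"
      by (intro mult_mono e xy) auto
    then show "cmod (\<zeta> x * cnj (\<eta> y) * (S (l2_delta x) y - T (l2_delta x) y)) \<le> e" by (simp add: norm_mult)
  qed
  also have "\<dots> = (real (card A))\<^sup>2 * e" by (simp add: power2_eq_square)
  finally show ?thesis .
qed

section \<open>The limit operator and the functional\<close>

context group
begin

text \<open>Weak compactness of the unit ball of VN(G): all matrix coefficients converge along one
  filter, and their limits form a bounded sesquilinear form.\<close>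

lemma contraction_weak_limit:
  assumes T: "\<And>n. T n \<in> VNs" "\<And>n \<xi>. \<xi> \<in> l2 (carrier G) \<Longrightarrow> l2_norm (T n \<xi>) \<le> l2_norm \<xi>"
  obtains \<U> S where "\<U> \<noteq> bot" "\<U> \<le> sequentially" "S \<in> VNs"
    "\<And>\<xi> \<eta>. \<xi> \<in> l2 (carrier G) \<Longrightarrow> \<eta> \<in> l2 (carrier G) \<Longrightarrow> ((\<lambda>n. l2_inner (T n \<xi>) \<eta>) \<longlongrightarrow> l2_inner (S \<xi>) \<eta>) \<U>"
proof -
  let ?L = "l2 (carrier G)"
  note TL = bounded_ops_l2[OF VN_bounded[OF T(1)]]
  define d where "d = (\<lambda>n p. if fst p \<in> ?L \<and> snd p \<in> ?L then l2_inner (T n (fst p)) (snd p) else 0)"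
  have le: "cmod (l2_inner (T n \<xi>) \<eta>) \<le> l2_norm \<xi> * l2_norm \<eta>" if "\<xi> \<in> ?L" "\<eta> \<in> ?L" for n \<xi> \<eta>
    by (rule order_trans[OF l2_CS[OF TL[OF that(1)] that(2)] mult_right_mono[OF T(2)[OF that(1)]]]) simp
  have d: "cmod (d n p) \<le> l2_norm (fst p) * l2_norm (snd p)" for n p
    using le[of "fst p" "snd p" n] by (auto simp: d_def)
  obtain \<U> \<sigma> where U: "\<U> \<noteq> bot" "\<U> \<le> sequentially" and \<sigma>: "\<And>p. ((\<lambda>n. d n p) \<longlongrightarrow> \<sigma> p) \<U>"
    by (rule bounded_families_limit_filter[of d, OF d]) (rule that)
  define B where "B = (\<lambda>\<xi> \<eta>. \<sigma> (\<xi>, \<eta>))"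
  have lim: "((\<lambda>n. l2_inner (T n \<xi>) \<eta>) \<longlongrightarrow> B \<xi> \<eta>) \<U>" if "\<xi> \<in> ?L" "\<eta> \<in> ?L" for \<xi> \<eta>
    using \<sigma>[of "(\<xi>, \<eta>)"] that by (simp add: d_def B_def)
  note uniq = tendsto_unique[OF U(1)]
  obtain S where S: "S \<in> bounded_ops (carrier G)" "\<And>\<xi> \<eta>. \<xi> \<in> ?L \<Longrightarrow> \<eta> \<in> ?L \<Longrightarrow> l2_inner (S \<xi>) \<eta> = B \<xi> \<eta>"
  proof (rule form_operator[of "carrier G" B 1])
    fix \<xi> \<xi>' \<eta> assume *: "\<xi> \<in> ?L" "\<xi>' \<in> ?L" "\<eta> \<in> ?L"
    have "l2_inner (T n (\<lambda>x. \<xi> x + \<xi>' x)) \<eta> = l2_inner (T n \<xi>) \<eta> + l2_inner (T n \<xi>') \<eta>" for n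
      unfolding bounded_ops_add[OF VN_bounded[OF T(1)] *(1,2)] by (rule l2_inner_add_left[OF TL[OF *(1)] TL[OF *(2)] *(3)])
    then show "B (\<lambda>x. \<xi> x + \<xi>' x) \<eta> = B \<xi> \<eta> + B \<xi>' \<eta>"
      using uniq[OF lim[OF l2_add[OF *(1,2)] *(3)]] tendsto_add[OF lim[OF *(1,3)] lim[OF *(2,3)]] by simp
    have "l2_inner (T n \<eta>) (\<lambda>x. \<xi> x + \<xi>' x) = l2_inner (T n \<eta>) \<xi> + l2_inner (T n \<eta>) \<xi>'" for n
      by (rule l2_inner_add_right[OF *(1,2) TL[OF *(3)]])
    then show "B \<eta> (\<lambda>x. \<xi> x + \<xi>' x) = B \<eta> \<xi> + B \<eta> \<xi>'"
      using uniq[OF lim[OF *(3) l2_add[OF *(1,2)]]] tendsto_add[OF lim[OF *(3,1)] lim[OF *(3,2)]] by simp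
  next
    fix c \<xi> \<eta> assume *: "\<xi> \<in> ?L" "\<eta> \<in> ?L"
    have "l2_inner (T n (\<lambda>x. c * \<xi> x)) \<eta> = c * l2_inner (T n \<xi>) \<eta>" for n
      unfolding bounded_ops_scale[OF VN_bounded[OF T(1)] *(1)] by (rule l2_inner_scale_left)
    then show "B (\<lambda>x. c * \<xi> x) \<eta> = c * B \<xi> \<eta>"
      using uniq[OF lim[OF l2_scale[OF *(1), of c] *(2)]] tendsto_mult_left[OF lim[OF *], of c] by simp
    have "l2_inner (T n \<eta>) (\<lambda>x. c * \<xi> x) = cnj c * l2_inner (T n \<eta>) \<xi>" for n
      by (rule l2_inner_scale_right)
    then show "B \<eta> (\<lambda>x. c * \<xi> x) = cnj c * B \<eta> \<xi>"
      using uniq[OF lim[OF *(2) l2_scale[OF *(1), of c]]] tendsto_mult_left[OF lim[OF *(2,1)], of "cnj c"] by simp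
    show "cmod (B \<xi> \<eta>) \<le> 1 * l2_norm \<xi> * l2_norm \<eta>"
      by (rule tendsto_upperbound[OF tendsto_norm[OF lim[OF *]] _ U(1)]) (use le[OF *] in simp)
  qed (simp, rule that)
  have limS: "((\<lambda>n. l2_inner (T n \<xi>) \<eta>) \<longlongrightarrow> l2_inner (S \<xi>) \<eta>) \<U>" if "\<xi> \<in> ?L" "\<eta> \<in> ?L" for \<xi> \<eta>
    using lim[OF that] S(2)[OF that] by simp
  have "S \<in> VNs" by (rule VN_weak_limit[OF S(1) U(1) T(1) limS])
  then show ?thesis by (rule that[OF U _ limS])
qed

text \<open>The state of the recursion is a contraction, the current pair of vectors and a finite
  set \<open>A\<close> that contains all supports met so far, of vectors and of coefficient
  functions. The next coefficient function avoids \<open>A\<close>, and the next contraction changes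
  entries by so little that pairings of vectors supported in \<open>A\<close> hardly move.\<close>

lemma disjoint_coefficients_with_lower_bound:
  assumes inf: "infinite (carrier G)"
  obtains T \<zeta> \<eta> where "T \<in> VNs" "\<And>n. \<zeta> n \<in> l2 (carrier G)" "\<And>n. l2_norm (\<zeta> n) \<le> 1"
    "\<And>n. \<eta> n \<in> l2 (carrier G)" "\<And>n. l2_norm (\<eta> n) \<le> 1"
    "\<And>s. eventually (\<lambda>n. vfun (\<zeta> n) (\<eta> n) s = 0) sequentially"
    "\<And>n::nat. 1 / 4 \<le> Re (l2_inner (T (\<zeta> n)) (\<eta> n))"
proof -
  let ?L = "l2 (carrier G)"
  define P where "P = (\<lambda>(T, A, \<zeta>, \<eta>). T \<in> VNs \<and> (\<forall>\<xi>\<in>?L. l2_norm (T \<xi>) \<le> l2_norm \<xi>) \<and> finite A \<and> A \<subseteq> carrier G \<and>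
     \<zeta> \<in> ?L \<and> l2_norm \<zeta> \<le> 1 \<and> \<eta> \<in> ?L \<and> l2_norm \<eta> \<le> 1 \<and>
     (\<forall>x. x \<notin> A \<longrightarrow> \<zeta> x = 0) \<and> (\<forall>x. x \<notin> A \<longrightarrow> \<eta> x = 0) \<and> (\<forall>x. x \<notin> A \<longrightarrow> vfun \<zeta> \<eta> x = 0) \<and>
     1 / 2 \<le> Re (l2_inner (T \<zeta>) \<eta>))"
  \<comment> \<open>The division by the square of 1 + card A compensates for the number of entries
    in a pairing; the summand 1 keeps the denominator positive for empty \<open>A\<close>.\<close>
  define Q where "Q = (\<lambda>(n :: nat) (T :: 'a l2_op, A, \<zeta> :: 'a \<Rightarrow> complex, \<eta> :: 'a \<Rightarrow> complex) (T', A', \<zeta>', \<eta>'). A \<subseteq> A' \<and> (\<forall>s\<in>A. vfun \<zeta>' \<eta>' s = 0) \<and>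
     (\<forall>x\<in>carrier G. \<forall>y\<in>carrier G. cmod (T' (l2_delta x) y - T (l2_delta x) y) \<le> (1 / 2) ^ n / 8 / (1 + real (card A))\<^sup>2))"
  have step: "\<exists>T' A' \<zeta> \<eta>. P (T', A', \<zeta>, \<eta>) \<and> A \<subseteq> A' \<and> (\<forall>s\<in>A. vfun \<zeta> \<eta> s = 0) \<and>
      (\<forall>x\<in>carrier G. \<forall>y\<in>carrier G. cmod (T' (l2_delta x) y - T (l2_delta x) y) \<le> \<epsilon>)"
    if T: "T \<in> VNs" and contr: "\<And>\<xi>. \<xi> \<in> ?L \<Longrightarrow> l2_norm (T \<xi>) \<le> l2_norm \<xi>" and A: "finite A" "A \<subseteq> carrier G" and \<epsilon>: "0 < \<epsilon>"
    for T A and \<epsilon> :: real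
  proof -
    obtain T' \<zeta> g where *: "T' \<in> VNs" "\<And>\<xi>. \<xi> \<in> ?L \<Longrightarrow> l2_norm (T' \<xi>) \<le> l2_norm \<xi>"
      "\<zeta> \<in> ?L" "l2_norm \<zeta> = 1" "finite {x. \<zeta> x \<noteq> 0}" "g \<in> carrier G"
      "\<And>s. s \<in> A \<Longrightarrow> vfun \<zeta> (lr g \<zeta>) s = 0" "finite {s. vfun \<zeta> (lr g \<zeta>) s \<noteq> 0}"
      "1 / 2 \<le> Re (l2_inner (T' \<zeta>) (lr g \<zeta>))"
      "\<And>x y. x \<in> carrier G \<Longrightarrow> y \<in> carrier G \<Longrightarrow> cmod (T' (l2_delta x) y - T (l2_delta x) y) \<le> \<epsilon>"
      by (rule perturb_contraction[OF inf T contr A(1) \<epsilon>]) (simp, rule that)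
    note \<eta> = lr_in[OF *(6,3)]
    let ?A = "A \<union> {x. \<zeta> x \<noteq> 0} \<union> {x. lr g \<zeta> x \<noteq> 0} \<union> {s. vfun \<zeta> (lr g \<zeta>) s \<noteq> 0}"
    have "{x. lr g \<zeta> x \<noteq> 0} \<subseteq> (\<lambda>x. g \<otimes> x) ` {x. \<zeta> x \<noteq> 0}"
    proof
      fix x assume "x \<in> {x. lr g \<zeta> x \<noteq> 0}"
      then have x: "x \<in> carrier G" "\<zeta> (inv g \<otimes> x) \<noteq> 0" by (auto simp: lr_eq[OF *(3)] split: if_splits)
      have "x = g \<otimes> (inv g \<otimes> x)" using x(1) *(6) by (simp add: m_assoc[symmetric])
      then show "x \<in> (\<lambda>x. g \<otimes> x) ` {x. \<zeta> x \<noteq> 0}" using x(2) by (intro image_eqI[of _ _ "inv g \<otimes> x"]) auto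
    qed
    then have fin: "finite ?A" using A(1) *(5,8) finite_subset[of "{x. lr g \<zeta> x \<noteq> 0}"] by simp
    have sub: "?A \<subseteq> carrier G"
      using A(2) l2_D[OF *(3)] l2_D[OF \<eta>(1)] Fourier_outside[OF vfun_in[OF *(3) \<eta>(1)]] by blast
    have "P (T', ?A, \<zeta>, lr g \<zeta>)"
      unfolding P_def prod.case using *(1-4,9) \<eta> fin sub by auto
    then show ?thesis using *(7,10) by (intro exI[of _ T'] exI[of _ ?A] exI[of _ \<zeta>] exI[of _ "lr g \<zeta>"]) auto
  qed
  have "\<exists>f. \<forall>n. P (f n) \<and> Q n (f n) (f (Suc n))"
  proof (rule dependent_nat_choice)
    \<comment> \<open>Start by perturbing the zero operator, with nothing to avoid.\<close>
    show "\<exists>p. P p"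
      using step[OF zero_VN _ finite.emptyI, of 1] by auto
  next
    fix p n assume p: "P p"
    obtain T A \<zeta> \<eta> where e: "p = (T, A, \<zeta>, \<eta>)" by (cases p)
    have "\<exists>T' A' \<zeta> \<eta>. P (T', A', \<zeta>, \<eta>) \<and> A \<subseteq> A' \<and> (\<forall>s\<in>A. vfun \<zeta> \<eta> s = 0) \<and>
      (\<forall>x\<in>carrier G. \<forall>y\<in>carrier G. cmod (T' (l2_delta x) y - T (l2_delta x) y) \<le> (1 / 2) ^ n / 8 / (1 + real (card A))\<^sup>2)"
      using p by (intro step) (auto simp: e P_def)
    then obtain T' A' \<zeta>' \<eta>' where q: "P (T', A', \<zeta>', \<eta>')"
      "A \<subseteq> A' \<and> (\<forall>s\<in>A. vfun \<zeta>' \<eta>' s = 0) \<and> (\<forall>x\<in>carrier G. \<forall>y\<in>carrier G.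
        cmod (T' (l2_delta x) y - T (l2_delta x) y) \<le> (1 / 2) ^ n / 8 / (1 + real (card A))\<^sup>2)"
      by (elim exE conjE) (rule that, assumption, intro conjI)
    have "Q n p (T', A', \<zeta>', \<eta>')" unfolding Q_def e prod.case by (rule q(2))
    with q(1) show "\<exists>q. P q \<and> Q n p q" by (intro exI conjI)
  qed
  then obtain f where f: "\<And>n. P (f n)" "\<And>n. Q n (f n) (f (Suc n))" by blast
  define T where "T = (\<lambda>n. fst (f n))"
  define A where "A = (\<lambda>n. fst (snd (f n)))"
  define \<zeta> where "\<zeta> = (\<lambda>n. fst (snd (snd (f n))))"
  define \<eta> where "\<eta> = (\<lambda>n. snd (snd (snd (f n))))"
  have fe: "f n = (T n, A n, \<zeta> n, \<eta> n)" for n by (simp add: T_def A_def \<zeta>_def \<eta>_def)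
  have TV: "T n \<in> VNs" and Tc: "\<And>\<xi>. \<xi> \<in> ?L \<Longrightarrow> l2_norm (T n \<xi>) \<le> l2_norm \<xi>" and A: "finite (A n)" "A n \<subseteq> carrier G"
    and \<zeta>: "\<zeta> n \<in> ?L" "l2_norm (\<zeta> n) \<le> 1" and \<eta>: "\<eta> n \<in> ?L" "l2_norm (\<eta> n) \<le> 1"
    and supp: "\<And>x. x \<notin> A n \<Longrightarrow> \<zeta> n x = 0" "\<And>x. x \<notin> A n \<Longrightarrow> \<eta> n x = 0" "\<And>x. x \<notin> A n \<Longrightarrow> vfun (\<zeta> n) (\<eta> n) x = 0"
    and low: "1 / 2 \<le> Re (l2_inner (T n (\<zeta> n)) (\<eta> n))" for n
    using f(1)[of n] unfolding fe P_def prod.case by blast+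
  have AS: "A n \<subseteq> A (Suc n)" and vS: "\<And>s. s \<in> A n \<Longrightarrow> vfun (\<zeta> (Suc n)) (\<eta> (Suc n)) s = 0"
    and TS: "\<And>x y. x \<in> carrier G \<Longrightarrow> y \<in> carrier G \<Longrightarrow>
      cmod (T (Suc n) (l2_delta x) y - T n (l2_delta x) y) \<le> (1 / 2) ^ n / 8 / (1 + real (card (A n)))\<^sup>2" for n
    using f(2)[of n] unfolding fe Q_def prod.case by blast+
  have Amono: "A m \<subseteq> A n" if "m \<le> n" for m n by (rule lift_Suc_mono_le[of A, OF AS that])
  \<comment> \<open>A step costs at most (1/2)^n / 8, which is exactly the drop of the surplus (1/4)
    (1/2)^n from n to n + 1. At n = k the claim asks for at most 1/2, which is available.\<close>
  have low': "1 / 4 + (1 / 4) * (1 / 2) ^ n \<le> Re (l2_inner (T n (\<zeta> k)) (\<eta> k))" if "k \<le> n" for k n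
    using that
  proof (induction n rule: dec_induct)
    case base
    have "(1 / 2 :: real) ^ k \<le> 1" by (rule power_le_one) auto
    then show ?case using low[of k] by linarith
  next
    case (step n)
    let ?c = "real (card (A n))"
    have out: "\<zeta> k x = 0" "\<eta> k x = 0" if "x \<notin> A n" for x
      using supp(1,2)[of x k] Amono[OF step.hyps(1)] that by blast+
    have "cmod (l2_inner (T (Suc n) (\<zeta> k)) (\<eta> k) - l2_inner (T n (\<zeta> k)) (\<eta> k)) \<le> ?c\<^sup>2 * ((1 / 2) ^ n / 8 / (1 + ?c)\<^sup>2)"
      by (rule l2_inner_entries_le[OF VN_bounded[OF TV] VN_bounded[OF TV] \<zeta> \<eta> A out TS])
    also have "\<dots> = (?c\<^sup>2 / (1 + ?c)\<^sup>2) * ((1 / 2) ^ n / 8)" by simp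
    also have "\<dots> \<le> 1 * ((1 / 2) ^ n / 8)"
      by (rule mult_right_mono) (auto simp: divide_le_eq_1 power_mono)
    finally have "cmod (l2_inner (T n (\<zeta> k)) (\<eta> k) - l2_inner (T (Suc n) (\<zeta> k)) (\<eta> k)) \<le> (1 / 2) ^ n / 8"
      by (simp add: norm_minus_commute)
    then have "Re (l2_inner (T n (\<zeta> k)) (\<eta> k)) - Re (l2_inner (T (Suc n) (\<zeta> k)) (\<eta> k)) \<le> (1 / 2) ^ n / 8"
      using complex_Re_le_cmod[of "l2_inner (T n (\<zeta> k)) (\<eta> k) - l2_inner (T (Suc n) (\<zeta> k)) (\<eta> k)"] by simp
    then show ?case using step.IH by simp
  qed
  obtain \<U> S where U: "\<U> \<noteq> bot" "\<U> \<le> sequentially" and S: "S \<in> VNs"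
    and lim: "\<And>\<xi> \<eta>. \<xi> \<in> ?L \<Longrightarrow> \<eta> \<in> ?L \<Longrightarrow> ((\<lambda>n. l2_inner (T n \<xi>) \<eta>) \<longlongrightarrow> l2_inner (S \<xi>) \<eta>) \<U>"
    by (rule contraction_weak_limit[of T, OF TV Tc]) (assumption, rule that)
  show ?thesis
  proof (rule that[OF S \<zeta> \<eta>])
    fix s
    show "eventually (\<lambda>n. vfun (\<zeta> n) (\<eta> n) s = 0) sequentially"
    proof (cases "\<exists>n. s \<in> A n")
      case True
      then obtain n where n: "s \<in> A n" by blast
      have "vfun (\<zeta> m) (\<eta> m) s = 0" if m: "Suc n \<le> m" for m
      proof -
        obtain j where j: "m = Suc j" "n \<le> j" using m by (cases m) auto
        then show ?thesis using vS[of s j] Amono[OF j(2)] n by auto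
      qed
      then show ?thesis unfolding eventually_sequentially by blast
    next
      case False
      then show ?thesis using supp(3) by simp
    qed
  next
    fix k
    have "eventually (\<lambda>n. k \<le> n) \<U>" by (rule filter_leD[OF U(2) eventually_ge_at_top])
    then have "eventually (\<lambda>n. 1 / 4 \<le> Re (l2_inner (T n (\<zeta> k)) (\<eta> k))) \<U>"
    proof (rule eventually_mono)
      fix n assume "k \<le> n"
      moreover have "(0 :: real) \<le> (1 / 2) ^ n" by simp
      ultimately show "1 / 4 \<le> Re (l2_inner (T n (\<zeta> k)) (\<eta> k))" using low'[of k n] by linarith
    qed
    then show "1 / 4 \<le> Re (l2_inner (S (\<zeta> k)) (\<eta> k))"
      by (rule tendsto_lowerbound[OF tendsto_Re[OF lim[OF \<zeta>(1) \<eta>(1)]] _ U(1)])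
  qed
qed

text \<open>The vector functionals are completely contractive, and this passes to the limit. For the
  vanishing, \<open>f\<close> is approximated by a finitely supported \<open>g\<close>; the
  coefficient functions eventually avoid the support of \<open>g\<close>, so that only the error of
  approximation is seen.\<close>

lemma invariant_functional:
  assumes inf: "infinite (carrier G)"
  obtains \<sigma> T\<^sub>0 where
    "\<And>S T. S \<in> VNs \<Longrightarrow> T \<in> VNs \<Longrightarrow> \<sigma> (\<lambda>\<xi> x. S \<xi> x + T \<xi> x) = \<sigma> S + \<sigma> T"
    "\<And>c T. T \<in> VNs \<Longrightarrow> \<sigma> (\<lambda>\<xi> x. c * T \<xi> x) = c * \<sigma> T"
    "\<And>n v. v \<in> mats (VN G) n \<Longrightarrow> scalar_norm n n (\<lambda>i j. \<sigma> (v i j)) \<le> opn n v"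
    "\<And>f T. f \<in> Acbs \<Longrightarrow> T \<in> VNs \<Longrightarrow> \<sigma> (VN_act G f T) = 0"
    "T\<^sub>0 \<in> VNs" "\<sigma> T\<^sub>0 \<noteq> (0 :: complex)"
proof -
  let ?L = "l2 (carrier G)"
  obtain T\<^sub>0 \<zeta> \<eta> where T0: "T\<^sub>0 \<in> VNs" and \<zeta>: "\<And>n. \<zeta> n \<in> ?L" "\<And>n. l2_norm (\<zeta> n) \<le> 1"
    and \<eta>: "\<And>n. \<eta> n \<in> ?L" "\<And>n. l2_norm (\<eta> n) \<le> 1"
    and ev: "\<And>s. eventually (\<lambda>n. vfun (\<zeta> n) (\<eta> n) s = 0) sequentially"
    and low: "\<And>n::nat. 1 / 4 \<le> Re (l2_inner (T\<^sub>0 (\<zeta> n)) (\<eta> n))"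
    by (rule disjoint_coefficients_with_lower_bound[OF inf]) (rule that)
  define d where "d = (\<lambda>n T. if T \<in> VNs then l2_inner (T (\<zeta> n)) (\<eta> n) else 0)"
  have TL: "T (\<zeta> n) \<in> ?L" if "T \<in> VNs" for T n by (rule bounded_ops_l2[OF VN_bounded[OF that] \<zeta>(1)])
  have mat: "scalar_norm m m (\<lambda>i j. d n (v i j)) \<le> opn m v" if v: "v \<in> mats (VN G) m" for m n v
  proof (rule scalar_norm_form_leI)
    note vV = VN_bounded[OF mats_VN[OF v]]
    show "0 \<le> opn m v" by (rule op_mnorm_nonneg[OF vV])
    fix w z
    have "(\<Sum>i<m. \<Sum>j<m. w i * d n (v i j) * z j)
        = (\<Sum>i<m. \<Sum>j<m. l2_inner (v i j (\<lambda>x. z j * \<zeta> n x)) (\<lambda>x. cnj (w i) * \<eta> n x))"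
    proof (intro sum.cong refl)
      fix i j assume "i \<in> {..<m}" "j \<in> {..<m}"
      then have ij: "i < m" "j < m" by auto
      show "w i * d n (v i j) * z j = l2_inner (v i j (\<lambda>x. z j * \<zeta> n x)) (\<lambda>x. cnj (w i) * \<eta> n x)"
        unfolding bounded_ops_scale[OF vV[OF ij] \<zeta>(1)] using mats_VN[OF v ij]
        by (simp add: l2_inner_scale_left l2_inner_scale_right d_def)
    qed
    then have "cmod (\<Sum>i<m. \<Sum>j<m. w i * d n (v i j) * z j)
        = cmod (\<Sum>i<m. \<Sum>j<m. l2_inner (v i j (\<lambda>x. z j * \<zeta> n x)) (\<lambda>x. cnj (w i) * \<eta> n x))" by (simp only:)
    also have "\<dots> \<le> opn m v * tuple_norm m (\<lambda>j x. z j * \<zeta> n x) * tuple_norm m (\<lambda>i x. cnj (w i) * \<eta> n x)"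
      by (rule op_mnorm_form[OF vV l2_scale[OF \<zeta>(1)] l2_scale[OF \<eta>(1)]])
    also have "\<dots> \<le> opn m v * vec_norm m z * vec_norm m w"
    proof (intro mult_mono order_refl)
      show "tuple_norm m (\<lambda>j x. z j * \<zeta> n x) \<le> vec_norm m z"
        using \<zeta>(2)[of n] by (intro L2_set_mono) (auto simp: l2_norm_scale mult_left_le)
      show "tuple_norm m (\<lambda>i x. cnj (w i) * \<eta> n x) \<le> vec_norm m w"
        using \<eta>(2)[of n] by (intro L2_set_mono) (auto simp: l2_norm_scale mult_left_le)
    qed (use op_mnorm_nonneg[OF vV] in auto)
    finally show "cmod (\<Sum>i<m. \<Sum>j<m. w i * d n (v i j) * z j) \<le> opn m v * vec_norm m w * vec_norm m z"
      by (simp add: mult_ac)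
  qed
  \<comment> \<open>The maximum with 0 covers operators outside VN(G), where \<open>d\<close> is 0
    but the sign of \<open>opn\<close> is unknown.\<close>
  have bd: "cmod (d n T) \<le> max 0 (opn 1 (\<lambda>_ _. T))" for n T
  proof (cases "T \<in> VNs")
    case True
    then show ?thesis using mat[of "\<lambda>_ _. T" 1 n] by (simp add: mats_def scalar_norm_1[simplified])
  qed (simp add: d_def)
  obtain \<U> \<sigma> where U: "\<U> \<noteq> bot" "\<U> \<le> sequentially" and \<sigma>: "\<And>T. ((\<lambda>n. d n T) \<longlongrightarrow> \<sigma> T) \<U>"
    by (rule bounded_families_limit_filter[of d, OF bd]) (rule that)
  note uniq = tendsto_unique[OF U(1)]
  show ?thesis
  proof (rule that[of \<sigma>, OF _ _ _ _ T0])
    fix S T assume *: "S \<in> VNs" "T \<in> VNs"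
    have "d n (\<lambda>\<xi> x. S \<xi> x + T \<xi> x) = d n S + d n T" for n
      using * VN_add[OF *] by (simp add: d_def l2_inner_add_left[OF TL[OF *(1)] TL[OF *(2)] \<eta>(1)])
    then show "\<sigma> (\<lambda>\<xi> x. S \<xi> x + T \<xi> x) = \<sigma> S + \<sigma> T"
      using uniq[OF \<sigma>[of "\<lambda>\<xi> x. S \<xi> x + T \<xi> x"]] tendsto_add[OF \<sigma>[of S] \<sigma>[of T]] by simp
  next
    fix c T assume *: "T \<in> VNs"
    have "d n (\<lambda>\<xi> x. c * T \<xi> x) = c * d n T" for n
      using * VN_smult[OF *] by (simp add: d_def l2_inner_scale_left)
    then show "\<sigma> (\<lambda>\<xi> x. c * T \<xi> x) = c * \<sigma> T"
      using uniq[OF \<sigma>[of "\<lambda>\<xi> x. c * T \<xi> x"]] tendsto_mult_left[OF \<sigma>[of T], of c] by simp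
  next
    fix m v assume v: "v \<in> mats (VN G) m"
    have o0: "0 \<le> opn m v" by (rule op_mnorm_nonneg[OF VN_bounded[OF mats_VN[OF v]]])
    show "scalar_norm m m (\<lambda>i j. \<sigma> (v i j)) \<le> opn m v"
    proof (rule scalar_norm_form_leI[OF o0])
      fix w z
      have "((\<lambda>n. cmod (\<Sum>i<m. \<Sum>j<m. w i * d n (v i j) * z j)) \<longlongrightarrow> cmod (\<Sum>i<m. \<Sum>j<m. w i * \<sigma> (v i j) * z j)) \<U>"
        by (intro tendsto_intros \<sigma>)
      moreover have "\<forall>n. cmod (\<Sum>i<m. \<Sum>j<m. w i * d n (v i j) * z j) \<le> opn m v * vec_norm m w * vec_norm m z"
        by (rule allI, rule order_trans[OF scalar_norm_form]) (intro mult_right_mono mat[OF v]; simp)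
      ultimately show "cmod (\<Sum>i<m. \<Sum>j<m. w i * \<sigma> (v i j) * z j) \<le> opn m v * vec_norm m w * vec_norm m z"
        by (rule tendsto_upperbound[OF _ always_eventually U(1)])
    qed
  next
    fix f T assume f: "f \<in> Acbs" and T: "T \<in> VNs"
    note act = VN_act_duality[OF Acb_Mcb[OF f] T]
    obtain c where c: "0 < c" "\<And>\<xi>. \<xi> \<in> ?L \<Longrightarrow> l2_norm (T \<xi>) \<le> c * l2_norm \<xi>"
      using VN_pos_bound[OF T] by blast
    have "(\<lambda>n. d n (VN_act G f T)) \<longlonglongrightarrow> 0"
    proof (rule LIMSEQ_I)
      fix r :: real assume r: "0 < r"
      \<comment> \<open>\<open>T\<close> is bounded by \<open>c\<close>, so the pairing below is at
        most c e = r / 2.\<close>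
      define e where "e = r / (2 * c)"
      have e: "0 < e" using r c(1) by (simp add: e_def)
      obtain g where g: "g \<in> Fourier G" "finite {s. g s \<noteq> 0}"
        "\<And>v. v \<in> Fourier G \<Longrightarrow> vA v \<le> 1 \<Longrightarrow> vA (\<lambda>x. (f x - g x) * v x) \<le> e"
        by (rule Acb_approx[OF f e]) (rule that)
      have "eventually (\<lambda>n. \<forall>s\<in>{s. g s \<noteq> 0}. vfun (\<zeta> n) (\<eta> n) s = 0) sequentially"
        by (rule eventually_ball_finite[OF g(2)]) (use ev in blast)
      then obtain N where N: "\<And>n s. n \<ge> N \<Longrightarrow> g s \<noteq> 0 \<Longrightarrow> vfun (\<zeta> n) (\<eta> n) s = 0"
        unfolding eventually_sequentially by blast
      have "norm (d n (VN_act G f T) - 0) < r" if n: "n \<ge> N" for n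
      proof -
        let ?v = "vfun (\<zeta> n) (\<eta> n)"
        have vF: "?v \<in> Fourier G" by (rule vfun_in[OF \<zeta>(1) \<eta>(1)])
        have "vA ?v \<le> 1 * 1"
          by (rule order_trans[OF vA_vfun_le[OF \<zeta>(1) \<eta>(1)]]) (intro mult_mono \<zeta>(2) \<eta>(2); simp)
        then have v1: "vA ?v \<le> 1" by simp
        \<comment> \<open>On the support of \<open>g\<close> the coefficient function vanishes from
          \<open>N\<close> on, and subtracting \<open>g\<close> changes nothing.\<close>
        have eq: "(\<lambda>x. f x * ?v x) = (\<lambda>x. (f x - g x) * ?v x)"
        proof
          fix x show "f x * ?v x = (f x - g x) * ?v x" using N[OF n, of x] by (cases "g x = 0") auto
        qed
        have fv: "(\<lambda>x. f x * ?v x) \<in> Fourier G" by (rule Mcb_mult[OF Acb_Mcb[OF f] vF])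
        have "d n (VN_act G f T) = duality G T (\<lambda>x. f x * ?v x)"
          unfolding act(2)[OF vF, symmetric] duality_vfun[OF act(1) \<zeta>(1) \<eta>(1)] using act(1) by (simp add: d_def)
        then have "cmod (d n (VN_act G f T)) \<le> c * vA (\<lambda>x. f x * ?v x)"
          using duality_le[OF T c fv] by simp
        also have "\<dots> \<le> c * e" unfolding eq by (intro mult_left_mono g(3)[OF vF v1]) (use c in simp)
        also have "\<dots> < r" using c(1) r by (simp add: e_def)
        finally show ?thesis by simp
      qed
      then show "\<exists>N. \<forall>n\<ge>N. norm (d n (VN_act G f T) - 0) < r" by blast
    qed
    then have "((\<lambda>n. d n (VN_act G f T)) \<longlongrightarrow> 0) \<U>" by (rule filterlim_mono[OF _ order_refl U(2)])
    then show "\<sigma> (VN_act G f T) = 0" by (rule uniq[OF \<sigma>])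
  next
    have "1 / 4 \<le> Re (\<sigma> T\<^sub>0)"
      by (rule tendsto_lowerbound[OF tendsto_Re[OF \<sigma>] _ U(1)]) (use low T0 in \<open>simp add: d_def\<close>)
    then show "\<sigma> T\<^sub>0 \<noteq> 0" by auto
  qed
qed

end

section \<open>The lifting problem\<close>

text \<open>The labelling \<open>q\<close> transports the points of \<open>I\<close> and the point
  \<open>None\<close> at infinity into a prescribed type, because the underlying type of the test
  modules is fixed in advance.\<close>

definition conv_domain :: "'a set \<Rightarrow> ('a option \<Rightarrow> 'i) \<Rightarrow> 'i set" where
  "conv_domain I q = q ` insert None (Some ` I)"

text \<open>
  The functions on a copy of the one-point compactification of the discrete space \<open>I\<close> that are
  continuous at the point \<open>q None\<close> at infinity.
\<close>

definition conv_funs :: "'a set \<Rightarrow> ('a option \<Rightarrow> 'i) \<Rightarrow> ('i \<Rightarrow> complex) set" where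
  "conv_funs I q = {f. (\<forall>i. i \<notin> conv_domain I q \<longrightarrow> f i = 0) \<and>
     (\<forall>e>0. finite {s \<in> I. e \<le> cmod (f (q (Some s)) - f (q None))})}"

lemma conv_funs_fin: "f \<in> conv_funs I q \<Longrightarrow> 0 < e \<Longrightarrow> finite {s \<in> I. e \<le> cmod (f (q (Some s)) - f (q None))}"
  by (simp add: conv_funs_def)

lemma conv_domain_cases:
  assumes "i \<in> conv_domain I q" obtains "i = q None" | s where "s \<in> I" "i = q (Some s)"
  using assms by (auto simp: conv_domain_def)

lemma conv_funs_bounded:
  assumes f: "f \<in> conv_funs I q"
  obtains B where "0 < B" "\<And>i. i \<in> conv_domain I q \<Longrightarrow> cmod (f i) \<le> B"
proof -
  let ?K = "{s \<in> I. 1 \<le> cmod (f (q (Some s)) - f (q None))}"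
  have K: "finite ?K" using f by (rule conv_funs_fin) simp
  \<comment> \<open>Only finitely many values differ from the value at infinity by 1 or more; the
    sum of their moduli takes care of them.\<close>
  define M where "M = (\<Sum>s\<in>?K. cmod (f (q (Some s))))"
  have M0: "0 \<le> M" by (simp add: M_def sum_nonneg)
  show ?thesis
  proof (rule that[of "cmod (f (q None)) + 1 + M"])
    show "0 < cmod (f (q None)) + 1 + M" using M0 by (simp add: add_nonneg_pos add_pos_nonneg)
    fix i assume "i \<in> conv_domain I q"
    then show "cmod (f i) \<le> cmod (f (q None)) + 1 + M"
    proof (cases rule: conv_domain_cases)
      case (2 s)
      show ?thesis
      proof (cases "s \<in> ?K")
        case True
        have "cmod (f (q (Some s))) \<le> M" unfolding M_def by (rule member_le_sum[OF True _ K]) simp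
        then show ?thesis unfolding 2(2) using norm_ge_zero[of "f (q None)"] by linarith
      next
        case False
        then have "cmod (f (q (Some s)) - f (q None)) < 1" using 2 by simp
        then show ?thesis using norm_triangle_sub[of "f (q (Some s))" "f (q None)"] M0 2 by simp
      qed
    qed (use M0 in simp)
  qed
qed

lemma conv_fun_space: "fun_space (conv_domain I q) (conv_funs I q)"
proof
  show "conv_domain I q \<noteq> {}" by (simp add: conv_domain_def)
  show "f x = 0" if "f \<in> conv_funs I q" "x \<notin> conv_domain I q" for f x
    using that by (simp add: conv_funs_def)
  show "\<exists>B. \<forall>x\<in>conv_domain I q. cmod (f x) \<le> B" if "f \<in> conv_funs I q" for f
    by (rule conv_funs_bounded[OF that]) blast
  show "(\<lambda>_. 0) \<in> conv_funs I q" by (simp add: conv_funs_def not_le)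
next
  fix f g assume f: "f \<in> conv_funs I q" and g: "g \<in> conv_funs I q"
  have "finite {s \<in> I. e \<le> cmod (f (q (Some s)) + g (q (Some s)) - (f (q None) + g (q None)))}" if e: "0 < e" for e
  proof (rule finite_subset)
    have "e / 2 \<le> cmod (f a - f b) \<or> e / 2 \<le> cmod (g a - g b)" if "e \<le> cmod (f a + g a - (f b + g b))" for a b
      using that norm_diff_triangle_ineq[of "f a" "g a" "f b" "g b"] by linarith
    then show "{s \<in> I. e \<le> cmod (f (q (Some s)) + g (q (Some s)) - (f (q None) + g (q None)))}
      \<subseteq> {s \<in> I. e / 2 \<le> cmod (f (q (Some s)) - f (q None))} \<union> {s \<in> I. e / 2 \<le> cmod (g (q (Some s)) - g (q None))}"
      by blast
  qed (use conv_funs_fin[OF f, of "e / 2"] conv_funs_fin[OF g, of "e / 2"] e in simp)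
  then show "(\<lambda>x. f x + g x) \<in> conv_funs I q" using f g by (simp add: conv_funs_def)
next
  fix f c assume f: "f \<in> conv_funs I q"
  have "finite {s \<in> I. e \<le> cmod (c * f (q (Some s)) - c * f (q None))}" if e: "0 < e" for e
  proof (rule finite_subset)
    \<comment> \<open>The denominator |c| + 1 covers c = 0.\<close>
    have "e / (cmod c + 1) \<le> cmod (f a - f b)" if "e \<le> cmod (c * f a - c * f b)" for a b
    proof -
      have "cmod (c * f a - c * f b) = cmod c * cmod (f a - f b)" by (simp add: norm_mult flip: right_diff_distrib)
      then have "e \<le> (cmod c + 1) * cmod (f a - f b)" 
        using norm_ge_zero[of "f a - f b"] that unfolding distrib_right mult_1 by linarith
      then show ?thesis by (simp add: divide_le_eq mult.commute add_nonneg_pos)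
    qed
    then show "{s \<in> I. e \<le> cmod (c * f (q (Some s)) - c * f (q None))}
      \<subseteq> {s \<in> I. e / (cmod c + 1) \<le> cmod (f (q (Some s)) - f (q None))}" by blast
  qed (use conv_funs_fin[OF f, of "e / (cmod c + 1)"] e in \<open>simp add: add_nonneg_pos\<close>)
  then show "(\<lambda>x. c * f x) \<in> conv_funs I q" using f by (simp add: conv_funs_def)
next
  fix F g assume F: "\<And>k::nat. F k \<in> conv_funs I q" and g: "\<And>x. x \<notin> conv_domain I q \<Longrightarrow> g x = 0"
    and lim: "\<And>e. 0 < e \<Longrightarrow> \<exists>k. \<forall>x\<in>conv_domain I q. cmod (F k x - g x) \<le> e"
  have "finite {s \<in> I. e \<le> cmod (g (q (Some s)) - g (q None))}" if e: "0 < e" for e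
  proof -
    obtain k where k: "\<And>x. x \<in> conv_domain I q \<Longrightarrow> cmod (F k x - g x) \<le> e / 3"
      using lim[of "e / 3"] e by auto
    show ?thesis
    proof (rule finite_subset)
      have "e / 3 \<le> cmod (F k a - F k b)"
        if "e \<le> cmod (g a - g b)" "a \<in> conv_domain I q" "b \<in> conv_domain I q" for a b
      proof -
        have "g a - g b = (F k a - F k b) - ((F k a - g a) - (F k b - g b))" by simp
        then have "cmod (g a - g b) \<le> cmod (F k a - F k b) + cmod ((F k a - g a) - (F k b - g b))"
          by (metis norm_triangle_ineq4)
        then show ?thesis
          using norm_triangle_ineq4[of "F k a - g a" "F k b - g b"] k[OF that(2)] k[OF that(3)] that(1) by linarith
      qed
      then show "{s \<in> I. e \<le> cmod (g (q (Some s)) - g (q None))} \<subseteq> {s \<in> I. e / 3 \<le> cmod (F k (q (Some s)) - F k (q None))}"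
        by (auto simp: conv_domain_def)
    qed (use conv_funs_fin[OF F, of "e / 3"] e in simp)
  qed
  then show "g \<in> conv_funs I q" using g by (simp add: conv_funs_def)
qed

text \<open>The complex numbers, realised as functions supported at one point because both test
  modules must live over the same type.\<close>

lemma point_fun_space: "fun_space {p} {f. \<forall>i. i \<noteq> p \<longrightarrow> f i = 0}"
  by unfold_locales auto

section \<open>The lift does not exist\<close>

context group
begin

lemma nM_nonneg:
  assumes "\<And>i j. i < n \<Longrightarrow> j < n \<Longrightarrow> f i j \<in> Mcb" shows "0 \<le> nM n f"
  using order_trans[OF scalar_norm_nonneg nM_eval[OF assms one_closed]] by simp

lemma VN_not_operator_projective:
  fixes q :: "'a option \<Rightarrow> 'i"
  assumes inf: "infinite (carrier G)" and q: "inj q"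
  shows "\<not> operator_projective TYPE('i \<Rightarrow> complex) (Acb G) (VN G) (VN_act G)"
proof
  assume op: "operator_projective TYPE('i \<Rightarrow> complex) (Acb G) (VN G) (VN_act G)"
  obtain \<sigma> T\<^sub>0 where \<sigma>:
    "\<And>S T. S \<in> VNs \<Longrightarrow> T \<in> VNs \<Longrightarrow> \<sigma> (\<lambda>\<xi> x. S \<xi> x + T \<xi> x) = \<sigma> S + \<sigma> T"
    "\<And>c T. T \<in> VNs \<Longrightarrow> \<sigma> (\<lambda>\<xi> x. c * T \<xi> x) = c * \<sigma> T"
    "\<And>n v. v \<in> mats (VN G) n \<Longrightarrow> scalar_norm n n (\<lambda>i j. \<sigma> (v i j)) \<le> opn n v"
    "\<And>f T. f \<in> Acbs \<Longrightarrow> T \<in> VNs \<Longrightarrow> \<sigma> (VN_act G f T) = 0"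
    and T0: "T\<^sub>0 \<in> VNs" "\<sigma> T\<^sub>0 \<noteq> (0 :: complex)"
    by (rule invariant_functional[OF inf]) (rule that)
  define J where "J = conv_domain (carrier G) q"
  define p where "p = q None"
  define CE where "CE = conv_funs (carrier G) q"
  define CF :: "('i \<Rightarrow> complex) set" where "CF = {f. \<forall>i. i \<noteq> p \<longrightarrow> f i = 0}"
  interpret E: fun_space J CE unfolding J_def CE_def by (rule conv_fun_space)
  interpret F: fun_space "{p}" CF unfolding CF_def by (rule point_fun_space)
  have pJ: "p \<in> J" by (simp add: J_def p_def conv_domain_def)
  have qJ: "q (Some s) \<in> J" if "s \<in> carrier G" for s using that by (simp add: J_def conv_domain_def)
  \<comment> \<open>Evaluation at a group element, and the zero character at infinity. Products stay
    continuous at infinity because elements of \<open>Acb G\<close> vanish there.\<close>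
  define ch :: "'i \<Rightarrow> ('a \<Rightarrow> complex) \<Rightarrow> complex" where
    "ch = (\<lambda>i a. case inv_into UNIV q i of None \<Rightarrow> 0 | Some s \<Rightarrow> a s)"
  have ch: "ch p a = 0" "ch (q (Some s)) a = a s" for a s
    by (simp_all add: ch_def p_def inv_f_f[OF q])
  define act :: "('a \<Rightarrow> complex) \<Rightarrow> ('i \<Rightarrow> complex) \<Rightarrow> 'i \<Rightarrow> complex" where "act = (\<lambda>a f x. ch x a * f x)"
  have ch_alg: "ch x (a \<oplus>\<^bsub>Acb G\<^esub> b) = ch x a + ch x b" "ch x (c \<odot>\<^bsub>Acb G\<^esub> a) = c * ch x a"
    "ch x (a \<otimes>\<^bsub>Acb G\<^esub> b) = ch x a * ch x b" for x a b c
    by (auto simp: ch_def Acb_simps split: option.split)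
  have matsM: "v i j \<in> Mcb" if "v \<in> mats (Acb G) n" "i < n" "j < n" for v n i j
    using that Acb_Mcb by (simp add: mats_def)
  have ch_bound: "scalar_norm n n (\<lambda>k l. ch x (v k l)) \<le> mnorm (Acb G) n v"
    if x: "x \<in> J" and v: "v \<in> mats (Acb G) n" for x n v
    using x unfolding J_def
  proof (cases rule: conv_domain_cases)
    case 1
    then show ?thesis using nM_nonneg[OF matsM[OF v]] by (simp add: ch[unfolded p_def] mnorm_Acb)
  next
    case (2 s)
    then show ?thesis using nM_eval[OF matsM[OF v]] by (simp add: ch mnorm_Acb)
  qed
  have ne: "Acbs \<noteq> {}" using Fourier_Acb[OF delta_Fourier[OF one_closed]] by blast
  have actE: "cb_left_module (Acb G) E.V act"
    unfolding act_def
  proof (rule E.pointwise_cb_left_module[OF ne _ ch_alg ch_bound])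
    fix a f assume a: "a \<in> Acbs" and f: "f \<in> CE"
    obtain B where B: "0 < B" "\<And>i. i \<in> J \<Longrightarrow> cmod (f i) \<le> B"
      by (rule conv_funs_bounded[OF f[unfolded CE_def]]) (simp add: J_def that)
    have "finite {s \<in> carrier G. e \<le> cmod (a s * f (q (Some s)))}" if e: "0 < e" for e
    proof (rule finite_subset)
      show "{s \<in> carrier G. e \<le> cmod (a s * f (q (Some s)))} \<subseteq> {s. e / B \<le> cmod (a s)}"
      proof
        fix s assume s: "s \<in> {s \<in> carrier G. e \<le> cmod (a s * f (q (Some s)))}"
        then have "e \<le> cmod (a s) * cmod (f (q (Some s)))" by (simp add: norm_mult)
        also have "\<dots> \<le> cmod (a s) * B" using s by (intro mult_left_mono B(2) qJ) auto
        finally show "s \<in> {s. e / B \<le> cmod (a s)}" using B(1) by (simp add: divide_le_eq)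
      qed
      show "finite {s. e / B \<le> cmod (a s)}" by (rule Acb_vanishes_at_infinity[OF a]) (use e B(1) in simp)
    qed
    then show "(\<lambda>x. ch x a * f x) \<in> CE"
      using E.outside[OF f] by (simp add: CE_def conv_funs_def ch[unfolded p_def] J_def)
  qed
  have actF: "cb_left_module (Acb G) F.V act"
    unfolding act_def
    by (rule F.pointwise_cb_left_module[OF ne _ ch_alg ch_bound]) (use pJ in \<open>auto simp: CF_def\<close>)
  define T :: "('i \<Rightarrow> complex) \<Rightarrow> 'i \<Rightarrow> complex" where "T = (\<lambda>f i. if i = p then f i else 0)"
  define S where "S = (\<lambda>x i. if i = p then \<sigma> x else 0)"
  have Tp: "T f p = f p" for f by (simp add: T_def)
  have Tcb: "completely_bounded E.V F.V T"
    unfolding completely_bounded_def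
  proof (intro conjI exI[of _ 1] allI impI ballI)
    show "linear_map E.V F.V T"
      by (auto simp: linear_map_def sup_space_simps T_def CF_def)
    fix n v assume v: "v \<in> mats E.V n"
    have "mnorm F.V n (\<lambda>i j. T (v i j)) \<le> mnorm E.V n v"
      by (rule F.mnorm_least) (use E.mnorm_upper[OF v pJ] in \<open>simp add: Tp\<close>)
    then show "mnorm F.V n (\<lambda>i j. T (v i j)) \<le> 1 * mnorm E.V n v" by simp
  qed
  have Tmod: "T \<in> cb_module_maps (Acb G) E.V act F.V act"
    unfolding cb_module_maps_def using Tcb by (auto simp: T_def act_def)
  have fun_in: "(\<lambda>i. if i \<in> J then c else 0) \<in> CE" for c
  proof -
    have "{s \<in> carrier G. e \<le> cmod ((if q (Some s) \<in> J then c else 0) - (if q None \<in> J then c else 0))} = {}"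
      if "0 < e" for e :: real
      using that qJ pJ by (auto simp: p_def)
    then have "finite {s \<in> carrier G. e \<le> cmod ((if q (Some s) \<in> J then c else 0) - (if q None \<in> J then c else 0))}"
      if "0 < e" for e :: real using that by (simp only: finite.emptyI)
    then show ?thesis unfolding CE_def conv_funs_def J_def[symmetric]
      by (intro CollectI conjI allI impI) (simp, assumption)
  qed
  have surj: "T ` carrier E.V = carrier F.V"
  proof
    show "T ` carrier E.V \<subseteq> carrier F.V" using Tcb by (auto simp: completely_bounded_def linear_map_def)
    show "carrier F.V \<subseteq> T ` carrier E.V"
    proof
      fix f assume "f \<in> carrier F.V"
      then have "f = T (\<lambda>i. if i \<in> J then f p else 0)" using pJ by (auto simp: sup_space_simps CF_def T_def)
      then show "f \<in> T ` carrier E.V" using fun_in[of "f p"] unfolding sup_space_simps by (rule image_eqI)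
    qed
  qed
  have kernel: "completely_complemented E.V {f \<in> carrier E.V. T f = \<zero>\<^bsub>F.V\<^esub>}"
    unfolding completely_complemented_def
  proof (intro exI conjI)
    \<comment> \<open>Subtracting the constant with the value at infinity: constants are a
      completely bounded right inverse of evaluation, and the difference of two complete
      contractions has bound 2.\<close>
    let ?P = "\<lambda>f x. f x - (if x \<in> J then f p else (0 :: complex))"
    have P_in: "?P f \<in> CE" if "f \<in> CE" for f by (rule E.diff_in[OF that fun_in])
    show "completely_bounded E.V E.V ?P"
      unfolding completely_bounded_def
    proof (intro conjI exI[of _ 2] allI impI ballI)
      show "linear_map E.V E.V ?P"
        by (auto simp: linear_map_def sup_space_simps P_in fun_eq_iff algebra_simps)
      fix n v assume v: "v \<in> mats E.V n"
      show "mnorm E.V n (\<lambda>i j. ?P (v i j)) \<le> 2 * mnorm E.V n v"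
      proof (rule E.mnorm_least)
        fix x assume x: "x \<in> J"
        have "scalar_norm n n (\<lambda>i j. v i j x + (-1) * v i j p)
            \<le> scalar_norm n n (\<lambda>i j. v i j x) + scalar_norm n n (\<lambda>i j. (-1) * v i j p)"
          by (rule scalar_norm_triangle)
        also have "scalar_norm n n (\<lambda>i j. (-1) * v i j p) = scalar_norm n n (\<lambda>i j. v i j p)"
          by (subst scalar_norm_scale) simp
        finally show "scalar_norm n n (\<lambda>i j. ?P (v i j) x) \<le> 2 * mnorm E.V n v"
          using E.mnorm_upper[OF v x] E.mnorm_upper[OF v pJ] x by simp
      qed
    qed
    show "\<forall>f\<in>carrier E.V. ?P (?P f) = ?P f" using pJ by auto
    show "?P ` carrier E.V = {f \<in> carrier E.V. T f = \<zero>\<^bsub>F.V\<^esub>}"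
    proof
      show "?P ` carrier E.V \<subseteq> {f \<in> carrier E.V. T f = \<zero>\<^bsub>F.V\<^esub>}"
        using P_in pJ by (auto simp: sup_space_simps T_def fun_eq_iff)
      show "{f \<in> carrier E.V. T f = \<zero>\<^bsub>F.V\<^esub>} \<subseteq> ?P ` carrier E.V"
      proof
        fix f assume f: "f \<in> {f \<in> carrier E.V. T f = \<zero>\<^bsub>F.V\<^esub>}"
        then have "T f p = 0" by (simp add: sup_space_simps)
        then have "f = ?P f" by (simp add: Tp fun_eq_iff)
        moreover have "f \<in> carrier E.V" using f by simp
        ultimately show "f \<in> ?P ` carrier E.V" by (rule image_eqI)
      qed
    qed
  qed
  have closure: "norm_closure F.V (carrier F.V) = carrier F.V"
  proof
    show "carrier F.V \<subseteq> norm_closure F.V (carrier F.V)"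
    proof
      fix f assume f: "f \<in> carrier F.V"
      have "vnorm F.V (f \<ominus>\<^bsub>F.V\<^esub> f) \<le> 0"
        using f by (subst F.minus_V) (simp_all add: sup_space_simps(1) F.vnorm_least)
      then show "f \<in> norm_closure F.V (carrier F.V)" using f unfolding norm_closure_def by force
    qed
  qed (auto simp: norm_closure_def)
  have "completely_complemented F.V (carrier F.V)"
    unfolding completely_complemented_def
    by (intro exI[of _ "\<lambda>x. x"]) (auto simp: completely_bounded_def linear_map_def intro: exI[of _ 1])
  then have adm: "admissible E.V F.V T"
    unfolding admissible_def surj using Tcb kernel closure by blast
  have VNs: "x \<oplus>\<^bsub>VN G\<^esub> y = (\<lambda>\<xi> t. x \<xi> t + y \<xi> t)" "c \<odot>\<^bsub>VN G\<^esub> x = (\<lambda>\<xi> t. c * x \<xi> t)"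
    "mnorm (VN G) = opn" for x y c
    by (simp_all add: VN_def)
  have "completely_bounded (VN G) F.V S"
    unfolding completely_bounded_def
  proof (intro conjI exI[of _ 1] allI impI ballI)
    show "linear_map (VN G) F.V S"
      by (auto simp: linear_map_def sup_space_simps CF_def VNs \<sigma>(1,2) S_def)
    fix n v assume v: "v \<in> mats (VN G) n"
    have "mnorm F.V n (\<lambda>i j. S (v i j)) \<le> opn n v"
      by (rule F.mnorm_least) (use \<sigma>(3)[OF v] in \<open>simp add: S_def\<close>)
    then show "mnorm F.V n (\<lambda>i j. S (v i j)) \<le> 1 * mnorm (VN G) n v" by (simp add: VNs)
  qed
  \<comment> \<open>Both sides of the module identity are 0: \<sigma> kills the range of the action,
    and the character at infinity is 0.\<close>
  then have "S \<in> cb_module_maps (Acb G) (VN G) (VN_act G) F.V act"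
    unfolding cb_module_maps_def by (auto simp: S_def act_def ch \<sigma>(4) fun_eq_iff)
  then obtain R where R: "R \<in> cb_module_maps (Acb G) (VN G) (VN_act G) E.V act" "\<forall>x\<in>VNs. T (R x) = S x"
    using op[unfolded operator_projective_def, rule_format, OF actE actF Tmod adm surj] by blast
  have Rcb: "completely_bounded (VN G) E.V R" and Ract: "\<And>a x. a \<in> Acbs \<Longrightarrow> x \<in> VNs \<Longrightarrow> R (VN_act G a x) = act a (R x)"
    using R(1) by (auto simp: cb_module_maps_def)
  obtain C where C: "\<And>n v. 0 < n \<Longrightarrow> v \<in> mats (VN G) n \<Longrightarrow> mnorm E.V n (\<lambda>i j. R (v i j)) \<le> C * opn n v"
    using Rcb by (auto simp: completely_bounded_def VNs)
  have Rin: "R x \<in> CE" if "x \<in> VNs" for x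
    using Rcb that by (auto simp: completely_bounded_def linear_map_def sup_space_simps)
  have Rs: "R (\<lambda>\<xi> t. c * x \<xi> t) = (\<lambda>i. c * R x i)" if "x \<in> VNs" for c x
    using Rcb that by (auto simp: completely_bounded_def linear_map_def sup_space_simps VNs)
  define l where "l = R T\<^sub>0 p"
  have "l = \<sigma> T\<^sub>0" using R(2) T0(1) Tp[of "R T\<^sub>0"] by (simp add: l_def S_def)
  then have l: "0 < cmod l" using T0(2) by simp
  have small: "cmod (R T\<^sub>0 (q (Some s))) \<le> \<bar>C\<bar> * cmod (T\<^sub>0 (l2_delta \<one>) s)" if s: "s \<in> carrier G" for s
  proof -
    note lrV = lr_VN[OF s]
    have "R (VN_act G (l2_delta s) T\<^sub>0) (q (Some s)) = R T\<^sub>0 (q (Some s))"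
      unfolding Ract[OF Fourier_Acb[OF delta_Fourier[OF s]] T0(1)] by (simp add: act_def ch l2_delta_def)
    then have "R T\<^sub>0 (q (Some s)) = T\<^sub>0 (l2_delta \<one>) s * R (lr s) (q (Some s))"
      unfolding VN_act_delta[OF T0(1) s] Rs[OF lrV] by simp
    moreover have "cmod (R (lr s) (q (Some s))) \<le> \<bar>C\<bar>"
    proof -
      have "cmod (R (lr s) (q (Some s))) \<le> vnorm E.V (R (lr s))" by (rule E.vnorm_upper[OF Rin[OF lrV] qJ[OF s]])
      also have "\<dots> \<le> C * opn 1 (\<lambda>_ _. lr s)" unfolding vnorm_def by (rule C) (use lrV in \<open>simp_all add: mats_def\<close>)
      also have "\<dots> \<le> \<bar>C\<bar> * 1"
        by (rule mult_mono) (use opn_lr[OF s] op_mnorm_nonneg[of 1 "\<lambda>_ _. lr s" "carrier G"] lr_bounded[OF s] in auto)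
      finally show ?thesis by simp
    qed
    ultimately show ?thesis by (simp add: norm_mult mult.commute[of "\<bar>C\<bar>"] mult_left_mono)
  qed
  \<comment> \<open>Outside the first set the value of R T_0 is within |l| / 2 of \<open>l\<close>,
    by continuity at infinity. Outside the second it is itself smaller than |l| / 2, by square
    summability. An infinite group has a point outside both.\<close>
  let ?K1 = "{s \<in> carrier G. cmod l / 2 \<le> cmod (R T\<^sub>0 (q (Some s)) - R T\<^sub>0 (q None))}"
  let ?K2 = "{s. cmod l / 2 / (\<bar>C\<bar> + 1) \<le> cmod (T\<^sub>0 (l2_delta \<one>) s)}"
  have "finite ?K1" by (rule conv_funs_fin[OF Rin[OF T0(1), unfolded CE_def]]) (use l in simp)
  moreover have "finite ?K2"
    by (rule l2_vanishes_at_infinity[OF bounded_ops_l2[OF VN_bounded[OF T0(1)], of "l2_delta \<one>"]])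
      (use l in \<open>simp_all add: add_nonneg_pos\<close>)
  ultimately have fin: "finite (?K1 \<union> ?K2)" by (rule finite_UnI)
  have "\<not> carrier G \<subseteq> ?K1 \<union> ?K2" using inf finite_subset[OF _ fin] by (rule contrapos_nn)
  then obtain s where s: "s \<in> carrier G" "s \<notin> ?K1 \<union> ?K2" unfolding subset_iff not_all not_imp by (elim exE conjE) (rule that)
  have "cmod (R T\<^sub>0 (q (Some s)) - l) < cmod l / 2" using s by (simp add: l_def p_def)
  moreover have "cmod (R T\<^sub>0 (q (Some s))) < cmod l / 2"
  proof -
    have "\<bar>C\<bar> * cmod (T\<^sub>0 (l2_delta \<one>) s) \<le> (\<bar>C\<bar> + 1) * cmod (T\<^sub>0 (l2_delta \<one>) s)" by (rule mult_right_mono) auto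
    also have "\<dots> < (\<bar>C\<bar> + 1) * (cmod l / 2 / (\<bar>C\<bar> + 1))"
      using s(2) by (intro mult_strict_left_mono) auto
    also have "\<dots> = cmod l / 2"
    proof -
      have "D * (x / 2 / D) = x / 2" if "D \<noteq> 0" for D x :: real using that by simp
      then show ?thesis using abs_ge_zero[of C] by (metis add_nonneg_pos less_irrefl zero_less_one)
    qed
    finally show ?thesis using small[OF s(1)] by linarith
  qed
  moreover have "cmod l \<le> cmod (R T\<^sub>0 (q (Some s))) + cmod (R T\<^sub>0 (q (Some s)) - l)"
    using norm_triangle_sub[of l "R T\<^sub>0 (q (Some s))"] by (simp add: norm_minus_commute)
  ultimately show False by linarith
qed

end

theorem theorem5p7:
  fixes G :: "('g, 'b) monoid_scheme" and H :: "'g set"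
  assumes "group G"
    and "subgroup H G" and "infinite H" and "weakly_amenable (G\<lparr>carrier := H\<rparr>)"
  shows "\<not> operator_projective TYPE('g test_universe) (Acb G) (VN G) (VN_act G)"
proof -
  interpret group G by fact
  \<comment> \<open>The test universe consists of functions on the type in which \<open>q\<close>
    takes its values, so G with a point at infinity has to be embedded there. A group element
    becomes evaluation of the first component, and infinity becomes the second component; suitable
    pairs \<open>(f, c)\<close> separate them.\<close>
  define q :: "'g option \<Rightarrow> ('g \<Rightarrow> complex) \<times> complex \<Rightarrow> 'g l2_op \<Rightarrow> complex" where
    "q = (\<lambda>o' (f, c) T. case o' of None \<Rightarrow> c | Some s \<Rightarrow> f s)"
  have "inj q"
  proof (rule injI)
    fix x y assume e: "q x = q y"
    have "q x (f, c) T = q y (f, c) T" for f c T unfolding e ..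
    from this[of "\<lambda>_. 0" 1] this[of "\<lambda>s. if Some s = x then 1 else 0" 0] show "x = y"
      by (cases x; cases y) (auto simp: q_def split: if_splits)
  qed
  moreover have "infinite (carrier G)"
    using assms(2,3) subgroup.subset finite_subset by blast
  ultimately show ?thesis by (intro VN_not_operator_projective)
qed

end
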